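(* Let $\mathcal L=\mathrm{div}(A\nabla)+\langle Bx,\nabla\rangle-\partial_t$ be a Kolmogorov-type operator on $\mathbb R^{n+1}=\mathbb R^n_x\times\mathbb R_t$ with constant matrices $A,B$ of the block form described in the context, with associated group law $\circ$, homogeneous dimension $Q$, fundamental solution $\Gamma$, kernel $W$ and $\mathcal L$-balls $\Omega_r(z_0)$. Let $z_0\in\mathbb R^{n+1}$ and let $D$ be a bounded open subset of $\mathbb R^{n+1}$ such that, for a suitable $r>0$, $$u(z_0)=\frac1r\int_D u(\zeta)\,W(z_0^{-1}\circ\zeta)\,d\zeta$$ for every nonnegative function $u$ which is $\mathcal L$-harmonic in an open set containing $D\cup\{z_0\}$. If the function $$\zeta\longmapsto \big(\mathbb 1_D-\mathbb 1_{\Omega_r(z_0)}\big)(\zeta)\,W(z_0^{-1}\circ\zeta)$$ belongs to $L^p(\mathbb R^{n+1})$ for some $p>\frac Q2$, then $D=\Omega_r(z_0)$.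
   Context: Setting. Let $n\ge 1$. Points of $\mathbb R^{n+1}$ are written $z=(x,t)$ or $\zeta=(\xi,\tau)$, with $x,\xi\in\mathbb R^n$ and $t,\tau\in\mathbb R$; $\nabla$, $\mathrm{div}$ and $\langle\cdot,\cdot\rangle$ are the gradient, divergence and inner product in $\mathbb R^n$ (with respect to $x$). $A$ and $B$ are $n\times n$ real constant matrices of the block form $$A=\begin{bmatrix} A_0 & 0 \\ 0 & 0 \end{bmatrix},\qquad B=\begin{bmatrix} 0 & 0 & \cdots & 0 & 0 \\ B_1 & 0 & \cdots & 0 & 0 \\ 0 & B_2 & \cdots & 0 & 0 \\ \vdots & \vdots & \ddots & \vdots & \vdots \\ 0 & 0 & \cdots & B_\kappa & 0 \end{bmatrix},$$ where $A_0$ is a $p_0\times p_0$ symmetric positive definite matrix ($1\le p_0\le n$), $B_j$ is a $p_j\times p_{j-1}$ block of rank $p_j$ for $j=1,\dots,\kappa$, $p_0\ge p_1\ge\dots\ge p_\kappa\ge1$ and $p_0+p_1+\dots+p_\kappa=n$. The case $\kappa=0$, i.e. $p_0=n$ and $B=0$, is allowed; $A=\mathbb I_n$, $B=0$ gives the heat operator. $\mathcal L$-harmonic functions. A function $u:O\to\mathbb R$, $O\subseteq\mathbb R^{n+1}$ open, is $\mathcal L$-harmonic in $O$ if $u\in C^\infty(O,\mathbb R)$ and $\mathcal Lu=0$ in $O$. Group law. Let $E(\tau)=\exp(-\tau B)$. The composition law on $\mathbb R^{n+1}$ is $(x,t)\circ(\xi,\tau)=(\xi+E(\tau)x,\;t+\tau)$,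 with neutral element $0$ and inverse $(\xi,\tau)^{-1}=(-E(-\tau)\xi,-\tau)$. Homogeneous dimension. $Q=p_0+3p_1+\dots+(2\kappa+1)p_\kappa+2$; equivalently $\lambda^Q$ is the determinant of $\mathrm{diag}(\lambda\mathbb I_{p_0},\lambda^3\mathbb I_{p_1},\dots,\lambda^{2\kappa+1}\mathbb I_{p_\kappa},\lambda^2)$ for $\lambda>0$. Fundamental solution. Let $C(t)=\int_0^tE(s)AE(s)^T\,ds$, which is positive definite for $t>0$ and negative definite for $t<0$. Define $$\gamma(x,t)=\begin{cases} 0, & t\le0, \\[2pt] \dfrac{(4\pi)^{-n/2}}{\sqrt{\det C(t)}}\exp\!\left(-\tfrac14\langle C^{-1}(t)x,x\rangle\right), & t>0, \end{cases}\qquad \Gamma(z,\zeta)=\gamma(\zeta^{-1}\circ z).$$ Kernel. For $(x,t)\in\mathbb R^{n+1}$ with $t\ne0$, $$W(x,t)=\tfrac14\langle AC^{-1}(t)x,\,C^{-1}(t)x\rangle .$$ It is nonnegative, and defined almost everywhere in $\mathbb R^{n+1}$. $\mathcal L$-balls. For $z_0\in\mathbb R^{n+1}$ and $r>0$, $\Omega_r(z_0)=\{z\in\mathbb R^{n+1}:\Gamma(z_0,z)>\tfrac1r\}$. Conventions. $\mathbb 1_E$ is the characteristic function of the set $E$; $d\zeta$ and $L^p$ refer to Lebesgue measure on $\mathbb R^{n+1}$. *)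

theory Defs
  imports "HOL-Analysis.Analysis"
begin

text \<open>
  The spatial dimension \<open>n\<close> is \<open>CARD('n)\<close>, and the coordinates are numbered by the order of
  the index type. A point \<open>(x, t)\<close> of \<open>\<real>\<^sup>n \<times> \<real>\<close> is a pair.
\<close>

type_synonym 'n spacetime = "(real^'n) \<times> real"


section \<open>Structure of the matrices\<close>

definition coord_pos :: "'n::{finite,wellorder} \<Rightarrow> nat"  \<comment> \<open>zero-based\<close>
  where "coord_pos i = card {..<i}"

definition level :: "(nat \<Rightarrow> nat) \<Rightarrow> nat \<Rightarrow> 'n::{finite,wellorder} set"
  where "level p k = {i. (\<Sum>j<k. p j) \<le> coord_pos i \<and> coord_pos i < (\<Sum>j\<le>k. p j)}"

text \<open>The block of \<open>M\<close> with rows \<open>I\<close> and columns \<open>J\<close>, padded with zeros to a matrix of the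
  size of \<open>M\<close>; the padding does not affect its rank.\<close>

definition block :: "'n set \<Rightarrow> 'n set \<Rightarrow> real^'n^'n \<Rightarrow> real^'n^'n"
  where "block I J M = (\<chi> i j. if i \<in> I \<and> j \<in> J then M $ i $ j else 0)"

text \<open>\<open>p 0, \<dots>, p \<kappa>\<close> are the block sizes. The block \<open>B\<^sub>k\<close> occupies the rows of level \<open>k\<close> and the
  columns of level \<open>k - 1\<close>.\<close>

definition kolmogorov_form ::
    "nat \<Rightarrow> (nat \<Rightarrow> nat) \<Rightarrow> real^('n::{finite,wellorder})^('n::{finite,wellorder}) \<Rightarrow> real^('n::{finite,wellorder})^('n::{finite,wellorder}) \<Rightarrow> bool"
  where "kolmogorov_form \<kappa> p A B \<longleftrightarrow>
    (\<forall>k<\<kappa>. p (Suc k) \<le> p k) \<and> 1 \<le> p \<kappa> \<and> (\<Sum>k\<le>\<kappa>. p k) = CARD('n) \<and>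
    (\<forall>i j. A $ i $ j \<noteq> 0 \<longrightarrow> i \<in> level p 0 \<and> j \<in> level p 0) \<and>
    transpose A = A \<and>
    (\<forall>x. x \<noteq> 0 \<and> (\<forall>i. i \<notin> level p 0 \<longrightarrow> x $ i = 0) \<longrightarrow> (A *v x) \<bullet> x > 0) \<and>
    (\<forall>i j. B $ i $ j \<noteq> 0 \<longrightarrow> (\<exists>k\<in>{1..\<kappa>}. i \<in> level p k \<and> j \<in> level p (k - 1))) \<and>
    (\<forall>k\<in>{1..\<kappa>}. rank (block (level p k) (level p (k - 1)) B) = p k)"

definition hom_dim :: "nat \<Rightarrow> (nat \<Rightarrow> nat) \<Rightarrow> nat"
  where "hom_dim \<kappa> p = (\<Sum>k\<le>\<kappa>. (2 * k + 1) * p k) + 2"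


section \<open>Smooth and L-harmonic functions\<close>

definition dir_deriv :: "'a::real_normed_vector \<Rightarrow> ('a \<Rightarrow> 'b::real_normed_vector) \<Rightarrow> 'a \<Rightarrow> 'b"
  where "dir_deriv v f z = frechet_derivative f (at z) v"

primrec C_k_on :: "nat \<Rightarrow> ('a::real_normed_vector \<Rightarrow> 'b::real_normed_vector) \<Rightarrow> 'a set \<Rightarrow> bool"
  where
    "C_k_on 0 f S \<longleftrightarrow> continuous_on S f"
  | "C_k_on (Suc k) f S \<longleftrightarrow>
       (\<forall>z\<in>S. f differentiable (at z)) \<and> (\<forall>v. C_k_on k (dir_deriv v f) S)"

definition smooth_on_open :: "('a::real_normed_vector \<Rightarrow> 'b::real_normed_vector) \<Rightarrow> 'a set \<Rightarrow> bool"
  where "smooth_on_open f S \<longleftrightarrow> open S \<and> (\<forall>k. C_k_on k f S)"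

definition grad_x :: "('n::finite spacetime \<Rightarrow> real) \<Rightarrow> 'n spacetime \<Rightarrow> real^'n"
  where "grad_x u z = (\<chi> i. dir_deriv (axis i 1, 0) u z)"

definition div_x :: "('n::finite spacetime \<Rightarrow> real^'n) \<Rightarrow> 'n spacetime \<Rightarrow> real"
  where "div_x F z = (\<Sum>i\<in>UNIV. dir_deriv (axis i 1, 0) F z $ i)"

definition L_op ::
    "real^'n^'n \<Rightarrow> real^'n^'n \<Rightarrow> ('n::finite spacetime \<Rightarrow> real) \<Rightarrow> 'n spacetime \<Rightarrow> real"
  where "L_op A B u z =
    div_x (\<lambda>\<zeta>. A *v grad_x u \<zeta>) z + (B *v fst z) \<bullet> grad_x u z - dir_deriv (0, 1) u z"

definition L_harmonic_on ::
    "real^'n^'n \<Rightarrow> real^'n^'n \<Rightarrow> ('n::finite spacetime \<Rightarrow> real) \<Rightarrow> 'n spacetime set \<Rightarrow> bool"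
  where "L_harmonic_on A B u S \<longleftrightarrow> smooth_on_open u S \<and> (\<forall>z\<in>S. L_op A B u z = 0)"


section \<open>The group law\<close>

text \<open>The overloaded \<open>exp\<close> does not apply to matrices: the overloaded product on type \<open>vec\<close> is
  componentwise.\<close>

definition mat_exp :: "real^'n^'n \<Rightarrow> real^'n^('n::finite)"
  where "mat_exp M = (\<Sum>k. (1 / fact k) *\<^sub>R (((**) M ^^ k) (mat 1)))"

definition E_mat :: "real^'n^'n \<Rightarrow> real \<Rightarrow> real^'n^('n::finite)"
  where "E_mat B \<tau> = mat_exp (- (\<tau> *\<^sub>R B))"

definition gcomp ::
    "real^'n^'n \<Rightarrow> 'n::finite spacetime \<Rightarrow> 'n spacetime \<Rightarrow> 'n spacetime"
  where "gcomp B z \<zeta> = (fst \<zeta> + E_mat B (snd \<zeta>) *v fst z, snd z + snd \<zeta>)"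

definition ginv :: "real^'n^'n \<Rightarrow> 'n::finite spacetime \<Rightarrow> 'n spacetime"
  where "ginv B \<zeta> = (- (E_mat B (- snd \<zeta>) *v fst \<zeta>), - snd \<zeta>)"


section \<open>Fundamental solution, kernel and L-balls\<close>

text \<open>The interval integral is oriented, as needed for \<open>t < 0\<close>.\<close>

definition C_mat :: "real^'n^'n \<Rightarrow> real^'n^'n \<Rightarrow> real \<Rightarrow> real^'n^('n::finite)"
  where "C_mat A B t =
    (LBINT s=ereal 0..ereal t. E_mat B s ** A ** transpose (E_mat B s))"

definition fund_gamma :: "real^'n^'n \<Rightarrow> real^'n^'n \<Rightarrow> 'n::finite spacetime \<Rightarrow> real"
  where "fund_gamma A B = (\<lambda>(x, t).
    if t \<le> 0 then 0
    else (4 * pi) powr (- (real CARD('n) / 2)) / sqrt (det (C_mat A B t))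
           * exp (- (1/4) * ((matrix_inv (C_mat A B t) *v x) \<bullet> x)))"

definition fund_sol ::
    "real^'n^'n \<Rightarrow> real^'n^'n \<Rightarrow> 'n::finite spacetime \<Rightarrow> 'n spacetime \<Rightarrow> real"
  where "fund_sol A B z \<zeta> = fund_gamma A B (gcomp B (ginv B \<zeta>) z)"

text \<open>The value \<open>0\<close> on the null set \<open>t = 0\<close>, where the kernel is undefined, is a convention.\<close>

definition W_kernel :: "real^'n^'n \<Rightarrow> real^'n^'n \<Rightarrow> 'n::finite spacetime \<Rightarrow> real"
  where "W_kernel A B = (\<lambda>(x, t).
    if t = 0 then 0
    else (1/4) * ((A *v (matrix_inv (C_mat A B t) *v x)) \<bullet> (matrix_inv (C_mat A B t) *v x)))"

definition L_ball ::
    "real^'n^'n \<Rightarrow> real^'n^'n \<Rightarrow> real \<Rightarrow> 'n::finite spacetime \<Rightarrow> 'n spacetime set"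
  where "L_ball A B r z\<^sub>0 = {z. fund_sol A B z\<^sub>0 z > 1 / r}"


section \<open>Lebesgue spaces\<close>

definition in_Lp :: "ennreal \<Rightarrow> 'a measure \<Rightarrow> ('a \<Rightarrow> real) \<Rightarrow> bool"
  where "in_Lp p M f \<longleftrightarrow> f \<in> borel_measurable M \<and>
    (if p = \<infinity> then (\<exists>c. AE x in M. \<bar>f x\<bar> \<le> c)
     else integrable M (\<lambda>x. \<bar>f x\<bar> powr enn2real p))"

end

theory Submission
  imports Defs "HOL-Probability.Probability" "HOL-Real_Asymp.Real_Asymp"
begin

text \<open>
  Let \<open>g = \<Gamma>(z\<^sub>0, \<cdot>)\<close>, let \<open>\<Omega> = {g > 1 / r}\<close> be the ball and \<open>f = (1\<^sub>D - 1\<^sub>\<Omega>) W\<close>. Since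
  \<open>\<Sum> (\<partial>\<^sub>a g)\<^sup>2 = W g\<^sup>2\<close> for a decomposition \<open>A = \<Sum> a a\<^sup>T\<close>, integrating by parts with functions of \<open>g\<close>
  shows that the potential of \<open>1\<^sub>\<Omega> W\<close> is \<open>r g\<close> outside \<open>\<Omega>\<close> and \<open>1 + ln (r g)\<close> inside. The mean value
  property for \<open>\<Gamma>(\<cdot>, \<zeta>)\<close> makes the potential of \<open>1\<^sub>D W\<close> equal to \<open>r g\<close> off \<open>D\<close>. Hence the potential \<open>u\<close>
  of \<open>f\<close> is nonnegative off \<open>D\<close> and vanishes off \<open>D \<union> \<Omega>\<close>. The condition \<open>p > Q / 2\<close> makes \<open>u\<close>
  continuous, and the minimum principle for the adjoint operator gives \<open>u \<ge> 0\<close> in \<open>D\<close> as well. If \<open>D\<close> left the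
  closed ball, a barrier \<open>h \<ge> 0\<close> with \<open>h = 0\<close> on \<open>\<Omega>\<close> and \<open>L h \<ge> 0\<close> on \<open>D \<union> \<Omega>\<close> would contradict
  \<open>\<integral> u L h = - \<integral> f h\<close>; so \<open>D \<subseteq> \<Omega>\<close>. Then \<open>f \<le> 0\<close>, hence \<open>u \<le> 0\<close>, whereas
  \<open>u = r g - 1 - ln (r g) > 0\<close> on \<open>\<Omega> - D\<close>.
\<close>

section \<open>Matrix exponentials and the covariance matrix\<close>

text \<open>The mean value property can be tested with \<open>\<Gamma>(., \<zeta>)\<close> only for
  poles \<open>\<zeta>\<close> outside \<open>D\<close> and different from \<open>z0\<close>, so it
  says nothing about the potential inside \<open>D\<close>; the minimum principle fills this gap. As
  \<open>D\<close> has an arbitrary boundary and \<open>f\<close> is merely in L^p, the potential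
  has no second derivatives: every use of its equation is weak, against C^2 barriers, or goes
  through kernels cut off in time near the pole. Cutting in time costs a single term, because the
  operator is of first order there, and that term is an approximate identity.

  With A = sum a a^T the operator is a sum of squares of constant directional derivatives minus the
  derivative along the drift flow. All these flows preserve Lebesgue measure, so integration by
  parts reduces to one fact: a flow derivative has integral zero.

  The threshold Q/2 comes from the height s^(-(Q-2)/2) of the kernel after time s: by Young's
  inequality, pairing it with an L^p function requires s^(-(Q-2)/(2(p-1))) to be integrable at
  0.\<close>

type_synonym 'n rvec = "(real, 'n) vec"
type_synonym 'n rmat = "((real, 'n) vec, 'n) vec"

lemma matrix_scaleR_left: "(c *\<^sub>R M) ** N = c *\<^sub>R (M ** (N :: real^'n^'m))"
  and matrix_scaleR_right: "M ** (c *\<^sub>R N) = c *\<^sub>R (M ** N)"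
  by (simp_all add: vec_eq_iff matrix_matrix_mult_def sum_distrib_left mult_ac)

lemma matrix_mult_0_left: "0 ** M = (0 :: real^'n^'m)" and matrix_mult_0_right: "M ** 0 = (0 :: real^'n^'m)"
  by (simp_all add: vec_eq_iff matrix_matrix_mult_def)

lemma matrix_add_rdistrib': "(M + N) ** K = M ** K + N ** (K :: real^'n^'m)"
  by (simp add: vec_eq_iff matrix_matrix_mult_def sum.distrib distrib_right)

lemma has_derivative_vecI:
  fixes f :: "'a::real_normed_vector \<Rightarrow> ('b::euclidean_space)^'n"
  assumes "\<And>i. ((\<lambda>x. f x $ i) has_derivative (\<lambda>x. f' x $ i)) (at a within S)"
  shows "(f has_derivative f') (at a within S)"
proof (subst has_derivative_componentwise_within, intro ballI)
  fix b :: "'b^'n" assume "b \<in> Basis"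
  then obtain k u where b: "b = axis k u" by (auto simp: Basis_vec_def)
  show "((\<lambda>x. f x \<bullet> b) has_derivative (\<lambda>x. f' x \<bullet> b)) (at a within S)"
    unfolding b inner_axis by (intro has_derivative_inner_left assms)
qed

definition mpow :: "real^'n^'n \<Rightarrow> nat \<Rightarrow> real^'n^'n"
  where "mpow M k = ((**) M ^^ k) (mat 1)"

lemma mpow_0: "mpow M 0 = mat 1"
  and mpow_Suc: "mpow M (Suc k) = M ** mpow M k"
  by (simp_all add: mpow_def)

lemma mpow_add: "mpow M (j + k) = mpow M j ** mpow M k"
  by (induction j) (simp_all add: mpow_0 mpow_Suc matrix_mul_assoc)

lemma mpow_scaleR: "mpow (c *\<^sub>R M) k = c ^ k *\<^sub>R mpow M k"
  by (induction k) (simp_all add: mpow_0 mpow_Suc matrix_scaleR_left matrix_scaleR_right)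

lemma matrix_mul_sum_left: "(\<Sum>a\<in>S. F a) ** (M :: real^'n^'m) = (\<Sum>a\<in>S. F a ** M)"
  by (induction S rule: infinite_finite_induct) (simp_all add: matrix_add_rdistrib' matrix_mult_0_left)

lemma matrix_mul_sum_right: "(M :: real^'n^'m) ** (\<Sum>a\<in>S. F a) = (\<Sum>a\<in>S. M ** F a)"
  by (induction S rule: infinite_finite_induct) (simp_all add: matrix_add_ldistrib matrix_mult_0_right)

text \<open>\<open>l i\<close> is the level of the coordinate \<open>i\<close>. The axioms are invariant under \<open>B \<mapsto> - B\<close>, which
  exchanges the roles of the two arguments of the fundamental solution and reverses time.\<close>

locale kolm =
  fixes A B :: "real^('n::{finite,wellorder})^('n::{finite,wellorder})" and l :: "'n \<Rightarrow> nat"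
  assumes A_sym: "transpose A = A"
    and A_level: "A $ i $ j \<noteq> 0 \<Longrightarrow> l i = 0 \<and> l j = 0"
    and A_pos: "x \<noteq> 0 \<Longrightarrow> (\<And>i. l i \<noteq> 0 \<Longrightarrow> x $ i = 0) \<Longrightarrow> (A *v x) \<bullet> x > 0"
    and B_level: "B $ i $ j \<noteq> 0 \<Longrightarrow> l i = Suc (l j)"
    and controllable: "(\<And>k i. l i = 0 \<Longrightarrow> (transpose (mpow B k) *v x) $ i = 0) \<Longrightarrow> x = 0"
begin

text \<open>\<open>B\<close> raises the level by exactly one, so it is nilpotent and its exponential
  is a polynomial. The same grading makes the entries of the exponential, of the covariance matrix
  and of its inverse monomials in time, which is the source of all scaling laws below.\<close>

lemma mpow_level: "mpow B k $ i $ j \<noteq> 0 \<Longrightarrow> l i = l j + k"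
proof (induction k arbitrary: i)
  case 0
  then show ?case by (auto simp: mpow_0 mat_def split: if_splits)
next
  case (Suc k)
  from Suc.prems have "(\<Sum>m\<in>UNIV. B $ i $ m * mpow B k $ m $ j) \<noteq> 0"
    by (simp add: mpow_Suc matrix_matrix_mult_def)
  then obtain m where "B $ i $ m * mpow B k $ m $ j \<noteq> 0"
    by (rule sum.not_neutral_contains_not_neutral)
  then show ?case using Suc.IH[of m] B_level[of i m] by auto
qed

definition top_level :: nat where "top_level = Max (range l)"

lemma level_le_top: "l i \<le> top_level"
  by (simp add: top_level_def)

lemma mpow_eq_0: "k > top_level \<Longrightarrow> mpow B k = 0"
proof -
  assume k: "k > top_level"
  have "mpow B k $ i $ j = 0" for i j
    using mpow_level[of k i j] level_le_top[of i] k by linarith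
  then show ?thesis by (simp add: vec_eq_iff)
qed

lemma E_mat_eq: "E_mat B t = (\<Sum>k\<le>top_level. ((-t)^k / fact k) *\<^sub>R mpow B k)"
proof -
  have "E_mat B t = (\<Sum>k. (1 / fact k) *\<^sub>R mpow ((-t) *\<^sub>R B) k)"
    by (simp add: E_mat_def mat_exp_def mpow_def)
  also have "\<dots> = (\<Sum>k. ((-t)^k / fact k) *\<^sub>R mpow B k)"
    by (simp only: mpow_scaleR) (simp add: field_simps del: scaleR_minus_left)
  also have "\<dots> = (\<Sum>k\<le>top_level. ((-t)^k / fact k) *\<^sub>R mpow B k)"
    by (rule suminf_finite) (auto simp: mpow_eq_0)
  finally show ?thesis .
qed

lemma E_mat_entry:
  "E_mat B t $ i $ j = (if l j \<le> l i then (-t)^(l i - l j) / fact (l i - l j) * mpow B (l i - l j) $ i $ j else 0)"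
proof -
  have *: "((-t)^k / fact k) * mpow B k $ i $ j
      = (if k = l i - l j \<and> l j \<le> l i then (-t)^(l i - l j) / fact (l i - l j) * mpow B (l i - l j) $ i $ j else 0)" for k
  proof (cases "k = l i - l j \<and> l j \<le> l i")
    case False
    then have "l i \<noteq> l j + k" by linarith
    then show ?thesis using mpow_level[of k i j] False by (metis mult_zero_right)
  qed simp
  have "E_mat B t $ i $ j = (\<Sum>k\<le>top_level. ((-t)^k / fact k) * mpow B k $ i $ j)"
    by (simp add: E_mat_eq)
  also have "\<dots> = (\<Sum>k\<le>top_level. if k = l i - l j \<and> l j \<le> l i then (-t)^(l i - l j) / fact (l i - l j) * mpow B (l i - l j) $ i $ j else 0)"
    by (intro sum.cong refl *)
  also have "\<dots> = (if l j \<le> l i then (-t)^(l i - l j) / fact (l i - l j) * mpow B (l i - l j) $ i $ j else 0)"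
    using level_le_top[of i] by (auto simp: sum.delta cong: conj_cong)
  finally show ?thesis .
qed

lemma E_mat_0: "E_mat B 0 = mat 1"
proof -
  have "(0::real)^k = (if k = 0 then 1 else 0)" for k by simp
  then have "E_mat B 0 = (\<Sum>k\<le>top_level. (if k = 0 then mpow B 0 else 0))"
    unfolding E_mat_eq by (intro sum.cong) auto
  then show ?thesis by (simp add: sum.delta mpow_0)
qed

lemma E_mat_add: "E_mat B (s + t) = E_mat B s ** E_mat B t"
proof -
  let ?K = "top_level"
  have "(E_mat B s ** E_mat B t) = (\<Sum>a\<le>?K. \<Sum>b\<le>?K. ((-s)^a / fact a * ((-t)^b / fact b)) *\<^sub>R mpow B (a + b))"
    unfolding E_mat_eq
    by (subst sum.swap)
      (simp add: matrix_mul_sum_left matrix_mul_sum_right mpow_add matrix_scaleR_left matrix_scaleR_right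
        scaleR_sum_right mult_ac)
  \<comment> \<open>The square of index pairs may be cut down to a triangle because powers beyond
    \<open>top_level\<close> vanish; on the triangle the binomial formula applies.\<close>
  also have "\<dots> = (\<Sum>(a,b)\<in>{(a,b). a + b \<le> ?K}. ((-s)^a / fact a * ((-t)^b / fact b)) *\<^sub>R mpow B (a + b))"
    unfolding sum.cartesian_product
    by (rule sum.mono_neutral_right) (auto, use mpow_eq_0 not_le in blast)
  also have "\<dots> = (\<Sum>c\<le>?K. \<Sum>a\<le>c. ((-s)^a / fact a * ((-t)^(c-a) / fact (c-a))) *\<^sub>R mpow B c)"
    by (subst sum.triangle_reindex_eq) simp
  also have "\<dots> = E_mat B (s + t)"
  proof -
    have "(\<Sum>a\<le>c. ((-s)^a / fact a * ((-t)^(c-a) / fact (c-a)))) = (-(s+t))^c / fact c" for c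
      using exp_series_add_commuting[of "-s" "-t" c] by (simp add: field_simps scaleR_conv_of_real)
    then show ?thesis unfolding E_mat_eq by (simp flip: scaleR_left.sum)
  qed
  finally show ?thesis by simp
qed

lemma E_mat_inverse: "E_mat B s ** E_mat B (-s) = mat 1" "E_mat B (-s) ** E_mat B s = mat 1"
  using E_mat_add[of s "-s"] E_mat_add[of "-s" s] by (simp_all add: E_mat_0)

lemma E_mat_mult_vec: "E_mat B s *v (E_mat B t *v x) = E_mat B (s + t) *v x"
  by (simp add: E_mat_add matrix_vector_mul_assoc)

lemma E_mat_uminus: "E_mat (-B) t = E_mat B (-t)"
  by (simp add: E_mat_def)

lemma E_mat_deriv: "((\<lambda>t. E_mat B t $ i $ j) has_real_derivative - (B ** E_mat B t) $ i $ j) (at t)"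
proof -
  have 1: "((\<lambda>t. (-t)^k / fact k) has_real_derivative (if k = 0 then 0 else - ((-t)^(k-1) / fact (k-1)))) (at t)" for k t
  proof (cases k)
    case (Suc n)
    have "((\<lambda>t. (-t) ^ Suc n) has_real_derivative - (real (Suc n) * (-t)^n)) (at t)"
      by (rule derivative_eq_intros refl | simp del: power_Suc)+
    from DERIV_cdivide[OF this, of "fact (Suc n)"] show ?thesis
      by (simp add: Suc field_simps del: power_Suc of_nat_Suc)
  qed simp
  have d: "((\<lambda>t. \<Sum>k\<le>top_level. ((-t)^k / fact k) * mpow B k $ i $ j) has_real_derivative
     (\<Sum>k\<le>top_level. (if k = 0 then 0 else - ((-t)^(k-1) / fact (k-1))) * mpow B k $ i $ j)) (at t)"
    by (intro DERIV_sum DERIV_cmult_right 1)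
  \<comment> \<open>The sum is lengthened by one vanishing term, so that it again runs up to
    \<open>top_level\<close> after the index shift.\<close>
  have "(\<Sum>k\<le>top_level. (if k = 0 then 0 else - ((-t)^(k-1) / fact (k-1))) * mpow B k $ i $ j)
     = (\<Sum>k\<le>Suc top_level. (if k = 0 then 0 else - ((-t)^(k-1) / fact (k-1))) * mpow B k $ i $ j)"
    by (simp add: mpow_eq_0)
  also have "\<dots> = (\<Sum>k\<le>top_level. - ((-t)^k / fact k) * mpow B (Suc k) $ i $ j)"
    by (subst sum.atMost_Suc_shift) simp
  also have "\<dots> = - (B ** E_mat B t) $ i $ j"
    unfolding E_mat_eq
    by (simp add: mpow_Suc matrix_mul_sum_right matrix_scaleR_left matrix_scaleR_right sum_negf)
  finally have eq: "(\<Sum>k\<le>top_level. (if k = 0 then 0 else - ((-t)^(k-1) / fact (k-1))) * mpow B k $ i $ j) = - (B ** E_mat B t) $ i $ j" .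
  have "(\<lambda>t. E_mat B t $ i $ j) = (\<lambda>t. \<Sum>k\<le>top_level. ((-t)^k / fact k) * mpow B k $ i $ j)"
    by (simp add: E_mat_eq)
  with d show ?thesis by (simp only: eq)
qed

lemma dual: "kolm A (- B) l"
proof
  show "x = 0" if "\<And>k i. l i = 0 \<Longrightarrow> (transpose (mpow (- B) k) *v x) $ i = 0" for x
  proof (rule controllable)
    fix k i assume "l i = 0"
    have "mpow (- B) k = (-1)^k *\<^sub>R mpow B k"
      using mpow_scaleR[of "-1" B k] by simp
    then have "(transpose (mpow (- B) k) *v x) $ i = (-1)^k * (transpose (mpow B k) *v x) $ i"
      by (simp add: transpose_def matrix_vector_mult_def sum_distrib_left mult_ac)
    with that[OF \<open>l i = 0\<close>, of k] show "(transpose (mpow B k) *v x) $ i = 0"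
      by simp
  qed
next
  show "transpose A = A" by (rule A_sym)
  show "l i = 0 \<and> l j = 0" if "A $ i $ j \<noteq> 0" for i j by (rule A_level[OF that])
  show "(A *v x) \<bullet> x > 0" if "x \<noteq> 0" "\<And>i. l i \<noteq> 0 \<Longrightarrow> x $ i = 0" for x by (rule A_pos[OF that])
  show "l i = Suc (l j)" if "(- B) $ i $ j \<noteq> 0" for i j by (rule B_level) (use that in simp)
qed

lemma E_level0: "l a = 0 \<Longrightarrow> E_mat B t $ i $ a = t ^ l i * E_mat B 1 $ i $ a"
  by (simp add: E_mat_entry power_minus[of t])

abbreviation EAE :: "real \<Rightarrow> 'n rmat" where "EAE s \<equiv> E_mat B s ** A ** transpose (E_mat B s)"

text \<open>\<open>A\<close> meets only the columns of level 0 of the exponential, whose entries in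
  row \<open>i\<close> are homogeneous of degree \<open>l i\<close>. Integration then gives degree
  \<open>l i + l j + 1\<close> for the covariance, for either sign of the time since the integral is
  oriented.\<close>

lemma EAE_entry: "EAE s $ i $ j = s ^ (l i + l j) * EAE 1 $ i $ j"
proof -
  have *: "E_mat B s $ i $ k * A $ k $ m * E_mat B s $ j $ m
     = s ^ (l i + l j) * (E_mat B 1 $ i $ k * A $ k $ m * E_mat B 1 $ j $ m)" for k m
    using A_level[of k m] E_level0[of k s i] E_level0[of m s j] by (cases "A $ k $ m = 0") (auto simp: power_add)
  have e: "EAE s $ i $ j = (\<Sum>m\<in>UNIV. \<Sum>k\<in>UNIV. E_mat B s $ i $ k * A $ k $ m * E_mat B s $ j $ m)" for s
    by (simp add: matrix_matrix_mult_def transpose_def sum_distrib_right)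
  show ?thesis
    unfolding e[of s] e[of 1] sum_distrib_left by (intro sum.cong refl *)
qed

lemma EAE_antideriv:
  "((\<lambda>s. EAE 1 $ i $ j * s ^ Suc (l i + l j) / real (Suc (l i + l j))) has_real_derivative EAE s $ i $ j) (at s within S)"
proof -
  have "((\<lambda>s. c * s ^ Suc m / real (Suc m)) has_real_derivative s ^ m * c) (at s within S)" for c :: real and m
    using DERIV_cmult[OF DERIV_pow[of "Suc m" s S], of "c / real (Suc m)"] by (simp add: mult_ac del: power_Suc of_nat_Suc)
  then show ?thesis by (subst EAE_entry)
qed

lemma continuous_EAE: "continuous_on S EAE"
proof -
  have "EAE = (\<lambda>s. \<chi> i j. s ^ (l i + l j) * EAE 1 $ i $ j)"
    by (intro ext, subst vec_eq_iff, intro allI, subst vec_eq_iff, intro allI, subst EAE_entry) (simp only: vec_lambda_beta)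
  moreover have "continuous_on S (\<lambda>s. \<chi> i j. s ^ (l i + l j) * EAE 1 $ i $ j)"
    by (intro continuous_intros)
  ultimately show ?thesis by (simp only:)
qed

lemma C_mat_entry: "C_mat A B t $ i $ j = EAE 1 $ i $ j * t ^ Suc (l i + l j) / real (Suc (l i + l j))"
proof -
  define F :: "real \<Rightarrow> 'n rmat" where "F t = (\<chi> i j. EAE 1 $ i $ j * t ^ Suc (l i + l j) / real (Suc (l i + l j)))" for t
  have d: "(F has_vector_derivative EAE s) (at s within S)" for s S
    unfolding has_vector_derivative_def F_def
    by (intro has_derivative_vecI, simp only: vec_lambda_beta vector_scaleR_component)
      (use EAE_antideriv in \<open>simp only: has_real_derivative_iff_has_vector_derivative has_vector_derivative_def\<close>)
  have "C_mat A B t = F t - F 0"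
    unfolding C_mat_def by (intro interval_integral_FTC_finite continuous_EAE d)
  moreover have "F 0 = 0" by (simp add: F_def vec_eq_iff)
  ultimately show ?thesis by (simp only: F_def vec_lambda_beta) simp
qed

end

section \<open>Positive definite and diagonal matrices\<close>

definition pos_def :: "real^'n^'n \<Rightarrow> bool"
  where "pos_def M \<longleftrightarrow> transpose M = M \<and> (\<forall>x. x \<noteq> 0 \<longrightarrow> (M *v x) \<bullet> x > 0)"

lemma matrix_inv_mult:
  fixes M :: "real^'n^'n"
  assumes "invertible M"
  shows "M ** matrix_inv M = mat 1" "matrix_inv M ** M = mat 1"
  using someI_ex[OF assms[unfolded invertible_def]] by (simp_all add: matrix_inv_def)

lemma matrix_inv_eqI:
  fixes M :: "real^'n^'n"
  assumes "N ** M = mat 1"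
  shows "matrix_inv M = N" "invertible M"
proof -
  show inv: "invertible M"
    using assms matrix_left_right_inverse unfolding invertible_def by blast
  show "matrix_inv M = N"
    using matrix_inv_mult[OF inv] assms by (metis matrix_mul_assoc matrix_mul_lid matrix_mul_rid)
qed

lemma pos_def_invertible: "pos_def M \<Longrightarrow> invertible M"
  unfolding invertible_left_inverse matrix_left_invertible_ker pos_def_def by fastforce

lemma sym_inner: "transpose M = M \<Longrightarrow> (M *v x) \<bullet> y = x \<bullet> (M *v (y :: real^'n))"
  by (metis dot_lmul_matrix transpose_matrix_vector)

lemma pos_def_inv:
  assumes "pos_def M"
  shows "pos_def (matrix_inv M)"
proof -
  note I = matrix_inv_mult[OF pos_def_invertible[OF assms]]
  have s: "transpose M = M" using assms by (simp add: pos_def_def)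
  have "transpose (matrix_inv M) ** M = mat 1"
    using arg_cong[OF I(1), of transpose] by (simp add: matrix_transpose_mul s transpose_mat)
  from matrix_inv_eqI(1)[OF this] have t: "transpose (matrix_inv M) = matrix_inv M" by simp
  have "(matrix_inv M *v x) \<bullet> x > 0" if "x \<noteq> 0" for x
  proof -
    have x: "M *v (matrix_inv M *v x) = x" by (simp add: matrix_vector_mul_assoc I)
    then have "matrix_inv M *v x \<noteq> 0" using that by (metis matrix_vector_mult_0_right)
    then have "(M *v (matrix_inv M *v x)) \<bullet> (matrix_inv M *v x) > 0"
      using assms by (auto simp: pos_def_def)
    then show ?thesis by (simp add: x inner_commute)
  qed
  with t show ?thesis by (simp add: pos_def_def)
qed

lemma pos_def_lower_bound:
  assumes "pos_def M"
  obtains c where "c > 0" "\<And>x :: real^'n. (M *v x) \<bullet> x \<ge> c * (norm x)\<^sup>2"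
proof -
  have "continuous_on (sphere 0 1) (\<lambda>x. (M *v x) \<bullet> x)"
    by (intro continuous_intros linear_continuous_on matrix_vector_mul_bounded_linear)
  moreover have "sphere (0 :: real^'n) 1 \<noteq> {}" by simp
  ultimately obtain v where v: "v \<in> sphere 0 1" "\<And>y. y \<in> sphere 0 1 \<Longrightarrow> (M *v v) \<bullet> v \<le> (M *v y) \<bullet> y"
    using continuous_attains_inf[of "sphere (0 :: real^'n) 1" "\<lambda>x. (M *v x) \<bullet> x"] by auto
  show ?thesis
  proof
    have "v \<noteq> 0" using v(1) by auto
    then show "(M *v v) \<bullet> v > 0" using assms by (auto simp: pos_def_def)
    fix x :: "real^'n"
    show "(M *v x) \<bullet> x \<ge> (M *v v) \<bullet> v * (norm x)\<^sup>2"
    proof (cases "x = 0")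
      case False
      have "(M *v v) \<bullet> v \<le> (M *v (x /\<^sub>R norm x)) \<bullet> (x /\<^sub>R norm x)"
        using False by (intro v(2)) simp
      also have "\<dots> = (M *v x) \<bullet> x / (norm x)\<^sup>2"
        by (simp add: matrix_vector_mult_scaleR power2_eq_square field_simps)
      finally show ?thesis using False by (simp add: field_simps)
    qed simp
  qed
qed

lemma quad_form_sum: "(M *v x) \<bullet> y = (\<Sum>i\<in>UNIV. \<Sum>j\<in>UNIV. M $ i $ j * x $ j * (y :: real^'n) $ i)"
  by (simp add: inner_vec_def matrix_vector_mult_def sum_distrib_right)

definition diag_mat :: "('n \<Rightarrow> real) \<Rightarrow> real^'n^'n"
  where "diag_mat d = (\<chi> i j. if i = j then d i else 0)"

lemma diag_mat_vec: "diag_mat d *v x = (\<chi> i. d i * x $ i)"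
  by (simp add: diag_mat_def matrix_vector_mult_def vec_eq_iff if_distrib if_distribR sum.delta cong: if_cong)

lemma diag_mat_mult: "(diag_mat d ** M) $ i $ j = d i * M $ i $ j"
  and mult_diag_mat: "(M ** diag_mat d) $ i $ j = M $ i $ j * d j"
  by (simp_all add: diag_mat_def matrix_matrix_mult_def if_distrib if_distribR sum.delta cong: if_cong)

lemma det_diag_mat: "det (diag_mat d) = prod d UNIV"
  by (subst det_diagonal) (simp_all add: diag_mat_def)

abbreviation Pm :: "real^'n^'n \<Rightarrow> real^'n^'n \<Rightarrow> real \<Rightarrow> real^'n^('n::finite)"
  where "Pm A B s \<equiv> matrix_inv (C_mat A B s)"

text \<open>The spatial part of the anisotropic dilations with ratio sqrt s: a coordinate of level k
  scales with the power 2k + 1 while time scales by s.\<close>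

definition dil :: "('n \<Rightarrow> nat) \<Rightarrow> real \<Rightarrow> real^'n^'n"
  where "dil l s = diag_mat (\<lambda>i. sqrt s ^ (2 * l i + 1))"

context kolm begin

lemma A_vec_nonneg: "(A *v y) \<bullet> y \<ge> 0"
  and A_vec_eq_0: "(A *v y) \<bullet> y = 0 \<Longrightarrow> l i = 0 \<Longrightarrow> y $ i = 0"
proof -
  define z :: "'n rvec" where "z = (\<chi> i. if l i = 0 then y $ i else 0)"
  have *: "A $ i $ j * y $ j * y $ i = A $ i $ j * z $ j * z $ i" for i j
    using A_level[of i j] by (auto simp: z_def)
  have eq: "(A *v y) \<bullet> y = (A *v z) \<bullet> z"
    unfolding quad_form_sum by (intro sum.cong refl *)
  have pos: "z \<noteq> 0 \<Longrightarrow> (A *v z) \<bullet> z > 0"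
    by (rule A_pos) (auto simp: z_def)
  show "(A *v y) \<bullet> y \<ge> 0" using eq pos by (cases "z = 0") auto
  show "y $ i = 0" if "(A *v y) \<bullet> y = 0" "l i = 0"
  proof -
    have "z = 0" using eq pos that by force
    then have "z $ i = 0" by simp
    then show ?thesis using that by (simp add: z_def)
  qed
qed

lemma EAE_sym: "transpose (EAE s) = EAE s"
  by (simp add: matrix_transpose_mul A_sym matrix_mul_assoc)

lemma C_sym: "transpose (C_mat A B s) = C_mat A B s"
  using EAE_sym[of 1, unfolded vec_eq_iff]
  by (simp add: vec_eq_iff transpose_def C_mat_entry add.commute)

lemma C_deriv: "((\<lambda>s. C_mat A B s $ i $ j) has_real_derivative EAE s $ i $ j) (at s)"
  unfolding C_mat_entry by (rule EAE_antideriv)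

lemma C_quad_deriv: "((\<lambda>s. (C_mat A B s *v x) \<bullet> x) has_real_derivative (EAE s *v x) \<bullet> x) (at s)"
  unfolding quad_form_sum by (intro DERIV_sum DERIV_cmult_right C_deriv)

lemma EAE_quad: "(EAE s *v x) \<bullet> x = (A *v (transpose (E_mat B s) *v x)) \<bullet> (transpose (E_mat B s) *v x)"
  by (metis matrix_vector_mul_assoc dot_lmul_matrix transpose_matrix_vector transpose_transpose)

text \<open>The quadratic form of C at a fixed \<open>x\<close> is nondecreasing in time and starts
  at 0. If it is not positive at \<open>s\<close>, it vanishes on the whole interval and so does its
  derivative; hence the level-0 components of E(a)^T x vanish for all \<open>a\<close> in the
  interval. They are polynomials in \<open>a\<close>, so all their coefficients vanish, and the
  Kalman-type axiom \<open>controllable\<close> gives \<open>x = 0\<close>.\<close>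

lemma C_pos_def:
  assumes "s > 0"
  shows "pos_def (C_mat A B s)"
proof -
  have "(C_mat A B s *v x) \<bullet> x > 0" if "x \<noteq> 0" for x
  proof (rule ccontr)
    let ?f = "\<lambda>s. (C_mat A B s *v x) \<bullet> x"
    assume neg: "\<not> ?f s > 0"
    have f0: "?f 0 = 0" by (simp add: quad_form_sum C_mat_entry)
    have mono: "?f a \<le> ?f b" if "a \<le> b" for a b
      by (rule DERIV_nonneg_imp_nondecreasing[OF that])
        (use C_quad_deriv EAE_quad A_vec_nonneg in metis)
    have zero: "?f a = 0" if "a \<in> {0..s}" for a
      using mono[of 0 a] mono[of a s] that f0 neg by auto
    have E0: "(transpose (E_mat B a) *v x) $ i = 0" if "a \<in> {0<..<s}" "l i = 0" for a i
    proof -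
      have "(?f has_real_derivative 0) (at a)"
        by (rule has_field_derivative_transform_within_open[of "\<lambda>_. 0" _ _ "{0<..<s}"])
          (use that zero in auto)
      then have "(EAE a *v x) \<bullet> x = 0" using C_quad_deriv DERIV_unique by blast
      then show ?thesis using A_vec_eq_0 that by (simp add: EAE_quad)
    qed
    have "(transpose (mpow B k) *v x) $ i = 0" if i: "l i = 0" for k i
    proof (cases "k \<le> top_level")
      case True
      define c where "c k = (-1)^k / fact k * (transpose (mpow B k) *v x) $ i" for k
      have E: "(transpose (E_mat B a) *v x) $ i = (\<Sum>k\<le>top_level. c k * a ^ k)" for a
      proof -
        have "(transpose (E_mat B a) *v x) $ i = (\<Sum>j\<in>UNIV. \<Sum>k\<le>top_level. (- a)^k / fact k * mpow B k $ j $ i * x $ j)"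
          by (simp add: E_mat_eq transpose_def matrix_vector_mult_def sum_distrib_right)
        also have "\<dots> = (\<Sum>k\<le>top_level. \<Sum>j\<in>UNIV. (- a)^k / fact k * mpow B k $ j $ i * x $ j)"
          by (rule sum.swap)
        also have "\<dots> = (\<Sum>k\<le>top_level. c k * a ^ k)"
          by (simp add: c_def power_minus[of a] transpose_def matrix_vector_mult_def sum_distrib_left mult_ac)
        finally show ?thesis .
      qed
      have "{0<..<s} \<subseteq> {a. (\<Sum>k\<le>top_level. c k * a ^ k) = 0}"
        using E0[OF _ i] by (simp only: E) blast
      moreover have "infinite {0<..<s}" using assms by simp
      ultimately have "infinite {a. (\<Sum>k\<le>top_level. c k * a ^ k) = 0}" using infinite_super by blast
      then have "c k = 0" using True polyfun_finite_roots[of c top_level] by blast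
      then show ?thesis by (simp add: c_def)
    next
      case False
      then show ?thesis by (simp add: mpow_eq_0 transpose_def matrix_vector_mult_def)
    qed
    then have "x = 0" by (rule controllable)
    with that show False by simp
  qed
  then show ?thesis by (simp add: pos_def_def C_sym)
qed

lemmas C_invertible = pos_def_invertible[OF C_pos_def]
lemmas C_P = matrix_inv_mult(1)[OF C_invertible] and P_C = matrix_inv_mult(2)[OF C_invertible]
lemmas P_pos_def = pos_def_inv[OF C_pos_def]

lemma P_sym: "s > 0 \<Longrightarrow> transpose (Pm A B s) = Pm A B s"
  using P_pos_def by (simp add: pos_def_def)

text \<open>Homogeneity of the covariance passes to its inverse: the rescaled inverse at time 1 is
  checked to be a left inverse.\<close>

lemma P_entry:
  assumes "s > 0"
  shows "Pm A B s $ i $ j = Pm A B 1 $ i $ j / s ^ (l i + l j + 1)"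
proof -
  let ?N = "(\<chi> i j. Pm A B 1 $ i $ j / s ^ (l i + l j + 1)) :: 'n rmat"
  have "(?N ** C_mat A B s) $ i $ k = (mat 1 :: 'n rmat) $ i $ k" for i k
  proof -
    have "Pm A B 1 $ i $ j / s ^ (l i + l j + 1) * C_mat A B s $ j $ k
       = Pm A B 1 $ i $ j * C_mat A B 1 $ j $ k * (s ^ l k / s ^ l i)" for j
      using assms by (simp add: C_mat_entry field_simps power_add)
    then have "(?N ** C_mat A B s) $ i $ k = (Pm A B 1 ** C_mat A B 1) $ i $ k * (s ^ l k / s ^ l i)"
      unfolding matrix_matrix_mult_def by (simp only: vec_lambda_beta sum_distrib_right)
    also have "\<dots> = (mat 1 :: 'n rmat) $ i $ k"
      using assms by (auto simp: P_C mat_def)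
    finally show ?thesis .
  qed
  then have "?N ** C_mat A B s = mat 1" by (simp add: vec_eq_iff)
  from matrix_inv_eqI(1)[OF this] show ?thesis by simp
qed

text \<open>The spatial part Q - 2 of the homogeneous dimension: the determinant of the dilation
  \<open>dil l s\<close> is the power \<open>hdim\<close> of sqrt s.\<close>

definition hdim :: nat where "hdim = (\<Sum>i\<in>UNIV. 2 * l i + 1)"

lemma hdim_pos: "hdim > 0"
  unfolding hdim_def by (intro sum_pos) auto

lemma dil_sandwich: "s > 0 \<Longrightarrow> (dil l s ** C_mat A B 1 ** dil l s) = C_mat A B s"
proof -
  assume s: "s > 0"
  have p: "sqrt s ^ (2 * m) = s ^ m" for m using s by (simp add: power_mult)
  have "sqrt s ^ (2 * l i + 1) * sqrt s ^ (2 * l j + 1) = s ^ (l i + l j + 1)" for i j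
    using p[of "l i + l j + 1"] by (simp add: power_add power2_eq_square algebra_simps power_mult)
  then show ?thesis
    by (simp add: vec_eq_iff dil_def mult_diag_mat diag_mat_mult C_mat_entry) (simp add: mult_ac)
qed

lemma det_dil: "s > 0 \<Longrightarrow> det (dil l s) = sqrt s ^ hdim"
  by (simp add: dil_def det_diag_mat hdim_def power_sum)

lemma det_C: "s > 0 \<Longrightarrow> det (C_mat A B s) = det (C_mat A B 1) * s ^ hdim"
proof -
  assume s: "s > 0"
  have "sqrt s ^ hdim * sqrt s ^ hdim = s ^ hdim"
    using s by (simp flip: power_mult_distrib)
  then show ?thesis
    by (subst dil_sandwich[OF s, symmetric]) (simp add: det_mul det_dil[OF s] mult_ac)
qed

lemma EAE_C: "s \<noteq> 0 \<Longrightarrow> EAE s $ i $ j = (l i + l j + 1) / s * C_mat A B s $ i $ j"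
  by (subst EAE_entry) (simp add: C_mat_entry)

text \<open>A second expression for the derivative of C. Both sides have the derivative -B EAE - EAE
  B^T in \<open>s\<close>, and they agree at \<open>s = 0\<close>. Comparing it with the homogeneous
  form of \<open>EAE\<close> is what makes the kernel satisfy its equation.\<close>

lemma lyapunov: "EAE s = A - B ** C_mat A B s - C_mat A B s ** transpose B"
proof -
  let ?R = "\<lambda>s. A - B ** C_mat A B s - C_mat A B s ** transpose B"
  have "EAE s $ i $ j - ?R s $ i $ j = EAE 0 $ i $ j - ?R 0 $ i $ j" for i j
  proof (rule DERIV_isconst_all[of "\<lambda>s. EAE s $ i $ j - ?R s $ i $ j"], rule allI)
    fix s
    have 1: "((\<lambda>s. (B ** C_mat A B s) $ i $ j) has_real_derivative (B ** EAE s) $ i $ j) (at s)"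
      unfolding matrix_matrix_mult_def[of B]
      by (simp only: vec_lambda_beta, intro DERIV_sum DERIV_cmult C_deriv)
    have 2: "((\<lambda>s. (C_mat A B s ** transpose B) $ i $ j) has_real_derivative (EAE s ** transpose B) $ i $ j) (at s)"
      unfolding matrix_matrix_mult_def[of _ "transpose B"]
      by (simp, intro DERIV_sum DERIV_cmult_right C_deriv)
    have 3: "((\<lambda>s. EAE s $ i $ j) has_real_derivative
         - (EAE s ** transpose B) $ i $ j - (B ** EAE s) $ i $ j) (at s)"
    proof -
      have e: "(X ** A ** transpose Y) $ i $ j = (\<Sum>n\<in>UNIV. (\<Sum>m\<in>UNIV. X $ i $ m * A $ m $ n) * Y $ j $ n)" for X Y :: "'n rmat"
        by (simp add: matrix_matrix_mult_def transpose_def)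
      have "((\<lambda>s. \<Sum>n\<in>UNIV. (\<Sum>m\<in>UNIV. E_mat B s $ i $ m * A $ m $ n) * E_mat B s $ j $ n)
        has_real_derivative (\<Sum>n\<in>UNIV. (\<Sum>m\<in>UNIV. E_mat B s $ i $ m * A $ m $ n) * - (B ** E_mat B s) $ j $ n
           + (\<Sum>m\<in>UNIV. - (B ** E_mat B s) $ i $ m * A $ m $ n) * E_mat B s $ j $ n)) (at s)"
        by (rule DERIV_sum DERIV_mult' DERIV_cmult_right E_mat_deriv)+
      moreover have "(\<lambda>s. \<Sum>n\<in>UNIV. (\<Sum>m\<in>UNIV. E_mat B s $ i $ m * A $ m $ n) * E_mat B s $ j $ n)
          = (\<lambda>s. EAE s $ i $ j)"
        by (simp only: e)
      moreover have "(\<Sum>n\<in>UNIV. (\<Sum>m\<in>UNIV. E_mat B s $ i $ m * A $ m $ n) * - (B ** E_mat B s) $ j $ n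
           + (\<Sum>m\<in>UNIV. - (B ** E_mat B s) $ i $ m * A $ m $ n) * E_mat B s $ j $ n)
          = - (E_mat B s ** A ** transpose (B ** E_mat B s)) $ i $ j
            - ((B ** E_mat B s) ** A ** transpose (E_mat B s)) $ i $ j"
        unfolding e by (simp add: sum_subtractf sum_negf)
      ultimately show ?thesis by (simp add: matrix_transpose_mul matrix_mul_assoc)
    qed
    show "((\<lambda>s. EAE s $ i $ j - ?R s $ i $ j) has_real_derivative 0) (at s)"
      using DERIV_add[OF 3 DERIV_add[OF 1 2], THEN DERIV_add[OF _ DERIV_const[of "- A $ i $ j"]]]
      by (simp add: algebra_simps)
  qed
  moreover have "EAE 0 = ?R 0"
  proof -
    have "C_mat A B 0 = 0" by (simp add: vec_eq_iff C_mat_entry)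
    then show ?thesis by (simp add: E_mat_0 transpose_mat matrix_mult_0_left matrix_mult_0_right)
  qed
  ultimately show ?thesis by (simp add: vec_eq_iff)
qed

end

section \<open>Matrix Riccati equation and the fundamental solution\<close>

lemma matrix_vector_mult_uminus: "M *v (- x) = - (M *v (x :: real^'n))"
  and matrix_uminus_vector_mult: "(- M) *v x = - (M *v (x :: real^'n))"
  by (simp_all add: vec_eq_iff matrix_vector_mult_def sum_negf)

lemma matrix_sub_ldistrib: "M ** (N - K) = M ** N - M ** (K :: real^'n^'m)"
  by (simp add: vec_eq_iff matrix_matrix_mult_def sum_subtractf right_diff_distrib)

text \<open>One function for the two roles of the fundamental solution: \<open>hk A B 1 p\<close> is
  \<open>\<Gamma>(., p)\<close>, and \<open>hk A (-B) (-1) p\<close> is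
  \<open>\<Gamma>(p, .)\<close>. The argument p is always the pole and the sign gives the direction
  of time, so every fact on the kernel is proved once and reused for the adjoint through
  \<open>dual\<close>.\<close>

definition hk :: "real^'n^'n \<Rightarrow> real^'n^'n \<Rightarrow> real \<Rightarrow> 'n spacetime \<Rightarrow> 'n::finite spacetime \<Rightarrow> real"
  where "hk A B \<sigma> p \<zeta> = fund_gamma A B
    (fst \<zeta> - E_mat B (\<sigma> * (snd \<zeta> - snd p)) *v fst p, \<sigma> * (snd \<zeta> - snd p))"

definition Wq :: "real^'n^'n \<Rightarrow> real^'n^'n \<Rightarrow> real \<Rightarrow> 'n spacetime \<Rightarrow> 'n::finite spacetime \<Rightarrow> real"
  where "Wq A B \<sigma> p \<zeta> = (let s = \<sigma> * (snd \<zeta> - snd p); X = fst \<zeta> - E_mat B s *v fst p in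
    1/4 * ((A *v (Pm A B s *v X)) \<bullet> (Pm A B s *v X)))"

context kolm begin

lemma trace_B: "trace B = 0"
  unfolding trace_def using B_level by (intro sum.neutral) force

text \<open>By the Lyapunov identity P A and P EAE differ by terms whose trace is that of
  \<open>B\<close> or its transpose, which is 0. The trace of P EAE is read off from the homogeneity
  of \<open>EAE\<close> and from P C = C P = 1. The value matches the decay rate of the Gaussian
  prefactor.\<close>

lemma trace_PA:
  assumes s: "s > 0"
  shows "trace (Pm A B s ** A) = hdim / s"
proof -
  let ?P = "Pm A B s" and ?C = "C_mat A B s"
  have e: "trace (?P ** EAE s) = trace (?P ** A)"
  proof -
    have "?P ** EAE s = ?P ** A - ?P ** (B ** ?C) - ?P ** (?C ** transpose B)"
      unfolding lyapunov by (simp add: matrix_sub_ldistrib)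
    moreover have "trace (?P ** (B ** ?C)) = 0"
      by (subst trace_mul_sym) (simp add: matrix_mul_assoc[symmetric] C_P[OF s] trace_B del: matrix_mul_assoc)
    moreover have "trace (?P ** (?C ** transpose B)) = 0"
      using trace_B by (simp add: matrix_mul_assoc P_C[OF s] trace_def transpose_def)
    ultimately show ?thesis by (simp add: trace_sub)
  qed
  have 1: "(\<Sum>j\<in>UNIV. ?P $ i $ j * ?C $ j $ i) = 1" for i
    using P_C[OF s] by (simp add: vec_eq_iff matrix_matrix_mult_def mat_def)
  have 2: "(\<Sum>i\<in>UNIV. ?P $ i $ j * ?C $ j $ i) = 1" for j
    using C_P[OF s] by (simp add: vec_eq_iff matrix_matrix_mult_def mat_def mult.commute)
  have "trace (?P ** EAE s) = (\<Sum>i\<in>UNIV. \<Sum>j\<in>UNIV. ?P $ i $ j * EAE s $ j $ i)"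
    unfolding trace_def matrix_matrix_mult_def[of ?P] by (simp only: vec_lambda_beta)
  also have "\<dots> = (\<Sum>i\<in>UNIV. \<Sum>j\<in>UNIV. (l i + 1) / s * (?P $ i $ j * ?C $ j $ i) + l j / s * (?P $ i $ j * ?C $ j $ i))"
    using s by (intro sum.cong refl, subst EAE_C) (auto simp: field_simps)
  also have "\<dots> = (\<Sum>i\<in>UNIV. (l i + 1) / s * (\<Sum>j\<in>UNIV. ?P $ i $ j * ?C $ j $ i))
      + (\<Sum>i\<in>UNIV. \<Sum>j\<in>UNIV. l j / s * (?P $ i $ j * ?C $ j $ i))"
    by (simp add: sum.distrib sum_distrib_left)
  also have "(\<Sum>i\<in>UNIV. \<Sum>j\<in>UNIV. l j / s * (?P $ i $ j * ?C $ j $ i))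
     = (\<Sum>j\<in>UNIV. l j / s * (\<Sum>i\<in>UNIV. ?P $ i $ j * ?C $ j $ i))"
    by (subst sum.swap) (simp add: sum_distrib_left)
  also have "(\<Sum>i\<in>UNIV. (l i + 1) / s * (\<Sum>j\<in>UNIV. ?P $ i $ j * ?C $ j $ i))
      + (\<Sum>j\<in>UNIV. l j / s * (\<Sum>i\<in>UNIV. ?P $ i $ j * ?C $ j $ i)) = hdim / s"
    unfolding 1 2 hdim_def
    by (simp add: sum.distrib add_divide_distrib sum_divide_distrib sum_distrib_left)
  finally show ?thesis using e by simp
qed

text \<open>The weights \<open>l i + l j + 1\<close> appear whenever a homogeneous matrix is
  differentiated in time. By symmetry they separate into a bilinear expression in \<open>x\<close>
  and \<open>M x\<close>; with M = P at X and M = C at P X that expression is the same.\<close>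

lemma weighted_quad:
  assumes "transpose M = M"
  shows "(\<Sum>i\<in>UNIV. \<Sum>j\<in>UNIV. real (l i + l j + 1) * (M $ i $ j * x $ j * x $ i))
    = 2 * (\<Sum>i\<in>UNIV. l i * x $ i * (M *v x) $ i) + (M *v x) \<bullet> x"
proof -
  have m: "M $ i $ j = M $ j $ i" for i j
    using assms by (metis transpose_def vec_lambda_beta)
  have "(\<Sum>i\<in>UNIV. \<Sum>j\<in>UNIV. real (l i + l j + 1) * (M $ i $ j * x $ j * x $ i))
    = (\<Sum>i\<in>UNIV. \<Sum>j\<in>UNIV. l i * (M $ i $ j * x $ j * x $ i))
    + (\<Sum>i\<in>UNIV. \<Sum>j\<in>UNIV. l j * (M $ i $ j * x $ j * x $ i)) + (M *v x) \<bullet> x"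
    unfolding quad_form_sum by (simp add: sum.distrib algebra_simps)
  also have "(\<Sum>i\<in>UNIV. \<Sum>j\<in>UNIV. l j * (M $ i $ j * x $ j * x $ i))
     = (\<Sum>i\<in>UNIV. \<Sum>j\<in>UNIV. l i * (M $ i $ j * x $ j * x $ i))"
    by (subst sum.swap, intro sum.cong refl, subst m) (simp add: mult_ac)
  also have "(\<Sum>i\<in>UNIV. \<Sum>j\<in>UNIV. l i * (M $ i $ j * x $ j * x $ i)) = (\<Sum>i\<in>UNIV. l i * x $ i * (M *v x) $ i)"
    unfolding matrix_vector_mult_def by (simp add: sum_distrib_left mult_ac)
  finally show ?thesis by simp
qed

lemma P_deriv:
  assumes s: "s > 0"
  shows "((\<lambda>s. Pm A B s $ i $ j) has_real_derivative - (real (l i + l j + 1) / s * Pm A B s $ i $ j)) (at s)"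
proof -
  define m where "m = l i + l j + 1"
  have "((\<lambda>s. Pm A B 1 $ i $ j * inverse (s ^ m)) has_real_derivative
     Pm A B 1 $ i $ j * - (real m * s ^ (m - Suc 0) * inverse (s ^ m) ^ 2)) (at s)"
    using s by (intro DERIV_cmult DERIV_cong[OF DERIV_inverse_fun[OF DERIV_pow]])
      (auto simp: power2_eq_square mult_ac numeral_2_eq_2)
  moreover have "Pm A B 1 $ i $ j * - (real m * s ^ (m - Suc 0) * inverse (s ^ m) ^ 2)
     = - (real m / s * Pm A B s $ i $ j)"
  proof -
    have "s ^ m = s * s ^ (m - Suc 0)" by (simp add: m_def)
    then show ?thesis
      unfolding P_entry[OF s] m_def[symmetric] using s by (simp add: power2_eq_square field_simps)
  qed
  ultimately have d: "((\<lambda>s. Pm A B 1 $ i $ j * inverse (s ^ m)) has_real_derivative - (real m / s * Pm A B s $ i $ j)) (at s)"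
    by (simp only:)
  have eq: "Pm A B 1 $ i $ j * inverse (t ^ m) = Pm A B t $ i $ j" if "t \<in> {0<..}" for t
    using P_entry[of t i j] that by (simp add: m_def divide_inverse)
  show ?thesis
    by (rule has_field_derivative_transform_within_open[OF d[unfolded m_def], of "{0<..}"])
      (use s eq in \<open>auto simp: m_def\<close>)
qed

lemma P_inner: "s > 0 \<Longrightarrow> (Pm A B s *v x) \<bullet> y = x \<bullet> (Pm A B s *v y)"
  by (rule sym_inner[OF P_sym])

lemma C_P_vec: "s > 0 \<Longrightarrow> C_mat A B s *v (Pm A B s *v x) = x"
  by (simp add: matrix_vector_mul_assoc C_P)

text \<open>The eikonal equation for the exponent of the Gaussian: along the drift the quadratic
  form of P decreases at the rate <A P X, P X>. It is the matrix Riccati equation for P, obtained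
  from the homogeneity of P and the Lyapunov identity for C.\<close>

lemma q_flow_deriv:
  assumes s: "s > 0"
  shows "((\<lambda>\<sigma>. (Pm A B (s + \<sigma>) *v (E_mat B \<sigma> *v X)) \<bullet> (E_mat B \<sigma> *v X)) has_real_derivative
    - ((A *v (Pm A B s *v X)) \<bullet> (Pm A B s *v X))) (at 0)"
proof -
  let ?P = "Pm A B s" and ?C = "C_mat A B s"
  let ?y = "?P *v X"
  have E: "((\<lambda>\<sigma>. (E_mat B \<sigma> *v X) $ i) has_real_derivative - (B *v X) $ i) (at 0)" for i
  proof -
    have "((\<lambda>\<sigma>. \<Sum>j\<in>UNIV. E_mat B \<sigma> $ i $ j * X $ j) has_real_derivative
       (\<Sum>j\<in>UNIV. - (B ** E_mat B 0) $ i $ j * X $ j)) (at 0)"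
      by (intro DERIV_sum DERIV_cmult_right E_mat_deriv)
    then show ?thesis
      by (simp add: E_mat_0 matrix_vector_mult_def sum_negf)
  qed
  have P: "((\<lambda>\<sigma>. Pm A B (s + \<sigma>) $ i $ j) has_real_derivative - (real (l i + l j + 1) / s * ?P $ i $ j)) (at 0)" for i j
    using DERIV_shift[of "\<lambda>s. Pm A B s $ i $ j" _ 0 s] P_deriv[OF s, of i j] by (simp add: add.commute)
  have d: "((\<lambda>\<sigma>. \<Sum>i\<in>UNIV. \<Sum>j\<in>UNIV. Pm A B (s + \<sigma>) $ i $ j * (E_mat B \<sigma> *v X) $ j * (E_mat B \<sigma> *v X) $ i)
     has_real_derivative (\<Sum>i\<in>UNIV. \<Sum>j\<in>UNIV.
        (Pm A B (s + 0) $ i $ j * (E_mat B 0 *v X) $ j) * - (B *v X) $ i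
      + (Pm A B (s + 0) $ i $ j * - (B *v X) $ j + - (real (l i + l j + 1) / s * ?P $ i $ j) * (E_mat B 0 *v X) $ j)
        * (E_mat B 0 *v X) $ i)) (at 0)"
    by (intro DERIV_sum DERIV_mult' E P)
  have "(\<Sum>i\<in>UNIV. \<Sum>j\<in>UNIV. (Pm A B (s + 0) $ i $ j * (E_mat B 0 *v X) $ j) * - (B *v X) $ i
      + (Pm A B (s + 0) $ i $ j * - (B *v X) $ j + - (real (l i + l j + 1) / s * ?P $ i $ j) * (E_mat B 0 *v X) $ j)
        * (E_mat B 0 *v X) $ i)
     = - (?y \<bullet> (B *v X)) - (?P *v (B *v X)) \<bullet> X
       - (\<Sum>i\<in>UNIV. \<Sum>j\<in>UNIV. real (l i + l j + 1) * (?P $ i $ j * X $ j * X $ i)) / s"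
    unfolding quad_form_sum
    by (simp add: E_mat_0 sum_subtractf sum_negf sum_divide_distrib algebra_simps flip: sum.distrib)
  also have "\<dots> = - 2 * (?y \<bullet> (B *v X)) - (2 * (\<Sum>i\<in>UNIV. l i * X $ i * ?y $ i) + ?y \<bullet> X) / s"
    unfolding weighted_quad[OF P_sym[OF s]] using P_inner[OF s, of "B *v X" X] by (simp add: inner_commute)
  \<comment> \<open>\<open>weighted_quad\<close> for C at ?y = P X gives the same expression as for
    P at X, because C ?y = X. This trades the time derivative of P for \<open>EAE\<close>.\<close>
  also have "(2 * (\<Sum>i\<in>UNIV. l i * X $ i * ?y $ i) + ?y \<bullet> X) / s = (EAE s *v ?y) \<bullet> ?y"
  proof -
    have "(EAE s *v ?y) \<bullet> ?y = (\<Sum>i\<in>UNIV. \<Sum>j\<in>UNIV. real (l i + l j + 1) * (?C $ i $ j * ?y $ j * ?y $ i)) / s"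
      unfolding quad_form_sum sum_divide_distrib using s
      by (intro sum.cong refl, subst EAE_C) (auto simp: field_simps)
    then show ?thesis
      unfolding weighted_quad[OF C_sym] C_P_vec[OF s] by (simp add: inner_commute mult_ac)
  qed
  also have "(EAE s *v ?y) \<bullet> ?y = (A *v ?y) \<bullet> ?y - 2 * ((B *v X) \<bullet> ?y)"
  proof -
    have "(?C ** transpose B *v ?y) \<bullet> ?y = (transpose B *v ?y) \<bullet> X"
      by (simp only: matrix_vector_mul_assoc[symmetric] sym_inner[OF C_sym] C_P_vec[OF s])
    also have "\<dots> = ?y \<bullet> (B *v X)"
      by (metis dot_lmul_matrix transpose_matrix_vector)
    finally show ?thesis
      unfolding lyapunov
      by (simp add: matrix_vector_mult_diff_rdistrib inner_diff_left)
        (simp add: matrix_vector_mul_assoc[symmetric] C_P_vec[OF s] inner_commute)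
  qed
  finally show ?thesis using d unfolding quad_form_sum[symmetric]
    by (simp add: inner_commute)
qed

text \<open>Conjugation by the dilations makes the determinant constant for times different from 0;
  by the group law that constant equals its own square, and it is not 0.\<close>

lemma det_E: "det (E_mat B s) = 1"
proof (cases "s = 0")
  case False
  have ne: "det (E_mat B t) \<noteq> 0" for t
    using E_mat_inverse[of t] by (metis det_I det_mul mult_zero_left zero_neq_one)
  have eq: "det (E_mat B t) = det (E_mat B 1)" if "t \<noteq> 0" for t
  proof -
    have "E_mat B t ** diag_mat (\<lambda>i. t ^ l i) = diag_mat (\<lambda>i. t ^ l i) ** E_mat B 1"
      by (simp add: vec_eq_iff mult_diag_mat diag_mat_mult E_mat_entry power_minus[of t] flip: power_add)
    then have "det (E_mat B t) * det (diag_mat (\<lambda>i::'n. t ^ l i)) = det (diag_mat (\<lambda>i::'n. t ^ l i)) * det (E_mat B 1)"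
      by (metis det_mul)
    then show ?thesis using that by (simp add: det_diag_mat)
  qed
  have "det (E_mat B s) = det (E_mat B (s/2)) * det (E_mat B (s/2))"
    using E_mat_add[of "s/2" "s/2"] by (simp add: det_mul)
  then show ?thesis using eq[of s] eq[of "s/2"] False ne[of s] by simp
qed (simp add: E_mat_0 det_I)

text \<open>Since E(s - \<sigma>) = E(s) E(-\<sigma>), the sum of C(s - \<sigma>) and of the
  conjugated dual covariance at \<sigma> does not depend on \<sigma>. The values at \<sigma> = 0 and
  \<sigma> = s are compared.\<close>

lemma C_dual: "C_mat A B s = E_mat B s ** C_mat A (-B) s ** transpose (E_mat B s)"
proof -
  interpret d: kolm A "-B" l by (rule dual)
  let ?G = "\<lambda>M. E_mat B s ** M ** transpose (E_mat B s)"
  have g: "?G M $ i $ j = (\<Sum>n\<in>UNIV. (\<Sum>m\<in>UNIV. E_mat B s $ i $ m * M $ m $ n) * E_mat B s $ j $ n)" for M i j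
    by (simp add: matrix_matrix_mult_def transpose_def)
  have "- C_mat A B (s - s) $ i $ j - ?G (C_mat A (-B) s) $ i $ j
      = - C_mat A B (s - 0) $ i $ j - ?G (C_mat A (-B) 0) $ i $ j" for i j
  proof (rule DERIV_isconst_all[of "\<lambda>\<sigma>. - C_mat A B (s - \<sigma>) $ i $ j - ?G (C_mat A (-B) \<sigma>) $ i $ j"], rule allI)
    fix \<sigma>
    have 1: "((\<lambda>\<sigma>. C_mat A B (s - \<sigma>) $ i $ j) has_real_derivative EAE (s - \<sigma>) $ i $ j * - 1) (at \<sigma>)"
      by (rule DERIV_chain2[OF C_deriv]) (auto intro!: derivative_eq_intros)
    have 2: "((\<lambda>\<sigma>. ?G (C_mat A (-B) \<sigma>) $ i $ j) has_real_derivative ?G (d.EAE \<sigma>) $ i $ j) (at \<sigma>)"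
      unfolding g by (intro DERIV_sum DERIV_cmult_right DERIV_cmult d.C_deriv)
    have "E_mat B (s - \<sigma>) = E_mat B s ** E_mat (-B) \<sigma>"
      using E_mat_add[of s "- \<sigma>"] by (simp add: E_mat_uminus)
    then have "?G (d.EAE \<sigma>) = EAE (s - \<sigma>)"
      by (simp add: matrix_transpose_mul matrix_mul_assoc)
    then show "((\<lambda>\<sigma>. - C_mat A B (s - \<sigma>) $ i $ j - ?G (C_mat A (-B) \<sigma>) $ i $ j) has_real_derivative 0) (at \<sigma>)"
      using DERIV_diff[OF DERIV_minus[OF 1] 2] by simp
  qed
  moreover have "C_mat A B 0 = 0" "C_mat A (-B) 0 = 0"
    by (simp_all add: vec_eq_iff C_mat_entry d.C_mat_entry)
  ultimately show ?thesis by (simp add: vec_eq_iff matrix_mult_0_left matrix_mult_0_right)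
qed

lemma det_C_dual: "det (C_mat A B s) = det (C_mat A (-B) s)"
  by (subst C_dual) (simp add: det_mul det_E det_transpose)

lemma P_dual:
  assumes s: "s > 0"
  shows "Pm A (-B) s = transpose (E_mat B s) ** Pm A B s ** E_mat B s"
proof (rule matrix_inv_eqI)
  interpret d: kolm A "-B" l by (rule dual)
  have "C_mat A (-B) s = E_mat B (-s) ** C_mat A B s ** transpose (E_mat B (-s))"
    using d.C_dual[of s] by (simp add: E_mat_uminus)
  then have "transpose (E_mat B s) ** Pm A B s ** E_mat B s ** C_mat A (- B) s
    = transpose (E_mat B s) ** (Pm A B s ** ((E_mat B s ** E_mat B (-s)) ** C_mat A B s)) ** transpose (E_mat B (-s))"
    by (simp add: matrix_mul_assoc)
  also have "\<dots> = transpose (E_mat B s) ** transpose (E_mat B (-s))"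
    by (simp add: E_mat_inverse P_C[OF s])
  also have "\<dots> = mat 1"
    unfolding matrix_transpose_mul[symmetric] by (simp add: E_mat_inverse transpose_mat)
  finally show "transpose (E_mat B s) ** Pm A B s ** E_mat B s ** C_mat A (- B) s = mat 1" .
qed

lemma q_dual: "s > 0 \<Longrightarrow> (Pm A B s *v (E_mat B s *v x)) \<bullet> (E_mat B s *v x) = (Pm A (-B) s *v x) \<bullet> x"
  unfolding P_dual by (metis dot_lmul_matrix matrix_vector_mul_assoc transpose_matrix_vector inner_commute)

text \<open>Expresses covariances at negative times through the dual operator at positive times;
  needed because \<open>W\<close> is evaluated at points before the centre.\<close>

lemma C_neg: "C_mat A B (-s) = - C_mat A (-B) s"
proof -
  interpret d: kolm A "-B" l by (rule dual)
  have "d.EAE 1 = EAE (-1)" by (simp add: E_mat_uminus)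
  then have "d.EAE 1 $ i $ j = (-1) ^ (l i + l j) * EAE 1 $ i $ j" for i j
    by (metis EAE_entry)
  then show ?thesis
    by (simp add: vec_eq_iff C_mat_entry d.C_mat_entry power_minus[of s] mult_ac del: of_nat_Suc)
qed

lemma P_neg: "s > 0 \<Longrightarrow> Pm A B (-s) = - Pm A (-B) s"
proof (rule matrix_inv_eqI)
  interpret d: kolm A "-B" l by (rule dual)
  have m: "(- X) ** (- Y) = X ** Y" for X Y :: "'n rmat"
    by (simp add: vec_eq_iff matrix_matrix_mult_def)
  show "s > 0 \<Longrightarrow> - Pm A (-B) s ** C_mat A B (-s) = mat 1"
    by (simp add: C_neg m d.P_C)
qed

text \<open>By homogeneity the form at time \<open>s\<close> equals the form at time 1 in rescaled
  coordinates. For s at most T every factor s^(2 l i + 1) is at most M s, which leaves the parabolic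
  bound of the heat kernel; this is the only decay estimate used later.\<close>

lemma q_lower_bound:
  assumes T: "T > 0"
  obtains c where "c > 0" "\<And>s x. 0 < s \<Longrightarrow> s \<le> T \<Longrightarrow> (Pm A B s *v x) \<bullet> x \<ge> c * (norm x)\<^sup>2 / s"
proof -
  obtain c where c: "c > 0" "\<And>x. (Pm A B 1 *v x) \<bullet> x \<ge> c * (norm x)\<^sup>2"
    using pos_def_lower_bound[OF P_pos_def[of 1]] by auto
  define M where "M = (max 1 T) ^ (2 * top_level)"
  have M: "M \<ge> 1" by (simp add: M_def)
  show ?thesis
  proof
    show "c / M > 0" using c M by simp
    fix s x assume s: "0 < s" "s \<le> T"
    define y :: "'n rvec" where "y = (\<chi> i. x $ i / sqrt s ^ (2 * l i + 1))"
    have p: "sqrt s ^ (2 * m) = s ^ m" for m using s by (simp add: power_mult)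
    have "sqrt s ^ (2 * l i + 1) * sqrt s ^ (2 * l j + 1) = s ^ (l i + l j + 1)" for i j
      using p[of "l i + l j + 1"] by (simp add: power_add power2_eq_square algebra_simps power_mult)
    then have q: "(Pm A B s *v x) \<bullet> x = (Pm A B 1 *v y) \<bullet> y"
      unfolding quad_form_sum y_def
      by (intro sum.cong refl, subst P_entry[OF s(1)]) (simp add: mult.commute)
    have "(norm x)\<^sup>2 / (M * s) = (\<Sum>i\<in>UNIV. (x $ i)\<^sup>2 / (M * s))"
      by (simp add: norm_vec_def L2_set_def sum_nonneg sum_divide_distrib)
    also have "\<dots> \<le> (\<Sum>i\<in>UNIV. (y $ i)\<^sup>2)"
    proof (rule sum_mono)
      fix i
      have "s ^ (2 * l i) \<le> (max 1 T) ^ (2 * l i)" using s by (intro power_mono) auto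
      also have "\<dots> \<le> M" unfolding M_def using level_le_top[of i] by (intro power_increasing) auto
      finally have le: "s ^ (2 * l i + 1) \<le> M * s" using s by (simp add: mult.commute)
      have "(y $ i)\<^sup>2 = (x $ i)\<^sup>2 / s ^ (2 * l i + 1)"
      proof -
        have "(sqrt s ^ (2 * l i + 1))\<^sup>2 = s ^ (2 * l i + 1)"
          using p[of "2 * l i + 1"] by (simp only: power_mult[symmetric] mult.commute)
        then show ?thesis by (simp add: y_def power_divide)
      qed
      then show "(x $ i)\<^sup>2 / (M * s) \<le> (y $ i)\<^sup>2"
        using le s M by (simp add: frac_le)
    qed
    also have "\<dots> = (norm y)\<^sup>2" by (simp add: norm_vec_def L2_set_def sum_nonneg)
    finally have "c * ((norm x)\<^sup>2 / (M * s)) \<le> c * (norm y)\<^sup>2" using c by (intro mult_left_mono) auto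
    also have "\<dots> \<le> (Pm A B s *v x) \<bullet> x" unfolding q by (rule c)
    finally show "c / M * (norm x)\<^sup>2 / s \<le> (Pm A B s *v x) \<bullet> x" by simp
  qed
qed

lemma fund_gamma_even: "fund_gamma A B (- x, s) = fund_gamma A B (x, s)"
  by (simp add: fund_gamma_def matrix_vector_mult_uminus)

lemma fund_gamma_dual: "fund_gamma A B (E_mat B s *v x, s) = fund_gamma A (-B) (x, s)"
  by (simp add: fund_gamma_def q_dual det_C_dual)

lemma rel_pos: "gcomp B (ginv B \<zeta>) z = (fst z - E_mat B (snd z - snd \<zeta>) *v fst \<zeta>, snd z - snd \<zeta>)"
  by (simp add: gcomp_def ginv_def E_mat_mult_vec matrix_vector_mult_uminus)

lemma fund_sol_forward: "fund_sol A B z \<zeta> = hk A B 1 \<zeta> z"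
  by (simp add: fund_sol_def hk_def rel_pos)

text \<open>As a function of the second argument, the fundamental solution is again a kernel of the
  same family, for \<open>-B\<close> and reversed time: the relative position is moved by E, which
  turns P into the dual P.\<close>

lemma fund_sol_backward: "fund_sol A B z \<zeta> = hk A (-B) (-1) z \<zeta>"
proof -
  let ?s = "snd z - snd \<zeta>"
  have "fst z - E_mat B ?s *v fst \<zeta> = - (E_mat B ?s *v (fst \<zeta> - E_mat (-B) ?s *v fst z))"
    by (simp add: matrix_vector_mult_diff_distrib E_mat_uminus E_mat_mult_vec E_mat_0)
  then show ?thesis
    by (simp add: fund_sol_def hk_def rel_pos fund_gamma_even fund_gamma_dual)
qed

lemma W_kernel_forward: "snd z < snd \<zeta> \<Longrightarrow> W_kernel A B (gcomp B (ginv B z) \<zeta>) = Wq A B 1 z \<zeta>"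
  by (simp add: W_kernel_def rel_pos Wq_def Let_def)

text \<open>The inverse covariance changes sign at negative times, but \<open>W\<close> is quadratic
  in it.\<close>

lemma W_kernel_backward:
  assumes "snd \<zeta> < snd z"
  shows "W_kernel A B (gcomp B (ginv B z) \<zeta>) = Wq A (-B) (-1) z \<zeta>"
proof -
  let ?s = "snd z - snd \<zeta>"
  have "snd \<zeta> - snd z = - ?s" by simp
  then have "Pm A B (snd \<zeta> - snd z) = - Pm A (-B) ?s" "E_mat B (snd \<zeta> - snd z) = E_mat (-B) ?s"
    using P_neg[of ?s] assms by (simp_all only: E_mat_uminus)
  then show ?thesis using assms
    by (simp add: W_kernel_def rel_pos Wq_def Let_def matrix_vector_mult_uminus matrix_uminus_vector_mult)
qed

end

section \<open>Linear changes of variables and differentiation under the integral\<close>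

lemma vimage_matrix_vec:
  fixes M :: "real^'n^'n"
  assumes "invertible M"
  shows "(*v) M -` S = (*v) (matrix_inv M) ` S"
proof -
  note I = matrix_inv_mult[OF assms]
  show ?thesis
  proof (intro set_eqI iffI)
    fix x assume "x \<in> (*v) M -` S"
    then have "x = matrix_inv M *v (M *v x)" "M *v x \<in> S"
      by (simp_all add: matrix_vector_mul_assoc I)
    then show "x \<in> (*v) (matrix_inv M) ` S" by blast
  qed (auto simp: matrix_vector_mul_assoc I)
qed

lemma borel_measurable_matrix_vec [measurable]: "(*v) (M :: real^'n^'m) \<in> borel_measurable borel"
  by (intro borel_measurable_continuous_onI linear_continuous_on matrix_vector_mul_bounded_linear)

lemma lborel_linear_image:
  fixes M :: "real^('n::{finite,wellorder})^('n::{finite,wellorder})"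
  assumes "invertible M"
  shows "lborel = density (distr lborel borel ((*v) M)) (\<lambda>_. ennreal \<bar>det M\<bar>)"
proof (rule lborel_eqI)
  have nz: "det M \<noteq> 0" using assms invertible_det_nz by blast
  have "det M * det (matrix_inv M) = 1"
    using matrix_inv_mult(1)[OF assms] by (metis det_I det_mul)
  then have d: "\<bar>det M\<bar> * \<bar>det (matrix_inv M)\<bar> = 1" by (simp flip: abs_mult)
  fix a b :: "'n rvec" assume ab: "\<And>c. c \<in> Basis \<Longrightarrow> a \<bullet> c \<le> b \<bullet> c"
  let ?S = "(*v) (matrix_inv M) ` box a b"
  have lm: "?S \<in> lmeasurable"
    and me: "measure lebesgue ?S = \<bar>det (matrix_inv M)\<bar> * measure lebesgue (box a b)"
    using measurable_linear_image[of "(*v) (matrix_inv M)" "box a b"]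
      measure_linear_image[of "(*v) (matrix_inv M)" "box a b"] by auto
  have S: "?S \<in> sets borel"
    using measurable_sets[OF borel_measurable_matrix_vec[of M], of "box a b"]
    by (simp add: vimage_matrix_vec[OF assms])
  have "emeasure (density (distr lborel borel ((*v) M)) (\<lambda>_. ennreal \<bar>det M\<bar>)) (box a b)
      = ennreal \<bar>det M\<bar> * emeasure lborel ?S"
    by (simp add: emeasure_density_const emeasure_distr vimage_matrix_vec[OF assms])
  also have "emeasure lborel ?S = emeasure lebesgue ?S" using S by simp
  also have "\<dots> = ennreal (\<bar>det (matrix_inv M)\<bar> * measure lebesgue (box a b))"
    unfolding me[symmetric] by (rule emeasure_eq_measure2[OF lm])
  also have "ennreal \<bar>det M\<bar> * \<dots> = ennreal (measure lebesgue (box a b))"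
    using d by (simp flip: ennreal_mult' add: mult.assoc[symmetric])
  also have "\<dots> = (\<Prod>c\<in>Basis. (b - a) \<bullet> c)"
    using ab by (simp add: measure_lborel_box_eq)
  finally show "emeasure (density (distr lborel borel ((*v) M)) (\<lambda>_. ennreal \<bar>det M\<bar>)) (box a b)
      = ennreal (\<Prod>c\<in>Basis. (b - a) \<bullet> c)" .
qed simp

lemma nn_integral_linear:
  fixes M :: "real^('n::{finite,wellorder})^('n::{finite,wellorder})"
  assumes "invertible M" and [measurable]: "f \<in> borel_measurable borel"
  shows "(\<integral>\<^sup>+x. f x \<partial>lborel) = ennreal \<bar>det M\<bar> * (\<integral>\<^sup>+x. f (M *v x) \<partial>lborel)"
  by (subst lborel_linear_image[OF assms(1)])
    (simp add: nn_integral_density nn_integral_distr nn_integral_cmult)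

lemma distr_lborel_linear:
  fixes M :: "real^('n::{finite,wellorder})^('n::{finite,wellorder})"
  assumes "\<bar>det M\<bar> = 1"
  shows "distr lborel borel ((*v) M) = lborel"
proof -
  have "invertible M" using assms invertible_det_nz by fastforce
  from lborel_linear_image[OF this] show ?thesis
    using density_1[of "distr lborel borel ((*v) M)"] by (simp add: assms)
qed

text \<open>Symmetric Gaussian elimination, one index at a time. It yields the factor R with S = R
  R^T used both to normalise the Gaussian and to write A as a sum of squares.\<close>

lemma congruence_elim:
  fixes S :: "real^'n^'n"
  assumes S: "pos_def S" and "finite J"
  shows "\<exists>T :: real^'n^'n. invertible T \<and> (\<forall>i\<in>J. \<forall>j. (T ** S ** transpose T) $ i $ j = (if i = j then 1 else 0))"
  using assms(2)
proof (induction J)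
  case empty
  show ?case by (rule exI[of _ "mat 1"]) (auto simp: invertible_def)
next
  case (insert k J)
  then obtain T :: "real^'n^'n" where T: "invertible T"
    and TJ: "\<And>i j. i \<in> J \<Longrightarrow> (T ** S ** transpose T) $ i $ j = (if i = j then 1 else 0)" by blast
  define R where "R = T ** S ** transpose T"
  have Rsym: "R $ i $ j = R $ j $ i" for i j
  proof -
    have "transpose R = R"
      using S by (simp add: R_def matrix_transpose_mul matrix_mul_assoc pos_def_def)
    then show ?thesis by (metis transpose_def vec_lambda_beta)
  qed
  have Rpos: "R $ k $ k > 0"
  proof -
    let ?e = "axis k 1 :: real^'n"
    have "R $ k $ k = (R *v ?e) \<bullet> ?e"
      by (simp add: inner_axis matrix_vector_mult_basis column_def)
    also have "\<dots> = (S *v (transpose T *v ?e)) \<bullet> (transpose T *v ?e)"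
      unfolding R_def by (metis dot_lmul_matrix matrix_vector_mul_assoc transpose_matrix_vector transpose_transpose)
    also have "\<dots> > 0"
    proof -
      have "transpose T *v ?e \<noteq> 0"
      proof
        assume 0: "transpose T *v ?e = 0"
        have "transpose (matrix_inv T) ** transpose T = mat 1"
          by (simp add: matrix_inv_mult[OF T] transpose_mat flip: matrix_transpose_mul)
        then have "?e = transpose (matrix_inv T) *v (transpose T *v ?e)"
          unfolding matrix_vector_mul_assoc by simp
        then show False by (simp only: 0 matrix_vector_mult_0_right axis_eq_0_iff)
      qed
      then show ?thesis using S by (auto simp: pos_def_def)
    qed
    finally show ?thesis .
  qed
  \<comment> \<open>The elementary elimination matrix: row k is divided by the root of the pivot,
    and from every other row the multiple of row k is subtracted that clears its entry in column k.
    Rows of indices already in J have no such entry.\<close>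
  define V :: "real^'n^'n" where "V = (\<chi> i j. if i = k then (if j = k then 1 / sqrt (R $ k $ k) else 0)
      else (if i = j then 1 else 0) - (if j = k then R $ i $ k / R $ k $ k else 0))"
  have Vk: "(\<Sum>m\<in>UNIV. V $ k $ m * f m) = f k / sqrt (R $ k $ k)" for f :: "'n \<Rightarrow> real"
  proof -
    have "(\<Sum>m\<in>UNIV. V $ k $ m * f m) = (\<Sum>m\<in>UNIV. if m = k then f m / sqrt (R $ k $ k) else 0)"
      by (intro sum.cong) (auto simp: V_def)
    then show ?thesis by (simp add: sum.delta)
  qed
  have Vi: "(\<Sum>m\<in>UNIV. V $ i $ m * f m) = f i - R $ i $ k / R $ k $ k * f k" if "i \<noteq> k" for i and f :: "'n \<Rightarrow> real"
  proof -
    have "(\<Sum>m\<in>UNIV. V $ i $ m * f m) = (\<Sum>m\<in>UNIV. (if m = i then f m else 0) - (if m = k then R $ i $ k / R $ k $ k * f m else 0))"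
      using that by (intro sum.cong) (auto simp: V_def)
    then show ?thesis by (simp add: sum_subtractf sum.delta)
  qed
  have inv: "invertible V"
    unfolding invertible_left_inverse matrix_left_invertible_ker
  proof (intro allI impI)
    fix x assume 0: "V *v x = 0"
    have e: "(\<Sum>m\<in>UNIV. V $ i $ m * x $ m) = 0" for i
      using 0 by (simp add: vec_eq_iff matrix_vector_mult_def)
    have k: "x $ k = 0" using e[of k] Rpos unfolding Vk by simp
    have "x $ i = 0" for i
    proof (cases "i = k")
      case False
      then show ?thesis using e[of i] k unfolding Vi[OF False] by simp
    qed (use k in simp)
    then show "x = 0" by (simp add: vec_eq_iff)
  qed
  have fin: "(V ** R ** transpose V) $ i $ j = (if i = j then 1 else 0)" if "i \<in> insert k J" for i j
  proof -
    have e: "(V ** R ** transpose V) $ i $ j = (\<Sum>m\<in>UNIV. V $ j $ m * (\<Sum>n\<in>UNIV. V $ i $ n * R $ n $ m))"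
      by (simp add: matrix_matrix_mult_def transpose_def mult.commute)
    show ?thesis
    proof (cases "i = k")
      case True
      have e': "(V ** R ** transpose V) $ i $ j = (\<Sum>m\<in>UNIV. V $ j $ m * (R $ k $ m / sqrt (R $ k $ k)))"
        unfolding e by (simp only: True Vk)
      show ?thesis
      proof (cases "j = k")
        case jk: True
        then show ?thesis
          using e' Vk[of "\<lambda>m. R $ k $ m / sqrt (R $ k $ k)"] Rpos True by simp
      next
        case jk: False
        then show ?thesis
          using e' Vi[OF jk, of "\<lambda>m. R $ k $ m / sqrt (R $ k $ k)"] Rpos Rsym[of j k] True by simp
      qed
    next
      case False
      then have iJ: "i \<in> J" using that by auto
      have Ri: "R $ i $ m = (if i = m then 1 else 0)" for m using TJ[OF iJ] by (simp add: R_def)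
      have "(V ** R ** transpose V) $ i $ j = (\<Sum>m\<in>UNIV. V $ j $ m * (if m = i then 1 else 0))"
        unfolding e Vi[OF False] using Ri False by (intro sum.cong) auto
      also have "\<dots> = V $ j $ i" by (simp add: sum.delta if_distrib cong: if_cong)
      also have "\<dots> = (if i = j then 1 else 0)" using False by (auto simp: V_def)
      finally show ?thesis .
    qed
  qed
  have "V ** T ** S ** transpose (V ** T) = V ** R ** transpose V"
    by (simp add: R_def matrix_transpose_mul matrix_mul_assoc)
  then show ?case
    using fin invertible_mult[OF inv T] by (intro exI[of _ "V ** T"]) simp
qed

lemma pos_def_factorization:
  fixes S :: "real^'n^'n"
  assumes "pos_def S"
  obtains R :: "real^'n^'n" where "invertible R" "S = R ** transpose R"
proof -
  obtain T :: "real^'n^'n" where T: "invertible T" "T ** S ** transpose T = mat 1"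
    using congruence_elim[OF assms finite[of UNIV]] by (auto simp: vec_eq_iff mat_def)
  let ?R = "matrix_inv T"
  note I = matrix_inv_mult[OF T(1)]
  have "transpose T ** transpose ?R = mat 1"
    by (simp add: I transpose_mat flip: matrix_transpose_mul)
  then have "S = (?R ** T) ** S ** (transpose T ** transpose ?R)" by (simp add: I)
  also have "\<dots> = ?R ** (T ** S ** transpose T) ** transpose ?R" by (simp add: matrix_mul_assoc)
  finally have "S = ?R ** transpose ?R" by (simp add: T)
  moreover have "invertible ?R" using I unfolding invertible_def by blast
  ultimately show ?thesis by (rule that[rotated])
qed

lemma nn_integral_gauss_1: "(\<integral>\<^sup>+x. ennreal (exp (- (x\<^sup>2 / 4))) \<partial>lborel) = ennreal (sqrt (4 * pi))"
proof -
  have "normal_density 0 (sqrt 2) x = exp (- (x\<^sup>2 / 4)) / sqrt (4 * pi)" for x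
    by (simp add: normal_density_def)
  then have eq: "exp (- (x\<^sup>2 / 4)) = sqrt (4 * pi) * normal_density 0 (sqrt 2) x" for x
    by simp
  have "(\<integral>\<^sup>+x. ennreal (exp (- (x\<^sup>2 / 4))) \<partial>lborel) = ennreal (\<integral>x. sqrt (4 * pi) * normal_density 0 (sqrt 2) x \<partial>lborel)"
    unfolding eq by (rule nn_integral_eq_integral) auto
  then show ?thesis by simp
qed

lemma nn_integral_gauss:
  "(\<integral>\<^sup>+x. ennreal (exp (- ((x :: real^'n) \<bullet> x / 4))) \<partial>lborel) = ennreal (sqrt (4 * pi) ^ CARD('n))"
proof -
  interpret product_sigma_finite "\<lambda>_ :: real^'n. lborel :: real measure" ..
  have e: "ennreal (exp (- ((\<Sum>b\<in>Basis. f b *\<^sub>R b) \<bullet> (\<Sum>b\<in>Basis. f b *\<^sub>R b) / 4)))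
      = (\<Prod>b\<in>Basis. ennreal (exp (- ((f b)\<^sup>2 / 4))))" for f :: "real^'n \<Rightarrow> real"
  proof -
    have "(\<Sum>b\<in>Basis. f b *\<^sub>R b) \<bullet> (\<Sum>b\<in>Basis. f b *\<^sub>R b) = (\<Sum>b\<in>Basis. (f b)\<^sup>2)"
      by (subst euclidean_inner) (simp add: power2_eq_square)
    then show ?thesis
      by (simp add: prod_ennreal exp_sum[symmetric] sum_divide_distrib sum_negf)
  qed
  have "(\<integral>\<^sup>+x. ennreal (exp (- ((x :: real^'n) \<bullet> x / 4))) \<partial>lborel)
      = (\<integral>\<^sup>+f. (\<Prod>b\<in>Basis. ennreal (exp (- ((f b)\<^sup>2 / 4)))) \<partial>(\<Pi>\<^sub>M b\<in>(Basis :: (real^'n) set). lborel))"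
    by (subst lborel_eq, subst nn_integral_distr) (simp_all add: e)
  also have "\<dots> = ennreal (sqrt (4 * pi)) ^ CARD('n)"
    by (subst product_nn_integral_prod) (simp_all add: nn_integral_gauss_1)
  finally show ?thesis by (simp add: ennreal_power)
qed

context kolm begin

lemma borel_measurable_quad [measurable]: "(\<lambda>x. ((M :: 'n rmat) *v x) \<bullet> x) \<in> borel_measurable borel"
  by measurable

text \<open>With C = R R^T the substitution x = R y turns the exponent into that of a standard
  Gaussian, and det R cancels the root of det C.\<close>

lemma nn_integral_fund_gamma:
  assumes s: "s > 0"
  shows "(\<integral>\<^sup>+x. ennreal (fund_gamma A B (x, s)) \<partial>lborel) = 1"
proof -
  let ?n = "CARD('n)"
  obtain R :: "'n rmat" where R: "invertible R" "C_mat A B s = R ** transpose R"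
    using pos_def_factorization[OF C_pos_def[OF s]] .
  note I = matrix_inv_mult[OF R(1)]
  have "transpose (matrix_inv R) ** matrix_inv R ** C_mat A B s = transpose (matrix_inv R) ** ((matrix_inv R ** R) ** transpose R)"
    by (simp add: R(2) matrix_mul_assoc)
  also have "\<dots> = mat 1"
    by (simp add: I transpose_mat flip: matrix_transpose_mul)
  finally have P: "Pm A B s = transpose (matrix_inv R) ** matrix_inv R" by (rule matrix_inv_eqI)
  have q: "(Pm A B s *v (R *v x)) \<bullet> (R *v x) = x \<bullet> x" for x
  proof -
    have "Pm A B s *v (R *v x) = transpose (matrix_inv R) *v ((matrix_inv R ** R) *v x)"
      by (simp add: P matrix_vector_mul_assoc matrix_mul_assoc)
    then have "(Pm A B s *v (R *v x)) \<bullet> (R *v x) = (transpose (matrix_inv R) *v x) \<bullet> (R *v x)" by (simp add: I)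
    also have "\<dots> = x \<bullet> ((matrix_inv R ** R) *v x)"
      by (metis dot_lmul_matrix matrix_vector_mul_assoc transpose_matrix_vector transpose_transpose)
    finally show ?thesis by (simp add: I)
  qed
  define c where "c = (4 * pi) powr (- (real ?n / 2)) / sqrt (det (C_mat A B s))"
  have dC: "det (C_mat A B s) = (det R)\<^sup>2" by (simp add: R(2) det_mul det_transpose power2_eq_square)
  have dR: "det R \<noteq> 0" using R(1) invertible_det_nz by blast
  have c0: "c \<ge> 0" by (simp add: c_def dC)
  have "(\<integral>\<^sup>+x. ennreal (fund_gamma A B (x, s)) \<partial>lborel)
     = ennreal c * (\<integral>\<^sup>+x. ennreal (exp (- (1/4) * ((Pm A B s *v x) \<bullet> x))) \<partial>lborel)"
    using s c0 by (simp add: fund_gamma_def c_def[symmetric] ennreal_mult nn_integral_cmult)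
  also have "(\<integral>\<^sup>+x. ennreal (exp (- (1/4) * ((Pm A B s *v x) \<bullet> x))) \<partial>lborel)
     = ennreal \<bar>det R\<bar> * (\<integral>\<^sup>+x. ennreal (exp (- ((x :: 'n rvec) \<bullet> x / 4))) \<partial>lborel)"
    by (subst nn_integral_linear[OF R(1)]) (simp_all add: q)
  also have "ennreal c * \<dots> = ennreal (c * \<bar>det R\<bar> * sqrt (4 * pi) ^ ?n)"
    unfolding nn_integral_gauss using c0 by (simp add: ennreal_mult mult.assoc)
  also have "c * \<bar>det R\<bar> * sqrt (4 * pi) ^ ?n = 1"
  proof -
    have "sqrt (4 * pi) ^ ?n = (4 * pi) powr (real ?n / 2)"
      by (simp add: powr_half_sqrt[symmetric] powr_powr flip: powr_realpow)
    then show ?thesis using dR by (simp add: c_def dC powr_minus field_simps)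
  qed
  finally show ?thesis by simp
qed

end

text \<open>The substitute for integration by parts. The integral of F composed with the time-1 map,
  minus F, is 0 by invariance of the measure; by the fundamental theorem and Fubini it is also the
  average over the flow times in [0, 1] of the integral of F' composed with the flow, which is again
  the integral of F'.\<close>

lemma integral_flow_derivative:
  fixes \<Theta> :: "real \<Rightarrow> 'a::euclidean_space \<Rightarrow> 'a" and F F' :: "'a \<Rightarrow> real"
  assumes pres: "\<And>\<sigma>. distr lborel borel (\<Theta> \<sigma>) = lborel"
    and cont: "continuous_on UNIV (\<lambda>p. \<Theta> (fst p) (snd p))"
    and zero: "\<And>z. \<Theta> 0 z = z" and add: "\<And>\<sigma> \<tau> z. \<Theta> (\<sigma> + \<tau>) z = \<Theta> \<tau> (\<Theta> \<sigma> z)"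
    and deriv: "\<And>z. ((\<lambda>\<sigma>. F (\<Theta> \<sigma> z)) has_real_derivative F' z) (at 0)"
    and F: "integrable lborel F" and F': "integrable lborel F'" and F'c: "continuous_on UNIV F'"
  shows "(\<integral>z. F' z \<partial>lborel) = 0"
proof -
  have [measurable]: "(\<lambda>p. \<Theta> (fst p) (snd p)) \<in> borel_measurable borel"
    using cont by (rule borel_measurable_continuous_onI)
  have mT [measurable]: "\<Theta> \<sigma> \<in> borel_measurable borel" for \<sigma>
    by (rule measurable_compose[of "\<lambda>z. (\<sigma>, z)" _ borel "\<lambda>p. \<Theta> (fst p) (snd p)", simplified]) (auto intro!: borel_measurable_continuous_onI continuous_intros)
  have [measurable]: "F' \<in> borel_measurable borel" "F \<in> borel_measurable borel"
    using F F' by auto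
  have dT: "((\<lambda>\<sigma>. F (\<Theta> \<sigma> z)) has_real_derivative F' (\<Theta> \<sigma> z)) (at \<sigma>)" for z \<sigma>
  proof -
    have "\<Theta> (x + \<sigma>) z = \<Theta> x (\<Theta> \<sigma> z)" for x
      using add[of \<sigma> x z] by (simp add: add.commute)
    then show ?thesis
      using deriv[of "\<Theta> \<sigma> z"] DERIV_shift[of "\<lambda>\<sigma>. F (\<Theta> \<sigma> z)" "F' (\<Theta> \<sigma> z)" 0 \<sigma>] by simp
  qed
  have cT: "continuous_on UNIV (\<lambda>\<sigma>. F' (\<Theta> \<sigma> z))" for z
    using continuous_on_compose2[OF F'c continuous_on_compose2[OF cont, of UNIV "\<lambda>\<sigma>. (\<sigma>, z)"]]
    by (simp add: continuous_on_Pair continuous_on_id continuous_on_const)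
  have ftc: "(\<integral>\<sigma>. indicator {0..1} \<sigma> * F' (\<Theta> \<sigma> z) \<partial>lborel) = F (\<Theta> 1 z) - F z" for z
    using integral_FTC_atLeastAtMost[of 0 1 "\<lambda>\<sigma>. F (\<Theta> \<sigma> z)" "\<lambda>\<sigma>. F' (\<Theta> \<sigma> z)"] dT cT[of z] zero
    by (auto simp: has_real_derivative_iff_has_vector_derivative intro: has_vector_derivative_at_within continuous_on_subset)
  have inv: "(\<integral>z. G (\<Theta> \<sigma> z) \<partial>lborel) = (\<integral>z. G z \<partial>lborel)" if [measurable]: "G \<in> borel_measurable borel" for G :: "'a \<Rightarrow> real" and \<sigma>
    by (subst (2) pres[of \<sigma>, symmetric]) (simp add: integral_distr)
  have invi: "integrable lborel (\<lambda>z. G (\<Theta> \<sigma> z))" if "integrable lborel G" for G :: "'a \<Rightarrow> real" and \<sigma>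
  proof -
    have "integrable (distr lborel borel (\<Theta> \<sigma>)) G" using that pres by simp
    then show ?thesis by (subst (asm) integrable_distr_eq) (use that in auto)
  qed
  let ?K = "\<lambda>(\<sigma>, z). indicator {0..1} \<sigma> * F' (\<Theta> \<sigma> z) :: real"
  have K: "integrable (lborel \<Otimes>\<^sub>M lborel) ?K"
  proof (rule lborel_pair.Fubini_integrable)
    show "?K \<in> borel_measurable (lborel \<Otimes>\<^sub>M lborel)"
    proof -
      have [measurable]: "fst \<in> borel_measurable (borel :: (real \<times> 'a) measure)"
        by (intro borel_measurable_continuous_onI continuous_intros)
      have "(\<lambda>p. indicator {0..1} (fst p) * F' (\<Theta> (fst p) (snd p))) \<in> borel_measurable (borel :: (real \<times> 'a) measure)"
        by measurable
      then show ?thesis unfolding lborel_prod by (simp add: split_beta)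
    qed
    have "(\<integral>z. norm (?K (\<sigma>, z)) \<partial>lborel) = indicator {0..1} \<sigma> * (\<integral>z. \<bar>F' z\<bar> \<partial>lborel)" for \<sigma>
      using inv[of "\<lambda>z. \<bar>F' z\<bar>" \<sigma>] by (simp add: abs_mult)
    then show "integrable lborel (\<lambda>\<sigma>. \<integral>z. norm (?K (\<sigma>, z)) \<partial>lborel)"
      by (simp only:) (intro integrable_mult_left, simp)
    show "AE \<sigma> in lborel. integrable lborel (\<lambda>z. ?K (\<sigma>, z))"
      using invi[OF F'] by simp
  qed
  have "0 = (\<integral>z. F (\<Theta> 1 z) \<partial>lborel) - (\<integral>z. F z \<partial>lborel)" by (simp add: inv)
  also have "\<dots> = (\<integral>z. (\<integral>\<sigma>. ?K (\<sigma>, z) \<partial>lborel) \<partial>lborel)"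
    using invi[OF F] F by (simp add: ftc)
  also have "\<dots> = (\<integral>\<sigma>. (\<integral>z. ?K (\<sigma>, z) \<partial>lborel) \<partial>lborel)"
    using lborel_pair.Fubini_integral[OF K] by simp
  also have "\<dots> = (\<integral>\<sigma>. indicator {0..1} (\<sigma> :: real) * (\<integral>z. F' z \<partial>lborel) \<partial>lborel)"
    by (simp add: inv)
  also have "\<dots> = (\<integral>z. F' z \<partial>lborel)"
    by (simp add: content_real)
  finally show ?thesis by simp
qed

text \<open>Differentiability and the bound are demanded only where \<open>f\<close> is nonzero, so
  a derivative that is bounded over the bounded support of \<open>f\<close> suffices for dominated
  convergence of the difference quotients.\<close>

lemma DERIV_under_integral:
  fixes K K' :: "real \<Rightarrow> 'a \<Rightarrow> real"
  assumes d: "d > 0" and f: "integrable M f"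
    and K_meas: "\<And>x. \<bar>x - x0\<bar> < d \<Longrightarrow> (\<lambda>a. K x a * f a) \<in> borel_measurable M"
    and K'_meas: "(\<lambda>a. K' x0 a * f a) \<in> borel_measurable M"
    and K0: "integrable M (\<lambda>a. K x0 a * f a)"
    and deriv: "\<And>x a. \<bar>x - x0\<bar> < d \<Longrightarrow> f a \<noteq> 0 \<Longrightarrow> ((\<lambda>x. K x a) has_real_derivative K' x a) (at x)"
    and bound: "\<And>x a. \<bar>x - x0\<bar> < d \<Longrightarrow> f a \<noteq> 0 \<Longrightarrow> \<bar>K' x a\<bar> \<le> C"
  shows "((\<lambda>x. \<integral>a. K x a * f a \<partial>M) has_real_derivative (\<integral>a. K' x0 a * f a \<partial>M)) (at x0)"
proof -
  have lip: "\<bar>K x a * f a - K x0 a * f a\<bar> \<le> C * \<bar>x - x0\<bar> * \<bar>f a\<bar>" if x: "\<bar>x - x0\<bar> < d" for x a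
  proof (cases "f a = 0")
    case False
    have "norm (K x a - K x0 a) \<le> C * norm (x - x0)"
    proof (rule field_differentiable_bound[of "ball x0 d" "\<lambda>x. K x a" "\<lambda>x. K' x a"])
      show "((\<lambda>x. K x a) has_field_derivative K' y a) (at y within ball x0 d)" if "y \<in> ball x0 d" for y
        using that deriv[of y a] False by (auto simp: dist_real_def abs_minus_commute intro: has_field_derivative_at_within)
      show "norm (K' y a) \<le> C" if "y \<in> ball x0 d" for y
        using that bound[of y a] False by (auto simp: dist_real_def abs_minus_commute)
    qed (use x d in \<open>auto simp: dist_real_def abs_minus_commute\<close>)
    then show ?thesis
      by (simp flip: left_diff_distrib add: abs_mult mult_right_mono)
  qed simp
  have Ki: "integrable M (\<lambda>a. K x a * f a)" if x: "\<bar>x - x0\<bar> < d" for x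
  proof -
    have "integrable M (\<lambda>a. K x a * f a - K x0 a * f a)"
      by (rule Bochner_Integration.integrable_bound[OF integrable_mult_right[OF integrable_abs[OF f], of "C * \<bar>x - x0\<bar>"]])
        (use K_meas[OF x] K0 lip[OF x] in \<open>auto intro: order_trans[OF _ abs_ge_self]\<close>)
    from Bochner_Integration.integrable_add[OF this K0] show ?thesis by simp
  qed
  show ?thesis
    unfolding has_field_derivative_iff tendsto_at_iff_sequentially
  proof (intro allI impI)
    fix X :: "nat \<Rightarrow> real" assume X: "\<forall>i. X i \<in> UNIV - {x0}" "X \<longlonglongrightarrow> x0"
    have ev: "\<forall>\<^sub>F n in sequentially. \<bar>X n - x0\<bar> < d"
      using X(2) d by (auto simp: tendsto_iff dist_real_def)
    then obtain N where N: "\<And>n. n \<ge> N \<Longrightarrow> \<bar>X n - x0\<bar> < d" by (auto simp: eventually_sequentially)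
    define Y where "Y n = X (n + N)" for n
    have Y: "\<bar>Y n - x0\<bar> < d" "Y n \<noteq> x0" for n using N X(1) by (auto simp: Y_def)
    have Yl: "Y \<longlonglongrightarrow> x0" unfolding Y_def using X(2) by (rule LIMSEQ_ignore_initial_segment)
    have "(\<lambda>n. \<integral>a. (K (Y n) a * f a - K x0 a * f a) / (Y n - x0) \<partial>M) \<longlonglongrightarrow> (\<integral>a. K' x0 a * f a \<partial>M)"
    proof (rule integral_dominated_convergence[where w = "\<lambda>a. C * \<bar>f a\<bar>"])
      show "(\<lambda>a. K' x0 a * f a) \<in> borel_measurable M" by (rule K'_meas)
      show "(\<lambda>a. (K (Y n) a * f a - K x0 a * f a) / (Y n - x0)) \<in> borel_measurable M" for n
        using K_meas[OF Y(1)] K0 by auto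
      show "integrable M (\<lambda>a. C * \<bar>f a\<bar>)" using f by simp
      show "AE a in M. (\<lambda>n. (K (Y n) a * f a - K x0 a * f a) / (Y n - x0)) \<longlonglongrightarrow> K' x0 a * f a"
      proof (rule AE_I2)
        fix a
        show "(\<lambda>n. (K (Y n) a * f a - K x0 a * f a) / (Y n - x0)) \<longlonglongrightarrow> K' x0 a * f a"
        proof (cases "f a = 0")
          case False
          have "(\<lambda>n. (K (Y n) a - K x0 a) / (Y n - x0)) \<longlonglongrightarrow> K' x0 a"
            using deriv[of x0 a] d False Y Yl
            unfolding has_field_derivative_iff tendsto_at_iff_sequentially by (auto simp: o_def)
          from tendsto_mult_right[OF this, of "f a"] show ?thesis by (simp add: left_diff_distrib)
        qed simp
      qed
      show "AE a in M. norm ((K (Y n) a * f a - K x0 a * f a) / (Y n - x0)) \<le> C * \<bar>f a\<bar>" for n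
        using lip[OF Y(1), of n] Y(2)[of n] by (intro AE_I2) (simp add: field_simps mult_ac)
    qed
    also have "(\<lambda>n. \<integral>a. (K (Y n) a * f a - K x0 a * f a) / (Y n - x0) \<partial>M)
      = (\<lambda>n. ((\<integral>a. K (Y n) a * f a \<partial>M) - (\<integral>a. K x0 a * f a \<partial>M)) / (Y n - x0))"
      using Ki[OF Y(1)] K0 by simp
    finally have "(\<lambda>n. ((\<lambda>x. ((\<integral>a. K x a * f a \<partial>M) - (\<integral>a. K x0 a * f a \<partial>M)) / (x - x0)) \<circ> X) (n + N)) \<longlonglongrightarrow> (\<integral>a. K' x0 a * f a \<partial>M)"
      by (simp add: Y_def o_def)
    then show "((\<lambda>x. ((\<integral>a. K x a * f a \<partial>M) - (\<integral>a. K x0 a * f a \<partial>M)) / (x - x0)) \<circ> X) \<longlonglongrightarrow> (\<integral>a. K' x0 a * f a \<partial>M)"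
      by (rule LIMSEQ_offset)
  qed
qed

lemma set_integral_pos_open:
  fixes f :: "'a::euclidean_space \<Rightarrow> real"
  assumes S: "open S" "p \<in> S" and f: "set_integrable lborel S f" "\<And>z. z \<in> S \<Longrightarrow> f z \<ge> 0"
    and p: "isCont f p" "f p > 0"
  shows "(LBINT z:S. f z) > 0"
proof -
  let ?g = "\<lambda>z. indicator S z * f z"
  have g: "integrable lborel ?g" using f(1) by (simp add: set_integrable_def)
  have g0: "?g z \<ge> 0" for z using f(2) by (simp add: indicator_def)
  have "\<forall>\<^sub>F z in nhds p. f z > 0"
    using p by (simp add: isCont_def tendsto_at_iff_tendsto_nhds order_tendstoD)
  moreover have "\<forall>\<^sub>F z in nhds p. z \<in> S" using S by (simp add: eventually_nhds_in_open)
  ultimately have "\<forall>\<^sub>F z in nhds p. f z > 0 \<and> z \<in> S" by (rule eventually_conj)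
  then obtain U where U: "open U" "p \<in> U" "\<And>z. z \<in> U \<Longrightarrow> z \<in> S \<and> f z > 0"
    unfolding eventually_nhds by blast
  have "(\<integral>z. ?g z \<partial>lborel) \<noteq> 0"
  proof
    assume "(\<integral>z. ?g z \<partial>lborel) = 0"
    then have "AE z in lborel. ?g z = 0"
      using integral_nonneg_eq_0_iff_AE[OF g] g0 by simp
    then have "AE z in lborel. z \<notin> U"
      by eventually_elim (use U(3) in force)
    then have "emeasure lborel U = 0"
      using AE_iff_null_sets[of U lborel] U(1) by auto
    then show False
      using open_not_negligible[of U] U by (auto simp: negligible_iff_null_sets null_sets_def)
  qed
  moreover have "(\<integral>z. ?g z \<partial>lborel) \<ge> 0" using g0 by simp
  ultimately show ?thesis by (simp add: set_lebesgue_integral_def)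
qed

section \<open>Derivatives of the fundamental solution along flows\<close>

abbreviation hs :: "real \<Rightarrow> 'n::finite spacetime \<Rightarrow> 'n spacetime \<Rightarrow> real"
  where "hs \<sigma> p \<zeta> \<equiv> \<sigma> * (snd \<zeta> - snd p)"

definition hX :: "real^'n^'n \<Rightarrow> real \<Rightarrow> 'n spacetime \<Rightarrow> 'n::finite spacetime \<Rightarrow> real^'n"
  where "hX B \<sigma> p \<zeta> = fst \<zeta> - E_mat B (hs \<sigma> p \<zeta>) *v fst p"

text \<open>Closed forms of the first and, with \<open>hk2\<close>, the second derivative of the
  kernel in the constant spatial direction \<open>a\<close>.\<close>

definition hk1 :: "real^'n^'n \<Rightarrow> real^'n^'n \<Rightarrow> real \<Rightarrow> 'n spacetime \<Rightarrow> real^'n \<Rightarrow> 'n::finite spacetime \<Rightarrow> real"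
  where "hk1 A B \<sigma> p a \<zeta> = - (1/2) * ((Pm A B (hs \<sigma> p \<zeta>) *v hX B \<sigma> p \<zeta>) \<bullet> a) * hk A B \<sigma> p \<zeta>"

definition hk2 :: "real^'n^'n \<Rightarrow> real^'n^'n \<Rightarrow> real \<Rightarrow> 'n spacetime \<Rightarrow> real^'n \<Rightarrow> 'n::finite spacetime \<Rightarrow> real"
  where "hk2 A B \<sigma> p a \<zeta> = (1/4 * ((Pm A B (hs \<sigma> p \<zeta>) *v hX B \<sigma> p \<zeta>) \<bullet> a)\<^sup>2
    - 1/2 * ((Pm A B (hs \<sigma> p \<zeta>) *v a) \<bullet> a)) * hk A B \<sigma> p \<zeta>"

text \<open>Vectors with A = sum a a^T, so that div(A grad) becomes a sum of squares of constant
  directional derivatives. Their existence is shown by the lemma of the same name.\<close>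

definition avec :: "real^'n^'n \<Rightarrow> 'n \<Rightarrow> real^'n"
  where "avec A = (SOME a. \<forall>i j. A $ i $ j = (\<Sum>k\<in>UNIV. a k $ i * a k $ j))"

text \<open>The second-order part of the operator applied to the kernel. That it is also the
  derivative along the drift, \<open>hk_tflow_deriv\<close>, is precisely the equation satisfied by
  the kernel.\<close>

definition hkT :: "real^'n^'n \<Rightarrow> real^'n^'n \<Rightarrow> real \<Rightarrow> 'n spacetime \<Rightarrow> 'n::finite spacetime \<Rightarrow> real"
  where "hkT A B \<sigma> p \<zeta> = (\<Sum>k\<in>UNIV. hk2 A B \<sigma> p (avec A k) \<zeta>)"

text \<open>For \<sigma> = 1 the flow of the field (-B x, 1), whose derivative is the first-order
  part of the operator with the opposite sign.\<close>

definition tflow :: "real^'n^'n \<Rightarrow> real \<Rightarrow> real \<Rightarrow> 'n spacetime \<Rightarrow> 'n::finite spacetime"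
  where "tflow B \<sigma> h \<zeta> = (E_mat B h *v fst \<zeta>, snd \<zeta> + \<sigma> * h)"

definition sflow :: "real^'n \<Rightarrow> real \<Rightarrow> 'n::finite spacetime \<Rightarrow> 'n spacetime"
  where "sflow a h \<zeta> = (fst \<zeta> + h *\<^sub>R a, snd \<zeta>)"

lemma hk_fund_gamma: "hk A B \<sigma> p \<zeta> = fund_gamma A B (hX B \<sigma> p \<zeta>, hs \<sigma> p \<zeta>)"
  by (simp add: hk_def hX_def)

lemma hk_nonpos_time: "hs \<sigma> p \<zeta> \<le> 0 \<Longrightarrow> hk A B \<sigma> p \<zeta> = 0"
  and hk1_nonpos_time: "hs \<sigma> p \<zeta> \<le> 0 \<Longrightarrow> hk1 A B \<sigma> p a \<zeta> = 0"
  and hk2_nonpos_time: "hs \<sigma> p \<zeta> \<le> 0 \<Longrightarrow> hk2 A B \<sigma> p a \<zeta> = 0"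
  and hkT_nonpos_time: "hs \<sigma> p \<zeta> \<le> 0 \<Longrightarrow> hkT A B \<sigma> p \<zeta> = 0"
  by (simp_all add: hk_fund_gamma hk1_def hk2_def hkT_def fund_gamma_def)

lemma Wq_alt: "Wq A B \<sigma> p \<zeta> = 1/4 * ((A *v (Pm A B (hs \<sigma> p \<zeta>) *v hX B \<sigma> p \<zeta>)) \<bullet> (Pm A B (hs \<sigma> p \<zeta>) *v hX B \<sigma> p \<zeta>))"
  by (simp add: Wq_def hX_def Let_def)

lemma continuous_on_matrix_vec [continuous_intros]:
  fixes f :: "'a::topological_space \<Rightarrow> real^'n^'m"
  assumes "continuous_on S f" "continuous_on S g"
  shows "continuous_on S (\<lambda>x. f x *v g x)"
  unfolding matrix_vector_mult_def using assms by (intro continuous_intros)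

section \<open>A cutoff in time and the translation flows\<close>

lemma max_pow_deriv:
  fixes n :: nat
  assumes n: "n \<ge> 2"
  shows "((\<lambda>v. max 0 v ^ n) has_real_derivative real n * max 0 v ^ (n - 1)) (at v)"
proof -
  consider "v > 0" | "v < 0" | "v = 0" by linarith
  then show ?thesis
  proof cases
    case 1
    have "((\<lambda>v. v ^ n) has_real_derivative real n * v ^ (n - 1)) (at v)"
      using DERIV_pow[of n v] by simp
    then have "((\<lambda>v. max 0 v ^ n) has_real_derivative real n * v ^ (n - 1)) (at v)"
      by (rule has_field_derivative_transform_within_open[of _ _ _ "{0<..}"]) (use 1 in auto)
    then show ?thesis using 1 by simp
  next
    case 2
    have "((\<lambda>v. max 0 v ^ n) has_real_derivative 0) (at v)"
      by (rule has_field_derivative_transform_within_open[of "\<lambda>_. 0" _ _ "{..<0}"]) (use 2 n in auto)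
    then show ?thesis using 2 n by (simp add: max_def power_0_left)
  next
    case 3
    have "((\<lambda>h. max 0 h ^ n / h) \<longlongrightarrow> 0) (at (0::real))"
    proof (rule Lim_null_comparison)
      show "\<forall>\<^sub>F h in at (0::real). norm (max 0 h ^ n / h) \<le> \<bar>h\<bar> ^ (n - 1)"
      proof (intro always_eventually allI)
        fix h :: real
        show "norm (max 0 h ^ n / h) \<le> \<bar>h\<bar> ^ (n - 1)"
        proof (cases "h > 0")
          case True
          then have "h ^ n = h * h ^ (n - 1)" using n by (cases n) auto
          then show ?thesis using True by simp
        next
          case False
          then show ?thesis using n by (simp add: max_def power_0_left)
        qed
      qed
      have "((\<lambda>h::real. \<bar>h\<bar> ^ (n - 1)) \<longlongrightarrow> \<bar>0\<bar> ^ (n - 1)) (at 0)" by (intro tendsto_intros)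
      then show "((\<lambda>h::real. \<bar>h\<bar> ^ (n - 1)) \<longlongrightarrow> 0) (at 0)" using n by (simp add: power_0_left)
    qed
    then show ?thesis using 3 n by (simp add: has_field_derivative_iff power_0_left)
  qed
qed

text \<open>A C^1 step from 0 on v \<le> 1 to 1 on v \<ge> 2. One derivative is enough: it is only
  composed with the elapsed time, in which the operator is of first order. Its derivative has
  integral 1 and serves as the mollifier.\<close>

definition cutoff :: "real \<Rightarrow> real"
  where "cutoff v = 1 - max 0 (1 - max 0 (v - 1) ^ 3) ^ 3"

definition cutoff' :: "real \<Rightarrow> real"
  where "cutoff' v = 9 * max 0 (1 - max 0 (v - 1) ^ 3) ^ 2 * max 0 (v - 1) ^ 2"

lemma cutoff_deriv: "(cutoff has_real_derivative cutoff' v) (at v)"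
proof -
  have 0: "((\<lambda>v. v - 1) has_real_derivative 1) (at v)"
    by (auto intro!: derivative_eq_intros)
  have 1: "((\<lambda>v. max 0 (v - 1) ^ 3) has_real_derivative (3 * max 0 (v - 1) ^ 2) * 1) (at v)"
    using DERIV_chain2[OF max_pow_deriv[of 3 "v - 1"] 0] by simp
  have 2: "((\<lambda>v. 1 - max 0 (v - 1) ^ 3) has_real_derivative 0 - (3 * max 0 (v - 1) ^ 2) * 1) (at v)"
    by (intro DERIV_diff DERIV_const 1)
  have 3: "((\<lambda>v. max 0 (1 - max 0 (v - 1) ^ 3) ^ 3) has_real_derivative
     (3 * max 0 (1 - max 0 (v - 1) ^ 3) ^ 2) * (0 - (3 * max 0 (v - 1) ^ 2) * 1)) (at v)"
    using DERIV_chain2[OF max_pow_deriv[of 3 "1 - max 0 (v - 1) ^ 3"] 2] by simp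
  have "((\<lambda>v. 1 - max 0 (1 - max 0 (v - 1) ^ 3) ^ 3) has_real_derivative 0 -
     (3 * max 0 (1 - max 0 (v - 1) ^ 3) ^ 2) * (0 - (3 * max 0 (v - 1) ^ 2) * 1)) (at v)"
    by (intro DERIV_diff DERIV_const 3)
  then show ?thesis unfolding cutoff_def[abs_def] cutoff'_def by (simp add: mult.assoc)
qed

lemma cutoff_eq_0: "v \<le> 1 \<Longrightarrow> cutoff v = 0" and cutoff_eq_1: "v \<ge> 2 \<Longrightarrow> cutoff v = 1"
  and cutoff'_nonneg: "cutoff' v \<ge> 0" and cutoff'_eq_0: "v \<le> 1 \<or> v \<ge> 2 \<Longrightarrow> cutoff' v = 0"
  and cutoff_nonneg: "cutoff v \<ge> 0" and cutoff_le_1: "cutoff v \<le> 1"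
proof -
  have p: "v \<ge> 2 \<Longrightarrow> (v - 1) ^ 3 \<ge> 1" using one_le_power[of "v - 1" 3] by simp
  show "v \<le> 1 \<Longrightarrow> cutoff v = 0" by (simp add: cutoff_def max_def)
  have p': "v \<ge> 2 \<Longrightarrow> max 0 (v - 1) ^ 3 \<ge> 1" using p by (simp add: max_def)
  then show "v \<ge> 2 \<Longrightarrow> cutoff v = 1" by (simp add: cutoff_def)
  show "cutoff' v \<ge> 0" by (simp add: cutoff'_def)
  show "v \<le> 1 \<or> v \<ge> 2 \<Longrightarrow> cutoff' v = 0" using p' by (auto simp: cutoff'_def)
  have "max 0 (1 - max 0 (v - 1) ^ 3) \<le> 1" by simp
  then show "cutoff v \<ge> 0" unfolding cutoff_def by (simp add: power_le_one)
  show "cutoff v \<le> 1" by (simp add: cutoff_def)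
qed

lemma continuous_cutoff [continuous_intros]:
  "continuous_on S f \<Longrightarrow> continuous_on S (\<lambda>x. cutoff (f x))"
  "continuous_on S f \<Longrightarrow> continuous_on S (\<lambda>x. cutoff' (f x))"
  unfolding cutoff_def cutoff'_def by (intro continuous_intros; assumption)+

lemma cutoff_mono: "v \<le> w \<Longrightarrow> cutoff v \<le> cutoff w"
  by (rule DERIV_nonneg_imp_nondecreasing) (use cutoff_deriv cutoff'_nonneg in blast)+

lemma integrable_cutoff': "integrable lborel cutoff'" and integral_cutoff': "(\<integral>v. cutoff' v \<partial>lborel) = 1"
proof -
  have e: "cutoff' v = indicator {1..2} v * cutoff' v" for v
    using cutoff'_eq_0[of v] by (cases "v \<in> {1..2}") auto
  have "integrable lborel (\<lambda>v. indicator {1..2} v *\<^sub>R cutoff' v)"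
    by (rule borel_integrable_compact) (auto intro!: continuous_intros)
  then show "integrable lborel cutoff'" by (subst e[abs_def]) simp
  have "(\<integral>v. indicator {1..2} v *\<^sub>R cutoff' v \<partial>lborel) = cutoff 2 - cutoff 1"
    by (rule integral_FTC_atLeastAtMost)
      (auto intro!: continuous_intros simp: has_real_derivative_iff_has_vector_derivative[symmetric]
        intro: has_field_derivative_at_within cutoff_deriv)
  then show "(\<integral>v. cutoff' v \<partial>lborel) = 1"
    by (subst e[abs_def]) (simp add: cutoff_eq_0 cutoff_eq_1)
qed

lemma sflow_0: "sflow a 0 z = z"
  and sflow_add: "sflow a (g + h) z = sflow a h (sflow a g z)"
  by (simp_all add: sflow_def scaleR_add_left)

lemma sflow_preserves: "distr lborel borel (sflow a h) = lborel"
proof -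
  have "sflow a h = (+) (h *\<^sub>R a, 0)" by (auto simp: sflow_def fun_eq_iff prod_eq_iff add.commute)
  then show ?thesis using lborel_distr_plus[of "(h *\<^sub>R a, 0)"] by simp
qed

context kolm begin

lemma continuous_E [continuous_intros]: "continuous_on S f \<Longrightarrow> continuous_on S (\<lambda>x. E_mat B (f x))"
proof -
  have "continuous_on UNIV (\<lambda>t. \<chi> i j. E_mat B t $ i $ j)"
    by (intro continuous_on_vec_lambda DERIV_continuous_on[OF E_mat_deriv])
  then have "continuous_on UNIV (E_mat B)" by simp
  then show "continuous_on S f \<Longrightarrow> continuous_on S (\<lambda>x. E_mat B (f x))"
    using continuous_on_compose2 by blast
qed

lemma continuous_P:
  assumes "continuous_on S f" "\<And>x. x \<in> S \<Longrightarrow> f x > 0"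
  shows "continuous_on S (\<lambda>x. Pm A B (f x))"
proof -
  have "continuous_on {0<..} (\<lambda>t. \<chi> i j. Pm A B t $ i $ j)"
    by (intro continuous_on_vec_lambda DERIV_continuous_on[OF has_field_derivative_at_within[OF P_deriv]]) auto
  then have "continuous_on {0<..} (\<lambda>t. Pm A B t)" by simp
  then show ?thesis using continuous_on_compose2[of "{0<..}" "\<lambda>t. Pm A B t" S f] assms by auto
qed

definition gamma_const :: real
  where "gamma_const = (4 * pi) powr (- (real CARD('n) / 2)) / sqrt (det (C_mat A B 1))"

text \<open>The largest value of the kernel at elapsed time \<open>s\<close>, attained on the drift
  curve through the pole.\<close>

definition peak :: "real \<Rightarrow> real" where "peak s = gamma_const * s powr (- (hdim / 2))"

lemma det_C1_pos: "det (C_mat A B 1) > 0"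
proof -
  obtain R :: "'n rmat" where R: "invertible R" "C_mat A B 1 = R ** transpose R"
    using pos_def_factorization[OF C_pos_def[of 1]] by auto
  then show ?thesis using invertible_det_nz[of R] by (simp add: det_mul det_transpose flip: power2_eq_square)
qed

lemma gamma_const_pos: "gamma_const > 0"
  by (simp add: gamma_const_def det_C1_pos)

lemma peak_pos: "s > 0 \<Longrightarrow> peak s > 0"
  by (simp add: peak_def gamma_const_pos)

lemma fund_gamma_eq:
  assumes "s > 0"
  shows "fund_gamma A B (x, s) = peak s * exp (- (1/4) * ((Pm A B s *v x) \<bullet> x))"
proof -
  have "sqrt (s ^ hdim) = s powr (hdim / 2)"
    using assms by (simp add: powr_half_sqrt[symmetric] powr_powr flip: powr_realpow)
  then have "sqrt (det (C_mat A B s)) = sqrt (det (C_mat A B 1)) * s powr (hdim / 2)"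
    by (simp add: det_C[OF assms] real_sqrt_mult)
  then show ?thesis using assms
    by (simp add: fund_gamma_def peak_def gamma_const_def powr_minus field_simps)
qed

lemma peak_deriv:
  assumes "s > 0"
  shows "(peak has_real_derivative - (hdim / (2 * s)) * peak s) (at s)"
proof -
  have "((\<lambda>s. s powr (- (hdim / 2))) has_real_derivative - (hdim / 2) * s powr (- (hdim / 2) - 1)) (at s)"
    by (rule has_real_derivative_powr[OF assms])
  moreover have "s powr (- (hdim / 2) - 1) = s powr (- (hdim / 2)) / s"
    using assms by (subst powr_diff) simp
  ultimately have "((\<lambda>s. s powr (- (hdim / 2))) has_real_derivative - (hdim / 2) * (s powr (- (hdim / 2)) / s)) (at s)"
    by (simp only:)
  from DERIV_cmult[OF this, of gamma_const] show ?thesis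
    unfolding peak_def[abs_def] by (simp add: mult_ac)
qed

lemma hk_eq: "hs \<sigma> p \<zeta> > 0 \<Longrightarrow> hk A B \<sigma> p \<zeta>
    = peak (hs \<sigma> p \<zeta>) * exp (- (1/4) * ((Pm A B (hs \<sigma> p \<zeta>) *v hX B \<sigma> p \<zeta>) \<bullet> hX B \<sigma> p \<zeta>))"
  by (simp add: hk_fund_gamma fund_gamma_eq)

lemma hk_pos: "hs \<sigma> p \<zeta> > 0 \<Longrightarrow> hk A B \<sigma> p \<zeta> > 0"
  by (simp add: hk_eq peak_pos)

lemma hk_nonneg: "hk A B \<sigma> p \<zeta> \<ge> 0"
  by (cases "hs \<sigma> p \<zeta> > 0") (auto simp: hk_nonpos_time intro: less_imp_le[OF hk_pos])

lemma P_nonneg: "s > 0 \<Longrightarrow> (Pm A B s *v x) \<bullet> x \<ge> 0"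
  using P_pos_def[of s] by (cases "x = 0") (auto simp: pos_def_def less_imp_le)

lemma hk_le_peak: "hs \<sigma> p \<zeta> > 0 \<Longrightarrow> hk A B \<sigma> p \<zeta> \<le> peak (hs \<sigma> p \<zeta>)"
  using P_nonneg peak_pos by (simp add: hk_eq mult_le_cancel_left1)

lemma peak_antimono: "0 < s \<Longrightarrow> s \<le> t \<Longrightarrow> peak t \<le> peak s"
  unfolding peak_def using gamma_const_pos by (intro mult_left_mono powr_mono2') auto

lemma continuous_hX [continuous_intros]:
  "continuous_on S f \<Longrightarrow> continuous_on S g \<Longrightarrow> continuous_on S (\<lambda>x. hX B \<sigma> (f x) (g x))"
  unfolding hX_def by (intro continuous_intros)

lemma continuous_hk:
  assumes f: "continuous_on S f" "continuous_on S g" and pos: "\<And>x. x \<in> S \<Longrightarrow> hs \<sigma> (f x) (g x) > 0"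
  shows "continuous_on S (\<lambda>x. hk A B \<sigma> (f x) (g x))"
    and "continuous_on S (\<lambda>x. hk1 A B \<sigma> (f x) a (g x))"
    and "continuous_on S (\<lambda>x. hk2 A B \<sigma> (f x) a (g x))"
    and "continuous_on S (\<lambda>x. hkT A B \<sigma> (f x) (g x))"
    and "continuous_on S (\<lambda>x. Wq A B \<sigma> (f x) (g x))"
proof -
  have s: "continuous_on S (\<lambda>x. hs \<sigma> (f x) (g x))" using f by (intro continuous_intros)
  note P = continuous_P[OF s pos]
  have "continuous_on S (\<lambda>x. peak (hs \<sigma> (f x) (g x)) *
     exp (- (1/4) * ((Pm A B (hs \<sigma> (f x) (g x)) *v hX B \<sigma> (f x) (g x)) \<bullet> hX B \<sigma> (f x) (g x))))"
    unfolding peak_def using f pos by (intro continuous_intros P s) force+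
  then show hk: "continuous_on S (\<lambda>x. hk A B \<sigma> (f x) (g x))"
    by (rule continuous_on_eq) (simp add: hk_eq pos)
  show "continuous_on S (\<lambda>x. hk1 A B \<sigma> (f x) a (g x))"
    unfolding hk1_def by (intro continuous_intros P hk f)
  show hk2: "continuous_on S (\<lambda>x. hk2 A B \<sigma> (f x) a (g x))" for a
    unfolding hk2_def by (intro continuous_intros P hk f)
  show "continuous_on S (\<lambda>x. hkT A B \<sigma> (f x) (g x))"
    unfolding hkT_def by (intro continuous_intros hk2)
  show "continuous_on S (\<lambda>x. Wq A B \<sigma> (f x) (g x))"
    unfolding Wq_alt by (intro continuous_intros P f)
qed

text \<open>\<open>A\<close> is only semidefinite. Adding 1 on the diagonal outside level 0 makes it
  positive definite; the columns of its factor, restricted to level 0, then decompose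
  \<open>A\<close>.\<close>

lemma avec: "A $ i $ j = (\<Sum>k\<in>UNIV. avec A k $ i * avec A k $ j)"
proof -
  define M :: "'n rmat" where "M = A + diag_mat (\<lambda>i. if l i = 0 then 0 else 1)"
  have "pos_def M"
    unfolding pos_def_def
  proof (intro conjI allI impI)
    have "transpose (diag_mat d) = diag_mat d" for d :: "'n \<Rightarrow> real"
      by (auto simp: vec_eq_iff transpose_def diag_mat_def)
    then show "transpose M = M"
      using A_sym by (simp add: M_def transpose_def vec_eq_iff)
    fix x :: "'n rvec" assume x: "x \<noteq> 0"
    let ?r = "\<Sum>i\<in>UNIV. if l i = 0 then 0 else (x $ i)\<^sup>2"
    have e: "(M *v x) \<bullet> x = (A *v x) \<bullet> x + ?r"
      by (simp add: M_def matrix_vector_mult_add_rdistrib inner_add_left diag_mat_vec)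
        (simp add: inner_vec_def power2_eq_square if_distrib if_distribR cong: if_cong)
    show "(M *v x) \<bullet> x > 0"
    proof (cases "\<exists>i. l i \<noteq> 0 \<and> x $ i \<noteq> 0")
      case True
      then obtain i where "l i \<noteq> 0" "x $ i \<noteq> 0" by blast
      then have "?r > 0" by (intro sum_pos2[of _ i]) auto
      then show ?thesis using A_vec_nonneg[of x] e by simp
    next
      case False
      then have "(A *v x) \<bullet> x > 0" by (intro A_pos) (use x False in blast)+
      moreover have "?r \<ge> 0" by (intro sum_nonneg) auto
      ultimately show ?thesis using e by simp
    qed
  qed
  then obtain R :: "'n rmat" where R: "M = R ** transpose R" using pos_def_factorization by metis
  define a :: "'n \<Rightarrow> 'n rvec" where "a k = (\<chi> i. if l i = 0 then R $ i $ k else 0)" for k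
  have "A $ i $ j = (\<Sum>k\<in>UNIV. a k $ i * a k $ j)" for i j
  proof (cases "l i = 0 \<and> l j = 0")
    case True
    then have "A $ i $ j = M $ i $ j" by (simp add: M_def diag_mat_def)
    then show ?thesis using True by (simp add: R a_def matrix_matrix_mult_def transpose_def)
  next
    case False
    have "A $ i $ j = 0" using A_level[of i j] False by blast
    moreover have "(\<Sum>k\<in>UNIV. a k $ i * a k $ j) = 0"
      using False by (intro sum.neutral) (auto simp: a_def)
    ultimately show ?thesis by simp
  qed
  then have "\<exists>a :: 'n \<Rightarrow> 'n rvec. \<forall>i j. A $ i $ j = (\<Sum>k\<in>UNIV. a k $ i * a k $ j)" by blast
  from someI_ex[OF this] show ?thesis unfolding avec_def by blast
qed

lemma A_avec: "(A *v x) \<bullet> y = (\<Sum>k\<in>UNIV. (x \<bullet> avec A k) * (y \<bullet> avec A k))"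
proof -
  have "(A *v x) \<bullet> y = (\<Sum>i\<in>UNIV. \<Sum>j\<in>UNIV. \<Sum>k\<in>UNIV. (x $ j * avec A k $ j) * (y $ i * avec A k $ i))"
    unfolding quad_form_sum by (subst avec) (simp add: sum_distrib_left sum_distrib_right mult_ac)
  also have "\<dots> = (\<Sum>i\<in>UNIV. \<Sum>k\<in>UNIV. \<Sum>j\<in>UNIV. (x $ j * avec A k $ j) * (y $ i * avec A k $ i))"
    by (intro sum.cong refl sum.swap)
  also have "\<dots> = (\<Sum>k\<in>UNIV. \<Sum>i\<in>UNIV. \<Sum>j\<in>UNIV. (x $ j * avec A k $ j) * (y $ i * avec A k $ i))"
    by (rule sum.swap)
  finally show ?thesis
    by (simp add: inner_vec_def sum_product sum_distrib_left sum_distrib_right mult_ac)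
qed

lemma trace_avec: "trace (M ** A) = (\<Sum>k\<in>UNIV. (M *v avec A k) \<bullet> avec A k)"
proof -
  have "trace (M ** A) = (\<Sum>i\<in>UNIV. \<Sum>j\<in>UNIV. \<Sum>k\<in>UNIV. M $ i $ j * avec A k $ j * avec A k $ i)"
    unfolding trace_def matrix_matrix_mult_def
    by (simp only: vec_lambda_beta, subst avec) (simp add: sum_distrib_left mult_ac)
  also have "\<dots> = (\<Sum>i\<in>UNIV. \<Sum>k\<in>UNIV. \<Sum>j\<in>UNIV. M $ i $ j * avec A k $ j * avec A k $ i)"
    by (intro sum.cong refl sum.swap)
  also have "\<dots> = (\<Sum>k\<in>UNIV. \<Sum>i\<in>UNIV. \<Sum>j\<in>UNIV. M $ i $ j * avec A k $ j * avec A k $ i)"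
    by (rule sum.swap)
  finally show ?thesis by (simp add: quad_form_sum)
qed

lemma hX_sflow: "hX B \<sigma> p (sflow a h \<zeta>) = hX B \<sigma> p \<zeta> + h *\<^sub>R a"
  and hs_sflow: "snd (sflow a h \<zeta>) = snd \<zeta>"
  by (simp_all add: hX_def sflow_def)

lemma P_quad_line:
  assumes "s > 0"
  shows "(Pm A B s *v (X + h *\<^sub>R a)) \<bullet> (X + h *\<^sub>R a)
    = (Pm A B s *v X) \<bullet> X + 2 * h * ((Pm A B s *v X) \<bullet> a) + h\<^sup>2 * ((Pm A B s *v a) \<bullet> a)"
  using P_inner[OF assms, of a X]
  by (simp add: matrix_vector_right_distrib matrix_vector_mult_scaleR inner_add_left inner_add_right
      power2_eq_square algebra_simps inner_commute)

text \<open>On a spatial line the elapsed time is fixed and the exponent is a quadratic polynomial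
  in the line parameter.\<close>

lemma hk_sflow_deriv:
  assumes s: "hs \<sigma> p \<zeta> > 0"
  shows "((\<lambda>h. hk A B \<sigma> p (sflow a h \<zeta>)) has_real_derivative hk1 A B \<sigma> p a \<zeta>) (at 0)"
    and "((\<lambda>h. hk1 A B \<sigma> p a (sflow a h \<zeta>)) has_real_derivative hk2 A B \<sigma> p a \<zeta>) (at 0)"
proof -
  let ?P = "Pm A B (hs \<sigma> p \<zeta>)" and ?X = "hX B \<sigma> p \<zeta>"
  define q b c where "q = (?P *v ?X) \<bullet> ?X" and "b = (?P *v ?X) \<bullet> a" and "c = (?P *v a) \<bullet> a"
  have e: "hk A B \<sigma> p (sflow a h \<zeta>) = peak (hs \<sigma> p \<zeta>) * exp (- (1/4) * (q + 2 * h * b + h\<^sup>2 * c))" for h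
    using s by (simp add: hk_eq hX_sflow hs_sflow P_quad_line q_def b_def c_def)
  have hk0: "hk A B \<sigma> p \<zeta> = peak (hs \<sigma> p \<zeta>) * exp (- (1/4) * q)"
    using s by (simp add: hk_eq q_def)
  have h1: "hk1 A B \<sigma> p a \<zeta> = - (1/2) * b * hk A B \<sigma> p \<zeta>" by (simp add: hk1_def b_def)
  show 1: "((\<lambda>h. hk A B \<sigma> p (sflow a h \<zeta>)) has_real_derivative hk1 A B \<sigma> p a \<zeta>) (at 0)"
    unfolding e h1 hk0 by (auto intro!: derivative_eq_intros)
  have e1: "hk1 A B \<sigma> p a (sflow a h \<zeta>) = - (1/2) * (b + h * c) * hk A B \<sigma> p (sflow a h \<zeta>)" for h
    by (simp add: hk1_def hX_sflow hs_sflow matrix_vector_right_distrib matrix_vector_mult_scaleR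
        inner_add_left b_def c_def)
  have "((\<lambda>h. - (1/2) * (b + h * c)) has_real_derivative - (1/2) * c) (at 0)"
    by (auto intro!: derivative_eq_intros)
  from DERIV_mult[OF this 1]
  have "((\<lambda>h. hk1 A B \<sigma> p a (sflow a h \<zeta>)) has_real_derivative
     - (1/2) * c * hk A B \<sigma> p \<zeta> + hk1 A B \<sigma> p a \<zeta> * (- (1/2) * b)) (at 0)"
    by (simp only: e1 sflow_0 mult_zero_left add_0_right)
  then show "((\<lambda>h. hk1 A B \<sigma> p a (sflow a h \<zeta>)) has_real_derivative hk2 A B \<sigma> p a \<zeta>) (at 0)"
  proof (rule DERIV_cong)
    have "hk2 A B \<sigma> p a \<zeta> = (1/4 * b\<^sup>2 - 1/2 * c) * hk A B \<sigma> p \<zeta>"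
      by (simp only: hk2_def b_def c_def)
    then show "- (1/2) * c * hk A B \<sigma> p \<zeta> + hk1 A B \<sigma> p a \<zeta> * (- (1/2) * b) = hk2 A B \<sigma> p a \<zeta>"
      by (simp add: h1 power2_eq_square algebra_simps)
  qed
qed

lemma hX_tflow:
  assumes "\<sigma> * \<sigma> = 1"
  shows "hX B \<sigma> p (tflow B \<sigma> h \<zeta>) = E_mat B h *v hX B \<sigma> p \<zeta>"
    and "hs \<sigma> p (tflow B \<sigma> h \<zeta>) = hs \<sigma> p \<zeta> + h"
proof -
  have *: "\<sigma> * (\<sigma> * h) = h" using assms by (simp flip: mult.assoc)
  show s: "hs \<sigma> p (tflow B \<sigma> h \<zeta>) = hs \<sigma> p \<zeta> + h"
    by (simp add: tflow_def algebra_simps *)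
  show "hX B \<sigma> p (tflow B \<sigma> h \<zeta>) = E_mat B h *v hX B \<sigma> p \<zeta>"
    unfolding hX_def s by (simp add: tflow_def matrix_vector_mult_diff_distrib E_mat_mult_vec add.commute)
qed

text \<open>The equation of the kernel. Along the drift the exponent contributes <A P X, P X>/4 by
  \<open>q_flow_deriv\<close> and the prefactor contributes -hdim/(2s); the sum of the second
  derivatives gives the same two terms, the last one through \<open>trace_PA\<close>.\<close>

lemma hk_tflow_deriv:
  assumes \<sigma>: "\<sigma> * \<sigma> = 1" and s: "hs \<sigma> p \<zeta> > 0"
  shows "((\<lambda>h. hk A B \<sigma> p (tflow B \<sigma> h \<zeta>)) has_real_derivative hkT A B \<sigma> p \<zeta>) (at 0)"
proof -
  let ?s = "hs \<sigma> p \<zeta>" and ?X = "hX B \<sigma> p \<zeta>"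
  let ?P = "Pm A B ?s"
  let ?Q = "\<lambda>h. (Pm A B (?s + h) *v (E_mat B h *v ?X)) \<bullet> (E_mat B h *v ?X)"
  let ?d = "(A *v (?P *v ?X)) \<bullet> (?P *v ?X)"
  have pk: "((\<lambda>h. peak (?s + h)) has_real_derivative - (hdim / (2 * ?s)) * peak ?s) (at 0)"
    using DERIV_shift[of peak _ 0 ?s] peak_deriv[OF s] by (simp add: add.commute)
  have ex: "((\<lambda>h. exp (- (1/4) * ?Q h)) has_real_derivative exp (- (1/4) * ?Q 0) * (- (1/4) * - ?d)) (at 0)"
    by (rule DERIV_chain2[OF DERIV_exp DERIV_cmult[OF q_flow_deriv[OF s]]])
  have "((\<lambda>h. peak (?s + h) * exp (- (1/4) * ?Q h)) has_real_derivative
     - (hdim / (2 * ?s)) * peak ?s * exp (- (1/4) * ?Q 0) + exp (- (1/4) * ?Q 0) * (- (1/4) * - ?d) * peak (?s + 0)) (at 0)"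
    using DERIV_mult[OF pk ex] by simp
  moreover have "- (hdim / (2 * ?s)) * peak ?s * exp (- (1/4) * ?Q 0) + exp (- (1/4) * ?Q 0) * (- (1/4) * - ?d) * peak (?s + 0)
     = (1/4 * ?d - hdim / (2 * ?s)) * hk A B \<sigma> p \<zeta>"
    using s by (simp add: hk_eq E_mat_0 algebra_simps)
  moreover have "(1/4 * ?d - hdim / (2 * ?s)) * hk A B \<sigma> p \<zeta> = hkT A B \<sigma> p \<zeta>"
  proof -
    have "?d = (\<Sum>k\<in>UNIV. ((?P *v ?X) \<bullet> avec A k)\<^sup>2)" by (simp add: A_avec power2_eq_square)
    moreover have "hdim / ?s = (\<Sum>k\<in>UNIV. (?P *v avec A k) \<bullet> avec A k)"
      using trace_PA[OF s] by (simp add: trace_avec)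
    moreover have "hkT A B \<sigma> p \<zeta> = (1/4 * (\<Sum>k\<in>UNIV. ((?P *v ?X) \<bullet> avec A k)\<^sup>2) -
        1/2 * (\<Sum>k\<in>UNIV. (?P *v avec A k) \<bullet> avec A k)) * hk A B \<sigma> p \<zeta>"
      unfolding hkT_def hk2_def by (simp add: sum_subtractf sum_distrib_left flip: sum_distrib_right)
    ultimately show ?thesis by simp
  qed
  ultimately have d: "((\<lambda>h. peak (?s + h) * exp (- (1/4) * ?Q h)) has_real_derivative hkT A B \<sigma> p \<zeta>) (at 0)"
    by (simp only:)
  have e: "peak (?s + h) * exp (- (1/4) * ?Q h) = hk A B \<sigma> p (tflow B \<sigma> h \<zeta>)" if "h \<in> {- ?s<..}" for h
    using that hk_eq[of \<sigma> "tflow B \<sigma> h \<zeta>" p] unfolding hX_tflow[OF \<sigma>] by simp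
  have "0 \<in> {- ?s<..}" using s by simp
  then show ?thesis
    by (rule has_field_derivative_transform_within_open[OF d open_greaterThan _ e])
qed

lemma sum_hk1_sq: "(\<Sum>k\<in>UNIV. (hk1 A B \<sigma> p (avec A k) \<zeta>)\<^sup>2) = Wq A B \<sigma> p \<zeta> * (hk A B \<sigma> p \<zeta>)\<^sup>2"
  unfolding hk1_def Wq_alt A_avec
  by (simp add: power_mult_distrib power2_eq_square sum_distrib_left sum_distrib_right mult_ac)

lemma Wq_nonneg: "Wq A B \<sigma> p \<zeta> \<ge> 0"
  unfolding Wq_alt using A_vec_nonneg by simp

lemma tflow_0: "tflow B \<sigma> 0 z = z"
  and tflow_add: "tflow B \<sigma> (g + h) z = tflow B \<sigma> h (tflow B \<sigma> g z)"
  by (simp_all add: tflow_def E_mat_0 E_mat_mult_vec algebra_simps)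

lemma tflow_continuous: "continuous_on UNIV (\<lambda>p. tflow B \<sigma> (fst p) (snd p))"
  unfolding tflow_def by (intro continuous_intros)

lemma tflow_preserves: "distr lborel borel (tflow B \<sigma> h) = lborel"
proof -
  have "distr lborel borel ((*v) (E_mat B h)) = lborel"
    by (rule distr_lborel_linear) (simp add: det_E)
  moreover have "distr lborel borel ((+) (\<sigma> * h)) = (lborel :: real measure)"
    by (rule lborel_distr_plus)
  moreover have "distr lborel borel ((*v) (E_mat B h)) \<Otimes>\<^sub>M distr lborel borel ((+) (\<sigma> * h))
      = distr (lborel \<Otimes>\<^sub>M lborel) (borel \<Otimes>\<^sub>M borel) (\<lambda>(x, y). (E_mat B h *v x, \<sigma> * h + y))"
    by (rule pair_measure_distr) (auto simp: lborel_distr_plus sigma_finite_lborel)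
  ultimately have "lborel = distr lborel borel (\<lambda>(x, y). (E_mat B h *v x, \<sigma> * h + y))"
    by (simp add: lborel_prod borel_prod)
  moreover have "(\<lambda>(x, y). (E_mat B h *v x, \<sigma> * h + y)) = tflow B \<sigma> h"
    by (auto simp: tflow_def)
  ultimately show ?thesis by simp
qed

end

lemma sflow_continuous: "continuous_on UNIV (\<lambda>p. sflow a (fst p) (snd p))"
  unfolding sflow_def by (intro continuous_intros)

section \<open>The fundamental solution as an approximate identity\<close>

lemma borel_measurable_open_zero:
  fixes f :: "'a::topological_space \<Rightarrow> real"
  assumes "open U" "continuous_on U f" "\<And>x. x \<notin> U \<Longrightarrow> f x = 0"
  shows "f \<in> borel_measurable borel"
proof -
  have "(\<lambda>x. indicator U x *\<^sub>R f x) \<in> borel_measurable borel"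
    using assms by (intro borel_measurable_continuous_on_indicator) auto
  moreover have "(\<lambda>x. indicator U x *\<^sub>R f x) = f"
    using assms(3) by (auto simp: indicator_def fun_eq_iff)
  ultimately show ?thesis by simp
qed

lemma nn_integral_translate:
  fixes c :: "'a::euclidean_space"
  assumes [measurable]: "f \<in> borel_measurable borel"
  shows "(\<integral>\<^sup>+x. f x \<partial>lborel) = (\<integral>\<^sup>+x. f (c + x) \<partial>lborel)"
  by (subst lborel_distr_plus[of c, symmetric]) (simp add: nn_integral_distr)

lemma nn_integral_lborel_prod:
  fixes f :: "'a::euclidean_space \<times> 'b::euclidean_space \<Rightarrow> ennreal"
  assumes [measurable]: "f \<in> borel_measurable borel"
  shows "(\<integral>\<^sup>+w. f w \<partial>lborel) = (\<integral>\<^sup>+s. \<integral>\<^sup>+y. f (y, s) \<partial>lborel \<partial>lborel)"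
  using lborel_pair.nn_integral_snd[of f] assms unfolding lborel_prod by (simp add: borel_prod)

lemma borel_measurable_slice:
  assumes "f \<in> borel_measurable (borel :: ('a::euclidean_space \<times> 'b::euclidean_space) measure)"
  shows "(\<lambda>y. f (y, s)) \<in> borel_measurable borel"
  by (rule measurable_compose[OF _ assms]) (intro borel_measurable_continuous_onI continuous_intros)

context kolm begin

text \<open>The point with rescaled coordinates w = (y, s) around the pole: follow the drift curve
  of \<open>p\<close> for the time \<epsilon> s, then add the dilated displacement y.\<close>

definition hpt :: "real \<Rightarrow> 'n spacetime \<Rightarrow> real \<Rightarrow> 'n spacetime \<Rightarrow> 'n spacetime"
  where "hpt \<sigma> p \<epsilon> w = (E_mat B (\<epsilon> * snd w) *v fst p + dil l (\<epsilon> * snd w) *v fst w, snd p + \<sigma> * (\<epsilon> * snd w))"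

lemma continuous_dil [continuous_intros]:
  "continuous_on S f \<Longrightarrow> continuous_on S (\<lambda>x. dil l (f x))"
proof -
  assume f: "continuous_on S f"
  have "continuous_on S (\<lambda>x. \<chi> i j. if i = j then sqrt (f x) ^ (2 * l i + 1) else 0)"
  proof (intro continuous_on_vec_lambda)
    fix i j
    show "continuous_on S (\<lambda>x. if i = j then sqrt (f x) ^ (2 * l i + 1) else 0)"
      by (cases "i = j") (auto intro!: continuous_intros f)
  qed
  then show ?thesis by (simp only: dil_def diag_mat_def)
qed

lemma continuous_hpt [continuous_intros]:
  assumes "continuous_on S f" "continuous_on S g" "continuous_on S h"
  shows "continuous_on S (\<lambda>x. hpt \<sigma> (h x) (f x) (g x))"
  unfolding hpt_def using assms by (intro continuous_intros)

lemma hpt_measurable [measurable]: "hpt \<sigma> p \<epsilon> \<in> borel_measurable borel"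
  by (intro borel_measurable_continuous_onI continuous_intros)

lemma hs_open: "open {x. hs \<sigma> (f x) (g x) > 0}" if "continuous_on UNIV f" "continuous_on UNIV g"
  for f g :: "'a::topological_space \<Rightarrow> 'n spacetime"
  using that by (intro open_Collect_less continuous_intros)

lemma hk_measurable2:
  assumes f: "continuous_on UNIV f" "continuous_on UNIV g"
  shows "(\<lambda>x. hk A B \<sigma> (f x) (g x)) \<in> borel_measurable borel"
    and "(\<lambda>x. hk1 A B \<sigma> (f x) a (g x)) \<in> borel_measurable borel"
    and "(\<lambda>x. hk2 A B \<sigma> (f x) a (g x)) \<in> borel_measurable borel"
    and "(\<lambda>x. hkT A B \<sigma> (f x) (g x)) \<in> borel_measurable borel"
proof -
  let ?U = "{x. hs \<sigma> (f x) (g x) > 0}"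
  note o = hs_open[OF f, of \<sigma>]
  have c: "continuous_on ?U f" "continuous_on ?U g" using f continuous_on_subset by blast+
  note H = continuous_hk[OF c, of \<sigma>]
  show "(\<lambda>x. hk A B \<sigma> (f x) (g x)) \<in> borel_measurable borel"
    by (rule borel_measurable_open_zero[OF o H(1)]) (auto intro: hk_nonpos_time)
  show "(\<lambda>x. hk1 A B \<sigma> (f x) a (g x)) \<in> borel_measurable borel"
    by (rule borel_measurable_open_zero[OF o H(2)]) (auto intro: hk1_nonpos_time)
  show "(\<lambda>x. hk2 A B \<sigma> (f x) a (g x)) \<in> borel_measurable borel"
    by (rule borel_measurable_open_zero[OF o H(3)]) (auto intro: hk2_nonpos_time)
  show "(\<lambda>x. hkT A B \<sigma> (f x) (g x)) \<in> borel_measurable borel"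
    by (rule borel_measurable_open_zero[OF o H(4)]) (auto intro: hkT_nonpos_time)
qed

lemmas hk_measurable [measurable] = hk_measurable2[OF continuous_on_const continuous_on_id]

lemma Wq_measurable: "(\<lambda>\<zeta>. indicator {\<zeta>. hs \<sigma> p \<zeta> > 0} \<zeta> * Wq A B \<sigma> p \<zeta>) \<in> borel_measurable borel"
proof (rule borel_measurable_open_zero)
  show "open {\<zeta>. hs \<sigma> p \<zeta> > 0}" by (intro hs_open continuous_intros)
  have "continuous_on {\<zeta>. hs \<sigma> p \<zeta> > 0} (\<lambda>\<zeta>. Wq A B \<sigma> p \<zeta>)"
    by (rule continuous_hk(5)) (auto intro: continuous_intros)
  then show "continuous_on {\<zeta>. hs \<sigma> p \<zeta> > 0} (\<lambda>\<zeta>. indicator {\<zeta>. hs \<sigma> p \<zeta> > 0} \<zeta> * Wq A B \<sigma> p \<zeta>)"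
    by (rule continuous_on_eq) simp
qed simp

text \<open>The height of the kernel decays exactly as the volume of the dilated cell grows.\<close>

lemma gamma_dil:
  assumes s: "s > 0"
  shows "\<bar>det (dil l s)\<bar> * fund_gamma A B (dil l s *v y, s) = fund_gamma A B (y, 1)"
proof -
  have p: "sqrt s ^ (2 * m) = s ^ m" for m using s by (simp add: power_mult)
  have d: "sqrt s ^ (2 * l i + 1) * sqrt s ^ (2 * l j + 1) = s ^ (l i + l j + 1)" for i j
    using p[of "l i + l j + 1"] by (simp add: power_add power2_eq_square algebra_simps power_mult)
  have q: "(Pm A B s *v (dil l s *v y)) \<bullet> (dil l s *v y) = (Pm A B 1 *v y) \<bullet> y"
    unfolding quad_form_sum
  proof (intro sum.cong refl)
    fix i j
    have "Pm A B s $ i $ j * (dil l s *v y) $ j * (dil l s *v y) $ i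
       = Pm A B s $ i $ j * (sqrt s ^ (2 * l i + 1) * sqrt s ^ (2 * l j + 1)) * y $ j * y $ i"
      by (simp add: dil_def diag_mat_vec mult_ac)
    also have "\<dots> = Pm A B 1 $ i $ j * y $ j * y $ i"
      unfolding d P_entry[OF s] using s by simp
    finally show "Pm A B s $ i $ j * (dil l s *v y) $ j * (dil l s *v y) $ i = Pm A B 1 $ i $ j * y $ j * y $ i" .
  qed
  have "sqrt s ^ hdim = s powr (hdim / 2)"
    using s by (simp add: powr_half_sqrt[symmetric] powr_powr flip: powr_realpow)
  then have "\<bar>det (dil l s)\<bar> * peak s = peak 1"
    using s by (simp add: det_dil peak_def powr_minus field_simps)
  then show ?thesis
    unfolding fund_gamma_eq[OF s] fund_gamma_eq[OF zero_less_one] q by (simp flip: mult.assoc)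
qed

lemma fund_gamma_measurable [measurable]: "(\<lambda>x. fund_gamma A B (x, s)) \<in> borel_measurable borel"
  by (cases "s \<le> 0") (simp_all add: fund_gamma_def)

lemma fund_gamma_nonneg: "fund_gamma A B (x, s) \<ge> 0"
  using hk_nonneg[of 1 0 "(x, s)"] by (simp add: hk_fund_gamma hX_def)

definition hker :: "real \<Rightarrow> 'n spacetime \<Rightarrow> real"
  where "hker \<epsilon> w = \<epsilon> * (indicator {0<..} (snd w) * fund_gamma A B (fst w, 1))"

lemma hker_measurable [measurable]: "hker \<epsilon> \<in> borel_measurable borel"
proof -
  have [measurable]: "fst \<in> borel_measurable (borel :: 'n spacetime measure)" "snd \<in> borel_measurable (borel :: 'n spacetime measure)"
    by (intro borel_measurable_continuous_onI continuous_intros)+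
  show ?thesis unfolding hker_def[abs_def] by measurable
qed

lemma hker_nonneg: "\<epsilon> > 0 \<Longrightarrow> hker \<epsilon> w \<ge> 0"
  by (simp add: hker_def fund_gamma_nonneg)

text \<open>The kernel in the coordinates \<open>(y, s)\<close> adapted to the dilations: its density does not
  depend on the scale \<open>\<epsilon>\<close>, up to the factor \<open>\<epsilon>\<close> coming from the time variable.\<close>

lemma hk_pushforward:
  fixes F :: "'n spacetime \<Rightarrow> ennreal"
  assumes \<sigma>: "\<bar>\<sigma>\<bar> = 1" and \<epsilon>: "\<epsilon> > 0" and [measurable]: "F \<in> borel_measurable borel"
  shows "(\<integral>\<^sup>+\<zeta>. ennreal (hk A B \<sigma> p \<zeta>) * F \<zeta> \<partial>lborel) = (\<integral>\<^sup>+w. ennreal (hker \<epsilon> w) * F (hpt \<sigma> p \<epsilon> w) \<partial>lborel)"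
proof -
  have \<sigma>2: "\<sigma> * (\<sigma> * x) = x" for x using \<sigma> by (auto simp: abs_if split: if_splits)
  have sl [measurable]: "(\<lambda>y. F (y, s)) \<in> borel_measurable borel" for s
    by (rule borel_measurable_slice) simp
  have slk [measurable]: "(\<lambda>y. hk A B \<sigma> p (y, s)) \<in> borel_measurable borel" for s
    by (rule borel_measurable_slice) simp
  have inner: "ennreal \<bar>\<sigma> * \<epsilon>\<bar> * (\<integral>\<^sup>+y. ennreal (hk A B \<sigma> p (y, snd p + \<sigma> * \<epsilon> * s)) * F (y, snd p + \<sigma> * \<epsilon> * s) \<partial>lborel)
     = (\<integral>\<^sup>+y. ennreal (hker \<epsilon> (y, s)) * F (hpt \<sigma> p \<epsilon> (y, s)) \<partial>lborel)" for s
  proof (cases "s > 0")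
    case False
    have "hk A B \<sigma> p (y, snd p + \<sigma> * \<epsilon> * s) = 0" for y
      using False \<epsilon> by (intro hk_nonpos_time) (simp add: mult.assoc \<sigma>2 mult_le_0_iff)
    then show ?thesis using False by (simp add: hker_def)
  next
    case True
    let ?S = "\<epsilon> * s" and ?t = "snd p + \<sigma> * \<epsilon> * s"
    have S: "?S > 0" using True \<epsilon> by simp
    have nz: "det (dil l ?S) \<noteq> 0" unfolding det_dil[OF S] using True \<epsilon> by (intro power_not_zero) simp
    have k: "hk A B \<sigma> p (E_mat B ?S *v fst p + y, ?t) = fund_gamma A B (y, ?S)" for y
      by (simp add: hk_fund_gamma hX_def mult.assoc \<sigma>2)
    have [measurable]: "(\<lambda>y. F (E_mat B ?S *v fst p + y, ?t)) \<in> borel_measurable borel"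
      by (rule measurable_compose[OF _ sl]) simp
    have [measurable]: "(\<lambda>y. F (hpt \<sigma> p \<epsilon> (y, s))) \<in> borel_measurable borel"
      by (rule borel_measurable_slice[of "\<lambda>w. F (hpt \<sigma> p \<epsilon> w)"]) measurable
    have "(\<integral>\<^sup>+y. ennreal (hk A B \<sigma> p (y, ?t)) * F (y, ?t) \<partial>lborel)
       = (\<integral>\<^sup>+y. ennreal (fund_gamma A B (y, ?S)) * F (E_mat B ?S *v fst p + y, ?t) \<partial>lborel)"
      by (subst nn_integral_translate[of _ "E_mat B ?S *v fst p"]) (simp_all add: k)
    also have "\<dots> = ennreal \<bar>det (dil l ?S)\<bar> *
        (\<integral>\<^sup>+y. ennreal (fund_gamma A B (dil l ?S *v y, ?S)) * F (E_mat B ?S *v fst p + dil l ?S *v y, ?t) \<partial>lborel)"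
      using nz by (subst nn_integral_linear[of "dil l ?S"]) (simp_all add: invertible_det_nz)
    also have "\<dots> = (\<integral>\<^sup>+y. ennreal \<bar>det (dil l ?S)\<bar> * (ennreal (fund_gamma A B (dil l ?S *v y, ?S)) * F (E_mat B ?S *v fst p + dil l ?S *v y, ?t)) \<partial>lborel)"
      by (rule nn_integral_cmult[symmetric]) measurable
    also have "\<dots> = (\<integral>\<^sup>+y. ennreal (fund_gamma A B (y, 1)) * F (hpt \<sigma> p \<epsilon> (y, s)) \<partial>lborel)"
      by (intro nn_integral_cong)
        (simp add: gamma_dil[OF S, symmetric] ennreal_mult fund_gamma_nonneg hpt_def mult.assoc)
    also have "ennreal \<bar>\<sigma> * \<epsilon>\<bar> * \<dots> = (\<integral>\<^sup>+y. ennreal \<bar>\<sigma> * \<epsilon>\<bar> * (ennreal (fund_gamma A B (y, 1)) * F (hpt \<sigma> p \<epsilon> (y, s))) \<partial>lborel)"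
      by (rule nn_integral_cmult[symmetric]) measurable
    also have "\<dots> = (\<integral>\<^sup>+y. ennreal (hker \<epsilon> (y, s)) * F (hpt \<sigma> p \<epsilon> (y, s)) \<partial>lborel)"
      using True \<epsilon> \<sigma> by (intro nn_integral_cong) (simp add: hker_def ennreal_mult fund_gamma_nonneg abs_mult mult.assoc)
    finally show ?thesis .
  qed
  have "(\<integral>\<^sup>+\<zeta>. ennreal (hk A B \<sigma> p \<zeta>) * F \<zeta> \<partial>lborel) = (\<integral>\<^sup>+t. \<integral>\<^sup>+y. ennreal (hk A B \<sigma> p (y, t)) * F (y, t) \<partial>lborel \<partial>lborel)"
    by (rule nn_integral_lborel_prod) measurable
  also have "\<dots> = ennreal \<bar>\<sigma> * \<epsilon>\<bar> * (\<integral>\<^sup>+s. \<integral>\<^sup>+y. ennreal (hk A B \<sigma> p (y, snd p + \<sigma> * \<epsilon> * s)) * F (y, snd p + \<sigma> * \<epsilon> * s) \<partial>lborel \<partial>lborel)"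
  proof (rule nn_integral_real_affine)
    have "(\<lambda>(t, y). ennreal (hk A B \<sigma> p (y, t)) * F (y, t)) \<in> borel_measurable (borel \<Otimes>\<^sub>M borel)"
      unfolding borel_prod split_beta
      by (rule measurable_compose[of "\<lambda>w. (snd w, fst w)" borel borel "\<lambda>\<zeta>. ennreal (hk A B \<sigma> p \<zeta>) * F \<zeta>"])
        (auto intro!: borel_measurable_continuous_onI continuous_intros)
    then show "(\<lambda>t. \<integral>\<^sup>+y. ennreal (hk A B \<sigma> p (y, t)) * F (y, t) \<partial>lborel) \<in> borel_measurable borel"
      by (intro lborel.borel_measurable_nn_integral) (simp add: measurable_lborel2 cong: measurable_cong_sets sets_pair_measure_cong)
    show "\<sigma> * \<epsilon> \<noteq> 0" using \<sigma> \<epsilon> by auto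
  qed
  also have "\<dots> = (\<integral>\<^sup>+s. ennreal \<bar>\<sigma> * \<epsilon>\<bar> * (\<integral>\<^sup>+y. ennreal (hk A B \<sigma> p (y, snd p + \<sigma> * \<epsilon> * s)) * F (y, snd p + \<sigma> * \<epsilon> * s) \<partial>lborel) \<partial>lborel)"
  proof (rule nn_integral_cmult[symmetric])
    have "(\<lambda>(s, y). ennreal (hk A B \<sigma> p (y, snd p + \<sigma> * \<epsilon> * s)) * F (y, snd p + \<sigma> * \<epsilon> * s)) \<in> borel_measurable (borel \<Otimes>\<^sub>M borel)"
      unfolding borel_prod split_beta
      by (rule measurable_compose[of "\<lambda>w. (snd w, snd p + \<sigma> * \<epsilon> * fst w)" borel borel "\<lambda>\<zeta>. ennreal (hk A B \<sigma> p \<zeta>) * F \<zeta>"])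
        (auto intro!: borel_measurable_continuous_onI continuous_intros)
    then show "(\<lambda>s. \<integral>\<^sup>+y. ennreal (hk A B \<sigma> p (y, snd p + \<sigma> * \<epsilon> * s)) * F (y, snd p + \<sigma> * \<epsilon> * s) \<partial>lborel) \<in> borel_measurable lborel"
      unfolding measurable_lborel2
      by (intro lborel.borel_measurable_nn_integral) (simp add: measurable_lborel2 cong: measurable_cong_sets sets_pair_measure_cong)
  qed
  also have "\<dots> = (\<integral>\<^sup>+s. \<integral>\<^sup>+y. ennreal (hker \<epsilon> (y, s)) * F (hpt \<sigma> p \<epsilon> (y, s)) \<partial>lborel \<partial>lborel)"
    by (simp only: inner)
  also have "\<dots> = (\<integral>\<^sup>+w. ennreal (hker \<epsilon> w) * F (hpt \<sigma> p \<epsilon> w) \<partial>lborel)"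
    by (rule nn_integral_lborel_prod[symmetric]) measurable
  finally show ?thesis .
qed

lemma hk_density:
  assumes "\<bar>\<sigma>\<bar> = 1" "\<epsilon> > 0"
  shows "density lborel (\<lambda>\<zeta>. ennreal (hk A B \<sigma> p \<zeta>)) = distr (density lborel (\<lambda>w. ennreal (hker \<epsilon> w))) borel (hpt \<sigma> p \<epsilon>)"
proof (rule measure_eqI)
  fix S assume "S \<in> sets (density lborel (\<lambda>\<zeta>. ennreal (hk A B \<sigma> p \<zeta>)))"
  then have S [measurable]: "S \<in> sets borel" by simp
  have "emeasure (density lborel (\<lambda>\<zeta>. ennreal (hk A B \<sigma> p \<zeta>))) S = (\<integral>\<^sup>+\<zeta>. ennreal (hk A B \<sigma> p \<zeta>) * indicator S \<zeta> \<partial>lborel)"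
    by (rule emeasure_density) simp_all
  also have "\<dots> = (\<integral>\<^sup>+w. ennreal (hker \<epsilon> w) * indicator S (hpt \<sigma> p \<epsilon> w) \<partial>lborel)"
    by (rule hk_pushforward[OF assms]) simp
  also have "\<dots> = (\<integral>\<^sup>+w. ennreal (hker \<epsilon> w) * indicator (hpt \<sigma> p \<epsilon> -` S) w \<partial>lborel)"
    by (simp add: indicator_def)
  also have "\<dots> = emeasure (density lborel (\<lambda>w. ennreal (hker \<epsilon> w))) (hpt \<sigma> p \<epsilon> -` S)"
    by (rule emeasure_density[symmetric]) (simp_all, use measurable_sets[OF hpt_measurable S] in simp)
  finally show "emeasure (density lborel (\<lambda>\<zeta>. ennreal (hk A B \<sigma> p \<zeta>))) S
     = emeasure (distr (density lborel (\<lambda>w. ennreal (hker \<epsilon> w))) borel (hpt \<sigma> p \<epsilon>)) S"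
    by (simp add: emeasure_distr)
qed simp

lemma hk_integral:
  fixes f :: "'n spacetime \<Rightarrow> real"
  assumes \<sigma>: "\<bar>\<sigma>\<bar> = 1" and \<epsilon>: "\<epsilon> > 0" and f [measurable]: "f \<in> borel_measurable borel"
  shows "(\<integral>\<zeta>. hk A B \<sigma> p \<zeta> * f \<zeta> \<partial>lborel) = (\<integral>w. hker \<epsilon> w * f (hpt \<sigma> p \<epsilon> w) \<partial>lborel)"
    and "integrable lborel (\<lambda>\<zeta>. hk A B \<sigma> p \<zeta> * f \<zeta>) \<longleftrightarrow> integrable lborel (\<lambda>w. hker \<epsilon> w * f (hpt \<sigma> p \<epsilon> w))"
proof -
  note D = hk_density[OF \<sigma> \<epsilon>, of p]
  have "(\<integral>\<zeta>. hk A B \<sigma> p \<zeta> * f \<zeta> \<partial>lborel) = integral\<^sup>L (density lborel (\<lambda>\<zeta>. ennreal (hk A B \<sigma> p \<zeta>))) f"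
    by (subst integral_density) (simp_all add: hk_nonneg)
  also have "\<dots> = integral\<^sup>L (density lborel (\<lambda>w. ennreal (hker \<epsilon> w))) (\<lambda>w. f (hpt \<sigma> p \<epsilon> w))"
    unfolding D by (subst integral_distr) simp_all
  also have "\<dots> = (\<integral>w. hker \<epsilon> w * f (hpt \<sigma> p \<epsilon> w) \<partial>lborel)"
    by (subst integral_density) (simp_all add: hker_nonneg[OF \<epsilon>])
  finally show "(\<integral>\<zeta>. hk A B \<sigma> p \<zeta> * f \<zeta> \<partial>lborel) = (\<integral>w. hker \<epsilon> w * f (hpt \<sigma> p \<epsilon> w) \<partial>lborel)" .
  have "integrable lborel (\<lambda>\<zeta>. hk A B \<sigma> p \<zeta> * f \<zeta>) \<longleftrightarrow> integrable (density lborel (\<lambda>\<zeta>. ennreal (hk A B \<sigma> p \<zeta>))) f"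
    by (subst integrable_density) (simp_all add: hk_nonneg)
  also have "\<dots> \<longleftrightarrow> integrable (density lborel (\<lambda>w. ennreal (hker \<epsilon> w))) (\<lambda>w. f (hpt \<sigma> p \<epsilon> w))"
    unfolding D by (subst integrable_distr_eq) simp_all
  also have "\<dots> \<longleftrightarrow> integrable lborel (\<lambda>w. hker \<epsilon> w * f (hpt \<sigma> p \<epsilon> w))"
    by (subst integrable_density) (simp_all add: hker_nonneg[OF \<epsilon>])
  finally show "integrable lborel (\<lambda>\<zeta>. hk A B \<sigma> p \<zeta> * f \<zeta>) \<longleftrightarrow> integrable lborel (\<lambda>w. hker \<epsilon> w * f (hpt \<sigma> p \<epsilon> w))" .
qed

lemma hs_hpt: "\<bar>\<sigma>\<bar> = 1 \<Longrightarrow> hs \<sigma> p (hpt \<sigma> p \<epsilon> w) = \<epsilon> * snd w"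
  by (auto simp: hpt_def abs_if split: if_splits)

text \<open>A function of the elapsed time sees only the total spatial mass of the kernel, which is
  1 at every positive time. This reduces singular integrals near the pole to one-dimensional
  ones.\<close>

lemma hk_time_integral:
  fixes \<phi> :: "real \<Rightarrow> ennreal"
  assumes \<sigma>: "\<bar>\<sigma>\<bar> = 1" and [measurable]: "\<phi> \<in> borel_measurable borel"
  shows "(\<integral>\<^sup>+\<zeta>. ennreal (hk A B \<sigma> p \<zeta>) * \<phi> (hs \<sigma> p \<zeta>) \<partial>lborel) = (\<integral>\<^sup>+s. indicator {0<..} s * \<phi> s \<partial>lborel)"
proof -
  have [measurable]: "fst \<in> borel_measurable (borel :: 'n spacetime measure)" "snd \<in> borel_measurable (borel :: 'n spacetime measure)"
    by (intro borel_measurable_continuous_onI continuous_intros)+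
  have "(\<integral>\<^sup>+\<zeta>. ennreal (hk A B \<sigma> p \<zeta>) * \<phi> (hs \<sigma> p \<zeta>) \<partial>lborel) = (\<integral>\<^sup>+w. ennreal (hker 1 w) * \<phi> (snd w) \<partial>lborel)"
    by (subst hk_pushforward[OF \<sigma>, of 1]) (simp_all add: hs_hpt[OF \<sigma>])
  also have "\<dots> = (\<integral>\<^sup>+s. \<integral>\<^sup>+y. ennreal (hker 1 (y, s)) * \<phi> s \<partial>lborel \<partial>lborel)"
    by (subst nn_integral_lborel_prod) simp_all
  also have "\<dots> = (\<integral>\<^sup>+s. \<integral>\<^sup>+y. (indicator {0<..} s * \<phi> s) * ennreal (fund_gamma A B (y, 1)) \<partial>lborel \<partial>lborel)"
    by (intro nn_integral_cong) (auto simp: hker_def indicator_def mult.commute)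
  also have "\<dots> = (\<integral>\<^sup>+s. indicator {0<..} s * \<phi> s \<partial>lborel)"
    by (subst nn_integral_cmult) (simp_all add: nn_integral_fund_gamma)
  finally show ?thesis .
qed

text \<open>In the coordinates of \<open>hpt\<close> the weight becomes the probability density
  \<open>fund_gamma A B (y, 1) * cutoff' s\<close>, independent of the scale, so dominated
  convergence applies. As \<open>cutoff'\<close> lives on 1 < s < 2, bound and limit are only asked
  for there; this matters for functions that are singular at the pole.\<close>

lemma hk_concentrates:
  fixes h :: "'n spacetime \<Rightarrow> real" and \<epsilon> :: "nat \<Rightarrow> real"
  assumes \<sigma>: "\<bar>\<sigma>\<bar> = 1" and \<epsilon>: "\<And>n. \<epsilon> n > 0" and h [measurable]: "h \<in> borel_measurable borel"
    and bound: "\<And>n y s. s > 0 \<Longrightarrow> \<bar>h (hpt \<sigma> p (\<epsilon> n) (y, s))\<bar> \<le> M \<or> s \<le> 1 \<or> s \<ge> 2"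
    and lim: "\<And>y s. 1 < s \<Longrightarrow> s < 2 \<Longrightarrow> (\<lambda>n. h (hpt \<sigma> p (\<epsilon> n) (y, s))) \<longlonglongrightarrow> L"
  shows "(\<lambda>n. \<integral>\<zeta>. hk A B \<sigma> p \<zeta> * (cutoff' (hs \<sigma> p \<zeta> / \<epsilon> n) / \<epsilon> n * h \<zeta>) \<partial>lborel) \<longlonglongrightarrow> L"
    and "integrable lborel (\<lambda>\<zeta>. hk A B \<sigma> p \<zeta> * (cutoff' (hs \<sigma> p \<zeta> / \<epsilon> n) / \<epsilon> n * h \<zeta>))"
proof -
  have [measurable]: "fst \<in> borel_measurable (borel :: 'n spacetime measure)" "snd \<in> borel_measurable (borel :: 'n spacetime measure)"
    by (intro borel_measurable_continuous_onI continuous_intros)+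
  have [measurable]: "cutoff' \<in> borel_measurable borel"
    using integrable_cutoff' by simp
  let ?k = "\<lambda>w :: 'n spacetime. fund_gamma A B (fst w, 1) * cutoff' (snd w)"
  have nn: "(\<integral>\<^sup>+w. ennreal (?k w) \<partial>lborel) = 1"
  proof -
    have "(\<integral>\<^sup>+w. ennreal (?k w) \<partial>lborel) = (\<integral>\<^sup>+s. \<integral>\<^sup>+y. ennreal (cutoff' s) * ennreal (fund_gamma A B (y, 1)) \<partial>lborel \<partial>lborel)"
      by (subst nn_integral_lborel_prod)
        (simp_all add: ennreal_mult fund_gamma_nonneg cutoff'_nonneg mult.commute)
    also have "\<dots> = (\<integral>\<^sup>+s. ennreal (cutoff' s) \<partial>lborel)"
      by (subst nn_integral_cmult) (simp_all add: nn_integral_fund_gamma)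
    also have "\<dots> = ennreal 1"
      using integral_cutoff' by (subst nn_integral_eq_integral) (auto simp: integrable_cutoff' cutoff'_nonneg)
    finally show ?thesis by simp
  qed
  have ki: "integrable lborel ?k"
    by (rule integrableI_nonneg) (auto simp: nn fund_gamma_nonneg cutoff'_nonneg)
  have k1: "(\<integral>w. ?k w \<partial>lborel) = 1"
    by (subst integral_eq_nn_integral) (auto simp: nn fund_gamma_nonneg cutoff'_nonneg)
  have e: "hker (\<epsilon> n) w * (cutoff' (hs \<sigma> p (hpt \<sigma> p (\<epsilon> n) w) / \<epsilon> n) / \<epsilon> n * h (hpt \<sigma> p (\<epsilon> n) w)) = ?k w * h (hpt \<sigma> p (\<epsilon> n) w)" for n w
    using \<epsilon>[of n] cutoff'_eq_0[of "snd w"] by (cases "snd w > 0") (auto simp: hs_hpt[OF \<sigma>] hker_def)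
  have m: "(\<lambda>\<zeta>. cutoff' (hs \<sigma> p \<zeta> / \<epsilon> n) / \<epsilon> n * h \<zeta>) \<in> borel_measurable borel" for n
    by measurable
  have I: "(\<integral>\<zeta>. hk A B \<sigma> p \<zeta> * (cutoff' (hs \<sigma> p \<zeta> / \<epsilon> n) / \<epsilon> n * h \<zeta>) \<partial>lborel) = (\<integral>w. ?k w * h (hpt \<sigma> p (\<epsilon> n) w) \<partial>lborel)"
    "integrable lborel (\<lambda>\<zeta>. hk A B \<sigma> p \<zeta> * (cutoff' (hs \<sigma> p \<zeta> / \<epsilon> n) / \<epsilon> n * h \<zeta>)) \<longleftrightarrow> integrable lborel (\<lambda>w. ?k w * h (hpt \<sigma> p (\<epsilon> n) w))" for n
    unfolding hk_integral[OF \<sigma> \<epsilon>[of n] m[of n]] e by (rule refl)+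
  have b: "norm (?k w * h (hpt \<sigma> p (\<epsilon> n) w)) \<le> \<bar>M\<bar> * ?k w" for n w
  proof (cases "1 < snd w \<and> snd w < 2")
    case True
    then have "\<bar>h (hpt \<sigma> p (\<epsilon> n) w)\<bar> \<le> \<bar>M\<bar>" using bound[of "snd w" n "fst w"] by fastforce
    then show ?thesis
      using mult_right_mono[of _ "\<bar>M\<bar>" "?k w"] by (simp add: abs_mult fund_gamma_nonneg cutoff'_nonneg mult.commute)
  next
    case False
    then show ?thesis using cutoff'_eq_0[of "snd w"] by auto
  qed
  have D: "integrable lborel (\<lambda>w. ?k w * L)" "\<And>n. integrable lborel (\<lambda>w. ?k w * h (hpt \<sigma> p (\<epsilon> n) w))"
    "(\<lambda>n. \<integral>w. ?k w * h (hpt \<sigma> p (\<epsilon> n) w) \<partial>lborel) \<longlonglongrightarrow> (\<integral>w. ?k w * L \<partial>lborel)"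
  proof -
    have l: "AE w in lborel. (\<lambda>n. ?k w * h (hpt \<sigma> p (\<epsilon> n) w)) \<longlonglongrightarrow> ?k w * L"
    proof (rule AE_I2)
      fix w :: "'n spacetime"
      show "(\<lambda>n. ?k w * h (hpt \<sigma> p (\<epsilon> n) w)) \<longlonglongrightarrow> ?k w * L"
      proof (cases "1 < snd w \<and> snd w < 2")
        case True
        then show ?thesis using lim[of "snd w" "fst w"] by (intro tendsto_mult_left) simp
      next
        case False
        then show ?thesis using cutoff'_eq_0[of "snd w"] by auto
      qed
    qed
    have i: "integrable lborel (\<lambda>w. \<bar>M\<bar> * ?k w)" using ki by simp
    have b': "AE w in lborel. norm (?k w * h (hpt \<sigma> p (\<epsilon> n) w)) \<le> \<bar>M\<bar> * ?k w" for n
      using b by (intro AE_I2)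
    have m1: "(\<lambda>w. ?k w * L) \<in> borel_measurable lborel" and m2: "\<And>n. (\<lambda>w. ?k w * h (hpt \<sigma> p (\<epsilon> n) w)) \<in> borel_measurable lborel"
      by measurable
    show "integrable lborel (\<lambda>w. ?k w * L)" "\<And>n. integrable lborel (\<lambda>w. ?k w * h (hpt \<sigma> p (\<epsilon> n) w))"
      "(\<lambda>n. \<integral>w. ?k w * h (hpt \<sigma> p (\<epsilon> n) w) \<partial>lborel) \<longlonglongrightarrow> (\<integral>w. ?k w * L \<partial>lborel)"
      using integrable_dominated_convergence[OF m1 m2 i l b'] integrable_dominated_convergence2[OF m1 m2 i l b']
        integral_dominated_convergence[OF m1 m2 i l b'] by blast+
  qed
  show "(\<lambda>n. \<integral>\<zeta>. hk A B \<sigma> p \<zeta> * (cutoff' (hs \<sigma> p \<zeta> / \<epsilon> n) / \<epsilon> n * h \<zeta>) \<partial>lborel) \<longlonglongrightarrow> L"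
    unfolding I(1) using D(3) k1 by simp
  show "integrable lborel (\<lambda>\<zeta>. hk A B \<sigma> p \<zeta> * (cutoff' (hs \<sigma> p \<zeta> / \<epsilon> n) / \<epsilon> n * h \<zeta>))"
    unfolding I(2) by (rule D(2))
qed

end

section \<open>Smoothness of the fundamental solution\<close>

text \<open>Polynomials in the coordinates and in the inverse elapsed time: all factors that can
  arise by differentiating the kernel repeatedly. The set is closed under derivatives and its
  members grow at most like a power of 1/(t - t0), so smoothness of every order becomes a single
  induction over products of such a factor with the kernel.\<close>

inductive_set rat_alg :: "real \<Rightarrow> ('n::finite spacetime \<Rightarrow> real) set" for t0 :: real
  where
    const: "(\<lambda>z. c) \<in> rat_alg t0"
  | coord: "(\<lambda>z. fst z $ i) \<in> rat_alg t0"
  | time: "(\<lambda>z. snd z - t0) \<in> rat_alg t0"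
  | inv: "(\<lambda>z. 1 / (snd z - t0)) \<in> rat_alg t0"
  | add: "f \<in> rat_alg t0 \<Longrightarrow> g \<in> rat_alg t0 \<Longrightarrow> (\<lambda>z. f z + g z) \<in> rat_alg t0"
  | mult: "f \<in> rat_alg t0 \<Longrightarrow> g \<in> rat_alg t0 \<Longrightarrow> (\<lambda>z. f z * g z) \<in> rat_alg t0"

lemma rat_alg_pow: "f \<in> rat_alg t0 \<Longrightarrow> (\<lambda>z. f z ^ k) \<in> rat_alg t0"
  by (induction k) (auto intro: rat_alg.intros)

lemma rat_alg_sum: "(\<And>i. i \<in> I \<Longrightarrow> f i \<in> rat_alg t0) \<Longrightarrow> (\<lambda>z. \<Sum>i\<in>I. f i z) \<in> rat_alg t0"
  by (induction I rule: infinite_finite_induct) (auto intro: rat_alg.intros)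

lemma rat_alg_diff: "f \<in> rat_alg t0 \<Longrightarrow> g \<in> rat_alg t0 \<Longrightarrow> (\<lambda>z. f z - g z) \<in> rat_alg t0"
  using rat_alg.add[of f t0 "\<lambda>z. -1 * g z"] rat_alg.mult[OF rat_alg.const[of "-1"]] by fastforce

lemma rat_alg_deriv:
  "f \<in> rat_alg t0 \<Longrightarrow> \<exists>f'. (\<forall>v. f' v \<in> rat_alg t0) \<and> (\<forall>z. snd z > t0 \<longrightarrow> (f has_derivative (\<lambda>v. f' v z)) (at z))"
proof (induction rule: rat_alg.induct)
  case (const c)
  show ?case by (rule exI[of _ "\<lambda>v z. 0"]) (auto intro: rat_alg.intros)
next
  case (coord i)
  have "((\<lambda>z. fst z $ i) has_derivative (\<lambda>v. fst v $ i)) (at z)" for z :: "'a spacetime"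
    by (rule bounded_linear.has_derivative[OF bounded_linear_vec_nth has_derivative_fst[OF has_derivative_ident]])
  then show ?case by (intro exI[of _ "\<lambda>v z. fst v $ i"]) (auto intro: rat_alg.intros)
next
  case time
  have "((\<lambda>z. snd z - t0) has_derivative (\<lambda>v. snd v)) (at z)" for z :: "'a spacetime"
    by (auto intro!: derivative_eq_intros)
  then show ?case by (intro exI[of _ "\<lambda>v z. snd v"]) (auto intro: rat_alg.intros)
next
  case inv
  have i1: "((\<lambda>z. 1 / (snd z - t0)) has_derivative (\<lambda>v. (- snd v) * ((1 / (snd z - t0)) * (1 / (snd z - t0))))) (at z)"
    if "snd z > t0" for z :: "'a spacetime"
    using that by (auto intro!: derivative_eq_intros simp: power2_eq_square)
  have i2: "(\<lambda>z. (- snd v) * ((1 / (snd z - t0)) * (1 / (snd z - t0)))) \<in> rat_alg t0" for v :: "'a spacetime"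
    by (intro rat_alg.mult rat_alg.const rat_alg.inv)
  show ?case
    by (intro exI[of _ "\<lambda>v z. (- snd v) * ((1 / (snd z - t0)) * (1 / (snd z - t0)))"] conjI allI impI, rule i2, erule i1)
next
  case (add f g)
  then obtain f' g' where "\<forall>v. f' v \<in> rat_alg t0" "\<forall>z. snd z > t0 \<longrightarrow> (f has_derivative (\<lambda>v. f' v z)) (at z)"
    "\<forall>v. g' v \<in> rat_alg t0" "\<forall>z. snd z > t0 \<longrightarrow> (g has_derivative (\<lambda>v. g' v z)) (at z)" by blast
  then show ?case
    by (intro exI[of _ "\<lambda>v z. f' v z + g' v z"]) (auto intro: rat_alg.intros has_derivative_add)
next
  case (mult f g)
  then obtain f' g' where d: "\<And>v. f' v \<in> rat_alg t0" "\<And>z. snd z > t0 \<Longrightarrow> (f has_derivative (\<lambda>v. f' v z)) (at z)"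
    "\<And>v. g' v \<in> rat_alg t0" "\<And>z. snd z > t0 \<Longrightarrow> (g has_derivative (\<lambda>v. g' v z)) (at z)" by blast
  show ?case
  proof (intro exI[of _ "\<lambda>v z. f z * g' v z + f' v z * g z"] conjI allI impI)
    show "(\<lambda>z. f z * g' v z + f' v z * g z) \<in> rat_alg t0" for v
      by (intro rat_alg.add rat_alg.mult mult.hyps d)
    show "((\<lambda>z. f z * g z) has_derivative (\<lambda>v. f z * g' v z + f' v z * g z)) (at z)" if "snd z > t0" for z
      by (intro has_derivative_mult d that)
  qed
qed

text \<open>The restriction to elapsed times below 1 lets the larger of two exponents of 1/(t - t0)
  dominate, which closes the bounds under addition.\<close>

lemma rat_alg_bound:
  assumes "f \<in> rat_alg t0"
  shows "\<exists>C m. C \<ge> 0 \<and> (\<forall>z. norm z \<le> N \<longrightarrow> t0 < snd z \<longrightarrow> snd z < t0 + 1 \<longrightarrow> \<bar>f z\<bar> \<le> C / (snd z - t0) ^ m)"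
  using assms
proof (induction rule: rat_alg.induct)
  case (const c)
  show ?case by (rule exI[of _ "\<bar>c\<bar>"], rule exI[of _ 0]) simp
next
  case (coord i)
  have "\<bar>fst z $ i\<bar> \<le> \<bar>N\<bar>" if "norm z \<le> N" for z :: "'a spacetime"
    using component_le_norm_cart[of "fst z" i] norm_fst_le[of "fst z" "snd z"] that by simp
  then show ?case by (intro exI[of _ "\<bar>N\<bar>"] exI[of _ 0]) simp
next
  case time
  show ?case by (rule exI[of _ 1], rule exI[of _ 0]) simp
next
  case inv
  show ?case by (rule exI[of _ 1], rule exI[of _ 1]) simp
next
  case (add f g)
  then obtain C m C' m' where b: "C \<ge> 0" "\<And>z. norm z \<le> N \<Longrightarrow> t0 < snd z \<Longrightarrow> snd z < t0 + 1 \<Longrightarrow> \<bar>f z\<bar> \<le> C / (snd z - t0) ^ m"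
    "C' \<ge> 0" "\<And>z. norm z \<le> N \<Longrightarrow> t0 < snd z \<Longrightarrow> snd z < t0 + 1 \<Longrightarrow> \<bar>g z\<bar> \<le> C' / (snd z - t0) ^ m'"
    by blast
  have "\<bar>f z + g z\<bar> \<le> (C + C') / (snd z - t0) ^ (m + m')" if z: "norm z \<le> N" "t0 < snd z" "snd z < t0 + 1" for z
  proof -
    let ?s = "snd z - t0"
    have s: "0 < ?s" "?s \<le> 1" using z by auto
    have "C / ?s ^ m \<le> C / ?s ^ (m + m')" "C' / ?s ^ m' \<le> C' / ?s ^ (m + m')"
      using s b by (auto intro!: divide_left_mono power_decreasing)
    then show ?thesis using b(2)[OF z] b(4)[OF z] by (simp add: add_divide_distrib)
  qed
  then show ?case using b by (intro exI[of _ "C + C'"] exI[of _ "m + m'"]) auto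
next
  case (mult f g)
  then obtain C m C' m' where b: "C \<ge> 0" "\<And>z. norm z \<le> N \<Longrightarrow> t0 < snd z \<Longrightarrow> snd z < t0 + 1 \<Longrightarrow> \<bar>f z\<bar> \<le> C / (snd z - t0) ^ m"
    "C' \<ge> 0" "\<And>z. norm z \<le> N \<Longrightarrow> t0 < snd z \<Longrightarrow> snd z < t0 + 1 \<Longrightarrow> \<bar>g z\<bar> \<le> C' / (snd z - t0) ^ m'"
    by blast
  have "\<bar>f z * g z\<bar> \<le> (C * C') / (snd z - t0) ^ (m + m')" if z: "norm z \<le> N" "t0 < snd z" "snd z < t0 + 1" for z
  proof -
    have "\<bar>f z\<bar> * \<bar>g z\<bar> \<le> (C / (snd z - t0) ^ m) * (C' / (snd z - t0) ^ m')"
      using b z by (intro mult_mono) auto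
    then show ?thesis by (simp add: abs_mult power_add)
  qed
  then show ?case using b by (intro exI[of _ "C * C'"] exI[of _ "m + m'"]) auto
qed

lemma power_le_exp:
  fixes x :: real
  assumes "x \<ge> 0"
  shows "x ^ n / fact n \<le> exp x"
proof -
  have "sum (\<lambda>n. x ^ n /\<^sub>R fact n) {n} \<le> (\<Sum>n. x ^ n /\<^sub>R fact n)"
    by (rule sum_le_suminf) (use assms exp_converges[of x] in \<open>auto simp: sums_iff\<close>)
  then show ?thesis using exp_converges[of x] by (simp add: sums_iff divide_inverse mult.commute)
qed

lemma C_k_on_cong:
  assumes S: "open S" and eq: "\<And>z. z \<in> S \<Longrightarrow> f z = g z"
  shows "C_k_on k f S \<longleftrightarrow> C_k_on k g S"
  using eq
proof (induction k arbitrary: f g)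
  case 0
  then show ?case by (simp cong: continuous_on_cong)
next
  case (Suc k)
  have d: "(f has_derivative D) (at z) \<longleftrightarrow> (g has_derivative D) (at z)" if "z \<in> S" for z D
    using has_derivative_transform_within_open[OF _ S that, of f D _ g] has_derivative_transform_within_open[OF _ S that, of g D _ f]
      Suc.prems by auto
  have "C_k_on k (dir_deriv v f) S \<longleftrightarrow> C_k_on k (dir_deriv v g) S" for v
    by (rule Suc.IH) (simp add: dir_deriv_def frechet_derivative_def d)
  moreover have "(\<forall>z\<in>S. f differentiable (at z)) \<longleftrightarrow> (\<forall>z\<in>S. g differentiable (at z))"
    using d by (simp add: differentiable_def)
  ultimately show ?case by simp
qed

lemma dir_deriv_eq: "(f has_derivative D) (at z) \<Longrightarrow> dir_deriv v f z = D v"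
  unfolding dir_deriv_def by (metis frechet_derivative_at)

lemma has_derivative_zero_quadratic:
  fixes f :: "'a::real_normed_vector \<Rightarrow> real"
  assumes "\<delta> > 0" "\<And>y. dist y x < \<delta> \<Longrightarrow> \<bar>f y\<bar> \<le> K * (norm (y - x))\<^sup>2"
  shows "(f has_derivative (\<lambda>v. 0)) (at x)"
proof (rule has_derivativeI_sandwich[where H = "\<lambda>y. K * norm (y - x)"])
  have f0: "f x = 0" using assms(2)[of x] assms(1) by simp
  show "norm (f y - f x - 0) / norm (y - x) \<le> K * norm (y - x)" if "y \<noteq> x" "dist y x < \<delta>" for y
    using assms(2)[OF that(2)] that(1) by (simp add: f0 power2_eq_square field_simps)
  have "((\<lambda>y. K * norm (y - x)) \<longlongrightarrow> K * norm (x - x)) (at x)" by (intro tendsto_intros)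
  then show "((\<lambda>y. K * norm (y - x)) \<longlongrightarrow> 0) (at x)" by simp
qed (use assms in auto)

context kolm begin

lemma hk_log_derivative:
  "\<exists>c. (\<forall>v. c v \<in> rat_alg (snd p)) \<and> (\<forall>z. snd z > snd p \<longrightarrow>
     (hk A B 1 p has_derivative (\<lambda>v. c v z * hk A B 1 p z)) (at z))"
proof -
  let ?t = "snd p"
  define Y where "Y i z = fst z $ i - (\<Sum>j\<in>UNIV. E_mat B (snd z - ?t) $ i $ j * fst p $ j)" for i z
  define Q where "Q z = (\<Sum>i\<in>UNIV. \<Sum>j\<in>UNIV. Pm A B 1 $ i $ j * (1 / (snd z - ?t)) ^ (l i + l j + 1) * Y j z * Y i z)" for z
  have E: "(\<lambda>z. E_mat B (snd z - ?t) $ i $ j) \<in> rat_alg ?t" for i j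
  proof -
    have "(\<lambda>z. (-1 * (snd z - ?t)) ^ (l i - l j) * (mpow B (l i - l j) $ i $ j / fact (l i - l j))) \<in> rat_alg ?t"
      by (intro rat_alg_pow rat_alg.mult rat_alg.const rat_alg.time)
    then show ?thesis
      unfolding E_mat_entry by (cases "l j \<le> l i") (simp_all add: rat_alg.const)
  qed
  have Y: "Y i \<in> rat_alg ?t" for i
    unfolding Y_def by (intro rat_alg_diff rat_alg_sum rat_alg.mult rat_alg.const rat_alg.coord E)
  have "Q \<in> rat_alg ?t"
    unfolding Q_def by (intro rat_alg_sum rat_alg.mult rat_alg.const rat_alg_pow rat_alg.inv Y)
  then obtain Q' where Q': "\<And>v. Q' v \<in> rat_alg ?t" "\<And>z. snd z > ?t \<Longrightarrow> (Q has_derivative (\<lambda>v. Q' v z)) (at z)"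
    using rat_alg_deriv by blast
  have hk: "hk A B 1 p z = peak (snd z - ?t) * exp (- (1/4) * Q z)" if "snd z > ?t" for z
  proof -
    have Yz: "hX B 1 p z $ i = Y i z" for i by (simp add: hX_def Y_def matrix_vector_mult_def)
    have "Q z = (Pm A B (snd z - ?t) *v hX B 1 p z) \<bullet> hX B 1 p z"
      unfolding quad_form_sum Yz Q_def
      by (intro sum.cong refl, subst P_entry[of "snd z - ?t"]) (use that in \<open>simp_all add: power_divide\<close>)
    then show ?thesis using hk_eq[of 1 z p] that by simp
  qed
  define c where "c v z = (- (hdim / 2) * snd v) * (1 / (snd z - ?t)) + (- (1/4)) * Q' v z" for v z
  have "(hk A B 1 p has_derivative (\<lambda>v. c v z * hk A B 1 p z)) (at z)" if z: "snd z > ?t" for z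
  proof -
    let ?s = "snd z - ?t"
    have 1: "((\<lambda>z. peak (snd z - ?t)) has_derivative (\<lambda>v. (- (hdim / (2 * ?s)) * peak ?s) * snd v)) (at z)"
    proof -
      have a: "((\<lambda>z. snd z - ?t) has_derivative snd) (at z)"
        by (auto intro!: derivative_eq_intros)
      have b: "(peak has_derivative (\<lambda>h. (- (hdim / (2 * ?s)) * peak ?s) * h)) (at ?s)"
        using peak_deriv[of ?s] z by (simp only: has_field_derivative_def)
      show ?thesis by (rule has_derivative_compose[OF a b])
    qed
    have 2: "((\<lambda>z. exp (- (1/4) * Q z)) has_derivative (\<lambda>v. exp (- (1/4) * Q z) * (- (1/4) * Q' v z))) (at z)"
      by (rule has_derivative_eq_rhs[OF has_derivative_exp[OF has_derivative_mult_right[OF Q'(2)[OF z]]]]) (simp add: fun_eq_iff)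
    have "((\<lambda>z. peak (snd z - ?t) * exp (- (1/4) * Q z)) has_derivative (\<lambda>v. c v z * hk A B 1 p z)) (at z)"
      by (rule has_derivative_eq_rhs[OF has_derivative_mult[OF 1 2]])
        (use z in \<open>auto simp: fun_eq_iff c_def hk field_simps\<close>)
    moreover have "open {z. snd z > ?t}" by (intro open_Collect_less continuous_intros)
    ultimately show ?thesis
      by (rule has_derivative_transform_within_open) (use z hk in auto)
  qed
  moreover have "c v \<in> rat_alg ?t" for v
    unfolding c_def by (intro rat_alg.add rat_alg.mult rat_alg.const rat_alg.inv Q')
  ultimately show ?thesis by blast
qed

text \<open>At the time of the pole but away from it, the displacement stays bounded away from 0, so
  the kernel is at most a power of 1/s times exp(-a/s). This beats every rational factor and leaves
  a quadratic remainder, hence derivative 0 across the singular time.\<close>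

lemma rat_hk_flat:
  assumes R: "R \<in> rat_alg (snd p)" and z: "snd z = snd p" "z \<noteq> p"
  obtains \<delta> K where "\<delta> > 0" "\<And>y. dist y z < \<delta> \<Longrightarrow> \<bar>R y * hk A B 1 p y\<bar> \<le> K * (norm (y - z))\<^sup>2"
proof -
  let ?t = "snd p"
  obtain c where c: "c > 0" "\<And>s x. 0 < s \<Longrightarrow> s \<le> 1 \<Longrightarrow> (Pm A B s *v x) \<bullet> x \<ge> c * (norm x)\<^sup>2 / s"
    using q_lower_bound[of 1] by auto
  define d where "d = norm (hX B 1 p z) / 2"
  have "hX B 1 p z = fst z - fst p" by (simp add: hX_def z(1) E_mat_0)
  then have d: "d > 0" using z by (auto simp: d_def prod_eq_iff)
  have "continuous_on UNIV (\<lambda>y. norm (hX B 1 p y))" by (intro continuous_intros)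
  then have "open {y. norm (hX B 1 p y) > d}" by (intro open_Collect_less continuous_intros)
  moreover have "z \<in> {y. norm (hX B 1 p y) > d}" using d by (simp add: d_def)
  ultimately obtain \<delta>1 where \<delta>1: "\<delta>1 > 0" "\<And>y. dist y z < \<delta>1 \<Longrightarrow> norm (hX B 1 p y) > d"
    unfolding open_dist by blast
  obtain C m where C: "C \<ge> 0" "\<And>y. norm y \<le> norm z + 1 \<Longrightarrow> ?t < snd y \<Longrightarrow> snd y < ?t + 1 \<Longrightarrow> \<bar>R y\<bar> \<le> C / (snd y - ?t) ^ m"
    using rat_alg_bound[OF R, of "norm z + 1"] by blast
  define a where "a = c * d\<^sup>2 / 4"
  have a: "a > 0" using c d by (simp add: a_def)
  \<comment> \<open>From exp(-a/s) \<le> n! (s/a)^n: m powers of s compensate the rational factor,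
    \<open>hdim\<close> powers the prefactor, and two remain for the quadratic bound.\<close>
  define n where "n = m + hdim + 2"
  define K where "K = C * gamma_const * fact n / a ^ n"
  have K0: "K \<ge> 0" using C gamma_const_pos a by (simp add: K_def)
  show ?thesis
  proof (rule that[of "min \<delta>1 1" K])
    show "min \<delta>1 1 > 0" using \<delta>1 by simp
    fix y assume y: "dist y z < min \<delta>1 1"
    show "\<bar>R y * hk A B 1 p y\<bar> \<le> K * (norm (y - z))\<^sup>2"
    proof (cases "snd y > ?t")
      case False
      then show ?thesis using K0 hk_nonpos_time[of 1 y p A B] by simp
    next
      case True
      let ?s = "snd y - ?t"
      have sle: "?s \<le> norm (y - z)"
      proof -
        have "norm (snd (y - z)) \<le> norm (y - z)" by (metis norm_snd_le prod.collapse)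
        then show ?thesis using True by (simp add: z(1))
      qed
      have s: "0 < ?s" "?s < 1" using True sle y by (auto simp: dist_norm)
      have ny: "norm y \<le> norm z + 1" using norm_triangle_sub[of y z] y by (simp add: dist_norm)
      have Ry: "\<bar>R y\<bar> \<le> C / ?s ^ m" using C(2)[OF ny] s by simp
      have "hk A B 1 p y = gamma_const * ?s powr (- (hdim / 2)) * exp (- (1/4) * ((Pm A B ?s *v hX B 1 p y) \<bullet> hX B 1 p y))"
        using hk_eq[of 1 y p] s by (simp add: peak_def)
      also have "\<dots> \<le> gamma_const * (1 / ?s ^ hdim) * (fact n * ?s ^ n / a ^ n)"
      proof (intro mult_mono)
        \<comment> \<open>The exponent is rounded up to an integer, which is harmless since the
          elapsed time is below 1.\<close>
        have "?s powr (- (hdim / 2)) \<le> ?s powr (- real hdim)"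
          using s by (intro powr_mono') auto
        also have "\<dots> = 1 / ?s ^ hdim"
          by (simp only: powr_minus_divide powr_realpow[OF s(1)])
        finally show "?s powr (- (hdim / 2)) \<le> 1 / ?s ^ hdim" .
        have "d\<^sup>2 \<le> (norm (hX B 1 p y))\<^sup>2"
          using \<delta>1(2)[of y] y d by (intro power_mono) auto
        then have "(1/4) * (c * d\<^sup>2 / ?s) \<le> (1/4) * (c * (norm (hX B 1 p y))\<^sup>2 / ?s)"
          using c s by (intro mult_left_mono divide_right_mono) auto
        then have "a / ?s \<le> (1/4) * (c * (norm (hX B 1 p y))\<^sup>2 / ?s)"
          by (simp add: a_def)
        also have "\<dots> \<le> (1/4) * ((Pm A B ?s *v hX B 1 p y) \<bullet> hX B 1 p y)"
          using c(2)[of ?s "hX B 1 p y"] s by (intro mult_left_mono) auto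
        finally have "exp (- (1/4) * ((Pm A B ?s *v hX B 1 p y) \<bullet> hX B 1 p y)) \<le> exp (- (a / ?s))" by simp
        also have "\<dots> \<le> fact n * ?s ^ n / a ^ n"
        proof -
          have "(a / ?s) ^ n / fact n \<le> exp (a / ?s)" using a s by (intro power_le_exp) simp
          moreover have "0 < (a / ?s) ^ n / fact n" using a s by simp
          ultimately have "inverse (exp (a / ?s)) \<le> inverse ((a / ?s) ^ n / fact n)" by (intro le_imp_inverse_le)
          then show ?thesis by (simp add: exp_minus power_divide mult.commute)
        qed
        finally show "exp (- (1/4) * ((Pm A B ?s *v hX B 1 p y) \<bullet> hX B 1 p y)) \<le> fact n * ?s ^ n / a ^ n" .
      qed (use gamma_const_pos s in auto)
      finally have hy: "hk A B 1 p y \<le> gamma_const * (1 / ?s ^ hdim) * (fact n * ?s ^ n / a ^ n)" .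
      have "\<bar>R y * hk A B 1 p y\<bar> = \<bar>R y\<bar> * hk A B 1 p y" using hk_nonneg by (simp add: abs_mult)
      also have "\<dots> \<le> (C / ?s ^ m) * (gamma_const * (1 / ?s ^ hdim) * (fact n * ?s ^ n / a ^ n))"
        using Ry hy hk_nonneg C s by (intro mult_mono) auto
      also have "\<dots> = K * ?s\<^sup>2" using s by (simp add: K_def n_def power_add power2_eq_square)
      also have "\<dots> \<le> K * (norm (y - z))\<^sup>2" using K0 sle s by (intro mult_left_mono power_mono) auto
      finally show ?thesis .
    qed
  qed
qed

text \<open>After the pole this is the product rule with the rational logarithmic derivative of the
  kernel; before it everything is 0; at the same time \<open>rat_hk_flat\<close> gives derivative 0,
  matching the formula because the kernel vanishes there. The family of such products is thus closed
  under differentiation off the pole.\<close>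

lemma rat_hk_deriv:
  assumes R: "R \<in> rat_alg (snd p)"
  shows "\<exists>R'. (\<forall>v. R' v \<in> rat_alg (snd p)) \<and> (\<forall>z. z \<noteq> p \<longrightarrow>
     ((\<lambda>z. R z * hk A B 1 p z) has_derivative (\<lambda>v. R' v z * hk A B 1 p z)) (at z))"
proof -
  let ?t = "snd p"
  obtain R1 where R1: "\<And>v. R1 v \<in> rat_alg ?t" "\<And>z. snd z > ?t \<Longrightarrow> (R has_derivative (\<lambda>v. R1 v z)) (at z)"
    using rat_alg_deriv[OF R] by blast
  obtain c where c: "\<And>v. c v \<in> rat_alg ?t"
    "\<And>z. snd z > ?t \<Longrightarrow> (hk A B 1 p has_derivative (\<lambda>v. c v z * hk A B 1 p z)) (at z)"
    using hk_log_derivative[of p] by blast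
  define R' where "R' v z = R z * c v z + R1 v z" for v z
  have "((\<lambda>z. R z * hk A B 1 p z) has_derivative (\<lambda>v. R' v z * hk A B 1 p z)) (at z)" if zp: "z \<noteq> p" for z
  proof -
    consider "snd z > ?t" | "snd z < ?t" | "snd z = ?t" by linarith
    then show ?thesis
    proof cases
      case 1
      show ?thesis
        by (rule has_derivative_eq_rhs[OF has_derivative_mult[OF R1(2)[OF 1] c(2)[OF 1]]])
          (simp add: R'_def fun_eq_iff algebra_simps)
    next
      case 2
      have o: "open {z. snd z < ?t}" by (intro open_Collect_less continuous_intros)
      have "((\<lambda>z. R z * hk A B 1 p z) has_derivative (\<lambda>v. 0)) (at z)"
        by (rule has_derivative_transform_within_open[OF _ o, of "\<lambda>_. 0"])
          (use 2 in \<open>auto simp: hk_nonpos_time\<close>)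
      then show ?thesis using 2 by (simp add: hk_nonpos_time)
    next
      case 3
      obtain \<delta> K where "\<delta> > 0" "\<And>y. dist y z < \<delta> \<Longrightarrow> \<bar>R y * hk A B 1 p y\<bar> \<le> K * (norm (y - z))\<^sup>2"
        using rat_hk_flat[OF R 3 zp] by blast
      from has_derivative_zero_quadratic[OF this] show ?thesis using 3 by (simp add: hk_nonpos_time)
    qed
  qed
  moreover have "R' v \<in> rat_alg ?t" for v
    unfolding R'_def by (intro rat_alg.add rat_alg.mult R c R1)
  ultimately show ?thesis by blast
qed

lemma rat_hk_C_k:
  assumes "open S" "p \<notin> S" "R \<in> rat_alg (snd p)"
  shows "C_k_on k (\<lambda>z. R z * hk A B 1 p z) S"
  using assms(3)
proof (induction k arbitrary: R)
  case 0
  then obtain R' where R': "\<forall>z. z \<noteq> p \<longrightarrow> ((\<lambda>z. R z * hk A B 1 p z) has_derivative (\<lambda>v. R' v z * hk A B 1 p z)) (at z)"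
    using rat_hk_deriv by blast
  have "isCont (\<lambda>z. R z * hk A B 1 p z) z" if "z \<in> S" for z
  proof -
    have "z \<noteq> p" using that assms(2) by auto
    with R' show ?thesis using has_derivative_continuous by blast
  qed
  then show ?case by (simp add: continuous_at_imp_continuous_on)
next
  case (Suc k)
  obtain R' where R': "\<And>v. R' v \<in> rat_alg (snd p)"
    "\<And>z. z \<noteq> p \<Longrightarrow> ((\<lambda>z. R z * hk A B 1 p z) has_derivative (\<lambda>v. R' v z * hk A B 1 p z)) (at z)"
    using rat_hk_deriv[OF Suc.prems] by blast
  have eq: "dir_deriv v (\<lambda>z. R z * hk A B 1 p z) w = R' v w * hk A B 1 p w" if "w \<in> S" for v w
    using dir_deriv_eq[OF R'(2)] assms(2) that by metis
  have "C_k_on k (dir_deriv v (\<lambda>z. R z * hk A B 1 p z)) S" for v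
    by (subst C_k_on_cong[OF assms(1) eq]) (assumption, rule Suc.IH[OF R'(1)])
  moreover have "(\<lambda>z. R z * hk A B 1 p z) differentiable (at z)" if "z \<in> S" for z
  proof -
    have "z \<noteq> p" using that assms(2) by auto
    from R'(2)[OF this] show ?thesis by (rule differentiableI)
  qed
  ultimately show ?case by simp
qed

lemma sflow_deriv_chain:
  assumes "(f has_derivative D) (at z)"
  shows "((\<lambda>h. f (sflow a h z)) has_real_derivative D (a, 0)) (at 0)"
proof -
  interpret D: bounded_linear D using assms by (rule has_derivative_bounded_linear)
  have s: "((\<lambda>h. sflow a h z) has_derivative (\<lambda>h. (h *\<^sub>R a, 0))) (at 0)"
  proof -
    have "((\<lambda>h. (fst z + h *\<^sub>R a, snd z)) has_derivative (\<lambda>h. (h *\<^sub>R a, 0))) (at 0)"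
      by (auto intro!: derivative_eq_intros)
    then show "((\<lambda>h. sflow a h z) has_derivative (\<lambda>h. (h *\<^sub>R a, 0))) (at 0)"
      by (simp add: sflow_def)
  qed
  from has_derivative_compose[OF s, of f D] assms
  have "((\<lambda>h. f (sflow a h z)) has_derivative (\<lambda>h. D (h *\<^sub>R a, 0))) (at 0)"
    by (simp add: sflow_0)
  moreover have "D (h *\<^sub>R a, 0) = D (a, 0) * h" for h
    using D.scaleR[of h "(a, 0)"] by simp
  ultimately show ?thesis by (simp add: has_field_derivative_def)
qed

lemma tflow_deriv_chain:
  assumes "(f has_derivative D) (at z)"
  shows "((\<lambda>h. f (tflow B 1 h z)) has_real_derivative D (- (B *v fst z), 1)) (at 0)"
proof -
  interpret D: bounded_linear D using assms by (rule has_derivative_bounded_linear)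
  have "((\<lambda>h. E_mat B h *v fst z) has_derivative (\<lambda>h. h *\<^sub>R (- (B *v fst z)))) (at 0)"
  proof (rule has_derivative_vecI)
    fix i
    have "((\<lambda>h. \<Sum>j\<in>UNIV. E_mat B h $ i $ j * fst z $ j) has_real_derivative
       (\<Sum>j\<in>UNIV. - (B ** E_mat B 0) $ i $ j * fst z $ j)) (at 0)"
      by (intro DERIV_sum DERIV_cmult_right E_mat_deriv)
    moreover have "(\<lambda>h. (E_mat B h *v fst z) $ i) = (\<lambda>h. \<Sum>j\<in>UNIV. E_mat B h $ i $ j * fst z $ j)"
      by (simp add: matrix_vector_mult_def)
    ultimately have "((\<lambda>h. (E_mat B h *v fst z) $ i) has_derivative (*) (\<Sum>j\<in>UNIV. - (B ** E_mat B 0) $ i $ j * fst z $ j)) (at 0)"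
      by (simp only: has_field_derivative_def)
    then show "((\<lambda>h. (E_mat B h *v fst z) $ i) has_derivative (\<lambda>h. (h *\<^sub>R (- (B *v fst z))) $ i)) (at 0)"
      by (rule has_derivative_eq_rhs) (simp add: fun_eq_iff E_mat_0 matrix_vector_mult_def sum_negf)
  qed
  then have "((\<lambda>h. tflow B 1 h z) has_derivative (\<lambda>h. (h *\<^sub>R (- (B *v fst z)), h))) (at 0)"
    unfolding tflow_def by (auto intro!: derivative_eq_intros)
  from has_derivative_compose[OF this, of f D] assms
  have "((\<lambda>h. f (tflow B 1 h z)) has_derivative (\<lambda>h. D (h *\<^sub>R (- (B *v fst z)), h))) (at 0)"
    by (simp add: tflow_0)
  moreover have "D (h *\<^sub>R (- (B *v fst z)), h) = D (- (B *v fst z), 1) * h" for h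
    using D.scaleR[of h "(- (B *v fst z), 1)"] by simp
  ultimately show ?thesis by (simp add: has_field_derivative_def)
qed

lemma hk1_linear: "hk1 A B \<sigma> p (\<Sum>j\<in>I. c j *\<^sub>R b j) z = (\<Sum>j\<in>I. c j * hk1 A B \<sigma> p (b j) z)"
  by (simp add: hk1_def inner_sum_right sum_distrib_left sum_distrib_right mult_ac)

text \<open>Transfers the flow computations to Frechet derivatives. Smoothness comes from
  \<open>rat_hk_C_k\<close>. After the pole the decomposition of \<open>A\<close> turns the
  divergence term into the sum of the \<open>hk2\<close>, and the first-order part is minus the
  drift derivative; up to the time of the pole all derivatives vanish.\<close>

theorem L_harmonic_hk:
  assumes S: "open S" "p \<notin> S"
  shows "L_harmonic_on A B (hk A B 1 p) S"
  unfolding L_harmonic_on_def smooth_on_open_def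
proof (intro conjI allI ballI S)
  let ?u = "hk A B 1 p"
  have one: "(\<lambda>z. 1) \<in> rat_alg (snd p)" by (rule rat_alg.const)
  show "C_k_on k ?u S" for k using rat_hk_C_k[OF S one] by simp
  fix z assume "z \<in> S"
  then have zp: "z \<noteq> p" using S by auto
  obtain R1 where R1: "\<And>v. R1 v \<in> rat_alg (snd p)"
    "\<And>z. z \<noteq> p \<Longrightarrow> (?u has_derivative (\<lambda>v. R1 v z * ?u z)) (at z)"
    using rat_hk_deriv[OF one] by auto
  obtain R2 where R2: "\<And>v w. z \<noteq> p \<Longrightarrow> ((\<lambda>z. R1 v z * ?u z) has_derivative (\<lambda>w. R2 v w z * ?u z)) (at z)" for z
    using rat_hk_deriv[OF R1(1)] by metis
  have G: "R1 (a, 0) y * ?u y = hk1 A B 1 p a y" if "y \<noteq> p" for a y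
  proof (cases "snd y > snd p")
    case True
    then show ?thesis
      using sflow_deriv_chain[OF R1(2)[OF that], of a] hk_sflow_deriv(1)[of 1 y p a] DERIV_unique by simp blast
  qed (simp add: hk_nonpos_time hk1_nonpos_time)
  define e :: "'n \<Rightarrow> 'n rvec" where "e j = axis j 1" for j
  define H where "H j w = R2 (e j, 0) w z * ?u z" for j w
  have oz: "open (- {p})" by auto
  have H: "(hk1 A B 1 p (e j) has_derivative H j) (at z)" for j
    unfolding H_def
    by (rule has_derivative_transform_within_open[OF R2[OF zp] oz]) (use zp G in auto)
  have "grad_x ?u y = (\<chi> j. hk1 A B 1 p (e j) y)" if "y \<noteq> p" for y
    using G[OF that] dir_deriv_eq[OF R1(2)[OF that]] by (simp add: grad_x_def e_def)
  then have A_grad: "A *v grad_x ?u y = (\<chi> i. \<Sum>j\<in>UNIV. A $ i $ j * hk1 A B 1 p (e j) y)" if "y \<noteq> p" for y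
    using that by (simp add: matrix_vector_mult_def)
  have "((\<lambda>y. \<chi> i. \<Sum>j\<in>UNIV. A $ i $ j * hk1 A B 1 p (e j) y) has_derivative (\<lambda>w. \<chi> i. \<Sum>j\<in>UNIV. A $ i $ j * H j w)) (at z)"
    by (rule has_derivative_vecI) (simp, intro has_derivative_sum has_derivative_mult_right H)
  then have "((\<lambda>y. A *v grad_x ?u y) has_derivative (\<lambda>w. \<chi> i. \<Sum>j\<in>UNIV. A $ i $ j * H j w)) (at z)"
    by (rule has_derivative_transform_within_open[OF _ oz]) (use zp A_grad in auto)
  from dir_deriv_eq[OF this]
  have "div_x (\<lambda>y. A *v grad_x ?u y) z = (\<Sum>i\<in>UNIV. \<Sum>j\<in>UNIV. A $ i $ j * H j (e i, 0))"
    by (simp add: div_x_def e_def)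
  also have "\<dots> = (\<Sum>k\<in>UNIV. hk2 A B 1 p (avec A k) z)"
  proof -
    have HL: "(\<Sum>i\<in>UNIV. a $ i * H j (e i, 0)) = H j (a, 0)" for a :: "'n rvec" and j
    proof -
      interpret Hj: bounded_linear "H j" using H by (rule has_derivative_bounded_linear)
      have "(a, 0) = (\<Sum>i\<in>UNIV. a $ i *\<^sub>R (e i, 0 :: real))"
      proof (rule prod_eqI)
        show "fst (a, 0) = fst (\<Sum>i\<in>UNIV. a $ i *\<^sub>R (e i, 0 :: real))"
          by (simp add: fst_sum vec_eq_iff e_def axis_def if_distrib cong: if_cong)
        show "snd (a, 0) = snd (\<Sum>i\<in>UNIV. a $ i *\<^sub>R (e i, 0 :: real))"
          by (simp add: snd_sum)
      qed
      then have "H j (a, 0) = H j (\<Sum>i\<in>UNIV. a $ i *\<^sub>R (e i, 0 :: real))" by (rule arg_cong)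
      also have "\<dots> = (\<Sum>i\<in>UNIV. a $ i * H j (e i, 0))"
        by (simp only: Hj.sum Hj.scaleR real_scaleR_def)
      finally show ?thesis by (rule sym)
    qed
    have hk2: "(\<Sum>j\<in>UNIV. a $ j * H j (a, 0)) = hk2 A B 1 p a z" for a :: "'n rvec"
    proof -
      have a: "a = (\<Sum>j\<in>UNIV. a $ j *\<^sub>R e j)"
        by (simp add: vec_eq_iff e_def axis_def if_distrib cong: if_cong)
      have "(\<lambda>y. hk1 A B 1 p a y) = (\<lambda>y. \<Sum>j\<in>UNIV. a $ j * hk1 A B 1 p (e j) y)"
        by (subst a, rule ext, rule hk1_linear)
      then have d: "(hk1 A B 1 p a has_derivative (\<lambda>w. \<Sum>j\<in>UNIV. a $ j * H j w)) (at z)"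
        by (simp only:) (intro has_derivative_sum has_derivative_mult_right H)
      show ?thesis
      proof (cases "snd z > snd p")
        case True
        then show ?thesis
          using sflow_deriv_chain[OF d, of a] hk_sflow_deriv(2)[of 1 z p a] DERIV_unique by simp blast
      next
        case False
        then show ?thesis by (simp add: H_def hk_nonpos_time hk2_nonpos_time)
      qed
    qed
    \<comment> \<open>The reordering brings the sum over the decomposition outside, where each
      vector occupies both slots of the second derivative.\<close>
    have "(\<Sum>i\<in>UNIV. \<Sum>j\<in>UNIV. A $ i $ j * H j (e i, 0))
       = (\<Sum>i\<in>UNIV. \<Sum>j\<in>UNIV. \<Sum>k\<in>UNIV. avec A k $ j * (avec A k $ i * H j (e i, 0)))"
      by (subst avec) (simp add: sum_distrib_left sum_distrib_right mult_ac)
    also have "\<dots> = (\<Sum>i\<in>UNIV. \<Sum>k\<in>UNIV. \<Sum>j\<in>UNIV. avec A k $ j * (avec A k $ i * H j (e i, 0)))"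
      by (intro sum.cong refl sum.swap)
    also have "\<dots> = (\<Sum>k\<in>UNIV. \<Sum>i\<in>UNIV. \<Sum>j\<in>UNIV. avec A k $ j * (avec A k $ i * H j (e i, 0)))"
      by (rule sum.swap)
    also have "\<dots> = (\<Sum>k\<in>UNIV. \<Sum>j\<in>UNIV. \<Sum>i\<in>UNIV. avec A k $ j * (avec A k $ i * H j (e i, 0)))"
      by (intro sum.cong refl sum.swap)
    also have "\<dots> = (\<Sum>k\<in>UNIV. hk2 A B 1 p (avec A k) z)"
      by (simp only: sum_distrib_left[symmetric] HL hk2)
    finally show ?thesis .
  qed
  finally have div: "div_x (\<lambda>y. A *v grad_x ?u y) z = hkT A B 1 p z" by (simp add: hkT_def)
  let ?D = "\<lambda>v. R1 v z * ?u z"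
  interpret D: bounded_linear ?D using R1(2)[OF zp] by (rule has_derivative_bounded_linear)
  have "(B *v fst z) \<bullet> grad_x ?u z - dir_deriv (0, 1) ?u z = - ?D (- (B *v fst z), 1)"
  proof -
    have "(B *v fst z) \<bullet> grad_x ?u z = (\<Sum>i\<in>UNIV. (B *v fst z) $ i * ?D (e i, 0))"
      using dir_deriv_eq[OF R1(2)[OF zp]] by (simp add: inner_vec_def grad_x_def e_def)
    also have "\<dots> = ?D (\<Sum>i\<in>UNIV. (B *v fst z) $ i *\<^sub>R (e i, 0))"
      by (simp only: D.sum D.scaleR real_scaleR_def)
    also have "(\<Sum>i\<in>UNIV. (B *v fst z) $ i *\<^sub>R (e i, 0 :: real)) = (B *v fst z, 0)"
    proof (rule prod_eqI)
      show "fst (\<Sum>i\<in>UNIV. (B *v fst z) $ i *\<^sub>R (e i, 0 :: real)) = fst (B *v fst z, 0)"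
        by (simp add: fst_sum vec_eq_iff e_def axis_def if_distrib cong: if_cong)
      show "snd (\<Sum>i\<in>UNIV. (B *v fst z) $ i *\<^sub>R (e i, 0 :: real)) = snd (B *v fst z, 0)"
        by (simp add: snd_sum)
    qed
    finally have "(B *v fst z) \<bullet> grad_x ?u z = ?D (B *v fst z, 0)" .
    moreover have "dir_deriv (0, 1) ?u z = ?D (0, 1)" by (rule dir_deriv_eq[OF R1(2)[OF zp]])
    moreover have "?D (B *v fst z, 0) - ?D (0, 1) = ?D ((B *v fst z, 0) - (0, 1))" by (rule D.diff[symmetric])
    moreover have "?D ((B *v fst z, 0) - (0, 1)) = - ?D (- (B *v fst z), 1)"
      by (subst D.neg[symmetric]) simp
    ultimately show ?thesis by simp
  qed
  moreover have "?D (- (B *v fst z), 1) = hkT A B 1 p z"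
  proof (cases "snd z > snd p")
    case True
    then show ?thesis
      using tflow_deriv_chain[OF R1(2)[OF zp]] hk_tflow_deriv[of 1 z p] DERIV_unique by simp blast
  qed (simp add: hk_nonpos_time hkT_nonpos_time)
  ultimately show "L_op A B ?u z = 0"
    using div by (simp add: L_op_def)
qed

end

section \<open>Green's identity\<close>

text \<open>A continuous one-parameter group that preserves Lebesgue measure: exactly what
  \<open>integral_flow_derivative\<close> asks of a flow. Spatial translations and the drift flow
  are the instances.\<close>

definition good_flow :: "(real \<Rightarrow> 'a::euclidean_space \<Rightarrow> 'a) \<Rightarrow> bool"
  where "good_flow \<Theta> \<longleftrightarrow> (\<forall>h. distr lborel borel (\<Theta> h) = lborel) \<and>
    continuous_on UNIV (\<lambda>p. \<Theta> (fst p) (snd p)) \<and> (\<forall>z. \<Theta> 0 z = z) \<and> (\<forall>g h z. \<Theta> (g + h) z = \<Theta> h (\<Theta> g z))"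

definition along :: "(real \<Rightarrow> 'a \<Rightarrow> 'a) \<Rightarrow> ('a \<Rightarrow> real) \<Rightarrow> ('a \<Rightarrow> real) \<Rightarrow> bool"
  where "along \<Theta> F F' \<longleftrightarrow> (\<forall>z. ((\<lambda>h. F (\<Theta> h z)) has_real_derivative F' z) (at 0))"

lemma along_mult:
  assumes "good_flow \<Theta>" "along \<Theta> F F'" "along \<Theta> G G'"
  shows "along \<Theta> (\<lambda>z. F z * G z) (\<lambda>z. F z * G' z + F' z * G z)"
  unfolding along_def
proof
  fix z
  have 0: "\<Theta> 0 z = z" using assms(1) by (simp add: good_flow_def)
  show "((\<lambda>h. F (\<Theta> h z) * G (\<Theta> h z)) has_real_derivative F z * G' z + F' z * G z) (at 0)"
    using DERIV_mult'[of "\<lambda>h. F (\<Theta> h z)" "F' z" 0 UNIV "\<lambda>h. G (\<Theta> h z)" "G' z"] assms(2,3) 0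
    by (simp add: along_def)
qed

lemma along_diff: "along \<Theta> F F' \<Longrightarrow> along \<Theta> G G' \<Longrightarrow> along \<Theta> (\<lambda>z. F z - G z) (\<lambda>z. F' z - G' z)"
  by (simp add: along_def DERIV_diff)

lemma integrable_bounded_support:
  fixes f :: "'a::euclidean_space \<Rightarrow> real"
  assumes "continuous_on UNIV f" "bounded K" "\<And>z. z \<notin> K \<Longrightarrow> f z = 0"
  shows "integrable lborel f"
proof -
  have "integrable lborel (\<lambda>z. indicator (closure K) z *\<^sub>R f z)"
    using assms by (intro borel_integrable_compact) (auto intro: continuous_on_subset)
  moreover have "(\<lambda>z. indicator (closure K) z *\<^sub>R f z) = f"
    using assms(3) closure_subset[of K] by (auto simp: indicator_def fun_eq_iff)
  ultimately show ?thesis by simp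
qed

lemma integral_along_zero:
  assumes "good_flow \<Theta>" "along \<Theta> F F'" "continuous_on UNIV F" "continuous_on UNIV F'"
    and "bounded K" "\<And>z. z \<notin> K \<Longrightarrow> F z = 0 \<and> F' z = 0"
  shows "integrable lborel F'" "(\<integral>z. F' z \<partial>lborel) = 0"
proof -
  show i: "integrable lborel F'" using assms by (intro integrable_bounded_support[of F' K]) auto
  have "integrable lborel F" using assms by (intro integrable_bounded_support[of F K]) auto
  then show "(\<integral>z. F' z \<partial>lborel) = 0"
    using assms i by (intro integral_flow_derivative[of \<Theta> F F']) (auto simp: good_flow_def along_def)
qed

text \<open>Green's identity. The sign of \<open>c\<close> selects whether the operator or its adjoint acts on \<open>\<phi>\<close>.\<close>

lemma green_identity:
  fixes G \<phi> :: "'a::euclidean_space \<Rightarrow> real" and S :: "'k::finite \<Rightarrow> real \<Rightarrow> 'a \<Rightarrow> 'a"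
  assumes S: "\<And>k. good_flow (S k)" and T: "good_flow T"
    and G: "\<And>k. along (S k) G (G1 k)" "\<And>k. along (S k) (G1 k) (G2 k)" "along T G Gt"
    and \<phi>: "\<And>k. along (S k) \<phi> (\<phi>1 k)" "\<And>k. along (S k) (\<phi>1 k) (\<phi>2 k)" "along T \<phi> \<phi>t"
    and cG: "continuous_on UNIV G" "\<And>k. continuous_on UNIV (G1 k)" "\<And>k. continuous_on UNIV (G2 k)" "continuous_on UNIV Gt"
    and c\<phi>: "continuous_on UNIV \<phi>" "\<And>k. continuous_on UNIV (\<phi>1 k)" "\<And>k. continuous_on UNIV (\<phi>2 k)" "continuous_on UNIV \<phi>t"
    and K: "bounded K" "\<And>z. z \<notin> K \<Longrightarrow> \<phi> z = 0" "\<And>z k. z \<notin> K \<Longrightarrow> \<phi>1 k z = 0"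
      "\<And>z k. z \<notin> K \<Longrightarrow> \<phi>2 k z = 0" "\<And>z. z \<notin> K \<Longrightarrow> \<phi>t z = 0"
  shows "(\<integral>z. G z * ((\<Sum>k\<in>UNIV. \<phi>2 k z) + c * \<phi>t z) \<partial>lborel) = (\<integral>z. \<phi> z * ((\<Sum>k\<in>UNIV. G2 k z) - c * Gt z) \<partial>lborel)"
proof -
  \<comment> \<open>\<open>?D k\<close> is the derivative of G \<phi>1 - \<phi> G1 along the k-th
    flow, and \<open>?E\<close> is the derivative of G \<phi> along T; both have integral 0.\<close>
  let ?D = "\<lambda>k z. (G z * \<phi>2 k z + G1 k z * \<phi>1 k z) - (\<phi> z * G2 k z + \<phi>1 k z * G1 k z)"
  let ?E = "\<lambda>z. G z * \<phi>t z + Gt z * \<phi> z"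
  have D: "integrable lborel (?D k)" "(\<integral>z. ?D k z \<partial>lborel) = 0" for k
  proof -
    have c: "continuous_on UNIV (\<lambda>z. G z * \<phi>1 k z - \<phi> z * G1 k z)" "continuous_on UNIV (?D k)"
      by (intro continuous_intros cG c\<phi>)+
    note I = integral_along_zero[OF S along_diff[OF along_mult[OF S G(1) \<phi>(2)] along_mult[OF S \<phi>(1) G(2)]] c K(1)]
    show "integrable lborel (?D k)" "(\<integral>z. ?D k z \<partial>lborel) = 0" by (rule I; simp add: K)+
  qed
  have E: "integrable lborel ?E" "(\<integral>z. ?E z \<partial>lborel) = 0"
  proof -
    have c: "continuous_on UNIV (\<lambda>z. G z * \<phi> z)" "continuous_on UNIV ?E"
      by (intro continuous_intros cG c\<phi>)+
    note I = integral_along_zero[OF T along_mult[OF T G(3) \<phi>(3)] c K(1)]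
    show "integrable lborel ?E" "(\<integral>z. ?E z \<partial>lborel) = 0" by (rule I; simp add: K)+
  qed
  have 1: "integrable lborel (\<lambda>z. G z * ((\<Sum>k\<in>UNIV. \<phi>2 k z) + c * \<phi>t z))"
    by (rule integrable_bounded_support[OF _ K(1)]) (auto intro!: continuous_intros cG c\<phi> simp: K)
  have 2: "integrable lborel (\<lambda>z. \<phi> z * ((\<Sum>k\<in>UNIV. G2 k z) - c * Gt z))"
    by (rule integrable_bounded_support[OF _ K(1)]) (auto intro!: continuous_intros cG c\<phi> simp: K)
  have eq: "G z * ((\<Sum>k\<in>UNIV. \<phi>2 k z) + c * \<phi>t z) - \<phi> z * ((\<Sum>k\<in>UNIV. G2 k z) - c * Gt z)
      = (\<Sum>k\<in>UNIV. ?D k z) + c * ?E z" for z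
    by (simp add: sum_subtractf sum_distrib_left algebra_simps)
  have "(\<integral>z. G z * ((\<Sum>k\<in>UNIV. \<phi>2 k z) + c * \<phi>t z) \<partial>lborel) - (\<integral>z. \<phi> z * ((\<Sum>k\<in>UNIV. G2 k z) - c * Gt z) \<partial>lborel)
      = (\<integral>z. (\<Sum>k\<in>UNIV. ?D k z) + c * ?E z \<partial>lborel)"
    unfolding eq[symmetric] using 1 2 by simp
  also have "\<dots> = (\<Sum>k\<in>UNIV. \<integral>z. ?D k z \<partial>lborel) + c * (\<integral>z. ?E z \<partial>lborel)"
    using D(1) E(1) by (subst Bochner_Integration.integral_add) (auto intro!: Bochner_Integration.integral_sum)
  also have "\<dots> = 0" unfolding D E by simp
  finally show ?thesis by simp
qed

lemma sflow_good: "good_flow (sflow a)"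
  unfolding good_flow_def using sflow_preserves sflow_continuous sflow_0 sflow_add by blast

text \<open>The drift flow of the adjoint operator is the original one run backwards.\<close>

lemma tflow_dual: "tflow (- B) (- 1) h z = tflow B 1 (- h) z"
  by (simp add: tflow_def E_mat_def)

lemma continuous_on_UNIV_zero:
  fixes f :: "'a::topological_space \<Rightarrow> real"
  assumes "open U" "open V" "U \<union> V = UNIV" "continuous_on U f" "\<And>z. z \<in> V \<Longrightarrow> f z = 0"
  shows "continuous_on UNIV f"
proof -
  have "continuous_on V f" using assms(5) by (simp cong: continuous_on_cong)
  then have "continuous_on (U \<union> V) f" using assms by (intro continuous_on_open_Un)
  then show ?thesis using assms by simp
qed

lemma continuous_time_cut:
  fixes c :: "real \<Rightarrow> real" and f :: "'n::finite spacetime \<Rightarrow> real"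
  assumes "continuous_on UNIV c" "\<And>v. v \<le> 1 \<Longrightarrow> c v = 0" "\<epsilon> > 0"
    and f: "continuous_on {z. hs \<sigma> p z > 0} f"
  shows "continuous_on UNIV (\<lambda>z. c (hs \<sigma> p z / \<epsilon>) * f z)"
proof (rule continuous_on_UNIV_zero[of "{z. hs \<sigma> p z > 0}" "{z. hs \<sigma> p z < \<epsilon>}"])
  show "open {z. hs \<sigma> p z > 0}" "open {z. hs \<sigma> p z < \<epsilon>}" by (intro open_Collect_less continuous_intros)+
  show "{z. hs \<sigma> p z > 0} \<union> {z. hs \<sigma> p z < \<epsilon>} = UNIV" using assms(3) by auto
  have "continuous_on {z. hs \<sigma> p z > 0} (\<lambda>z. c (hs \<sigma> p z / \<epsilon>))"
  proof -
    have nz: "\<epsilon> \<noteq> 0" using assms(3) by simp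
    have "continuous_on {z. hs \<sigma> p z > 0} (\<lambda>z. hs \<sigma> p z / \<epsilon>)"
      by (intro continuous_intros) (simp add: nz)
    from continuous_on_compose2[OF assms(1) this] show ?thesis by simp
  qed
  then show "continuous_on {z. hs \<sigma> p z > 0} (\<lambda>z. c (hs \<sigma> p z / \<epsilon>) * f z)" using f by (intro continuous_intros)
  show "c (hs \<sigma> p z / \<epsilon>) * f z = 0" if "z \<in> {z. hs \<sigma> p z < \<epsilon>}" for z
    using assms(2)[of "hs \<sigma> p z / \<epsilon>"] that assms(3) by (simp add: field_simps)
qed

text \<open>Where the elapsed time is not positive the cutoff vanishes in a whole neighbourhood, so
  the singular factor F is differentiated only after the pole.\<close>

lemma DERIV_cut_mult:
  fixes s F :: "real \<Rightarrow> real"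
  assumes s: "\<And>h. s h = s 0 + \<mu> * h" and \<epsilon>: "\<epsilon> > 0" and F: "s 0 > 0 \<Longrightarrow> (F has_real_derivative F') (at 0)"
  shows "((\<lambda>h. cutoff (s h / \<epsilon>) * F h) has_real_derivative cutoff (s 0 / \<epsilon>) * F' + (\<mu> / \<epsilon> * cutoff' (s 0 / \<epsilon>)) * F 0) (at 0)"
proof (cases "s 0 > 0")
  case True
  have "((\<lambda>h. s h / \<epsilon>) has_real_derivative \<mu> / \<epsilon>) (at 0)"
    by (subst s[abs_def]) (use \<epsilon> in \<open>auto intro!: derivative_eq_intros\<close>)
  from DERIV_chain2[OF cutoff_deriv this]
  have "((\<lambda>h. cutoff (s h / \<epsilon>)) has_real_derivative cutoff' (s 0 / \<epsilon>) * (\<mu> / \<epsilon>)) (at 0)" .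
  from DERIV_mult'[OF this F[OF True]] show ?thesis by (simp add: mult_ac)
next
  case False
  have c: "continuous_on UNIV s" by (subst s[abs_def]) (intro continuous_intros)
  have o: "open {h. s h < \<epsilon>}" by (intro open_Collect_less continuous_intros c)
  have "cutoff (s h / \<epsilon>) = 0" if "h \<in> {h. s h < \<epsilon>}" for h
    using that \<epsilon> by (intro cutoff_eq_0) (simp add: field_simps)
  then have "((\<lambda>h. cutoff (s h / \<epsilon>) * F h) has_real_derivative 0) (at 0)"
    using False \<epsilon> by (intro has_field_derivative_transform_within_open[OF DERIV_const[of 0] o]) auto
  moreover have "cutoff (s 0 / \<epsilon>) = 0" "cutoff' (s 0 / \<epsilon>) = 0"
    using False \<epsilon> by (auto intro!: cutoff_eq_0 cutoff'_eq_0 simp: field_simps)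
  ultimately show ?thesis by simp
qed

context kolm begin

lemma tflow_good: "good_flow (tflow B \<sigma>)"
  unfolding good_flow_def using tflow_preserves tflow_continuous tflow_0 tflow_add by blast

lemma hk_swap: "hk A (- B) (- 1) z \<zeta> = hk A B 1 \<zeta> z"
  using fund_sol_forward fund_sol_backward by metis

lemma hk_deriv_good:
  assumes "\<bar>\<sigma>\<bar> = (1 :: real)"
  shows "\<sigma> * \<sigma> = 1"
  using abs_mult_self_eq[of \<sigma>] assms by simp

lemma along_cut_hk:
  assumes \<sigma>: "\<bar>\<sigma>\<bar> = 1" and \<epsilon>: "\<epsilon> > 0"
  shows "along (sflow a) (\<lambda>z. cutoff (hs \<sigma> p z / \<epsilon>) * hk A B \<sigma> p z) (\<lambda>z. cutoff (hs \<sigma> p z / \<epsilon>) * hk1 A B \<sigma> p a z)"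
    and "along (sflow a) (\<lambda>z. cutoff (hs \<sigma> p z / \<epsilon>) * hk1 A B \<sigma> p a z) (\<lambda>z. cutoff (hs \<sigma> p z / \<epsilon>) * hk2 A B \<sigma> p a z)"
    and "along (tflow B \<sigma>) (\<lambda>z. cutoff (hs \<sigma> p z / \<epsilon>) * hk A B \<sigma> p z)
      (\<lambda>z. cutoff (hs \<sigma> p z / \<epsilon>) * hkT A B \<sigma> p z + (1 / \<epsilon> * cutoff' (hs \<sigma> p z / \<epsilon>)) * hk A B \<sigma> p z)"
  unfolding along_def
proof (safe)
  fix z
  note \<sigma>2 = hk_deriv_good[OF \<sigma>]
  show "((\<lambda>h. cutoff (hs \<sigma> p (sflow a h z) / \<epsilon>) * hk A B \<sigma> p (sflow a h z)) has_real_derivative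
      cutoff (hs \<sigma> p z / \<epsilon>) * hk1 A B \<sigma> p a z) (at 0)"
    using DERIV_cut_mult[of "\<lambda>h. hs \<sigma> p (sflow a h z)" 0 \<epsilon> "\<lambda>h. hk A B \<sigma> p (sflow a h z)" "hk1 A B \<sigma> p a z"]
      hk_sflow_deriv(1)[of \<sigma> z p a] \<epsilon> by (simp add: hs_sflow)
  show "((\<lambda>h. cutoff (hs \<sigma> p (sflow a h z) / \<epsilon>) * hk1 A B \<sigma> p a (sflow a h z)) has_real_derivative
      cutoff (hs \<sigma> p z / \<epsilon>) * hk2 A B \<sigma> p a z) (at 0)"
    using DERIV_cut_mult[of "\<lambda>h. hs \<sigma> p (sflow a h z)" 0 \<epsilon> "\<lambda>h. hk1 A B \<sigma> p a (sflow a h z)" "hk2 A B \<sigma> p a z"]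
      hk_sflow_deriv(2)[of \<sigma> z p a] \<epsilon> by (simp add: hs_sflow)
  show "((\<lambda>h. cutoff (hs \<sigma> p (tflow B \<sigma> h z) / \<epsilon>) * hk A B \<sigma> p (tflow B \<sigma> h z)) has_real_derivative
      cutoff (hs \<sigma> p z / \<epsilon>) * hkT A B \<sigma> p z + (1 / \<epsilon> * cutoff' (hs \<sigma> p z / \<epsilon>)) * hk A B \<sigma> p z) (at 0)"
    using DERIV_cut_mult[of "\<lambda>h. hs \<sigma> p (tflow B \<sigma> h z)" 1 \<epsilon> "\<lambda>h. hk A B \<sigma> p (tflow B \<sigma> h z)" "hkT A B \<sigma> p z"]
      hk_tflow_deriv[OF \<sigma>2, of z p] \<epsilon> unfolding hX_tflow(2)[OF \<sigma>2] tflow_0 by simp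
qed

lemma continuous_cut_hk:
  assumes c: "c = cutoff \<or> c = cutoff'" and \<epsilon>: "\<epsilon> > 0"
  shows "continuous_on UNIV (\<lambda>z. c (hs \<sigma> p z / \<epsilon>) * hk A B \<sigma> p z)"
    and "continuous_on UNIV (\<lambda>z. c (hs \<sigma> p z / \<epsilon>) * hk1 A B \<sigma> p a z)"
    and "continuous_on UNIV (\<lambda>z. c (hs \<sigma> p z / \<epsilon>) * hk2 A B \<sigma> p a z)"
    and "continuous_on UNIV (\<lambda>z. c (hs \<sigma> p z / \<epsilon>) * hkT A B \<sigma> p z)"
proof -
  have cc: "continuous_on UNIV c" "\<And>v. v \<le> 1 \<Longrightarrow> c v = 0"
    using c cutoff_eq_0 cutoff'_eq_0 by (auto intro!: continuous_intros simp: continuous_on_id)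
  note H = continuous_hk[OF continuous_on_const continuous_on_id, of "{z. hs \<sigma> p z > 0}" \<sigma> p]
  show "continuous_on UNIV (\<lambda>z. c (hs \<sigma> p z / \<epsilon>) * hk A B \<sigma> p z)"
    by (rule continuous_time_cut[OF cc \<epsilon> H(1)]) auto
  show "continuous_on UNIV (\<lambda>z. c (hs \<sigma> p z / \<epsilon>) * hk1 A B \<sigma> p a z)"
    by (rule continuous_time_cut[OF cc \<epsilon> H(2)]) auto
  show "continuous_on UNIV (\<lambda>z. c (hs \<sigma> p z / \<epsilon>) * hk2 A B \<sigma> p a z)"
    by (rule continuous_time_cut[OF cc \<epsilon> H(3)]) auto
  show "continuous_on UNIV (\<lambda>z. c (hs \<sigma> p z / \<epsilon>) * hkT A B \<sigma> p z)"
    by (rule continuous_time_cut[OF cc \<epsilon> H(4)]) auto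
qed

text \<open>The height bounds the elapsed time. The logarithm of the kernel then bounds c |X|^2 by 4
  (s ln(const/\<rho>) - (hdim/2) s ln s), which stays bounded as s tends to 0; the drift curve of
  the pole is bounded on the remaining time interval.\<close>

lemma bounded_superlevel:
  assumes \<sigma>: "\<bar>\<sigma>\<bar> = 1" and \<rho>: "\<rho> > 0"
  shows "bounded {z. hk A B \<sigma> p z > \<rho>}"
proof -
  \<comment> \<open>The time at which the height of the kernel has dropped to \<rho>.\<close>
  define S where "S = (gamma_const / \<rho>) powr (2 / hdim)"
  have S0: "S > 0" using gamma_const_pos \<rho> by (simp add: S_def)
  have h0: "real hdim > 0" using hdim_pos by simp
  obtain c where c: "c > 0" "\<And>s x. 0 < s \<Longrightarrow> s \<le> S \<Longrightarrow> (Pm A B s *v x) \<bullet> x \<ge> c * (norm x)\<^sup>2 / s"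
    using q_lower_bound[OF S0] by auto
  \<comment> \<open>The resulting bound for the squared displacement; the term hdim/2 uses that -s
    ln s is at most 1.\<close>
  define R where "R = 4 / c * (S * \<bar>ln (gamma_const / \<rho>)\<bar> + hdim / 2)"
  have cE: "continuous_on {0..S} (\<lambda>s. E_mat B s *v fst p)" by (intro continuous_intros)
  have "bounded ((\<lambda>s. E_mat B s *v fst p) ` {0..S})"
    by (intro compact_imp_bounded compact_continuous_image cE) simp
  then obtain N where N: "\<And>s. s \<in> {0..S} \<Longrightarrow> norm (E_mat B s *v fst p) \<le> N"
    unfolding bounded_iff by (metis imageI)
  have main: "norm (fst z) \<le> sqrt R + N \<and> \<bar>snd z - snd p\<bar> \<le> S" if hz: "hk A B \<sigma> p z > \<rho>" for z
  proof -
    let ?s = "hs \<sigma> p z" and ?X = "hX B \<sigma> p z"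
    have s: "?s > 0" using hz \<rho> hk_nonpos_time[of \<sigma> z p A B] by fastforce
    have "\<rho> < gamma_const * ?s powr (- (hdim / 2))"
      using hk_le_peak[OF s] hz by (simp add: peak_def)
    moreover have pw: "t powr (- a) * t powr a = 1 \<and> t powr a > 0" if "t > 0" for t a :: real
      using that by (simp flip: powr_add)
    moreover note pw[OF s, of "hdim / 2"]
    ultimately have "\<rho> * ?s powr (hdim / 2) < gamma_const"
      using mult_strict_right_mono[of \<rho> "gamma_const * ?s powr (- (hdim / 2))" "?s powr (hdim / 2)"]
      by (simp only: mult.assoc mult_1_right)
    then have "?s powr (hdim / 2) < gamma_const / \<rho>"
      using \<rho> by (simp add: pos_less_divide_eq mult.commute)
    then have "(?s powr (hdim / 2)) powr (2 / hdim) \<le> S"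
      unfolding S_def using h0 by (intro powr_mono2) auto
    then have sS: "?s \<le> S" using s h0 by (simp add: powr_powr)
    have "ln \<rho> < ln (hk A B \<sigma> p z)" using hz \<rho> by simp
    also have "ln (hk A B \<sigma> p z) = ln gamma_const - hdim / 2 * ln ?s - (1/4) * ((Pm A B ?s *v ?X) \<bullet> ?X)"
    proof -
      have "ln (gamma_const * t powr (- (hdim / 2)) * exp (- (1/4) * q)) = ln gamma_const - hdim / 2 * ln t - (1/4) * q"
        if "t > 0" for t q :: real using that gamma_const_pos by (simp add: ln_mult ln_powr)
      then show ?thesis unfolding hk_eq[OF s] peak_def using s by blast
    qed
    finally have lt: "(Pm A B ?s *v ?X) \<bullet> ?X < 4 * (ln gamma_const - ln \<rho> - hdim / 2 * ln ?s)" by simp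
    have arith: "x \<le> 4 * (a' + b')" if "x < 4 * (a + b)" "a \<le> a'" "b \<le> b' * 1" for x a b a' b' :: real
      using that by simp
    have "c * (norm ?X)\<^sup>2 / ?s < 4 * (ln (gamma_const / \<rho>) - hdim / 2 * ln ?s)"
      using lt c(2)[OF s sS, of ?X] gamma_const_pos \<rho> by (simp add: ln_div)
    then have "c * (norm ?X)\<^sup>2 < 4 * (?s * ln (gamma_const / \<rho>) + hdim / 2 * (?s * - ln ?s))"
      unfolding pos_divide_less_eq[OF s] by (simp only: algebra_simps)
    moreover have "?s * ln (gamma_const / \<rho>) \<le> S * \<bar>ln (gamma_const / \<rho>)\<bar>"
    proof -
      have "?s * ln (gamma_const / \<rho>) \<le> ?s * \<bar>ln (gamma_const / \<rho>)\<bar>" using s by (intro mult_left_mono) auto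
      also have "\<dots> \<le> S * \<bar>ln (gamma_const / \<rho>)\<bar>" using sS by (intro mult_right_mono) auto
      finally show ?thesis .
    qed
    moreover have "?s * - ln ?s \<le> 1"
    proof -
      have "t * - ln t \<le> 1" if "t > 0" for t :: real
      proof -
        have "- ln t \<le> 1 / t" using ln_le_minus_one[of "1 / t"] that by (simp add: ln_div)
        then have "t * - ln t \<le> t * (1 / t)" using that by (intro mult_left_mono) auto
        then show ?thesis using that by simp
      qed
      then show ?thesis using s by blast
    qed
    then have "hdim / 2 * (?s * - ln ?s) \<le> hdim / 2 * 1" using h0 by (intro mult_left_mono) auto
    ultimately have "c * (norm ?X)\<^sup>2 \<le> 4 * (S * \<bar>ln (gamma_const / \<rho>)\<bar> + hdim / 2)" by (rule arith)
    then have "(norm ?X)\<^sup>2 \<le> R" using c by (simp add: R_def field_simps)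
    then have "norm ?X \<le> sqrt R" by (simp add: real_le_rsqrt)
    moreover have "fst z = ?X + E_mat B ?s *v fst p" by (simp add: hX_def)
    ultimately have "norm (fst z) \<le> sqrt R + N"
      using norm_triangle_ineq[of ?X "E_mat B ?s *v fst p"] N[of ?s] s sS by simp
    moreover have "\<bar>snd z - snd p\<bar> = ?s" using s \<sigma> by (metis abs_mult abs_of_pos mult_1)
    ultimately show ?thesis using sS by simp
  qed
  have "{z. hk A B \<sigma> p z > \<rho>} \<subseteq> cball 0 (sqrt R + N) \<times> cball (snd p) S"
    using main by (auto simp: dist_real_def abs_minus_commute mem_Times_iff)
  then show ?thesis by (rule bounded_subset[OF bounded_Times[OF bounded_cball bounded_cball]])
qed

lemma hpt_tendsto:
  assumes "\<epsilon> \<longlonglongrightarrow> 0"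
  shows "(\<lambda>n. hpt \<sigma> p (\<epsilon> n) w) \<longlonglongrightarrow> p"
proof -
  have "continuous_on UNIV (\<lambda>e. hpt \<sigma> p e w)" by (intro continuous_intros)
  then have "isCont (\<lambda>e. hpt \<sigma> p e w) 0" by (simp add: continuous_on_eq_continuous_at)
  from isCont_tendsto_compose[OF this assms] have "(\<lambda>n. hpt \<sigma> p (\<epsilon> n) w) \<longlonglongrightarrow> hpt \<sigma> p 0 w" .
  moreover have "dil l 0 = 0"
    by (simp add: dil_def diag_mat_def vec_eq_iff)
  ultimately show ?thesis by (simp add: hpt_def E_mat_0)
qed

lemma hk_hpt:
  assumes "\<bar>\<sigma>\<bar> = 1" "\<epsilon> * snd w > 0"
  shows "hk A B \<sigma> p (hpt \<sigma> p \<epsilon> w) = fund_gamma A B (fst w, 1) / sqrt (\<epsilon> * snd w) ^ hdim"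
proof -
  have s: "hs \<sigma> p (hpt \<sigma> p \<epsilon> w) = \<epsilon> * snd w" by (rule hs_hpt[OF assms(1)])
  have "hX B \<sigma> p (hpt \<sigma> p \<epsilon> w) = dil l (\<epsilon> * snd w) *v fst w"
    unfolding hX_def s by (simp add: hpt_def)
  moreover have "sqrt (\<epsilon> * snd w) ^ hdim \<noteq> 0" using assms(2) by (intro power_not_zero) auto
  moreover have "\<bar>det (dil l (\<epsilon> * snd w))\<bar> = sqrt (\<epsilon> * snd w) ^ hdim"
    using assms(2) by (simp add: det_dil)
  ultimately show ?thesis
    unfolding hk_fund_gamma s using gamma_dil[OF assms(2), of "fst w"]
    by (simp only: eq_divide_eq mult.commute) simp
qed

end

section \<open>Potentials of the balls\<close>

lemma DERIV_max_one:
  fixes F :: "real \<Rightarrow> real"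
  assumes F: "\<And>x. x > 0 \<Longrightarrow> (F has_real_derivative F' x) (at x)" and 1: "F' 1 = 0"
  shows "((\<lambda>x. F (max 1 x)) has_real_derivative F' (max 1 x)) (at x)"
proof -
  consider "x > 1" | "x < 1" | "x = 1" by linarith
  then show ?thesis
  proof cases
    case 1
    show ?thesis
      by (rule has_field_derivative_transform_within_open[of F _ _ "{1<..}"]) (use 1 F[of x] in auto)
  next
    case 2
    have "((\<lambda>x. F (max 1 x)) has_real_derivative 0) (at x)"
      by (rule has_field_derivative_transform_within_open[of "\<lambda>_. F 1" _ _ "{..<1}"]) (use 2 in auto)
    then show ?thesis using 2 assms(2) by (simp add: max_def)
  next
    case 3
    have "((\<lambda>h. (F (1 + h) - F 1) / h) \<longlongrightarrow> 0) (at 0)"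
      using F[of 1] assms(2) by (simp add: DERIV_def)
    then have lim: "((\<lambda>h. \<bar>(F (1 + h) - F 1) / h\<bar>) \<longlongrightarrow> 0) (at 0)"
      by (rule tendsto_rabs_zero)
    have "((\<lambda>h. (F (max 1 (1 + h)) - F 1) / h) \<longlongrightarrow> 0) (at 0)"
      by (rule Lim_null_comparison[OF always_eventually lim]) (auto simp: max_def intro!: divide_nonneg_neg)
    then show ?thesis using 3 assms(2) by (simp add: DERIV_def)
  qed
qed

lemma cutoff_scaled_limit:
  assumes "s > 0" "c > 0"
  shows "(\<lambda>n. cutoff (s / (c / (real n + 1)))) \<longlonglongrightarrow> 1"
proof -
  have "\<forall>\<^sub>F n in sequentially. real n \<ge> 2 * c / s" by real_asymp
  then have "\<forall>\<^sub>F n in sequentially. cutoff (s / (c / (real n + 1))) = 1"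
  proof eventually_elim
    case (elim n)
    have "2 * c \<le> s * real n" using elim assms by (simp add: pos_divide_le_eq mult.commute)
    then have "2 \<le> s * (real n + 1) / c" using assms by (simp add: pos_le_divide_eq distrib_left)
    then have "2 \<le> s / (c / (real n + 1))" by simp
    then show ?case by (rule cutoff_eq_1)
  qed
  then show ?thesis by (rule tendsto_eventually)
qed

context kolm begin

text \<open>Green's identity for \<open>\<Gamma>(., \<zeta>)\<close> and \<Phi>(g), each cut off at
  its own pole. As g solves the adjoint equation, that operator applied to \<Phi>(g) leaves only
  \<Phi>''(g) times the sum of squared derivatives, that is \<Phi>''(g) g^2 W. The cutoff at
  \<open>z0\<close> produces C' g(\<zeta>) from the slope of \<Phi> at infinity, the one at
  \<open>\<zeta>\<close> produces \<Phi>(g(\<zeta>)). Vanishing of \<Phi> below \<rho> provides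
  bounded support.\<close>

lemma ball_potential_general:
  fixes \<Phi> \<Phi>' \<Phi>'' :: "real \<Rightarrow> real"
  assumes lt: "snd \<zeta> < snd z0" and \<rho>: "\<rho> > 0"
    and d1: "\<And>s. (\<Phi> has_real_derivative \<Phi>' s) (at s)" and d2: "\<And>s. (\<Phi>' has_real_derivative \<Phi>'' s) (at s)"
    and cont: "continuous_on UNIV \<Phi>''" and nonneg: "\<And>s. \<Phi>'' s \<ge> 0"
    and zero: "\<And>s. s \<le> \<rho> \<Longrightarrow> \<Phi> s = 0 \<and> \<Phi>' s = 0 \<and> \<Phi>'' s = 0"
    and growth: "\<And>s. s > 0 \<Longrightarrow> \<bar>\<Phi> s\<bar> \<le> C * s" and lim: "((\<lambda>s. \<Phi> s / s) \<longlongrightarrow> C') at_top"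
  defines "g \<equiv> hk A (-B) (-1) z0" and "G \<equiv> hk A B 1 \<zeta>"
  shows "integrable lborel (\<lambda>z. G z * (\<Phi>'' (g z) * (g z)\<^sup>2 * Wq A (-B) (-1) z0 z))"
    and "(\<integral>z. G z * (\<Phi>'' (g z) * (g z)\<^sup>2 * Wq A (-B) (-1) z0 z) \<partial>lborel) = C' * g \<zeta> - \<Phi> (g \<zeta>)"
proof -
  interpret d: kolm A "-B" l by (rule dual)
  let ?T = "snd z0 - snd \<zeta>"
  \<comment> \<open>A quarter of the time between the two poles: where the derivative of one cutoff
    lives, elapsed time at most 2 \<epsilon> from its pole, the other cutoff is already 1.\<close>
  define \<epsilon> :: "nat \<Rightarrow> real" where "\<epsilon> n = ?T / 4 / (real n + 1)" for n
  have \<epsilon>: "\<epsilon> n > 0" for n using lt by (simp add: \<epsilon>_def)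
  have \<epsilon>T: "\<epsilon> n \<le> ?T / 4" for n
  proof -
    have "?T / 4 / (real n + 1) \<le> ?T / 4 / 1" using lt by (intro divide_left_mono) auto
    then show ?thesis by (simp add: \<epsilon>_def)
  qed
  have \<epsilon>0: "\<epsilon> \<longlonglongrightarrow> 0" unfolding \<epsilon>_def by real_asymp
  let ?s1 = "\<lambda>z. hs 1 \<zeta> z" and ?s0 = "\<lambda>z. hs (-1) z0 z"
  let ?W = "Wq A (-B) (-1) z0"
  let ?c1 = "\<lambda>n z. cutoff (?s1 z / \<epsilon> n)" and ?c0 = "\<lambda>n z. cutoff (?s0 z / \<epsilon> n)"
  let ?c1' = "\<lambda>n z. cutoff' (?s1 z / \<epsilon> n)" and ?c0' = "\<lambda>n z. cutoff' (?s0 z / \<epsilon> n)"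
  have c\<Phi>: "continuous_on UNIV \<Phi>" "continuous_on UNIV \<Phi>'"
    using DERIV_continuous_on[OF d1] DERIV_continuous_on[OF d2] by auto
  have m1: "\<bar>1::real\<bar> = 1" "\<bar>-1::real\<bar> = 1" by simp_all
  have g0: "g z \<ge> 0" and G0: "G z \<ge> 0" for z
    unfolding g_def G_def by (rule d.hk_nonneg, rule hk_nonneg)
  have gpos: "?s0 z > 0 \<Longrightarrow> g z > 0" for z unfolding g_def by (rule d.hk_pos)
  have [measurable]: "g \<in> borel_measurable borel" "G \<in> borel_measurable borel"
    unfolding g_def G_def by (simp_all add: d.hk_measurable hk_measurable)
  have [measurable]: "\<Phi> \<in> borel_measurable borel"
    by (rule borel_measurable_continuous_onI[OF c\<Phi>(1)])

  \<comment> \<open>The left side is the cut-off main term; the two integrals on the right come from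
    the derivatives of the cutoffs at \<open>z0\<close> and at \<open>\<zeta>\<close>.\<close>
  have ident: "(\<integral>z. (?c1 n z * ?c0 n z) * (G z * (\<Phi>'' (g z) * (g z)\<^sup>2 * ?W z)) \<partial>lborel)
      = (\<integral>z. g z * (?c0' n z / \<epsilon> n * (?c1 n z * G z * (\<Phi> (g z) / g z))) \<partial>lborel)
        - (\<integral>z. G z * (?c1' n z / \<epsilon> n * (?c0 n z * \<Phi> (g z))) \<partial>lborel)" for n
  proof -
    let ?e = "\<epsilon> n"
    let ?g1 = "\<lambda>k. hk1 A (-B) (-1) z0 (avec A k)" and ?g2 = "\<lambda>k. hk2 A (-B) (-1) z0 (avec A k)"
    let ?gt = "hkT A (-B) (-1) z0"
    let ?Gn = "\<lambda>z. ?c1 n z * G z" and ?f = "\<lambda>z. ?c0 n z * \<Phi> (g z)"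
    let ?f1 = "\<lambda>k z. ?c0 n z * (\<Phi>' (g z) * ?g1 k z)"
    let ?f2 = "\<lambda>k z. ?c0 n z * (\<Phi>'' (g z) * (?g1 k z)\<^sup>2 + \<Phi>' (g z) * ?g2 k z)"
    let ?ft = "\<lambda>z. - (?c0 n z * (\<Phi>' (g z) * ?gt z) + (1 / ?e * ?c0' n z) * \<Phi> (g z))"
    let ?G2 = "\<lambda>k z. ?c1 n z * hk2 A B 1 \<zeta> (avec A k) z"
    let ?Gt = "\<lambda>z. ?c1 n z * hkT A B 1 \<zeta> z + (1 / ?e * ?c1' n z) * G z"
    let ?U = "{z. ?s0 z > 0}"
    have cg: "continuous_on ?U g" "\<And>k. continuous_on ?U (?g1 k)" "\<And>k. continuous_on ?U (?g2 k)" "continuous_on ?U ?gt"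
      unfolding g_def by (intro d.continuous_hk continuous_on_const continuous_on_id; simp)+
    have comp: "continuous_on ?U (\<lambda>z. F (g z))" if "continuous_on UNIV F" for F :: "real \<Rightarrow> real"
      by (rule continuous_on_compose2[OF that cg(1)]) simp
    have cut: "continuous_on UNIV (\<lambda>z. ?c0 n z * F z)" "continuous_on UNIV (\<lambda>z. ?c0' n z * F z)"
      if "continuous_on ?U F" for F :: "'n spacetime \<Rightarrow> real"
      by (rule continuous_time_cut[OF _ _ \<epsilon> that]; intro continuous_intros cutoff_eq_0 cutoff'_eq_0; simp)+
    have bd: "bounded {z. g z > \<rho>}" unfolding g_def by (rule d.bounded_superlevel[OF m1(2) \<rho>])
    have dS: "((\<lambda>h. ?c0 n (sflow a h z) * F (sflow a h z)) has_real_derivative ?c0 n z * D) (at 0)"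
      if "?s0 z > 0 \<Longrightarrow> ((\<lambda>h. F (sflow a h z)) has_real_derivative D) (at 0)" for a z D and F :: "'n spacetime \<Rightarrow> real"
      using DERIV_cut_mult[of "\<lambda>h. ?s0 (sflow a h z)" 0 ?e "\<lambda>h. F (sflow a h z)" D] that \<epsilon>[of n]
      by (simp add: hs_sflow)
    have a1: "along (sflow (avec A k)) ?f (?f1 k)" for k
      unfolding along_def
    proof
      fix z
      show "((\<lambda>h. ?f (sflow (avec A k) h z)) has_real_derivative ?f1 k z) (at 0)"
      proof (rule dS)
        assume s: "?s0 z > 0"
        show "((\<lambda>h. \<Phi> (g (sflow (avec A k) h z))) has_real_derivative \<Phi>' (g z) * ?g1 k z) (at 0)"
          using DERIV_chain2[OF d1 d.hk_sflow_deriv(1)[OF s]] by (simp add: g_def sflow_0)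
      qed
    qed
    have a2: "along (sflow (avec A k)) (?f1 k) (?f2 k)" for k
      unfolding along_def
    proof
      fix z
      show "((\<lambda>h. ?f1 k (sflow (avec A k) h z)) has_real_derivative ?f2 k z) (at 0)"
      proof (rule dS)
        assume s: "?s0 z > 0"
        have e: "((\<lambda>h. \<Phi>' (g (sflow (avec A k) h z))) has_real_derivative \<Phi>'' (g z) * ?g1 k z) (at 0)"
          using DERIV_chain2[OF d2 d.hk_sflow_deriv(1)[OF s]] by (simp add: g_def sflow_0)
        have "((\<lambda>h. \<Phi>' (g (sflow (avec A k) h z)) * ?g1 k (sflow (avec A k) h z)) has_real_derivative
            \<Phi>' (g z) * ?g2 k z + (\<Phi>'' (g z) * ?g1 k z) * ?g1 k z) (at 0)"
          using DERIV_mult'[OF e d.hk_sflow_deriv(2)[OF s, of "avec A k"]] by (simp only: sflow_0)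
        then show "((\<lambda>h. \<Phi>' (g (sflow (avec A k) h z)) * ?g1 k (sflow (avec A k) h z)) has_real_derivative
            \<Phi>'' (g z) * (?g1 k z)\<^sup>2 + \<Phi>' (g z) * ?g2 k z) (at 0)"
          by (rule DERIV_cong) (simp add: power2_eq_square)
      qed
    qed
    have a3: "along (tflow B 1) ?f ?ft"
      unfolding along_def
    proof
      fix z
      have sf: "?s0 (tflow B 1 h z) = ?s0 z + (- 1) * h" for h by (simp add: tflow_def)
      have F: "((\<lambda>h. \<Phi> (g (tflow B 1 h z))) has_real_derivative - (\<Phi>' (g z) * ?gt z)) (at 0)" if s: "?s0 z > 0"
      proof -
        have "((\<lambda>h. g (tflow (-B) (-1) h z)) has_real_derivative ?gt z) (at (- 0))"
          unfolding g_def using d.hk_tflow_deriv[of "-1" z z0] s by simp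
        from DERIV_chain2[OF this DERIV_minus[OF DERIV_ident]]
        have "((\<lambda>h. g (tflow B 1 h z)) has_real_derivative ?gt z * - 1) (at 0)"
          by (simp add: tflow_dual)
        from DERIV_chain2[OF d1 this] show ?thesis by (simp add: tflow_0)
      qed
      show "((\<lambda>h. ?f (tflow B 1 h z)) has_real_derivative ?ft z) (at 0)"
        using DERIV_cut_mult[of "\<lambda>h. ?s0 (tflow B 1 h z)" "-1" ?e "\<lambda>h. \<Phi> (g (tflow B 1 h z))" "- (\<Phi>' (g z) * ?gt z)"] F \<epsilon>[of n]
        unfolding sf tflow_0 by simp
    qed
    have cf: "continuous_on UNIV ?f" "\<And>k. continuous_on UNIV (?f1 k)" "\<And>k. continuous_on UNIV (?f2 k)"
      by (intro cut continuous_intros comp c\<Phi> cont cg)+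
    have "continuous_on UNIV (\<lambda>z. 1 / ?e * (?c0' n z * \<Phi> (g z)))"
      by (intro continuous_on_mult continuous_on_const cut comp c\<Phi>)
    then have cc: "continuous_on UNIV (\<lambda>z. (1 / ?e * ?c0' n z) * \<Phi> (g z))" by (simp only: mult.assoc)
    have cft: "continuous_on UNIV ?ft"
      by (rule continuous_on_minus[OF continuous_on_add[OF cut(1)[OF continuous_on_mult[OF comp[OF c\<Phi>(2)] cg(4)]] cc]])
    have "continuous_on UNIV (\<lambda>z. 1 / ?e * (?c1' n z * G z))"
      unfolding G_def by (intro continuous_on_mult continuous_on_const continuous_cut_hk[OF _ \<epsilon>]) simp
    then have cc': "continuous_on UNIV (\<lambda>z. (1 / ?e * ?c1' n z) * G z)" by (simp only: mult.assoc)
    have cGt: "continuous_on UNIV ?Gt"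
      by (rule continuous_on_add[OF continuous_cut_hk(4)[OF _ \<epsilon>] cc']) simp
    have z: "?f z = 0 \<and> ?f1 k z = 0 \<and> ?f2 k z = 0 \<and> ?ft z = 0" if "z \<notin> {z. g z > \<rho>}" for z k
      using zero[of "g z"] that by simp
    note A1 = along_cut_hk[OF m1(1) \<epsilon>[of n], where p = \<zeta>, folded G_def]
    have gr: "(\<integral>z. ?Gn z * ((\<Sum>k\<in>UNIV. ?f2 k z) + 1 * ?ft z) \<partial>lborel) = (\<integral>z. ?f z * ((\<Sum>k\<in>UNIV. ?G2 k z) - 1 * ?Gt z) \<partial>lborel)"
    proof (rule green_identity[OF sflow_good tflow_good, of "avec A"])
      show "along (sflow (avec A k)) ?Gn (\<lambda>z. ?c1 n z * hk1 A B 1 \<zeta> (avec A k) z)"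
        "along (sflow (avec A k)) (\<lambda>z. ?c1 n z * hk1 A B 1 \<zeta> (avec A k) z) (?G2 k)"
        "along (tflow B 1) ?Gn ?Gt" for k by (rule A1)+
      show "continuous_on UNIV ?Gn" "continuous_on UNIV (\<lambda>z. ?c1 n z * hk1 A B 1 \<zeta> (avec A k) z)"
        "continuous_on UNIV (?G2 k)" for k
        unfolding G_def by (rule continuous_cut_hk[OF _ \<epsilon>]; simp)+
    qed (use a1 a2 a3 cf cft cGt bd z in blast)+
    have e1: "(\<Sum>k\<in>UNIV. ?f2 k z) + 1 * ?ft z = ?c0 n z * (\<Phi>'' (g z) * (g z)\<^sup>2 * ?W z) - ?c0' n z / ?e * \<Phi> (g z)" for z
    proof -
      have "(\<Sum>k\<in>UNIV. ?f2 k z) = ?c0 n z * (\<Phi>'' (g z) * (\<Sum>k\<in>UNIV. (?g1 k z)\<^sup>2) + \<Phi>' (g z) * ?gt z)"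
        by (simp add: hkT_def sum_distrib_left sum.distrib distrib_left)
      also have "(\<Sum>k\<in>UNIV. (?g1 k z)\<^sup>2) = ?W z * (g z)\<^sup>2" unfolding g_def by (rule d.sum_hk1_sq)
      finally show ?thesis by (simp add: algebra_simps)
    qed
    have e2: "(\<Sum>k\<in>UNIV. ?G2 k z) - 1 * ?Gt z = - (?c1' n z / ?e * G z)" for z
      by (simp add: hkT_def sum_distrib_left)
    have eq: "(\<integral>z. ?Gn z * (?c0 n z * (\<Phi>'' (g z) * (g z)\<^sup>2 * ?W z) - ?c0' n z / ?e * \<Phi> (g z)) \<partial>lborel)
        = (\<integral>z. ?f z * - (?c1' n z / ?e * G z) \<partial>lborel)"
      using gr unfolding e1 e2 .
    have cW: "continuous_on ?U ?W" by (intro d.continuous_hk continuous_on_const continuous_on_id; simp)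
    have i1: "integrable lborel (\<lambda>z. ?Gn z * (?c0 n z * (\<Phi>'' (g z) * (g z)\<^sup>2 * ?W z)))"
    proof (rule integrable_bounded_support[OF _ bd])
      show "continuous_on UNIV (\<lambda>z. ?Gn z * (?c0 n z * (\<Phi>'' (g z) * (g z)\<^sup>2 * ?W z)))"
        unfolding G_def by (intro continuous_on_mult[OF continuous_cut_hk(1)[OF _ \<epsilon>]] cut continuous_intros comp cont cg cW) simp
    qed (use zero in auto)
    have i2: "integrable lborel (\<lambda>z. ?Gn z * (?c0' n z / ?e * \<Phi> (g z)))"
    proof (rule integrable_bounded_support[OF _ bd])
      have "continuous_on UNIV (\<lambda>z. ?Gn z * (?c0' n z * (\<Phi> (g z) / ?e)))"
        unfolding G_def using \<epsilon>[of n]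
        by (intro continuous_on_mult[OF continuous_cut_hk(1)[OF _ \<epsilon>]] cut continuous_intros comp c\<Phi>) auto
      then show "continuous_on UNIV (\<lambda>z. ?Gn z * (?c0' n z / ?e * \<Phi> (g z)))" by simp
    qed (use zero in auto)
    have "(\<integral>z. ?Gn z * (?c0 n z * (\<Phi>'' (g z) * (g z)\<^sup>2 * ?W z)) \<partial>lborel)
       = (\<integral>z. ?Gn z * (?c0' n z / ?e * \<Phi> (g z)) \<partial>lborel) + (\<integral>z. ?f z * - (?c1' n z / ?e * G z) \<partial>lborel)"
      unfolding eq[symmetric] using i1 i2 by (simp add: right_diff_distrib)
    moreover have "?Gn z * (?c0' n z / ?e * \<Phi> (g z)) = g z * (?c0' n z / ?e * (?c1 n z * G z * (\<Phi> (g z) / g z)))" for z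
      using gpos[of z] zero[of "g z"] \<rho> by (cases "g z = 0") auto
    moreover have "(\<integral>z. ?f z * - (?c1' n z / ?e * G z) \<partial>lborel) = - (\<integral>z. G z * (?c1' n z / ?e * (?c0 n z * \<Phi> (g z))) \<partial>lborel)"
      by (subst Bochner_Integration.integral_minus[symmetric]) (simp add: mult_ac)
    ultimately show ?thesis by (simp add: mult_ac)
  qed

  have L1: "(\<lambda>n. \<integral>z. g z * (?c0' n z / \<epsilon> n * (?c1 n z * G z * (\<Phi> (g z) / g z))) \<partial>lborel) \<longlonglongrightarrow> G z0 * C'"
  proof -
    \<comment> \<open>Truncation keeps away from the pole \<open>\<zeta>\<close>, where G is
      unbounded, and changes nothing on the support of the mollifier at \<open>z0\<close>. The ratio
      \<Phi>(g)/g stays bounded although g blows up there.\<close>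
    define h where "h z = (if ?s1 z \<ge> ?T / 2 then G z * (\<Phi> (g z) / g z) else 0)" for z
    have "g z * (?c0' n z / \<epsilon> n * (?c1 n z * G z * (\<Phi> (g z) / g z))) = g z * (?c0' n z / \<epsilon> n * h z)" for n z
    proof (cases "1 < ?s0 z / \<epsilon> n \<and> ?s0 z / \<epsilon> n < 2")
      case True
      then have "?s0 z < 2 * \<epsilon> n" using \<epsilon>[of n] by (simp add: pos_divide_less_eq)
      then have s1: "?s1 z \<ge> ?T / 2" using \<epsilon>T[of n] by simp
      then have "?s1 z \<ge> 2 * \<epsilon> n" using \<epsilon>T[of n] by simp
      then have "?c1 n z = 1" using \<epsilon>[of n] by (intro cutoff_eq_1) (simp add: pos_le_divide_eq)
      then show ?thesis using s1 by (simp add: h_def)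
    next
      case False
      then have "?c0' n z = 0" by (intro cutoff'_eq_0) auto
      then show ?thesis by simp
    qed
    moreover have "(\<lambda>n. \<integral>z. g z * (?c0' n z / \<epsilon> n * h z) \<partial>lborel) \<longlonglongrightarrow> G z0 * C'"
      unfolding g_def
    proof (rule d.hk_concentrates(1)[OF m1(2) \<epsilon>, where M = "peak (?T / 2) * \<bar>C\<bar>"])
      have [measurable]: "(\<lambda>z :: 'n spacetime. ?s1 z) \<in> borel_measurable borel"
        by (intro borel_measurable_continuous_onI continuous_intros)
      show "h \<in> borel_measurable borel" unfolding h_def[abs_def] by measurable
      have hb: "\<bar>h z\<bar> \<le> peak (?T / 2) * \<bar>C\<bar>" for z
      proof (cases "?s1 z \<ge> ?T / 2")
        case True
        have "G z \<le> peak (?s1 z)" unfolding G_def by (rule hk_le_peak) (use True lt in simp)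
        also have "\<dots> \<le> peak (?T / 2)" by (rule peak_antimono) (use True lt in auto)
        finally have "G z \<le> peak (?T / 2)" .
        moreover have "\<bar>\<Phi> (g z) / g z\<bar> \<le> \<bar>C\<bar>"
        proof (cases "g z = 0")
          case False
          then have "g z > 0" using g0[of z] by simp
          then show ?thesis
            using growth[of "g z"] by (simp add: abs_divide pos_divide_le_eq) (meson abs_ge_self mult_right_mono order_trans less_imp_le)
        qed simp
        ultimately have "G z * \<bar>\<Phi> (g z) / g z\<bar> \<le> peak (?T / 2) * \<bar>C\<bar>"
          using G0[of z] peak_pos[of "?T / 2"] lt by (intro mult_mono) auto
        moreover have "\<bar>h z\<bar> = G z * \<bar>\<Phi> (g z) / g z\<bar>" using True G0[of z] by (simp add: h_def abs_mult)
        ultimately show ?thesis by simp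
      next
        case False
        then show ?thesis using peak_pos[of "?T / 2"] lt by (simp add: h_def)
      qed
      show "\<bar>h (d.hpt (-1) z0 (\<epsilon> n) (y, s))\<bar> \<le> peak (?T / 2) * \<bar>C\<bar> \<or> s \<le> 1 \<or> 2 \<le> s" for n y s
        using hb by blast
      fix y :: "'n rvec" and s :: real assume s: "1 < s" "s < 2"
      let ?z = "\<lambda>n. d.hpt (-1) z0 (\<epsilon> n) (y, s)"
      have zl: "?z \<longlonglongrightarrow> z0" by (rule d.hpt_tendsto[OF \<epsilon>0])
      have "isCont G z0"
      proof -
        have "open {z :: 'n spacetime. ?s1 z > 0}" by (intro open_Collect_less continuous_intros)
        moreover have "continuous_on {z. ?s1 z > 0} G"
          unfolding G_def by (intro continuous_hk continuous_on_const continuous_on_id) simp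
        ultimately have "isCont G z" if "z \<in> {z. ?s1 z > 0}" for z
          using that continuous_on_eq_continuous_at by blast
        from this[of z0] show ?thesis using lt by simp
      qed
      then have Gl: "(\<lambda>n. G (?z n)) \<longlonglongrightarrow> G z0" using zl by (rule isCont_tendsto_compose)
      have pos: "\<epsilon> n * s > 0" for n using \<epsilon>[of n] s by simp
      have gz: "g (?z n) = fund_gamma A (-B) (y, 1) / sqrt (\<epsilon> n * s) ^ hdim" for n
        unfolding g_def using d.hk_hpt[OF m1(2), of "\<epsilon> n" "(y, s)" z0] pos by (simp add: d.hdim_def hdim_def)
      have "fund_gamma A (-B) (y, 1) > 0"
        using d.fund_gamma_eq[of 1 y] d.peak_pos[of 1] by simp
      moreover have "filterlim (\<lambda>n. sqrt (\<epsilon> n * s) ^ hdim) (at_right 0) sequentially"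
      proof -
        have "(\<lambda>n. sqrt (\<epsilon> n * s)) \<longlonglongrightarrow> sqrt (0 * s)" by (intro tendsto_intros \<epsilon>0)
        from tendsto_power[OF this, of hdim] have l: "(\<lambda>n. sqrt (\<epsilon> n * s) ^ hdim) \<longlonglongrightarrow> 0"
          using hdim_pos by (simp only: mult_zero_left real_sqrt_zero zero_power)
        have pp: "sqrt (\<epsilon> n * s) ^ hdim > 0" for n
          by (intro zero_less_power real_sqrt_gt_zero pos)
        have "\<forall>n. sqrt (\<epsilon> n * s) ^ hdim \<in> {0<..} \<and> sqrt (\<epsilon> n * s) ^ hdim \<noteq> 0"
          using pp by (metis greaterThan_iff less_irrefl)
        then show ?thesis unfolding filterlim_at using l always_eventually by blast
      qed
      then have "filterlim (\<lambda>n. inverse (sqrt (\<epsilon> n * s) ^ hdim)) at_top sequentially"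
        by (rule filterlim_compose[OF filterlim_inverse_at_top_right])
      ultimately have "filterlim (\<lambda>n. g (?z n)) at_top sequentially"
        unfolding gz divide_inverse by (intro filterlim_tendsto_pos_mult_at_top[OF tendsto_const])
      then have "(\<lambda>n. \<Phi> (g (?z n)) / g (?z n)) \<longlonglongrightarrow> C'" using lim filterlim_compose by blast
      from tendsto_mult[OF Gl this] have "(\<lambda>n. G (?z n) * (\<Phi> (g (?z n)) / g (?z n))) \<longlonglongrightarrow> G z0 * C'" .
      moreover have "\<forall>\<^sub>F n in sequentially. G (?z n) * (\<Phi> (g (?z n)) / g (?z n)) = h (?z n)"
      proof (intro always_eventually allI)
        fix n
        have "?s0 (?z n) = \<epsilon> n * s" using d.hs_hpt[OF m1(2), of z0 "\<epsilon> n" "(y, s)"] by simp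
        moreover have "\<epsilon> n * s \<le> ?T / 2" using \<epsilon>T[of n] \<epsilon>[of n] s mult_mono[of "\<epsilon> n" "?T / 4" s 2] by simp
        ultimately show "G (?z n) * (\<Phi> (g (?z n)) / g (?z n)) = h (?z n)" by (simp add: h_def)
      qed
      ultimately show "(\<lambda>n. h (?z n)) \<longlonglongrightarrow> G z0 * C'" by (rule Lim_transform_eventually)
    qed
    ultimately show ?thesis by simp
  qed

  have L2: "(\<lambda>n. \<integral>z. G z * (?c1' n z / \<epsilon> n * (?c0 n z * \<Phi> (g z))) \<partial>lborel) \<longlonglongrightarrow> \<Phi> (g \<zeta>)"
  proof -
    define h where "h z = (if ?s0 z \<ge> ?T / 2 then \<Phi> (g z) else 0)" for z
    have e: "G z * (?c1' n z / \<epsilon> n * (?c0 n z * \<Phi> (g z))) = G z * (?c1' n z / \<epsilon> n * h z)" for n z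
    proof (cases "1 < ?s1 z / \<epsilon> n \<and> ?s1 z / \<epsilon> n < 2")
      case True
      then have "?s1 z < 2 * \<epsilon> n" using \<epsilon>[of n] by (simp add: pos_divide_less_eq)
      then have s0: "?s0 z \<ge> ?T / 2" using \<epsilon>T[of n] by simp
      then have "?s0 z \<ge> 2 * \<epsilon> n" using \<epsilon>T[of n] by simp
      then have "?c0 n z = 1" using \<epsilon>[of n] by (intro cutoff_eq_1) (simp add: pos_le_divide_eq)
      then show ?thesis using s0 by (simp add: h_def)
    next
      case False
      then have "?c1' n z = 0" by (intro cutoff'_eq_0) auto
      then show ?thesis by simp
    qed
    have "(\<lambda>n. \<integral>z. G z * (?c1' n z / \<epsilon> n * h z) \<partial>lborel) \<longlonglongrightarrow> \<Phi> (g \<zeta>)"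
      unfolding G_def
    proof (rule hk_concentrates(1)[OF m1(1) \<epsilon>, where M = "\<bar>C\<bar> * d.peak (?T / 2)"])
      have [measurable]: "(\<lambda>z :: 'n spacetime. ?s0 z) \<in> borel_measurable borel"
        by (intro borel_measurable_continuous_onI continuous_intros)
      show "h \<in> borel_measurable borel" unfolding h_def[abs_def] by measurable
      have hb: "\<bar>h z\<bar> \<le> \<bar>C\<bar> * d.peak (?T / 2)" for z
      proof (cases "?s0 z \<ge> ?T / 2")
        case True
        have s0: "?s0 z > 0" using True lt by simp
        have "g z \<le> d.peak (?s0 z)" unfolding g_def by (rule d.hk_le_peak[OF s0])
        also have "\<dots> \<le> d.peak (?T / 2)" by (rule d.peak_antimono) (use True lt in auto)
        finally have "\<bar>C\<bar> * g z \<le> \<bar>C\<bar> * d.peak (?T / 2)" by (intro mult_left_mono) auto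
        moreover have "\<bar>\<Phi> (g z)\<bar> \<le> \<bar>C\<bar> * g z"
          using growth[OF gpos[OF s0]] mult_right_mono[OF abs_ge_self[of C] g0[of z]] by linarith
        ultimately show ?thesis using True by (simp add: h_def)
      next
        case False
        then show ?thesis using d.peak_pos[of "?T / 2"] lt by (simp add: h_def)
      qed
      show "\<bar>h (hpt 1 \<zeta> (\<epsilon> n) (y, s))\<bar> \<le> \<bar>C\<bar> * d.peak (?T / 2) \<or> s \<le> 1 \<or> 2 \<le> s" for n y s
        using hb by blast
      fix y :: "'n rvec" and s :: real assume s: "1 < s" "s < 2"
      let ?z = "\<lambda>n. hpt 1 \<zeta> (\<epsilon> n) (y, s)"
      have zl: "?z \<longlonglongrightarrow> \<zeta>" by (rule hpt_tendsto[OF \<epsilon>0])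
      have "isCont g \<zeta>"
      proof -
        have "open {z :: 'n spacetime. ?s0 z > 0}" by (intro open_Collect_less continuous_intros)
        moreover have "continuous_on {z. ?s0 z > 0} g"
          unfolding g_def by (intro d.continuous_hk continuous_on_const continuous_on_id) simp
        ultimately have "isCont g z" if "z \<in> {z. ?s0 z > 0}" for z
          using that continuous_on_eq_continuous_at by blast
        from this[of \<zeta>] show ?thesis using lt by simp
      qed
      moreover have "isCont \<Phi> (g \<zeta>)" by (rule DERIV_isCont[OF d1])
      ultimately have "isCont (\<lambda>z. \<Phi> (g z)) \<zeta>" by (rule isCont_o2)
      then have "(\<lambda>n. \<Phi> (g (?z n))) \<longlonglongrightarrow> \<Phi> (g \<zeta>)" using zl by (rule isCont_tendsto_compose)
      moreover have "\<forall>\<^sub>F n in sequentially. \<Phi> (g (?z n)) = h (?z n)"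
      proof (intro always_eventually allI)
        fix n
        have "?s1 (?z n) = \<epsilon> n * s" using hs_hpt[OF m1(1), of \<zeta> "\<epsilon> n" "(y, s)"] by simp
        moreover have "\<epsilon> n * s \<le> ?T / 2" using \<epsilon>T[of n] \<epsilon>[of n] s mult_mono[of "\<epsilon> n" "?T / 4" s 2] by simp
        ultimately show "\<Phi> (g (?z n)) = h (?z n)" by (simp add: h_def)
      qed
      ultimately show "(\<lambda>n. h (?z n)) \<longlonglongrightarrow> \<Phi> (g \<zeta>)" by (rule Lim_transform_eventually)
    qed
    then show ?thesis by (simp only: e)
  qed

  let ?I = "\<lambda>n z. (?c1 n z * ?c0 n z) * (G z * (\<Phi>'' (g z) * (g z)\<^sup>2 * ?W z))"
  let ?J = "\<lambda>z. G z * (\<Phi>'' (g z) * (g z)\<^sup>2 * ?W z)"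
  have J0: "?J z \<ge> 0" for z using G0 nonneg d.Wq_nonneg by simp
  have ilim: "(\<lambda>n. \<integral>z. ?I n z \<partial>lborel) \<longlonglongrightarrow> C' * g \<zeta> - \<Phi> (g \<zeta>)"
  proof -
    have "G z0 = g \<zeta>" unfolding G_def g_def by (simp add: hk_swap)
    then show ?thesis unfolding ident using tendsto_diff[OF L1 L2] by (simp add: mult.commute)
  qed
  have Jm: "?J \<in> borel_measurable borel"
  proof (rule borel_measurable_open_zero)
    have o: "open {z :: 'n spacetime. ?s0 z > 0}" "open {z :: 'n spacetime. ?s1 z > 0}"
      by (intro open_Collect_less continuous_intros)+
    then show "open ({z. ?s0 z > 0} \<inter> {z :: 'n spacetime. ?s1 z > 0})" by (rule open_Int)
    let ?V = "{z. ?s0 z > 0} \<inter> {z :: 'n spacetime. ?s1 z > 0}"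
    have cG: "continuous_on ?V G" unfolding G_def by (intro continuous_hk continuous_on_const continuous_on_id) auto
    have cg: "continuous_on ?V g" unfolding g_def by (intro d.continuous_hk continuous_on_const continuous_on_id) auto
    have cW: "continuous_on ?V ?W" by (intro d.continuous_hk continuous_on_const continuous_on_id) auto
    show "continuous_on ?V ?J"
      by (intro continuous_on_mult cG cg cW continuous_on_power continuous_on_compose2[OF cont cg]) simp
    show "?J z = 0" if "z \<notin> ?V" for z
      using that hk_nonpos_time[of 1 z \<zeta> A B] hk_nonpos_time[of "-1" z z0 A "-B"] by (auto simp: G_def g_def)
  qed
  have cm: "(\<lambda>z :: 'n spacetime. ?c1 n z * ?c0 n z) \<in> borel_measurable borel" for n
    using \<epsilon>[of n] by (intro borel_measurable_continuous_onI continuous_intros) auto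
  have Ii: "integrable lborel (?I n)" for n
  proof -
    have bd: "bounded {z. g z > \<rho>}" unfolding g_def by (rule d.bounded_superlevel[OF m1(2) \<rho>])
    let ?U = "{z :: 'n spacetime. ?s0 z > 0}"
    have cg: "continuous_on ?U g" unfolding g_def by (intro d.continuous_hk continuous_on_const continuous_on_id) auto
    have cW: "continuous_on ?U ?W" by (intro d.continuous_hk continuous_on_const continuous_on_id) auto
    have "continuous_on ?U (\<lambda>z. \<Phi>'' (g z) * (g z)\<^sup>2 * ?W z)"
      by (intro continuous_on_mult cg cW continuous_on_power continuous_on_compose2[OF cont cg]) simp
    then have c0: "continuous_on UNIV (\<lambda>z. ?c0 n z * (\<Phi>'' (g z) * (g z)\<^sup>2 * ?W z))"
      by (intro continuous_time_cut[OF _ _ \<epsilon>]) (auto intro!: continuous_intros cutoff_eq_0)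
    have "continuous_on UNIV (\<lambda>z. (?c1 n z * G z) * (?c0 n z * (\<Phi>'' (g z) * (g z)\<^sup>2 * ?W z)))"
      unfolding G_def by (rule continuous_on_mult[OF continuous_cut_hk(1)[OF _ \<epsilon>] c0]) simp
    then have "integrable lborel (\<lambda>z. (?c1 n z * G z) * (?c0 n z * (\<Phi>'' (g z) * (g z)\<^sup>2 * ?W z)))"
      by (rule integrable_bounded_support[OF _ bd]) (use zero in auto)
    then show ?thesis by (simp add: mult_ac)
  qed
  \<comment> \<open>The cutoffs increase as \<epsilon> decreases and \<Phi>'' is nonnegative, so
    monotone convergence yields integrability of the limit together with its value.\<close>
  have mono: "AE z in lborel. mono (\<lambda>n. ?I n z)"
  proof (intro AE_I2 monoI)
    fix z :: "'n spacetime" and m n :: nat assume mn: "m \<le> n"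
    have e: "\<epsilon> n \<le> \<epsilon> m" unfolding \<epsilon>_def using mn lt by (intro divide_left_mono) auto
    have c: "cutoff (s / \<epsilon> m) \<le> cutoff (s / \<epsilon> n)" for s
    proof (cases "s \<ge> 0")
      case True
      then show ?thesis using e \<epsilon> by (intro cutoff_mono divide_left_mono) auto
    next
      case False
      then have "s / \<epsilon> m \<le> 1" using \<epsilon>[of m] by (simp add: pos_divide_le_eq)
      then show ?thesis by (simp add: cutoff_eq_0 cutoff_nonneg)
    qed
    show "?I m z \<le> ?I n z"
      by (intro mult_right_mono mult_mono c J0) (simp_all add: cutoff_nonneg)
  qed
  have lim: "AE z in lborel. (\<lambda>n. ?I n z) \<longlonglongrightarrow> ?J z"
  proof (rule AE_I2)
    fix z :: "'n spacetime"
    show "(\<lambda>n. ?I n z) \<longlonglongrightarrow> ?J z"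
    proof (cases "?s0 z > 0 \<and> ?s1 z > 0")
      case True
      have "(\<lambda>n. ?c1 n z * ?c0 n z) \<longlonglongrightarrow> 1 * 1"
        unfolding \<epsilon>_def using True lt by (intro tendsto_mult cutoff_scaled_limit) auto
      from tendsto_mult_right[OF this, of "?J z"] show ?thesis by simp
    next
      case False
      then have "?J z = 0"
        using hk_nonpos_time[of 1 z \<zeta> A B] hk_nonpos_time[of "-1" z z0 A "-B"] by (auto simp: G_def g_def)
      then show ?thesis by (simp only: mult_zero_right tendsto_const)
    qed
  qed
  show "integrable lborel ?J" "(\<integral>z. ?J z \<partial>lborel) = C' * g \<zeta> - \<Phi> (g \<zeta>)"
    using integrable_monotone_convergence[OF Ii mono lim ilim] integral_monotone_convergence[OF Ii mono lim ilim] Jm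
    by simp_all
qed

end

text \<open>Obtained backwards: \<open>prof2\<close> is x^(-2) - x^(-(m+2)), and
  \<open>prof1\<close> and \<open>prof\<close> are its successive antiderivatives that vanish at x =
  1. The slope of \<open>prof m\<close> at infinity is 1 - 1/(m+1).\<close>

definition prof :: "nat \<Rightarrow> real \<Rightarrow> real"
  where "prof m x = (x - 1 - ln x) - (x - 1) / (real m + 1) + (1 - (1 / x) ^ m) / (real m * (real m + 1))"

definition prof1 :: "nat \<Rightarrow> real \<Rightarrow> real"
  where "prof1 m x = (1 - 1 / x) - 1 / (real m + 1) + (1 / x) ^ (m + 1) / (real m + 1)"

definition prof2 :: "nat \<Rightarrow> real \<Rightarrow> real"
  where "prof2 m x = (1 - (1 / x) ^ m) * (1 / x)\<^sup>2"

lemma inverse_power_deriv: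
  fixes x :: real
  assumes "x > 0"
  shows "((\<lambda>x. (1 / x) ^ m) has_real_derivative - (real m * (1 / x) ^ (m + 1))) (at x)"
proof -
  have "((\<lambda>x. 1 / x) has_real_derivative - (1 / x)\<^sup>2) (at x)"
    using assms by (auto intro!: derivative_eq_intros simp: power2_eq_square)
  from DERIV_power[OF this, of m] show ?thesis
    by (rule DERIV_cong) (cases m; simp add: power2_eq_square)
qed

lemma prof_deriv:
  assumes m: "m > 0" and x: "x > 0"
  shows "(prof m has_real_derivative prof1 m x) (at x)" "(prof1 m has_real_derivative prof2 m x) (at x)"
proof -
  have "((\<lambda>x. (x - 1 - ln x) - (x - 1) / (real m + 1)) has_real_derivative (1 - 0 - 1 / x) - (1 - 0) / (real m + 1)) (at x)"
    using x by (intro DERIV_diff DERIV_cdivide DERIV_ident DERIV_const DERIV_ln_divide)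
  moreover have "((\<lambda>x. (1 - (1 / x) ^ m) / (real m * (real m + 1))) has_real_derivative
     (0 - - (real m * (1 / x) ^ (m + 1))) / (real m * (real m + 1))) (at x)"
    by (intro DERIV_diff DERIV_cdivide DERIV_const inverse_power_deriv x)
  ultimately have "(prof m has_real_derivative ((1 - 0 - 1 / x) - (1 - 0) / (real m + 1)) +
     (0 - - (real m * (1 / x) ^ (m + 1))) / (real m * (real m + 1))) (at x)"
    unfolding prof_def[abs_def] by (rule DERIV_add)
  then show "(prof m has_real_derivative prof1 m x) (at x)"
    by (rule DERIV_cong) (use m in \<open>simp add: prof1_def\<close>)
  have 1: "((\<lambda>x. 1 / x) has_real_derivative - (1 / x)\<^sup>2) (at x)"
    using x by (auto intro!: derivative_eq_intros simp: power2_eq_square)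
  have "(prof1 m has_real_derivative ((0 - - (1 / x)\<^sup>2) - 0) + (- (real (m + 1) * (1 / x) ^ (m + 1 + 1))) / (real m + 1)) (at x)"
    unfolding prof1_def[abs_def]
    by (intro DERIV_add DERIV_diff DERIV_cdivide DERIV_const inverse_power_deriv x 1)
  moreover have "(- (real (m + 1) * (1 / x) ^ (m + 1 + 1))) / (real m + 1) = - ((1 / x) ^ (m + 2))"
  proof -
    have "real (m + 1) = real m + 1" by simp
    then show ?thesis by (simp only:) (simp add: add_nonneg_eq_0_iff)
  qed
  ultimately have "(prof1 m has_real_derivative ((0 - - (1 / x)\<^sup>2) - 0) + (- ((1 / x) ^ (m + 2)))) (at x)"
    by (simp only:)
  then show "(prof1 m has_real_derivative prof2 m x) (at x)"
    by (rule DERIV_cong) (simp add: prof2_def left_diff_distrib power_add power2_eq_square diff_divide_distrib)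
qed

lemma prof_at_1: "prof m 1 = 0" "prof1 m 1 = 0" "prof2 m 1 = 0"
  by (simp_all add: prof_def prof1_def prof2_def)

context kolm begin

text \<open>With x = r g this is the potential of W on \<open>D\<close> minus that of W on the ball,
  at points outside \<open>D\<close> and before \<open>z0\<close>: x - 1 - ln x inside the ball and
  0 outside. Its strict positivity inside finishes the proof.\<close>

definition ball_defect :: "real \<Rightarrow> real"
  where "ball_defect x = (let y = max 1 x in y - 1 - ln y)"

lemma ball_defect_nonneg: "ball_defect x \<ge> 0"
  using ln_le_minus_one[of "max 1 x"] by (simp add: ball_defect_def Let_def)

lemma ball_defect_eq_0: "x \<le> 1 \<Longrightarrow> ball_defect x = 0"
  by (simp add: ball_defect_def max_def)

lemma ball_defect_pos: "x > 1 \<Longrightarrow> ball_defect x > 0"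
  using ln_le_minus_one[of x] ln_eq_minus_one[of x] by (force simp: ball_defect_def Let_def max_def)

text \<open>The profiles \<open>prof m\<close> regularise \<open>x - 1 - ln x\<close>: they vanish to second order at \<open>x = 1\<close>, so that
  their extension by \<open>0\<close> is of class \<open>C\<^sup>2\<close>, and \<open>prof2 m x * x\<^sup>2 = 1 - (1 / x) ^ m\<close> increases to the
  indicator of \<open>x > 1\<close>.\<close>

lemma ball_potential:
  assumes lt: "snd \<zeta> < snd z0" and r: "r > 0"
  defines "g \<equiv> hk A (-B) (-1) z0" and "G \<equiv> hk A B 1 \<zeta>"
  shows "integrable lborel (\<lambda>z. G z * (indicator {z. g z > 1 / r} z * Wq A (-B) (-1) z0 z))"
    and "(\<integral>z. G z * (indicator {z. g z > 1 / r} z * Wq A (-B) (-1) z0 z) \<partial>lborel) = r * g \<zeta> - ball_defect (r * g \<zeta>)"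
proof -
  interpret d: kolm A "-B" l by (rule dual)
  let ?W = "Wq A (-B) (-1) z0"
  define \<Phi> where "\<Phi> m s = prof m (max 1 (r * s))" for m s
  define \<Phi>1 where "\<Phi>1 m s = prof1 m (max 1 (r * s)) * r" for m s
  define \<Phi>2 where "\<Phi>2 m s = prof2 m (max 1 (r * s)) * r * r" for m s
  have lin: "((\<lambda>s. r * s) has_real_derivative r) (at s)" for s
    by (auto intro!: derivative_eq_intros)
  let ?I = "\<lambda>n z. G z * (\<Phi>2 (Suc n) (g z) * (g z)\<^sup>2 * ?W z)"
  have I2: "\<Phi>2 m s * s\<^sup>2 = (if r * s > 1 then 1 - (1 / (r * s)) ^ m else 0)" for m s
  proof (cases "r * s > 1")
    case True
    then have "s \<noteq> 0" by auto
    then show ?thesis using True r by (simp add: \<Phi>2_def prof2_def power2_eq_square)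
  next
    case False
    then have "max 1 (r * s) = 1" by simp
    then show ?thesis using False by (simp add: \<Phi>2_def prof_at_1)
  qed
  \<comment> \<open>The profile index is \<open>Suc n\<close> since the profile divides by its
    index; r - r/(Suc n + 1) is the slope at infinity of the profile rescaled by r.\<close>
  have gen: "integrable lborel (?I n) \<and> (\<integral>z. ?I n z \<partial>lborel) = (r - r / (real (Suc n) + 1)) * g \<zeta> - \<Phi> (Suc n) (g \<zeta>)" for n
  proof -
    let ?m = "Suc n"
    have d1: "(\<Phi> ?m has_real_derivative \<Phi>1 ?m s) (at s)" for s
      unfolding \<Phi>_def[abs_def] \<Phi>1_def
      by (rule DERIV_chain2[OF DERIV_max_one[OF prof_deriv(1)] lin]) (simp_all add: prof_at_1)
    have d2: "(\<Phi>1 ?m has_real_derivative \<Phi>2 ?m s) (at s)" for s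
      unfolding \<Phi>1_def[abs_def] \<Phi>2_def
      by (rule DERIV_cmult_right, rule DERIV_chain2[OF DERIV_max_one[OF prof_deriv(2)] lin]) (simp_all add: prof_at_1)
    have c: "continuous_on UNIV (\<Phi>2 ?m)"
      unfolding \<Phi>2_def[abs_def] prof2_def by (intro continuous_intros) auto
    have nn: "\<Phi>2 ?m s \<ge> 0" for s
    proof -
      have "(1 / max 1 (r * s)) ^ ?m \<le> 1" by (intro power_le_one) auto
      then show ?thesis using r by (simp add: \<Phi>2_def prof2_def)
    qed
    have z: "\<Phi> ?m s = 0 \<and> \<Phi>1 ?m s = 0 \<and> \<Phi>2 ?m s = 0" if "s \<le> 1 / r" for s
    proof -
      have "max 1 (r * s) = 1" using that r by (simp add: pos_le_divide_eq mult.commute)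
      then show ?thesis by (simp add: \<Phi>_def \<Phi>1_def \<Phi>2_def prof_at_1)
    qed
    have gr: "\<bar>\<Phi> ?m s\<bar> \<le> (2 * r) * s" if s: "s > 0" for s
    proof (cases "r * s > 1")
      case True
      define y where "y = r * s"
      have y: "y > 1" using True by (simp add: y_def)
      have k: "real ?m \<ge> 1" by simp
      have L: "0 \<le> ln y" "ln y \<le> y - 1" using y ln_le_minus_one[of y] by auto
      have 1: "0 \<le> (y - 1) / (real ?m + 1)" using y by simp
      have 2: "(y - 1) / (real ?m + 1) \<le> (y - 1) / 1"
        by (rule divide_left_mono) (use y in auto)
      have pw: "0 \<le> (1 / y) ^ ?m \<and> (1 / y) ^ ?m \<le> 1"
        by (intro conjI zero_le_power power_le_one) (use y in auto)
      have den: "real ?m * (real ?m + 1) \<ge> 1"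
        using mult_mono[of 1 "real ?m" 1 "real ?m + 1"] by simp
      have 3: "0 \<le> (1 - (1 / y) ^ ?m) / (real ?m * (real ?m + 1))"
        by (rule divide_nonneg_nonneg) (use pw den in linarith)+
      have 4: "(1 - (1 / y) ^ ?m) / (real ?m * (real ?m + 1)) \<le> 1 / 1"
        by (rule frac_le) (use pw den in linarith)+
      have ar: "\<bar>y - 1 - L - a + b\<bar> \<le> 2 * y" if "0 \<le> L" "L \<le> y - 1" "0 \<le> a" "a \<le> (y - 1) / 1" "0 \<le> b" "b \<le> 1 / 1" for L a b :: real
        using that y by (simp add: abs_le_iff)
      have "\<bar>prof ?m y\<bar> \<le> 2 * y" unfolding prof_def by (rule ar[OF L 1 2 3 4])
      then show ?thesis using y by (simp add: \<Phi>_def y_def mult.assoc)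
    next
      case False
      then show ?thesis using s r by (simp add: \<Phi>_def max_def prof_at_1)
    qed
    have lim: "((\<lambda>s. \<Phi> ?m s / s) \<longlongrightarrow> r - r / (real ?m + 1)) at_top"
    proof -
      have k: "real ?m > 0" by simp
      define k where "k = real ?m"
      have k0: "k > 0" by (simp add: k_def)
      have p1: "((\<lambda>s. ((r * s - 1 - ln (r * s)) - (r * s - 1) / (k + 1)) / s) \<longlongrightarrow> r - r * inverse (k + 1)) at_top"
        using r k0 by real_asymp
      have p2: "((\<lambda>s. (1 - (1 / (r * s)) ^ ?m) / (k * (k + 1)) / s) \<longlongrightarrow> 0) at_top"
      proof (rule Lim_null_comparison)
        show "\<forall>\<^sub>F s in at_top. norm ((1 - (1 / (r * s)) ^ ?m) / (k * (k + 1)) / s) \<le> (1 / (k * (k + 1))) / s"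
          using eventually_gt_at_top[of "max 1 (1 / r)"]
        proof eventually_elim
          case (elim s)
          then have rs: "r * s > 1" using r by (simp add: pos_divide_less_eq mult.commute)
          have "0 \<le> (1 / (r * s)) ^ ?m \<and> (1 / (r * s)) ^ ?m \<le> 1"
            by (intro conjI zero_le_power power_le_one) (use rs in auto)
          then have "\<bar>1 - (1 / (r * s)) ^ ?m\<bar> \<le> 1" by linarith
          then have "\<bar>1 - (1 / (r * s)) ^ ?m\<bar> / (k * (k + 1)) / s \<le> 1 / (k * (k + 1)) / s"
            using elim k0 by (intro divide_right_mono) auto
          then show ?case using elim k0 by (simp add: abs_divide abs_mult)
        qed
        show "((\<lambda>s. (1 / (k * (k + 1))) / s) \<longlongrightarrow> 0) at_top" by real_asymp
      qed
      have "((\<lambda>s. prof ?m (r * s) / s) \<longlongrightarrow> (r - r * inverse (k + 1)) + 0) at_top"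
        using tendsto_add[OF p1 p2] by (simp add: prof_def k_def add_divide_distrib)
      moreover have "\<forall>\<^sub>F s in at_top. prof ?m (r * s) / s = \<Phi> ?m s / s"
        using eventually_gt_at_top[of "1 / r"]
      proof eventually_elim
        case (elim s)
        then have "r * s > 1" using r by (simp add: pos_divide_less_eq mult.commute)
        then show ?case by (simp add: \<Phi>_def)
      qed
      ultimately have "((\<lambda>s. \<Phi> ?m s / s) \<longlongrightarrow> (r - r * inverse (k + 1)) + 0) at_top" by (rule Lim_transform_eventually)
      then show ?thesis unfolding k_def by (simp add: divide_inverse)
    qed
    have rp: "1 / r > 0" using r by simp
    show ?thesis
      using ball_potential_general[where \<rho> = "1 / r", OF lt rp d1 d2 c nn z gr lim] unfolding g_def G_def by blast
  qed
  have G0: "G z \<ge> 0" and W0: "?W z \<ge> 0" for z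
    unfolding G_def by (rule hk_nonneg, rule d.Wq_nonneg)
  let ?J = "\<lambda>z. G z * (indicator {z. g z > 1 / r} z * ?W z)"
  have gi: "r * g z > 1 \<longleftrightarrow> z \<in> {z. g z > 1 / r}" for z
    using r by (simp add: pos_divide_less_eq mult.commute)
  have mono: "AE z in lborel. mono (\<lambda>n. ?I n z)"
  proof (intro AE_I2 monoI)
    fix z :: "'n spacetime" and m n :: nat assume mn: "m \<le> n"
    have "\<Phi>2 (Suc m) (g z) * (g z)\<^sup>2 \<le> \<Phi>2 (Suc n) (g z) * (g z)\<^sup>2"
    proof (cases "r * g z > 1")
      case True
      then have "(1 / (r * g z)) ^ Suc n \<le> (1 / (r * g z)) ^ Suc m"
        by (intro power_decreasing) (use mn in auto)
      then show ?thesis unfolding I2 using True by (simp del: power_Suc)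
    next
      case False
      then show ?thesis unfolding I2 by simp
    qed
    then show "?I m z \<le> ?I n z" by (rule mult_left_mono[OF mult_right_mono[OF _ W0] G0])
  qed
  have lim: "AE z in lborel. (\<lambda>n. ?I n z) \<longlonglongrightarrow> ?J z"
  proof (rule AE_I2)
    fix z :: "'n spacetime"
    have "(\<lambda>n. \<Phi>2 (Suc n) (g z) * (g z)\<^sup>2) \<longlonglongrightarrow> indicator {z. g z > 1 / r} z"
    proof (cases "r * g z > 1")
      case True
      then have "(\<lambda>n. (1 / (r * g z)) ^ n) \<longlonglongrightarrow> 0" by (intro LIMSEQ_power_zero) auto
      then have "(\<lambda>n. 1 - (1 / (r * g z)) ^ Suc n) \<longlonglongrightarrow> 1 - 0"
        by (intro tendsto_diff tendsto_const LIMSEQ_Suc)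
      then show ?thesis unfolding I2 using True gi[of z] by simp
    next
      case False
      then show ?thesis unfolding I2 using gi[of z] by simp
    qed
    then show "(\<lambda>n. ?I n z) \<longlonglongrightarrow> ?J z" by (intro tendsto_mult_left tendsto_mult_right)
  qed
  have ilim: "(\<lambda>n. \<integral>z. ?I n z \<partial>lborel) \<longlonglongrightarrow> r * g \<zeta> - ball_defect (r * g \<zeta>)"
  proof -
    define y where "y = max 1 (r * g \<zeta>)"
    have y: "y \<ge> 1" by (simp add: y_def)
    have p1: "(\<lambda>n. (y - 1 - ln y) - (y - 1) / (real (Suc n) + 1)) \<longlonglongrightarrow> y - 1 - ln y" by real_asymp
    have p2: "(\<lambda>n. (1 - (1 / y) ^ Suc n) / (real (Suc n) * (real (Suc n) + 1))) \<longlonglongrightarrow> 0"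
    proof (rule Lim_null_comparison)
      show "\<forall>\<^sub>F n in sequentially. norm ((1 - (1 / y) ^ Suc n) / (real (Suc n) * (real (Suc n) + 1))) \<le> 1 / (real (Suc n) * (real (Suc n) + 1))"
      proof (intro always_eventually allI)
        fix n
        have "0 \<le> (1 / y) ^ Suc n \<and> (1 / y) ^ Suc n \<le> 1"
          by (intro conjI zero_le_power power_le_one) (use y in auto)
        then have "\<bar>1 - (1 / y) ^ Suc n\<bar> \<le> 1" by linarith
        then show "norm ((1 - (1 / y) ^ Suc n) / (real (Suc n) * (real (Suc n) + 1))) \<le> 1 / (real (Suc n) * (real (Suc n) + 1))"
          unfolding real_norm_def abs_divide by (intro frac_le) (auto simp: abs_mult)
      qed
      show "(\<lambda>n. 1 / (real (Suc n) * (real (Suc n) + 1))) \<longlonglongrightarrow> 0" by real_asymp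
    qed
    have "(\<lambda>n. \<Phi> (Suc n) (g \<zeta>)) \<longlonglongrightarrow> (y - 1 - ln y) + 0"
      unfolding \<Phi>_def prof_def y_def[symmetric] by (rule tendsto_add[OF p1 p2])
    moreover have "(\<lambda>n. (r - r / (real (Suc n) + 1)) * g \<zeta>) \<longlonglongrightarrow> r * g \<zeta>" by real_asymp
    ultimately have "(\<lambda>n. (r - r / (real (Suc n) + 1)) * g \<zeta> - \<Phi> (Suc n) (g \<zeta>)) \<longlonglongrightarrow> r * g \<zeta> - ((y - 1 - ln y) + 0)"
      by (rule tendsto_diff[rotated])
    then show ?thesis using gen by (simp add: ball_defect_def Let_def y_def)
  qed
  have Jm: "?J \<in> borel_measurable lborel"
  proof -
    have [measurable]: "g \<in> borel_measurable borel" "G \<in> borel_measurable borel"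
      unfolding g_def G_def by (simp_all add: d.hk_measurable hk_measurable)
    have m: "(\<lambda>z. indicator {z. hs (-1) z0 z > 0} z * ?W z) \<in> borel_measurable borel" by (rule d.Wq_measurable)
    \<comment> \<open>Measurability of the kernel \<open>Wq\<close> is available on the past of
      \<open>z0\<close>, which contains the superlevel set.\<close>
    have "?J = (\<lambda>z. G z * (indicator {z. g z > 1 / r} z * (indicator {z. hs (-1) z0 z > 0} z * ?W z)))"
    proof
      fix z
      have "g z > 1 / r \<Longrightarrow> hs (-1) z0 z > 0"
        using hk_nonpos_time[of "-1" z z0 A "-B"] r unfolding g_def by (metis divide_pos_pos less_asym not_le zero_less_one)
      then show "?J z = G z * (indicator {z. g z > 1 / r} z * (indicator {z. hs (-1) z0 z > 0} z * ?W z))"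
        by (auto simp: indicator_def)
    qed
    then show ?thesis using m by simp
  qed
  have Ii: "integrable lborel (?I n)" for n using gen by blast
  show "integrable lborel ?J" "(\<integral>z. ?J z \<partial>lborel) = r * g \<zeta> - ball_defect (r * g \<zeta>)"
    using integrable_monotone_convergence[OF Ii mono lim ilim Jm] integral_monotone_convergence[OF Ii mono lim ilim Jm]
    by simp_all
qed

end

section \<open>Potentials of compactly supported functions\<close>

text \<open>According to whether x is at most y^(p-1) or not, one of the two powers alone dominates
  the product. The exponent of x is the conjugate of p; the constants of the sharp inequality are
  irrelevant since a free weight enters at its use.\<close>

lemma powr_young:
  fixes x y p :: real
  assumes "x \<ge> 0" "y \<ge> 0" "p > 1"
  shows "x * y \<le> x powr (1 + 1 / (p - 1)) + y powr p"
proof (cases "x \<le> y powr (p - 1)")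
  case True
  have "x * y \<le> y powr (p - 1) * y" by (rule mult_right_mono[OF True assms(2)])
  also have "\<dots> = y powr p" using powr_add[of y "p - 1" 1] assms by (cases "y = 0") auto
  finally show ?thesis by (simp add: add_increasing)
next
  case False
  then have x: "x > 0" using powr_ge_zero[of y "p - 1"] by linarith
  have "y = (y powr (p - 1)) powr (1 / (p - 1))" using assms by (simp add: powr_powr)
  also have "\<dots> \<le> x powr (1 / (p - 1))" using False assms by (intro powr_mono2) auto
  finally have "x * y \<le> x * x powr (1 / (p - 1))" by (intro mult_left_mono assms(1))
  also have "\<dots> = x powr (1 + 1 / (p - 1))" using x by (simp add: powr_add)
  finally show ?thesis by (simp add: add_increasing2)
qed

lemma nn_integral_powr_from_0:
  fixes b c :: real
  assumes "b < 1" "c \<ge> 0"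
  shows "(\<integral>\<^sup>+s. indicator {0<..} s * (indicator {..c} s * ennreal (s powr (-b))) \<partial>lborel) = ennreal (c powr (1 - b) / (1 - b))"
proof -
  have h: "((\<lambda>s. s powr (-b)) has_integral (c powr (- b + 1) / (- b + 1))) {0..c}"
    by (rule has_integral_powr_from_0) (use assms in auto)
  have "((\<lambda>s. if s \<in> {0..c} then s powr (-b) else 0) has_integral (c powr (- b + 1) / (- b + 1))) UNIV"
    by (subst has_integral_restrict_UNIV) (rule h)
  then have "(\<integral>\<^sup>+s. ennreal (if s \<in> {0..c} then s powr (-b) else 0) \<partial>lborel) = ennreal (c powr (- b + 1) / (- b + 1))"
    by (intro nn_integral_has_integral_lborel) auto
  moreover have "ennreal (if s \<in> {0..c} then s powr (-b) else 0) = indicator {0<..} s * (indicator {..c} s * ennreal (s powr (-b)))" for s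
    by (cases "s = 0") (auto simp: indicator_def)
  ultimately show ?thesis by (simp add: add.commute)
qed

lemma continuous_bounded_on:
  fixes f :: "'a::euclidean_space \<Rightarrow> real"
  assumes "continuous_on UNIV f" "bounded K"
  obtains C where "\<And>z. z \<in> K \<Longrightarrow> \<bar>f z\<bar> \<le> C"
proof -
  have "compact (f ` closure K)"
    by (rule compact_continuous_image[OF continuous_on_subset[OF assms(1)]]) (use assms(2) in auto)
  then have "bounded (f ` closure K)" by (rule compact_imp_bounded)
  then obtain C where "\<And>y. y \<in> f ` closure K \<Longrightarrow> norm y \<le> C" by (auto simp: bounded_iff)
  then show ?thesis using that[of C] closure_subset[of K] by auto
qed

lemma integrable_continuous_mult:
  fixes f c :: "'a::euclidean_space \<Rightarrow> real"
  assumes c: "continuous_on UNIV c" and f: "integrable lborel f" and K: "bounded K" "\<And>z. f z \<noteq> 0 \<Longrightarrow> z \<in> K"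
  shows "integrable lborel (\<lambda>z. c z * f z)"
proof -
  obtain C where C: "\<And>z. z \<in> K \<Longrightarrow> \<bar>c z\<bar> \<le> C" by (rule continuous_bounded_on[OF c K(1)]) blast
  have [measurable]: "c \<in> borel_measurable borel" "f \<in> borel_measurable borel"
    using c f by (auto intro: borel_measurable_continuous_onI)
  show ?thesis
  proof (rule Bochner_Integration.integrable_bound)
    show "integrable lborel (\<lambda>z. C * f z)" using f by simp
    have "\<bar>c z\<bar> * \<bar>f z\<bar> \<le> \<bar>C\<bar> * \<bar>f z\<bar>" for z
      using C[of z] K(2)[of z] by (cases "f z = 0") (auto intro!: mult_right_mono)
    then show "AE z in lborel. norm (c z * f z) \<le> norm (C * f z)" by (simp add: abs_mult)
  qed simp
qed

lemma continuous_slice: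
  assumes "continuous_on UNIV (\<lambda>q. k (fst q) (snd q))"
  shows "continuous_on UNIV (\<lambda>z. k z \<zeta>)"
proof -
  have "continuous_on UNIV (\<lambda>z. (z, \<zeta>))" by (intro continuous_intros)
  from continuous_on_compose2[OF assms this] show ?thesis by simp
qed

lemma continuous_potential:
  fixes k :: "'a::euclidean_space \<Rightarrow> 'a \<Rightarrow> real"
  assumes k: "continuous_on UNIV (\<lambda>q. k (fst q) (snd q))"
    and f: "integrable lborel f" and K: "bounded K" "\<And>z. f z \<noteq> 0 \<Longrightarrow> z \<in> K"
  shows "continuous_on UNIV (\<lambda>\<zeta>. \<integral>z. k z \<zeta> * f z \<partial>lborel)"
proof -
  have [measurable]: "f \<in> borel_measurable borel" using f by auto
  have km: "(\<lambda>z. k z \<zeta>) \<in> borel_measurable borel" for \<zeta>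
    by (intro borel_measurable_continuous_onI continuous_slice[OF k])
  have "isCont (\<lambda>\<zeta>. \<integral>z. k z \<zeta> * f z \<partial>lborel) \<zeta>" for \<zeta>
    unfolding continuous_at_sequentially o_def
  proof (intro allI impI)
    fix x assume x: "x \<longlonglongrightarrow> \<zeta>"
    have "bounded (range x)" using x by (intro convergent_imp_bounded) (auto simp: convergent_def)
    then have b: "bounded (K \<times> range x)" using K(1) by (intro bounded_Times)
    obtain C where C: "\<And>q. q \<in> K \<times> range x \<Longrightarrow> \<bar>k (fst q) (snd q)\<bar> \<le> C"
      by (rule continuous_bounded_on[OF k b]) blast
    show "(\<lambda>n. \<integral>z. k z (x n) * f z \<partial>lborel) \<longlonglongrightarrow> (\<integral>z. k z \<zeta> * f z \<partial>lborel)"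
    proof (rule integral_dominated_convergence[where w = "\<lambda>z. \<bar>C\<bar> * \<bar>f z\<bar>"])
      show "(\<lambda>z. k z \<zeta> * f z) \<in> borel_measurable lborel" "\<And>n. (\<lambda>z. k z (x n) * f z) \<in> borel_measurable lborel"
        using km by simp_all
      show "integrable lborel (\<lambda>z. \<bar>C\<bar> * \<bar>f z\<bar>)" using f by simp
      show "AE z in lborel. (\<lambda>n. k z (x n) * f z) \<longlonglongrightarrow> k z \<zeta> * f z"
      proof (intro AE_I2 tendsto_mult_right)
        fix z :: 'a
        have "(\<lambda>n. (z, x n)) \<longlonglongrightarrow> (z, \<zeta>)" by (intro tendsto_Pair tendsto_const x)
        from continuous_on_tendsto_compose[OF k, where g = "\<lambda>n. (z, x n)", OF this] show "(\<lambda>n. k z (x n)) \<longlonglongrightarrow> k z \<zeta>" by simp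
      qed
      have "\<bar>k z (x n)\<bar> * \<bar>f z\<bar> \<le> \<bar>C\<bar> * \<bar>f z\<bar>" for z n
        using C[of "(z, x n)"] K(2)[of z] by (cases "f z = 0") (auto intro!: mult_right_mono)
      then show "\<And>n. AE z in lborel. norm (k z (x n) * f z) \<le> \<bar>C\<bar> * \<bar>f z\<bar>" by (simp add: abs_mult)
    qed
  qed
  then show ?thesis by (simp add: continuous_on_eq_continuous_at)
qed

lemma along_at:
  assumes "good_flow \<Theta>" "along \<Theta> F F'"
  shows "((\<lambda>h. F (\<Theta> h z)) has_real_derivative F' (\<Theta> x z)) (at x)"
proof -
  have "((\<lambda>h. F (\<Theta> h (\<Theta> x z))) has_real_derivative F' (\<Theta> x z)) (at 0)" using assms(2) by (simp add: along_def)
  moreover have "\<Theta> h (\<Theta> x z) = \<Theta> (h + x) z" for h using assms(1) unfolding good_flow_def by (metis add.commute)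
  ultimately show ?thesis using DERIV_shift[of "\<lambda>h. F (\<Theta> h z)" "F' (\<Theta> x z)" 0 x] by simp
qed

text \<open>Applied to cut-off kernels, which are jointly continuous; their derivatives are bounded
  over the bounded support of \<open>f\<close> and flow times in [-1, 1].\<close>

lemma along_potential:
  fixes k k' :: "'a::euclidean_space \<Rightarrow> 'a \<Rightarrow> real"
  assumes k: "continuous_on UNIV (\<lambda>q. k (fst q) (snd q))" and k': "continuous_on UNIV (\<lambda>q. k' (fst q) (snd q))"
    and f: "integrable lborel f" and K: "bounded K" "\<And>z. f z \<noteq> 0 \<Longrightarrow> z \<in> K"
    and \<Theta>: "good_flow \<Theta>" and al: "\<And>z. along \<Theta> (k z) (k' z)"
  shows "along \<Theta> (\<lambda>\<zeta>. \<integral>z. k z \<zeta> * f z \<partial>lborel) (\<lambda>\<zeta>. \<integral>z. k' z \<zeta> * f z \<partial>lborel)"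
  unfolding along_def
proof
  fix \<zeta>
  have [measurable]: "f \<in> borel_measurable borel" using f by auto
  have cz: "continuous_on UNIV (\<lambda>z. k z \<zeta>)" "continuous_on UNIV (\<lambda>z. k' z \<zeta>)" for \<zeta>
    by (rule continuous_slice[OF k], rule continuous_slice[OF k'])
  then have km: "(\<lambda>z. k z \<zeta>) \<in> borel_measurable borel" "(\<lambda>z. k' z \<zeta>) \<in> borel_measurable borel" for \<zeta>
    by (auto intro!: borel_measurable_continuous_onI)
  have \<Theta>0: "\<Theta> 0 \<zeta> = \<zeta>" and \<Theta>c: "continuous_on UNIV (\<lambda>p. \<Theta> (fst p) (snd p))" using \<Theta> by (auto simp: good_flow_def)
  have "continuous_on UNIV (\<lambda>q :: 'a \<times> real. (snd q, \<zeta>))" by (intro continuous_intros)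
  from continuous_on_compose2[OF \<Theta>c this] have "continuous_on UNIV (\<lambda>q :: 'a \<times> real. \<Theta> (snd q) \<zeta>)" by simp
  then have "continuous_on UNIV (\<lambda>q :: 'a \<times> real. (fst q, \<Theta> (snd q) \<zeta>))" by (intro continuous_intros)
  from continuous_on_compose2[OF k' this] have c: "continuous_on UNIV (\<lambda>q. k' (fst q) (\<Theta> (snd q) \<zeta>))" by simp
  have b: "bounded (K \<times> {-1..1::real})" using K(1) by (intro bounded_Times) auto
  obtain C where C: "\<And>q. q \<in> K \<times> {-1..1::real} \<Longrightarrow> \<bar>k' (fst q) (\<Theta> (snd q) \<zeta>)\<bar> \<le> C"
    by (rule continuous_bounded_on[OF c b]) blast
  have "((\<lambda>x. \<integral>z. k z (\<Theta> x \<zeta>) * f z \<partial>lborel) has_real_derivative (\<integral>z. k' z (\<Theta> 0 \<zeta>) * f z \<partial>lborel)) (at 0)"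
  proof (rule DERIV_under_integral[where d = 1 and C = C])
    show "(\<lambda>a. k a (\<Theta> x \<zeta>) * f a) \<in> borel_measurable lborel" for x using km by simp
    show "(\<lambda>a. k' a (\<Theta> 0 \<zeta>) * f a) \<in> borel_measurable lborel" using km by simp
    show "integrable lborel (\<lambda>a. k a (\<Theta> 0 \<zeta>) * f a)" by (rule integrable_continuous_mult[OF cz(1) f K])
    show "((\<lambda>x. k a (\<Theta> x \<zeta>)) has_real_derivative k' a (\<Theta> x \<zeta>)) (at x)" for x a by (rule along_at[OF \<Theta> al])
    fix x :: real and a assume x: "\<bar>x - 0\<bar> < 1" and "f a \<noteq> 0"
    then have "a \<in> K" using K(2) by blast
    then show "\<bar>k' a (\<Theta> x \<zeta>)\<bar> \<le> C" using C[of "(a, x)"] x by (auto simp: abs_less_iff)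
  qed (use f in auto)
  then show "((\<lambda>h. \<integral>z. k z (\<Theta> h \<zeta>) * f z \<partial>lborel) has_real_derivative (\<integral>z. k' z \<zeta> * f z \<partial>lborel)) (at 0)"
    by (simp add: \<Theta>0)
qed

lemma continuous_time_cut2:
  fixes c :: "real \<Rightarrow> real" and f :: "'n::finite spacetime \<times> 'n spacetime \<Rightarrow> real"
  assumes "continuous_on UNIV c" "\<And>v. v \<le> 1 \<Longrightarrow> c v = 0" "\<epsilon> > 0"
    and f: "continuous_on {q. hs \<sigma> (fst q) (snd q) > 0} f"
  shows "continuous_on UNIV (\<lambda>q. c (hs \<sigma> (fst q) (snd q) / \<epsilon>) * f q)"
proof (rule continuous_on_UNIV_zero[of "{q. hs \<sigma> (fst q) (snd q) > 0}" "{q. hs \<sigma> (fst q) (snd q) < \<epsilon>}"])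
  let ?s = "\<lambda>q :: 'n spacetime \<times> 'n spacetime. hs \<sigma> (fst q) (snd q)"
  show "open {q. ?s q > 0}" "open {q. ?s q < \<epsilon>}" by (intro open_Collect_less continuous_intros)+
  show "{q. ?s q > 0} \<union> {q. ?s q < \<epsilon>} = UNIV" using assms(3) by auto
  have "\<epsilon> \<noteq> 0" using assms(3) by simp
  then have "continuous_on {q. ?s q > 0} (\<lambda>q. ?s q / \<epsilon>)" by (intro continuous_intros) simp
  from continuous_on_compose2[OF assms(1) this] have "continuous_on {q. ?s q > 0} (\<lambda>q. c (?s q / \<epsilon>))" by simp
  then show "continuous_on {q. ?s q > 0} (\<lambda>q. c (?s q / \<epsilon>) * f q)" by (rule continuous_on_mult[OF _ f])
  show "c (?s q / \<epsilon>) * f q = 0" if "q \<in> {q. ?s q < \<epsilon>}" for q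
    using assms(2)[of "?s q / \<epsilon>"] that assms(3) by (simp add: field_simps)
qed

section \<open>Smallness near the pole and continuity of the potential\<close>

context kolm begin

lemma continuous_cut_hk2:
  assumes c: "c = cutoff \<or> c = cutoff'" and \<epsilon>: "\<epsilon> > 0"
  shows "continuous_on UNIV (\<lambda>q. c (hs \<sigma> (fst q) (snd q) / \<epsilon>) * hk A B \<sigma> (fst q) (snd q))"
    and "continuous_on UNIV (\<lambda>q. c (hs \<sigma> (fst q) (snd q) / \<epsilon>) * hk1 A B \<sigma> (fst q) a (snd q))"
    and "continuous_on UNIV (\<lambda>q. c (hs \<sigma> (fst q) (snd q) / \<epsilon>) * hk2 A B \<sigma> (fst q) a (snd q))"
    and "continuous_on UNIV (\<lambda>q. c (hs \<sigma> (fst q) (snd q) / \<epsilon>) * hkT A B \<sigma> (fst q) (snd q))"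
proof -
  have cc: "continuous_on UNIV c" "\<And>v. v \<le> 1 \<Longrightarrow> c v = 0"
    using c cutoff_eq_0 cutoff'_eq_0 by (auto intro!: continuous_intros simp: continuous_on_id)
  note H = continuous_hk[OF continuous_on_fst[OF continuous_on_id] continuous_on_snd[OF continuous_on_id],
    of "{q. hs \<sigma> (fst q) (snd q) > 0}" \<sigma>]
  show "continuous_on UNIV (\<lambda>q. c (hs \<sigma> (fst q) (snd q) / \<epsilon>) * hk A B \<sigma> (fst q) (snd q))"
    by (rule continuous_time_cut2[OF cc \<epsilon> H(1)]) auto
  show "continuous_on UNIV (\<lambda>q. c (hs \<sigma> (fst q) (snd q) / \<epsilon>) * hk1 A B \<sigma> (fst q) a (snd q))"
    by (rule continuous_time_cut2[OF cc \<epsilon> H(2)]) auto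
  show "continuous_on UNIV (\<lambda>q. c (hs \<sigma> (fst q) (snd q) / \<epsilon>) * hk2 A B \<sigma> (fst q) a (snd q))"
    by (rule continuous_time_cut2[OF cc \<epsilon> H(3)]) auto
  show "continuous_on UNIV (\<lambda>q. c (hs \<sigma> (fst q) (snd q) / \<epsilon>) * hkT A B \<sigma> (fst q) (snd q))"
    by (rule continuous_time_cut2[OF cc \<epsilon> H(4)]) auto
qed

lemma hk_powr_bound:
  assumes s: "hs \<sigma> p z > 0" and "a \<ge> 0"
  shows "hk A B \<sigma> p z powr (1 + a) \<le> hk A B \<sigma> p z * (gamma_const powr a * hs \<sigma> p z powr (- (hdim / 2 * a)))"
proof -
  have "hk A B \<sigma> p z powr (1 + a) = hk A B \<sigma> p z * hk A B \<sigma> p z powr a"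
    using hk_pos[OF s] by (simp add: powr_add)
  also have "\<dots> \<le> hk A B \<sigma> p z * peak (hs \<sigma> p z) powr a"
    using hk_le_peak[OF s] hk_nonneg assms(2) by (intro mult_left_mono powr_mono2) auto
  also have "peak (hs \<sigma> p z) powr a = gamma_const powr a * hs \<sigma> p z powr (- (hdim / 2 * a))"
    unfolding peak_def using gamma_const_pos by (subst powr_mult) (auto simp: powr_powr)
  finally show ?thesis .
qed

text \<open>The place where p > Q/2 = hdim/2 + 1 enters. Young's inequality is applied to
  (kernel/\<mu>) (\<mu> |f|); all but one power of the kernel is replaced by its height, and
  integrating out space leaves the integral of s^(-b) over (0, \<epsilon>], finite exactly because b
  < 1. The bound does not depend on the pole.\<close>

lemma near_pole_estimate:
  fixes f :: "'n spacetime \<Rightarrow> real"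
  assumes [measurable]: "f \<in> borel_measurable borel" and p: "p > hdim / 2 + 1"
    and F: "integrable lborel (\<lambda>z. \<bar>f z\<bar> powr p)" and la: "\<mu> > 0" and \<epsilon>: "\<epsilon> \<ge> 0"
  defines "b \<equiv> hdim / 2 * (1 / (p - 1))"
  shows "(\<integral>\<^sup>+z. ennreal (hk A B 1 \<zeta> z * (indicator {..\<epsilon>} (hs 1 \<zeta> z) * \<bar>f z\<bar>)) \<partial>lborel)
    \<le> ennreal ((\<mu> powr (- (1 + 1 / (p - 1))) * gamma_const powr (1 / (p - 1))) * (\<epsilon> powr (1 - b) / (1 - b)))
      + ennreal (\<mu> powr p * (\<integral>z. \<bar>f z\<bar> powr p \<partial>lborel))"
proof -
  let ?a = "1 / (p - 1)"
  define c where "c = \<mu> powr (- (1 + ?a)) * gamma_const powr ?a"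
  have p1: "p > 1" using p by (simp add: add_pos_nonneg le_less_trans[of 1 "hdim / 2 + 1"])
  have b1: "b < 1" unfolding b_def using p p1 by (simp add: pos_divide_less_eq)
  have c0: "c \<ge> 0" by (simp add: c_def)
  let ?\<phi> = "\<lambda>s. ennreal c * (indicator {..\<epsilon>} s * ennreal (s powr (- b)))"
  have pw: "ennreal (hk A B 1 \<zeta> z * (indicator {..\<epsilon>} (hs 1 \<zeta> z) * \<bar>f z\<bar>))
     \<le> ennreal (hk A B 1 \<zeta> z) * ?\<phi> (hs 1 \<zeta> z) + ennreal (\<mu> powr p * \<bar>f z\<bar> powr p)" for z
  proof (cases "hs 1 \<zeta> z > 0 \<and> hs 1 \<zeta> z \<le> \<epsilon>")
    case True
    let ?h = "hk A B 1 \<zeta> z" and ?s = "hs 1 \<zeta> z"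
    have h0: "?h \<ge> 0" by (rule hk_nonneg)
    have "?h * \<bar>f z\<bar> = (?h / \<mu>) * (\<mu> * \<bar>f z\<bar>)" using la by simp
    also have "\<dots> \<le> (?h / \<mu>) powr (1 + ?a) + (\<mu> * \<bar>f z\<bar>) powr p"
      by (rule powr_young) (use la h0 p1 in auto)
    also have "(?h / \<mu>) powr (1 + ?a) = \<mu> powr (- (1 + ?a)) * ?h powr (1 + ?a)"
      using la h0 by (subst powr_divide) (auto simp: powr_minus divide_inverse mult.commute simp del: minus_add_distrib)
    also have "\<dots> \<le> \<mu> powr (- (1 + ?a)) * (?h * (gamma_const powr ?a * ?s powr (- b)))"
      unfolding b_def using True p1 by (intro mult_left_mono hk_powr_bound) auto
    also have "\<dots> = ?h * (c * ?s powr (- b))" by (simp add: c_def)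
    also have "(\<mu> * \<bar>f z\<bar>) powr p = \<mu> powr p * \<bar>f z\<bar> powr p" using la by (simp add: powr_mult)
    finally have e: "?h * \<bar>f z\<bar> \<le> ?h * (c * ?s powr (- b)) + \<mu> powr p * \<bar>f z\<bar> powr p" by simp
    have "ennreal (?h * (c * ?s powr (- b)) + \<mu> powr p * \<bar>f z\<bar> powr p) = ennreal ?h * (ennreal c * ennreal (?s powr (- b))) + ennreal (\<mu> powr p * \<bar>f z\<bar> powr p)"
      using h0 c0 by (simp add: ennreal_plus ennreal_mult)
    then show ?thesis using True ennreal_leI[OF e] by simp
  next
    case False
    then consider "hk A B 1 \<zeta> z = 0" | "indicator {..\<epsilon>} (hs 1 \<zeta> z) = (0 :: real)"
      using hk_nonpos_time[of 1 z \<zeta> A B] by (auto simp: indicator_def not_less)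
    then show ?thesis by cases simp_all
  qed
  have [measurable]: "(\<lambda>s. s powr (- b)) \<in> borel_measurable borel" by simp
  have fs [measurable]: "(\<lambda>z :: 'n spacetime. hs 1 \<zeta> z) \<in> borel_measurable borel"
    by (intro borel_measurable_continuous_onI continuous_intros)
  have [measurable]: "hk A B 1 \<zeta> \<in> borel_measurable borel" by (rule hk_measurable)
  have m\<phi>: "?\<phi> \<in> borel_measurable borel" by measurable
  have "(\<integral>\<^sup>+z. ennreal (hk A B 1 \<zeta> z * (indicator {..\<epsilon>} (hs 1 \<zeta> z) * \<bar>f z\<bar>)) \<partial>lborel)
     \<le> (\<integral>\<^sup>+z. ennreal (hk A B 1 \<zeta> z) * ?\<phi> (hs 1 \<zeta> z) + ennreal (\<mu> powr p * \<bar>f z\<bar> powr p) \<partial>lborel)"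
    by (intro nn_integral_mono pw)
  also have "\<dots> = (\<integral>\<^sup>+z. ennreal (hk A B 1 \<zeta> z) * ?\<phi> (hs 1 \<zeta> z) \<partial>lborel) + (\<integral>\<^sup>+z. ennreal (\<mu> powr p * \<bar>f z\<bar> powr p) \<partial>lborel)"
    by (rule nn_integral_add) measurable
  also have "(\<integral>\<^sup>+z. ennreal (hk A B 1 \<zeta> z) * ?\<phi> (hs 1 \<zeta> z) \<partial>lborel) = (\<integral>\<^sup>+s. indicator {0<..} s * ?\<phi> s \<partial>lborel)"
    by (rule hk_time_integral[OF _ m\<phi>]) simp
  also have "\<dots> = (\<integral>\<^sup>+s. ennreal c * (indicator {0<..} s * (indicator {..\<epsilon>} s * ennreal (s powr (- b)))) \<partial>lborel)"
    by (intro nn_integral_cong) (simp add: mult_ac)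
  also have "\<dots> = ennreal c * (\<integral>\<^sup>+s. indicator {0<..} s * (indicator {..\<epsilon>} s * ennreal (s powr (- b))) \<partial>lborel)"
    by (rule nn_integral_cmult) measurable
  also have "\<dots> = ennreal (c * (\<epsilon> powr (1 - b) / (1 - b)))"
    unfolding nn_integral_powr_from_0[OF b1 \<epsilon>] using c0 b1 by (intro ennreal_mult[symmetric]) auto
  also have "(\<integral>\<^sup>+z. ennreal (\<mu> powr p * \<bar>f z\<bar> powr p) \<partial>lborel) = ennreal (\<mu> powr p * (\<integral>z. \<bar>f z\<bar> powr p \<partial>lborel))"
    using F by (subst nn_integral_eq_integral) auto
  finally show ?thesis unfolding c_def .
qed

lemma near_pole_small:
  fixes f :: "'n spacetime \<Rightarrow> real"
  assumes f: "f \<in> borel_measurable borel" and p: "p > hdim / 2 + 1"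
    and F: "integrable lborel (\<lambda>z. \<bar>f z\<bar> powr p)" and \<eta>: "\<eta> > 0"
  obtains \<epsilon> where "\<epsilon> > 0"
    "\<And>\<zeta>. (\<integral>\<^sup>+z. ennreal (hk A B 1 \<zeta> z * (indicator {..\<epsilon>} (hs 1 \<zeta> z) * \<bar>f z\<bar>)) \<partial>lborel) \<le> ennreal \<eta>"
proof -
  define b where "b = hdim / 2 * (1 / (p - 1))"
  define J where "J = (\<integral>z. \<bar>f z\<bar> powr p \<partial>lborel)"
  have J: "J \<ge> 0" by (simp add: J_def)
  have p1: "p > 1" using p by (simp add: add_pos_nonneg le_less_trans[of 1 "hdim / 2 + 1"])
  have b1: "b < 1" unfolding b_def using p p1 by (simp add: pos_divide_less_eq)
  \<comment> \<open>The weight is fixed first, making the L^p term at most \<eta>/2; J + 1 instead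
    of J avoids division by 0.\<close>
  define \<mu> where "\<mu> = (\<eta> / (2 * (J + 1))) powr (1 / p)"
  have la: "\<mu> > 0" using \<eta> J by (simp add: \<mu>_def)
  have "\<mu> powr p = \<eta> / (2 * (J + 1))" using p1 \<eta> J by (simp add: \<mu>_def powr_powr)
  then have "\<mu> powr p * J = \<eta> / 2 * (J / (J + 1))" by simp
  also have "\<dots> \<le> \<eta> / 2 * 1" using \<eta> J by (intro mult_left_mono) auto
  finally have l2: "\<mu> powr p * J \<le> \<eta> / 2" by simp
  define c where "c = \<mu> powr (- (1 + 1 / (p - 1))) * gamma_const powr (1 / (p - 1))"
  have c: "c > 0" unfolding c_def using la gamma_const_pos by simp
  \<comment> \<open>Solves c \<epsilon>^(1-b)/(1-b) = \<eta>/2 for the remaining half.\<close>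
  define \<epsilon> where "\<epsilon> = (\<eta> * (1 - b) / (2 * c)) powr (1 / (1 - b))"
  have \<epsilon>: "\<epsilon> > 0" using \<eta> b1 c by (simp add: \<epsilon>_def)
  have "\<epsilon> powr (1 - b) = \<eta> * (1 - b) / (2 * c)" using \<eta> b1 c by (simp add: \<epsilon>_def powr_powr)
  then have l1: "c * (\<epsilon> powr (1 - b) / (1 - b)) = \<eta> / 2" using b1 c by simp
  show ?thesis
  proof (rule that[OF \<epsilon>])
    fix \<zeta>
    have "(\<integral>\<^sup>+z. ennreal (hk A B 1 \<zeta> z * (indicator {..\<epsilon>} (hs 1 \<zeta> z) * \<bar>f z\<bar>)) \<partial>lborel)
      \<le> ennreal (c * (\<epsilon> powr (1 - b) / (1 - b))) + ennreal (\<mu> powr p * J)"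
      unfolding c_def b_def J_def by (rule near_pole_estimate[OF f p F la]) (use \<epsilon> in simp)
    also have "\<dots> \<le> ennreal (\<eta> / 2) + ennreal (\<eta> / 2)" unfolding l1 by (intro add_left_mono ennreal_leI l2)
    also have "\<dots> = ennreal \<eta>" using \<eta> by (simp flip: ennreal_plus)
    finally show "(\<integral>\<^sup>+z. ennreal (hk A B 1 \<zeta> z * (indicator {..\<epsilon>} (hs 1 \<zeta> z) * \<bar>f z\<bar>)) \<partial>lborel) \<le> ennreal \<eta>" .
  qed
qed

definition pot :: "('n spacetime \<Rightarrow> real) \<Rightarrow> 'n spacetime \<Rightarrow> real"
  where "pot f \<zeta> = (\<integral>z. hk A B 1 \<zeta> z * f z \<partial>lborel)"

text \<open>The kernel is written with \<open>z\<close> as the pole of the adjoint family because it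
  is going to be differentiated in \<zeta>; \<open>hk_swap\<close> identifies it with the kernel in
  \<open>pot\<close>.\<close>

definition cut_pot :: "real \<Rightarrow> ('n spacetime \<Rightarrow> real) \<Rightarrow> 'n spacetime \<Rightarrow> real"
  where "cut_pot \<epsilon> f \<zeta> = (\<integral>z. (cutoff (hs (-1) z \<zeta> / \<epsilon>) * hk A (-B) (-1) z \<zeta>) * f z \<partial>lborel)"

lemma cut_hk_bound:
  assumes "\<epsilon> > 0"
  shows "\<bar>cutoff (hs 1 \<zeta> z / \<epsilon>) * hk A B 1 \<zeta> z\<bar> \<le> peak \<epsilon>"
proof (cases "hs 1 \<zeta> z > \<epsilon>")
  case True
  then have s: "hs 1 \<zeta> z > 0" using assms by linarith
  have "hk A B 1 \<zeta> z \<le> peak \<epsilon>"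
    using hk_le_peak[OF s] peak_antimono[OF assms, of "hs 1 \<zeta> z"] True by linarith
  then have "cutoff (hs 1 \<zeta> z / \<epsilon>) * hk A B 1 \<zeta> z \<le> 1 * peak \<epsilon>"
    by (intro mult_mono) (simp_all add: cutoff_le_1 cutoff_nonneg hk_nonneg)
  then show ?thesis by (simp add: abs_mult cutoff_nonneg hk_nonneg)
next
  case False
  then have "cutoff (hs 1 \<zeta> z / \<epsilon>) = 0" using assms by (intro cutoff_eq_0) (simp add: pos_divide_le_eq)
  then show ?thesis using peak_pos[OF assms] by simp
qed

lemma hs_back: "hs (-1) z \<zeta> = hs 1 \<zeta> z" by simp

context
  fixes f :: "'n spacetime \<Rightarrow> real" and p :: real and K
  assumes f: "integrable lborel f" and p: "p > hdim / 2 + 1"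
    and F: "integrable lborel (\<lambda>z. \<bar>f z\<bar> powr p)" and K: "bounded K" "\<And>z. f z \<noteq> 0 \<Longrightarrow> z \<in> K"
begin

lemma f_measurable [measurable]: "f \<in> borel_measurable borel" using f by auto

lemma cut_integrable:
  assumes "\<epsilon> > 0"
  shows "integrable lborel (\<lambda>z. (cutoff (hs 1 \<zeta> z / \<epsilon>) * hk A B 1 \<zeta> z) * f z)"
proof (rule Bochner_Integration.integrable_bound)
  show "integrable lborel (\<lambda>z. peak \<epsilon> * f z)" using f by simp
  have "continuous_on UNIV (\<lambda>z. cutoff (hs 1 \<zeta> z / \<epsilon>) * hk A B 1 \<zeta> z)" by (rule continuous_cut_hk(1)[OF _ assms]) simp
  then have "(\<lambda>z. cutoff (hs 1 \<zeta> z / \<epsilon>) * hk A B 1 \<zeta> z) \<in> borel_measurable borel" by (rule borel_measurable_continuous_onI)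
  then show "(\<lambda>z. (cutoff (hs 1 \<zeta> z / \<epsilon>) * hk A B 1 \<zeta> z) * f z) \<in> borel_measurable lborel" by simp
  have "\<bar>cutoff (hs 1 \<zeta> z / \<epsilon>) * hk A B 1 \<zeta> z\<bar> * \<bar>f z\<bar> \<le> \<bar>peak \<epsilon>\<bar> * \<bar>f z\<bar>" for z
    by (rule mult_right_mono[OF order_trans[OF cut_hk_bound[OF assms] abs_ge_self]]) simp
  then show "AE z in lborel. norm ((cutoff (hs 1 \<zeta> z / \<epsilon>) * hk A B 1 \<zeta> z) * f z) \<le> norm (peak \<epsilon> * f z)"
    by (simp add: abs_mult)
qed

lemma cut_remainder:
  assumes "\<epsilon> > 0"
  shows "\<bar>(1 - cutoff (hs 1 \<zeta> z / \<epsilon>)) * (hk A B 1 \<zeta> z * f z)\<bar> \<le> hk A B 1 \<zeta> z * (indicator {..2 * \<epsilon>} (hs 1 \<zeta> z) * \<bar>f z\<bar>)"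
proof (cases "hs 1 \<zeta> z \<le> 2 * \<epsilon>")
  case True
  have "(1 - cutoff (hs 1 \<zeta> z / \<epsilon>)) * (hk A B 1 \<zeta> z * \<bar>f z\<bar>) \<le> 1 * (hk A B 1 \<zeta> z * \<bar>f z\<bar>)"
    by (intro mult_right_mono) (simp_all add: cutoff_nonneg hk_nonneg)
  then show ?thesis using True by (simp add: abs_mult cutoff_le_1 hk_nonneg)
next
  case False
  then have "cutoff (hs 1 \<zeta> z / \<epsilon>) = 1" using assms by (intro cutoff_eq_1) (simp add: pos_le_divide_eq)
  then show ?thesis using False by simp
qed

lemma remainder_integrable:
  assumes \<epsilon>: "\<epsilon> > 0" and \<eta>: "\<eta> \<ge> 0"
    and n: "(\<integral>\<^sup>+z. ennreal (hk A B 1 \<zeta> z * (indicator {..2 * \<epsilon>} (hs 1 \<zeta> z) * \<bar>f z\<bar>)) \<partial>lborel) \<le> ennreal \<eta>"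
  shows "integrable lborel (\<lambda>z. (1 - cutoff (hs 1 \<zeta> z / \<epsilon>)) * (hk A B 1 \<zeta> z * f z))"
    and "\<bar>\<integral>z. (1 - cutoff (hs 1 \<zeta> z / \<epsilon>)) * (hk A B 1 \<zeta> z * f z) \<partial>lborel\<bar> \<le> \<eta>"
proof -
  let ?R = "\<lambda>z. (1 - cutoff (hs 1 \<zeta> z / \<epsilon>)) * (hk A B 1 \<zeta> z * f z)"
  have [measurable]: "hk A B 1 \<zeta> \<in> borel_measurable borel" by (rule hk_measurable)
  have "continuous_on UNIV (\<lambda>z :: 'n spacetime. cutoff (hs 1 \<zeta> z / \<epsilon>))" using \<epsilon> by (intro continuous_intros) auto
  then have [measurable]: "(\<lambda>z :: 'n spacetime. cutoff (hs 1 \<zeta> z / \<epsilon>)) \<in> borel_measurable borel"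
    by (rule borel_measurable_continuous_onI)
  have m: "?R \<in> borel_measurable lborel" by measurable
  have b: "(\<integral>\<^sup>+z. ennreal \<bar>?R z\<bar> \<partial>lborel) \<le> ennreal \<eta>"
    by (rule order_trans[OF nn_integral_mono n]) (intro ennreal_leI cut_remainder[OF \<epsilon>])
  show i: "integrable lborel ?R"
    by (rule integrableI_bounded[OF m]) (use b in \<open>auto simp: le_less_trans\<close>)
  have "ennreal (\<integral>z. \<bar>?R z\<bar> \<partial>lborel) \<le> ennreal \<eta>"
    using b i by (subst nn_integral_eq_integral[symmetric]) auto
  then have "(\<integral>z. \<bar>?R z\<bar> \<partial>lborel) \<le> \<eta>" using \<eta> by simp
  then show "\<bar>\<integral>z. ?R z \<partial>lborel\<bar> \<le> \<eta>" using integral_abs_bound[of lborel ?R] by linarith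
qed

lemma pot_integrable: "integrable lborel (\<lambda>z. hk A B 1 \<zeta> z * f z)"
proof -
  obtain \<epsilon> where \<epsilon>: "\<epsilon> > 0" and n: "\<And>\<zeta>. (\<integral>\<^sup>+z. ennreal (hk A B 1 \<zeta> z * (indicator {..\<epsilon>} (hs 1 \<zeta> z) * \<bar>f z\<bar>)) \<partial>lborel) \<le> ennreal 1"
    by (rule near_pole_small[OF f_measurable p F zero_less_one]) blast
  have "integrable lborel (\<lambda>z. (1 - cutoff (hs 1 \<zeta> z / (\<epsilon> / 2))) * (hk A B 1 \<zeta> z * f z))"
    by (rule remainder_integrable(1)[where \<eta> = 1]) (use n[of \<zeta>] \<epsilon> in auto)
  moreover have "integrable lborel (\<lambda>z. (cutoff (hs 1 \<zeta> z / (\<epsilon> / 2)) * hk A B 1 \<zeta> z) * f z)"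
    by (rule cut_integrable) (use \<epsilon> in simp)
  ultimately have "integrable lborel (\<lambda>z. (1 - cutoff (hs 1 \<zeta> z / (\<epsilon> / 2))) * (hk A B 1 \<zeta> z * f z) + (cutoff (hs 1 \<zeta> z / (\<epsilon> / 2)) * hk A B 1 \<zeta> z) * f z)"
    by (rule Bochner_Integration.integrable_add)
  then show ?thesis by (simp add: algebra_simps)
qed

text \<open>The remainder lives at elapsed times up to twice the cutoff scale, so half of the scale
  from \<open>near_pole_small\<close> works, uniformly in the pole. Continuity of
  \<open>pot f\<close> is then inherited from the continuous cut-off potentials.\<close>

lemma cut_pot_uniform:
  assumes "\<eta> > 0"
  obtains \<epsilon>0 where "\<epsilon>0 > 0" "\<And>\<epsilon> \<zeta>. 0 < \<epsilon> \<Longrightarrow> \<epsilon> \<le> \<epsilon>0 \<Longrightarrow> \<bar>pot f \<zeta> - cut_pot \<epsilon> f \<zeta>\<bar> \<le> \<eta>"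
proof -
  obtain \<epsilon>1 where \<epsilon>1: "\<epsilon>1 > 0" and n: "\<And>\<zeta>. (\<integral>\<^sup>+z. ennreal (hk A B 1 \<zeta> z * (indicator {..\<epsilon>1} (hs 1 \<zeta> z) * \<bar>f z\<bar>)) \<partial>lborel) \<le> ennreal \<eta>"
    by (rule near_pole_small[OF f_measurable p F assms]) blast
  show ?thesis
  proof (rule that[of "\<epsilon>1 / 2"])
    show "\<epsilon>1 / 2 > 0" using \<epsilon>1 by simp
    fix \<epsilon> \<zeta> assume \<epsilon>: "0 < \<epsilon>" "\<epsilon> \<le> \<epsilon>1 / 2"
    have "(\<integral>\<^sup>+z. ennreal (hk A B 1 \<zeta> z * (indicator {..2 * \<epsilon>} (hs 1 \<zeta> z) * \<bar>f z\<bar>)) \<partial>lborel)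
       \<le> (\<integral>\<^sup>+z. ennreal (hk A B 1 \<zeta> z * (indicator {..\<epsilon>1} (hs 1 \<zeta> z) * \<bar>f z\<bar>)) \<partial>lborel)"
    proof (intro nn_integral_mono ennreal_leI mult_left_mono mult_right_mono hk_nonneg abs_ge_zero)
      show "indicator {..2 * \<epsilon>} (hs 1 \<zeta> z) \<le> (indicator {..\<epsilon>1} (hs 1 \<zeta> z) :: real)" for z
        using \<epsilon> by (auto simp: indicator_def)
    qed
    also note n
    finally have "\<bar>\<integral>z. (1 - cutoff (hs 1 \<zeta> z / \<epsilon>)) * (hk A B 1 \<zeta> z * f z) \<partial>lborel\<bar> \<le> \<eta>"
      by (intro remainder_integrable(2)[OF \<epsilon>(1)]) (use assms in auto)
    moreover have "(\<integral>z. (1 - cutoff (hs 1 \<zeta> z / \<epsilon>)) * (hk A B 1 \<zeta> z * f z) \<partial>lborel) = pot f \<zeta> - cut_pot \<epsilon> f \<zeta>"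
      unfolding pot_def cut_pot_def hk_swap hs_back
      by (subst Bochner_Integration.integral_diff[OF pot_integrable cut_integrable[OF \<epsilon>(1)], symmetric]) (simp add: algebra_simps)
    ultimately show "\<bar>pot f \<zeta> - cut_pot \<epsilon> f \<zeta>\<bar> \<le> \<eta>" by simp
  qed
qed

lemma cut_pot_continuous: "\<epsilon> > 0 \<Longrightarrow> continuous_on UNIV (cut_pot \<epsilon> f)"
proof -
  interpret d: kolm A "-B" l by (rule dual)
  assume \<epsilon>: "\<epsilon> > 0"
  show ?thesis unfolding cut_pot_def[abs_def]
    by (rule continuous_potential[OF d.continuous_cut_hk2(1)[OF _ \<epsilon>] f K]) simp_all
qed

lemma pot_continuous: "continuous_on UNIV (pot f)"
proof -
  have "uniform_limit UNIV (\<lambda>n. cut_pot (1 / real (Suc n)) f) (pot f) sequentially"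
    unfolding uniform_limit_iff
  proof (intro allI impI)
    fix e :: real assume "e > 0"
    then have "e / 2 > 0" by simp
    then obtain \<epsilon>0 where \<epsilon>0: "\<epsilon>0 > 0" and u: "\<And>\<epsilon> \<zeta>. 0 < \<epsilon> \<Longrightarrow> \<epsilon> \<le> \<epsilon>0 \<Longrightarrow> \<bar>pot f \<zeta> - cut_pot \<epsilon> f \<zeta>\<bar> \<le> e / 2"
      by (rule cut_pot_uniform) blast
    have "(\<lambda>n. 1 / real (Suc n)) \<longlonglongrightarrow> 0" by real_asymp
    then have "\<forall>\<^sub>F n in sequentially. 1 / real (Suc n) < \<epsilon>0" using \<epsilon>0 by (rule order_tendstoD)
    then show "\<forall>\<^sub>F n in sequentially. \<forall>x\<in>UNIV. dist (cut_pot (1 / real (Suc n)) f x) (pot f x) < e"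
    proof eventually_elim
      case (elim n)
      show ?case
      proof
        fix x
        have "\<bar>pot f x - cut_pot (1 / real (Suc n)) f x\<bar> \<le> e / 2" using elim by (intro u) auto
        then show "dist (cut_pot (1 / real (Suc n)) f x) (pot f x) < e" using \<open>e > 0\<close> unfolding dist_real_def by linarith
      qed
    qed
  qed
  then show ?thesis
    by (rule uniform_limit_theorem[rotated]) (auto intro!: cut_pot_continuous always_eventually)
qed

end

end

section \<open>Weak equation and minimum principle\<close>

lemma second_derivative_local_min:
  fixes g :: "real \<Rightarrow> real"
  assumes g: "\<And>x. (g has_real_derivative g1 x) (at x)" and g1: "(g1 has_real_derivative g2) (at 0)"
    and d: "d > 0" "\<And>x. \<bar>x\<bar> < d \<Longrightarrow> g 0 \<le> g x"
  shows "g2 \<ge> 0"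
proof (rule ccontr)
  assume "\<not> g2 \<ge> 0"
  then have "g2 < 0" by simp
  have "g1 0 = 0" by (rule DERIV_local_min[OF g[of 0] d(1)]) (use d(2) in simp)
  obtain e where e: "e > 0" "\<And>h. 0 < h \<Longrightarrow> h < e \<Longrightarrow> g1 (0 + h) < g1 0"
    using DERIV_neg_dec_right[OF g1 \<open>g2 < 0\<close>] by blast
  define h where "h = min d e / 2"
  have h: "0 < h" "h < d" "h < e" using d(1) e(1) by (auto simp: h_def)
  obtain x where x: "0 < x" "x < h" "g h - g 0 = (h - 0) * g1 x"
    using MVT2[OF h(1), of g g1] g by blast
  have "g1 x < 0" using e(2)[of x] x h \<open>g1 0 = 0\<close> by simp
  then have "h * g1 x < 0" using h(1) by (rule mult_pos_neg[rotated])
  then have "g h < g 0" using x(3) by simp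
  then show False using d(2)[of h] h by simp
qed

lemma cutoff'_le: "cutoff' v \<le> 9"
proof (cases "v \<le> 2")
  case True
  have "max 0 (1 - max 0 (v - 1) ^ 3) ^ 2 \<le> (1 :: real)" by (rule power_le_one) (auto simp: max_def)
  moreover have "max 0 (v - 1) ^ 2 \<le> 1" by (rule power_le_one) (use True in \<open>auto simp: max_def\<close>)
  ultimately have "9 * (max 0 (1 - max 0 (v - 1) ^ 3) ^ 2 * max 0 (v - 1) ^ 2) \<le> 9 * (1 * 1)"
    by (intro mult_left_mono mult_mono) auto
  then show ?thesis by (simp add: cutoff'_def)
next
  case False
  then show ?thesis by (simp add: cutoff'_eq_0)
qed

lemma continuous_bounded_everywhere:
  fixes f :: "'a::euclidean_space \<Rightarrow> real"
  assumes "continuous_on UNIV f" "bounded K" "\<And>z. z \<notin> K \<Longrightarrow> f z = 0"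
  obtains C where "C \<ge> 0" "\<And>z. \<bar>f z\<bar> \<le> C"
proof -
  obtain C where C: "\<And>z. z \<in> K \<Longrightarrow> \<bar>f z\<bar> \<le> C" by (rule continuous_bounded_on[OF assms(1,2)]) blast
  have "\<bar>f z\<bar> \<le> \<bar>C\<bar>" for z
    using C[of z] assms(3)[of z] abs_ge_self[of C] abs_ge_zero[of C] by (cases "z \<in> K") linarith+
  then show ?thesis using that[of "\<bar>C\<bar>"] by simp
qed

lemma alongD: "along \<Theta> F F' \<Longrightarrow> ((\<lambda>h. F (\<Theta> h z)) has_real_derivative F' z) (at 0)"
  by (simp add: along_def)

lemma along_tflow_dual:
  assumes "along (tflow B 1) h h'"
  shows "along (tflow (- B) (-1)) h (\<lambda>z. - h' z)"
  unfolding along_def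
proof
  fix z
  have "((\<lambda>s. h (tflow B 1 s z)) has_real_derivative h' z) (at (- 0))"
    using alongD[OF assms, of z] by simp
  then have "((\<lambda>s. h (tflow B 1 (- s) z)) has_real_derivative - h' z) (at 0)"
    by (subst (asm) DERIV_mirror) simp
  then show "((\<lambda>s. h (tflow (- B) (-1) s z)) has_real_derivative - h' z) (at 0)" by (simp add: tflow_dual)
qed

section \<open>Test functions and the weak form of the equation\<close>

context kolm begin

lemma hk_bounded_integral:
  assumes \<sigma>: "\<bar>\<sigma>\<bar> = 1" and g: "\<And>\<zeta>. \<bar>g \<zeta>\<bar> \<le> M" "\<And>\<zeta>. g \<zeta> \<noteq> 0 \<Longrightarrow> hs \<sigma> p \<zeta> \<le> T" and T: "T \<ge> 0"
  shows "(\<integral>\<^sup>+\<zeta>. ennreal (hk A B \<sigma> p \<zeta> * \<bar>g \<zeta>\<bar>) \<partial>lborel) \<le> ennreal (M * T)"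
proof -
  have M: "M \<ge> 0" using g(1)[of undefined] by linarith
  let ?\<phi> = "\<lambda>s. ennreal M * indicator {..T} s"
  have "ennreal (hk A B \<sigma> p \<zeta> * \<bar>g \<zeta>\<bar>) \<le> ennreal (hk A B \<sigma> p \<zeta>) * ?\<phi> (hs \<sigma> p \<zeta>)" for \<zeta>
  proof (cases "g \<zeta> = 0")
    case False
    then have "hs \<sigma> p \<zeta> \<in> {..T}" using g(2) by auto
    moreover have "ennreal (hk A B \<sigma> p \<zeta> * \<bar>g \<zeta>\<bar>) \<le> ennreal (hk A B \<sigma> p \<zeta> * M)"
      by (intro ennreal_leI mult_left_mono g(1) hk_nonneg)
    ultimately show ?thesis using M by (simp add: ennreal_mult hk_nonneg)
  qed simp
  then have "(\<integral>\<^sup>+\<zeta>. ennreal (hk A B \<sigma> p \<zeta> * \<bar>g \<zeta>\<bar>) \<partial>lborel) \<le> (\<integral>\<^sup>+\<zeta>. ennreal (hk A B \<sigma> p \<zeta>) * ?\<phi> (hs \<sigma> p \<zeta>) \<partial>lborel)"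
    by (rule nn_integral_mono)
  also have "\<dots> = (\<integral>\<^sup>+s. indicator {0<..} s * ?\<phi> s \<partial>lborel)"
    by (rule hk_time_integral[OF \<sigma>]) measurable
  also have "\<dots> = (\<integral>\<^sup>+s. ennreal M * indicator {0<..T} s \<partial>lborel)"
    by (intro nn_integral_cong) (auto simp: indicator_def)
  also have "\<dots> = ennreal M * ennreal T" using T by (subst nn_integral_cmult_indicator) auto
  also have "\<dots> = ennreal (M * T)" using M T by (simp add: ennreal_mult)
  finally show ?thesis .
qed

lemma hk_mult_integrable:
  assumes \<sigma>: "\<bar>\<sigma>\<bar> = 1" and g: "continuous_on UNIV g" "bounded K" "\<And>\<zeta>. \<zeta> \<notin> K \<Longrightarrow> g \<zeta> = 0"
  shows "integrable lborel (\<lambda>\<zeta>. hk A B \<sigma> p \<zeta> * g \<zeta>)"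
proof -
  obtain M where M: "\<And>z. z \<in> K \<Longrightarrow> \<bar>g z\<bar> \<le> M" by (rule continuous_bounded_on[OF g(1,2)]) blast
  have "continuous_on UNIV (\<lambda>\<zeta> :: 'n spacetime. hs \<sigma> p \<zeta>)" by (intro continuous_intros)
  then obtain T where T: "\<And>z. z \<in> K \<Longrightarrow> \<bar>hs \<sigma> p z\<bar> \<le> T" by (rule continuous_bounded_on[OF _ g(2)]) blast
  have [measurable]: "g \<in> borel_measurable borel" "hk A B \<sigma> p \<in> borel_measurable borel"
    by (rule borel_measurable_continuous_onI[OF g(1)], rule hk_measurable)
  have "(\<integral>\<^sup>+\<zeta>. ennreal (hk A B \<sigma> p \<zeta> * \<bar>g \<zeta>\<bar>) \<partial>lborel) \<le> ennreal (\<bar>M\<bar> * \<bar>T\<bar>)"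
  proof (rule hk_bounded_integral[OF \<sigma>])
    show "\<bar>g \<zeta>\<bar> \<le> \<bar>M\<bar>" for \<zeta> using M[of \<zeta>] g(3)[of \<zeta>] by (cases "\<zeta> \<in> K") auto
    show "g \<zeta> \<noteq> 0 \<Longrightarrow> hs \<sigma> p \<zeta> \<le> \<bar>T\<bar>" for \<zeta> using T[of \<zeta>] g(3)[of \<zeta>] by (cases "\<zeta> \<in> K") auto
  qed simp
  then show ?thesis
    by (intro integrableI_bounded) (auto simp: abs_mult hk_nonneg le_less_trans)
qed

context
  fixes h hT :: "'n spacetime \<Rightarrow> real" and h1 h2 :: "'n \<Rightarrow> 'n spacetime \<Rightarrow> real" and H
  assumes h: "\<And>k. along (sflow (avec A k)) h (h1 k)" "\<And>k. along (sflow (avec A k)) (h1 k) (h2 k)" "along (tflow B 1) h hT"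
    and c: "continuous_on UNIV h" "\<And>k. continuous_on UNIV (h1 k)" "\<And>k. continuous_on UNIV (h2 k)" "continuous_on UNIV hT"
    and H: "bounded H" "\<And>z. z \<notin> H \<Longrightarrow> h z = 0" "\<And>z k. z \<notin> H \<Longrightarrow> h1 k z = 0"
      "\<And>z k. z \<notin> H \<Longrightarrow> h2 k z = 0" "\<And>z. z \<notin> H \<Longrightarrow> hT z = 0"
begin

text \<open>The operator applied to h, expressed by flow derivatives; no Frechet differentiability
  of h is involved, which suits the barriers below.\<close>

abbreviation "Lh \<zeta> \<equiv> (\<Sum>k\<in>UNIV. h2 k \<zeta>) - hT \<zeta>"

lemma Lh_continuous: "continuous_on UNIV (\<lambda>\<zeta>. Lh \<zeta>)"
  by (intro continuous_intros c)

text \<open>The kernel is a fundamental solution in the distributional sense. In Green's identity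
  with the cut-off adjoint kernel only the mollifier term survives, and it concentrates at the pole;
  the cutoff is then removed by dominated convergence.\<close>

lemma backward_representation: "(\<integral>\<zeta>. hk A (-B) (-1) z \<zeta> * Lh \<zeta> \<partial>lborel) = - h z"
proof -
  interpret d: kolm A "-B" l by (rule dual)
  let ?\<Gamma> = "hk A (-B) (-1) z"
  define \<epsilon> where "\<epsilon> n = 1 / (real n + 1)" for n
  have \<epsilon>: "\<epsilon> n > 0" for n by (simp add: \<epsilon>_def)
  have \<epsilon>0: "\<epsilon> \<longlonglongrightarrow> 0" unfolding \<epsilon>_def[abs_def] by real_asymp
  have s1: "\<bar>- 1 :: real\<bar> = 1" by simp
  let ?c = "\<lambda>n \<zeta>. cutoff (hs (-1) z \<zeta> / \<epsilon> n)" and ?c' = "\<lambda>n \<zeta>. cutoff' (hs (-1) z \<zeta> / \<epsilon> n)"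
  have ident: "(\<integral>\<zeta>. (?c n \<zeta> * ?\<Gamma> \<zeta>) * Lh \<zeta> \<partial>lborel) = - (\<integral>\<zeta>. ?\<Gamma> \<zeta> * (?c' n \<zeta> / \<epsilon> n * h \<zeta>) \<partial>lborel)" for n
  proof -
    note C = d.continuous_cut_hk[OF disjI1[OF refl] \<epsilon>[of n], of "-1" z]
    note C' = d.continuous_cut_hk[OF disjI2[OF refl] \<epsilon>[of n], of "-1" z]
    have ct: "continuous_on UNIV (\<lambda>\<zeta>. ?c n \<zeta> * hkT A (-B) (-1) z \<zeta> + (1 / \<epsilon> n * ?c' n \<zeta>) * ?\<Gamma> \<zeta>)"
      using continuous_on_add[OF C(4) continuous_on_mult_left[OF C'(1), of "1 / \<epsilon> n"]] by (simp add: mult.assoc)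
    have g: "(\<integral>\<zeta>. (?c n \<zeta> * ?\<Gamma> \<zeta>) * ((\<Sum>k\<in>UNIV. h2 k \<zeta>) + 1 * (- hT \<zeta>)) \<partial>lborel)
      = (\<integral>\<zeta>. h \<zeta> * ((\<Sum>k\<in>UNIV. ?c n \<zeta> * hk2 A (-B) (-1) z (avec A k) \<zeta>) - 1 * (?c n \<zeta> * hkT A (-B) (-1) z \<zeta> + (1 / \<epsilon> n * ?c' n \<zeta>) * ?\<Gamma> \<zeta>)) \<partial>lborel)"
      by (rule green_identity[where S = "\<lambda>k. sflow (avec A k)" and T = "tflow (-B) (-1)" and K = H, OF sflow_good d.tflow_good
            d.along_cut_hk(1,2)[OF s1 \<epsilon>] d.along_cut_hk(3)[OF s1 \<epsilon>] h(1,2) along_tflow_dual[OF h(3)] C(1,2,3) ct c(1,2,3) continuous_on_minus[OF c(4)] H(1-4)])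
        (assumption | (drule H(5), simp))+
    have sm: "(\<Sum>k\<in>UNIV. ?c n \<zeta> * hk2 A (-B) (-1) z (avec A k) \<zeta>) = ?c n \<zeta> * hkT A (-B) (-1) z \<zeta>" for \<zeta>
      by (simp only: hkT_def sum_distrib_left)
    have r: "h \<zeta> * ((\<Sum>k\<in>UNIV. ?c n \<zeta> * hk2 A (-B) (-1) z (avec A k) \<zeta>) - 1 * (?c n \<zeta> * hkT A (-B) (-1) z \<zeta> + (1 / \<epsilon> n * ?c' n \<zeta>) * ?\<Gamma> \<zeta>))
      = - (?\<Gamma> \<zeta> * (?c' n \<zeta> / \<epsilon> n * h \<zeta>))" for \<zeta>
      unfolding sm by simp
    show ?thesis using g unfolding r by (simp only: mult_1 add_uminus_conv_diff Bochner_Integration.integral_minus)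
  qed
  obtain M where M: "\<And>z. \<bar>h z\<bar> \<le> M" by (rule continuous_bounded_everywhere[OF c(1) H(1,2)]) (blast+)
  have R: "(\<lambda>n. - (\<integral>\<zeta>. ?\<Gamma> \<zeta> * (?c' n \<zeta> / \<epsilon> n * h \<zeta>) \<partial>lborel)) \<longlonglongrightarrow> - h z"
  proof (rule tendsto_minus, rule d.hk_concentrates(1)[OF s1 \<epsilon>, where M = M])
    show "h \<in> borel_measurable borel" by (rule borel_measurable_continuous_onI[OF c(1)])
    show "\<bar>h (d.hpt (- 1) z (\<epsilon> n) (y, s))\<bar> \<le> M \<or> s \<le> 1 \<or> 2 \<le> s" for n y s using M by blast
    fix y :: "'n rvec" and s :: real
    show "(\<lambda>n. h (d.hpt (- 1) z (\<epsilon> n) (y, s))) \<longlonglongrightarrow> h z"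
      by (rule continuous_on_tendsto_compose[OF c(1) d.hpt_tendsto[OF \<epsilon>0]]) auto
  qed
  have Li: "integrable lborel (\<lambda>\<zeta>. ?\<Gamma> \<zeta> * Lh \<zeta>)"
    by (rule d.hk_mult_integrable[OF s1 Lh_continuous H(1)]) (simp add: H(4) H(5))
  have L: "(\<lambda>n. \<integral>\<zeta>. (?c n \<zeta> * ?\<Gamma> \<zeta>) * Lh \<zeta> \<partial>lborel) \<longlonglongrightarrow> (\<integral>\<zeta>. ?\<Gamma> \<zeta> * Lh \<zeta> \<partial>lborel)"
  proof (rule integral_dominated_convergence[where w = "\<lambda>\<zeta>. \<bar>?\<Gamma> \<zeta> * Lh \<zeta>\<bar>"])
    show "(\<lambda>\<zeta>. ?\<Gamma> \<zeta> * Lh \<zeta>) \<in> borel_measurable lborel" using Li by auto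
    have Lm: "(\<lambda>\<zeta>. Lh \<zeta>) \<in> borel_measurable borel" by (rule borel_measurable_continuous_onI[OF Lh_continuous])
    have "(\<lambda>\<zeta>. ?c n \<zeta> * ?\<Gamma> \<zeta>) \<in> borel_measurable borel" for n
      by (rule borel_measurable_continuous_onI[OF d.continuous_cut_hk(1)[OF disjI1[OF refl] \<epsilon>]])
    then show "(\<lambda>\<zeta>. (?c n \<zeta> * ?\<Gamma> \<zeta>) * Lh \<zeta>) \<in> borel_measurable lborel" for n using Lm by simp
    show "integrable lborel (\<lambda>\<zeta>. \<bar>?\<Gamma> \<zeta> * Lh \<zeta>\<bar>)" using Li by (rule integrable_abs)
    show "AE \<zeta> in lborel. (\<lambda>n. (?c n \<zeta> * ?\<Gamma> \<zeta>) * Lh \<zeta>) \<longlonglongrightarrow> ?\<Gamma> \<zeta> * Lh \<zeta>"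
    proof (rule AE_I2)
      fix \<zeta>
      show "(\<lambda>n. (?c n \<zeta> * ?\<Gamma> \<zeta>) * Lh \<zeta>) \<longlonglongrightarrow> ?\<Gamma> \<zeta> * Lh \<zeta>"
      proof (cases "hs (-1) z \<zeta> > 0")
        case True
        have "(\<lambda>n. ?c n \<zeta>) \<longlonglongrightarrow> 1" unfolding \<epsilon>_def by (rule cutoff_scaled_limit) (use True in auto)
        from tendsto_mult_right[OF tendsto_mult_right[OF this, of "?\<Gamma> \<zeta>"], of "Lh \<zeta>"] show ?thesis by simp
      next
        case False
        then have "?\<Gamma> \<zeta> = 0" using hk_nonpos_time[of "-1" \<zeta> z A "-B"] by linarith
        then show ?thesis by simp
      qed
    qed
    have "\<bar>?c n \<zeta>\<bar> * \<bar>?\<Gamma> \<zeta> * Lh \<zeta>\<bar> \<le> 1 * \<bar>?\<Gamma> \<zeta> * Lh \<zeta>\<bar>" for n \<zeta>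
      by (intro mult_right_mono) (simp_all add: cutoff_nonneg cutoff_le_1)
    then show "\<And>n. AE \<zeta> in lborel. norm ((?c n \<zeta> * ?\<Gamma> \<zeta>) * Lh \<zeta>) \<le> \<bar>?\<Gamma> \<zeta> * Lh \<zeta>\<bar>"
      by (simp add: abs_mult mult.assoc)
  qed
  from LIMSEQ_unique[OF L] R show ?thesis unfolding ident by blast
qed

text \<open>By Fubini the kernel is integrated against Lh first, which reproduces -h. Joint
  integrability holds since the kernel has mass at most the elapsed time, bounded over the two
  bounded supports.\<close>

lemma pot_weak_equation:
  assumes f: "integrable lborel f" and K: "bounded K" "\<And>z. f z \<noteq> 0 \<Longrightarrow> z \<in> K"
  shows "(\<integral>\<zeta>. pot f \<zeta> * Lh \<zeta> \<partial>lborel) = - (\<integral>z. f z * h z \<partial>lborel)"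
proof -
  interpret d: kolm A "-B" l by (rule dual)
  have s1: "\<bar>- 1 :: real\<bar> = 1" by simp
  have [measurable]: "f \<in> borel_measurable borel" using f by auto
  have [measurable]: "(\<lambda>\<zeta>. Lh \<zeta>) \<in> borel_measurable borel" by (rule borel_measurable_continuous_onI[OF Lh_continuous])
  have L0: "Lh z = 0" if "z \<notin> H" for z using H(4)[OF that] H(5)[OF that] by simp
  obtain M where M0: "M \<ge> 0" and M: "\<And>z. \<bar>Lh z\<bar> \<le> M"
    by (rule continuous_bounded_everywhere[OF Lh_continuous H(1) L0]) (blast+)
  have "continuous_on UNIV (\<lambda>q :: 'n spacetime \<times> 'n spacetime. hs (-1) (fst q) (snd q))" by (intro continuous_intros)
  then obtain T where T: "\<And>q. q \<in> K \<times> H \<Longrightarrow> \<bar>hs (-1) (fst q) (snd q)\<bar> \<le> T"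
    by (rule continuous_bounded_on[OF _ bounded_Times[OF K(1) H(1)]]) blast
  let ?F = "\<lambda>q :: 'n spacetime \<times> 'n spacetime. f (fst q) * (hk A (-B) (-1) (fst q) (snd q) * Lh (snd q))"
  have hm: "(\<lambda>q :: 'n spacetime \<times> 'n spacetime. hk A (-B) (-1) (fst q) (snd q)) \<in> borel_measurable borel"
    by (rule d.hk_measurable2(1)) (intro continuous_intros)+
  have Fm: "?F \<in> borel_measurable (lborel \<Otimes>\<^sub>M lborel)"
  proof -
    have [measurable]: "(\<lambda>q :: 'n spacetime \<times> 'n spacetime. hk A (-B) (-1) (fst q) (snd q)) \<in> borel_measurable (lborel \<Otimes>\<^sub>M lborel)"
      using hm by (simp add: lborel_prod)
    show ?thesis by measurable
  qed
  have slice: "integrable lborel (\<lambda>\<zeta>. hk A (-B) (-1) z \<zeta> * Lh \<zeta>)" for z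
    by (rule d.hk_mult_integrable[OF s1 Lh_continuous H(1)]) (simp add: H(4) H(5))
  have ib: "(\<integral>\<zeta>. \<bar>hk A (-B) (-1) z \<zeta> * Lh \<zeta>\<bar> \<partial>lborel) \<le> M * \<bar>T\<bar>" if "z \<in> K" for z
  proof -
    have "ennreal (\<integral>\<zeta>. \<bar>hk A (-B) (-1) z \<zeta> * Lh \<zeta>\<bar> \<partial>lborel) = (\<integral>\<^sup>+\<zeta>. ennreal \<bar>hk A (-B) (-1) z \<zeta> * Lh \<zeta>\<bar> \<partial>lborel)"
      using slice[of z] by (intro nn_integral_eq_integral[symmetric]) auto
    also have "\<dots> = (\<integral>\<^sup>+\<zeta>. ennreal (hk A (-B) (-1) z \<zeta> * \<bar>Lh \<zeta>\<bar>) \<partial>lborel)" by (simp add: abs_mult d.hk_nonneg)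
    also have "\<dots> \<le> ennreal (M * \<bar>T\<bar>)"
    proof (rule d.hk_bounded_integral[OF s1 M])
      show "Lh \<zeta> \<noteq> 0 \<Longrightarrow> hs (-1) z \<zeta> \<le> \<bar>T\<bar>" for \<zeta>
        using T[of "(z, \<zeta>)"] that L0[of \<zeta>] by (cases "\<zeta> \<in> H") auto
    qed simp
    finally show ?thesis using M0 by simp
  qed
  have Fi: "integrable (lborel \<Otimes>\<^sub>M lborel) ?F"
  proof (rule lborel_pair.Fubini_integrable[OF Fm])
    have m: "(\<lambda>z. \<integral>\<zeta>. norm (?F (z, \<zeta>)) \<partial>lborel) \<in> borel_measurable lborel"
      using Fm by (intro lborel.borel_measurable_lebesgue_integral) (simp add: split_beta')
    show "integrable lborel (\<lambda>z. \<integral>\<zeta>. norm (?F (z, \<zeta>)) \<partial>lborel)"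
    proof (rule Bochner_Integration.integrable_bound[OF _ m])
      show "integrable lborel (\<lambda>z. \<bar>f z\<bar> * (M * \<bar>T\<bar>))" using f by simp
      have e: "(\<integral>\<zeta>. norm (?F (z, \<zeta>)) \<partial>lborel) = \<bar>f z\<bar> * (\<integral>\<zeta>. \<bar>hk A (-B) (-1) z \<zeta> * Lh \<zeta>\<bar> \<partial>lborel)" for z
        by (subst Bochner_Integration.integral_mult_right_zero[symmetric]) (simp add: abs_mult)
      have p1: "\<bar>f z\<bar> * (\<integral>\<zeta>. \<bar>hk A (-B) (-1) z \<zeta> * Lh \<zeta>\<bar> \<partial>lborel) \<le> \<bar>f z\<bar> * (M * \<bar>T\<bar>)" for z
        using ib[of z] K(2)[of z] by (cases "f z = 0") (auto intro!: mult_left_mono)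
      have p0: "0 \<le> \<bar>f z\<bar> * (\<integral>\<zeta>. \<bar>hk A (-B) (-1) z \<zeta> * Lh \<zeta>\<bar> \<partial>lborel)" for z by simp
      show "AE z in lborel. norm (\<integral>\<zeta>. norm (?F (z, \<zeta>)) \<partial>lborel) \<le> norm (\<bar>f z\<bar> * (M * \<bar>T\<bar>))"
        unfolding real_norm_def e[unfolded real_norm_def]
        by (rule AE_I2) (rule order_trans[OF eq_refl[OF abs_of_nonneg[OF p0]] order_trans[OF p1 abs_ge_self]])
    qed
    show "AE z in lborel. integrable lborel (\<lambda>\<zeta>. ?F (z, \<zeta>))" using slice by simp
  qed
  have "(\<integral>\<zeta>. pot f \<zeta> * Lh \<zeta> \<partial>lborel) = (\<integral>\<zeta>. \<integral>z. ?F (z, \<zeta>) \<partial>lborel \<partial>lborel)"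
    unfolding pot_def by (intro Bochner_Integration.integral_cong refl, subst Bochner_Integration.integral_mult_left_zero[symmetric])
      (simp add: hk_swap mult_ac)
  also have "\<dots> = (\<integral>z. \<integral>\<zeta>. ?F (z, \<zeta>) \<partial>lborel \<partial>lborel)"
    by (rule lborel_pair.Fubini_integral[of "\<lambda>z \<zeta>. ?F (z, \<zeta>)"]) (use Fi in \<open>simp add: split_beta'\<close>)
  also have "\<dots> = (\<integral>z. f z * (- h z) \<partial>lborel)"
    by (simp add: backward_representation)
  finally show ?thesis by simp
qed

end

text \<open>The mollifier attached to a pole is negligible away from it: at elapsed times in
  (\<epsilon>, 2 \<epsilon>) and distance at least \<rho> the displacement from the drift curve is
  still at least \<rho>/2, so exp(-k/\<epsilon>) beats all negative powers of \<epsilon>. Uniform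
  continuity of the drift on the bounded set makes this uniform in the pole.\<close>

lemma kernel_tail:
  assumes K: "bounded K" and \<rho>: "\<rho> > 0" and \<eta>: "\<eta> > 0"
  obtains \<epsilon>0 where "\<epsilon>0 > 0" "\<And>\<epsilon> \<zeta> z. 0 < \<epsilon> \<Longrightarrow> \<epsilon> \<le> \<epsilon>0 \<Longrightarrow> \<zeta> \<in> K \<Longrightarrow> dist z \<zeta> \<ge> \<rho> \<Longrightarrow>
     1 / \<epsilon> * cutoff' (hs 1 \<zeta> z / \<epsilon>) * hk A B 1 \<zeta> z \<le> \<eta>"
proof -
  have "(2::real) > 0" by simp
  then obtain c where c: "c > 0" "\<And>s x. 0 < s \<Longrightarrow> s \<le> 2 \<Longrightarrow> (Pm A B s *v x) \<bullet> x \<ge> c * (norm x)\<^sup>2 / s"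
    by (rule q_lower_bound) blast
  let ?S = "{0..1::real} \<times> closure (fst ` K)"
  have "compact ?S" using bounded_fst[OF K] by (intro compact_Times) auto
  moreover have "continuous_on ?S (\<lambda>q. E_mat B (fst q) *v snd q)" by (intro continuous_intros)
  ultimately have uc: "uniformly_continuous_on ?S (\<lambda>q. E_mat B (fst q) *v snd q)" by (rule compact_uniformly_continuous[rotated])
  have r4: "\<rho> / 4 > 0" using \<rho> by simp
  from uc[unfolded uniformly_continuous_on_def, rule_format, OF r4]
  obtain d where d0: "0 < d \<and> (\<forall>q\<in>?S. \<forall>q'\<in>?S. dist q' q < d \<longrightarrow> dist (E_mat B (fst q') *v snd q') (E_mat B (fst q) *v snd q) < \<rho> / 4)" ..
  note d = conjunct1[OF d0]
  have E: "norm (E_mat B s *v fst \<zeta> - fst \<zeta>) < \<rho> / 4" if "0 \<le> s" "s \<le> 1" "s < d" "\<zeta> \<in> K" for s \<zeta>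
  proof -
    have "fst \<zeta> \<in> closure (fst ` K)" by (rule subsetD[OF closure_subset imageI[OF that(4)]])
    then have q: "(0, fst \<zeta>) \<in> ?S" "(s, fst \<zeta>) \<in> ?S" using that by (simp_all add: mem_Times_iff)
    have "dist (s, fst \<zeta>) (0, fst \<zeta>) < d" unfolding dist_Pair_Pair using that by (simp add: dist_real_def)
    from mp[OF bspec[OF bspec[OF conjunct2[OF d0] q(1)] q(2)] this]
    show ?thesis unfolding fst_conv snd_conv E_mat_0 matrix_vector_mul_lid dist_norm .
  qed
  \<comment> \<open>One quarter of the lower bound c (\<rho>/2)^2/(2 \<epsilon>) for the quadratic
    form, multiplied by \<epsilon>.\<close>
  define k where "k = c * \<rho>\<^sup>2 / 32"
  have k: "k > 0" using c \<rho> by (simp add: k_def)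
  define N where "N = real hdim / 2"
  have "((\<lambda>\<epsilon>. 9 / \<epsilon> * (gamma_const * \<epsilon> powr (- N)) * exp (- (k / \<epsilon>))) \<longlongrightarrow> 0) (at_right 0)"
    using k gamma_const_pos by real_asymp
  then have "\<forall>\<^sub>F \<epsilon> in at_right 0. 9 / \<epsilon> * (gamma_const * \<epsilon> powr (- N)) * exp (- (k / \<epsilon>)) < \<eta>"
    using \<eta> by (rule order_tendstoD)
  then obtain \<epsilon>1 where \<epsilon>1: "\<epsilon>1 > 0" "\<And>\<epsilon>. 0 < \<epsilon> \<Longrightarrow> \<epsilon> < \<epsilon>1 \<Longrightarrow> 9 / \<epsilon> * (gamma_const * \<epsilon> powr (- N)) * exp (- (k / \<epsilon>)) < \<eta>"
    unfolding eventually_at_right_field by auto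
  \<comment> \<open>Elapsed times below 2 \<epsilon> then stay below 1 and d, for the drift
    estimate, and below \<rho>/4, for the distance in time; the last bound puts \<epsilon> in the
    range of the limit statement.\<close>
  define \<epsilon>0 where "\<epsilon>0 = min (min (1 / 4) (d / 4)) (min (\<rho> / 8) (\<epsilon>1 / 2))"
  have \<epsilon>0: "\<epsilon>0 > 0" "\<epsilon>0 \<le> 1 / 4" "\<epsilon>0 \<le> d / 4" "\<epsilon>0 \<le> \<rho> / 8" "\<epsilon>0 \<le> \<epsilon>1 / 2"
    using d \<rho> \<epsilon>1(1) by (auto simp: \<epsilon>0_def)
  show ?thesis
  proof (rule that[OF \<epsilon>0(1)])
    fix \<epsilon> :: real and \<zeta> z :: "'n spacetime"
    assume \<epsilon>: "0 < \<epsilon>" "\<epsilon> \<le> \<epsilon>0" and \<zeta>: "\<zeta> \<in> K" and far: "dist z \<zeta> \<ge> \<rho>"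
    let ?s = "hs 1 \<zeta> z"
    show "1 / \<epsilon> * cutoff' (?s / \<epsilon>) * hk A B 1 \<zeta> z \<le> \<eta>"
    proof (cases "1 < ?s / \<epsilon> \<and> ?s / \<epsilon> < 2")
      case False
      then have "cutoff' (?s / \<epsilon>) = 0" by (intro cutoff'_eq_0) auto
      then show ?thesis using \<eta> by simp
    next
      case True
      then have s: "\<epsilon> < ?s" "?s < 2 * \<epsilon>" using \<epsilon> by (auto simp: pos_less_divide_eq pos_divide_less_eq)
      have s0: "?s > 0" using s \<epsilon> by linarith
      let ?X = "hX B 1 \<zeta> z"
      have "dist z \<zeta> \<le> norm (fst z - fst \<zeta>) + norm (snd z - snd \<zeta>)"
        unfolding dist_norm using norm_Pair_le[of "fst z - fst \<zeta>" "snd z - snd \<zeta>"] by (simp add: minus_prod_def)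
      moreover have "norm (snd z - snd \<zeta>) \<le> \<rho> / 4" using s s0 \<epsilon> \<epsilon>0 by (simp add: real_norm_def)
      moreover have "norm (fst z - fst \<zeta>) \<le> norm ?X + norm (E_mat B ?s *v fst \<zeta> - fst \<zeta>)"
        using norm_triangle_ineq[of ?X "E_mat B ?s *v fst \<zeta> - fst \<zeta>"] by (simp add: hX_def)
      moreover have "norm (E_mat B ?s *v fst \<zeta> - fst \<zeta>) < \<rho> / 4"
        by (rule E) (use s s0 \<epsilon> \<epsilon>0 \<zeta> d in linarith)+
      ultimately have X: "norm ?X \<ge> \<rho> / 2" using far by linarith
      have "(\<rho> / 2)\<^sup>2 \<le> (norm ?X)\<^sup>2" using X \<rho> by (intro power_mono) auto
      then have "c * (\<rho> / 2)\<^sup>2 / (2 * \<epsilon>) \<le> c * (norm ?X)\<^sup>2 / ?s"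
        using c(1) s s0 by (intro frac_le mult_left_mono) auto
      also have "\<dots> \<le> (Pm A B ?s *v ?X) \<bullet> ?X" by (rule c(2)) (use s s0 \<epsilon> \<epsilon>0 in linarith)+
      finally have q: "4 * (k / \<epsilon>) \<le> (Pm A B ?s *v ?X) \<bullet> ?X" by (simp add: k_def power2_eq_square mult_ac)
      have "hk A B 1 \<zeta> z = peak ?s * exp (- (1/4) * ((Pm A B ?s *v ?X) \<bullet> ?X))" by (rule hk_eq[OF s0])
      also have "\<dots> \<le> peak \<epsilon> * exp (- (k / \<epsilon>))"
        proof (rule mult_mono)
        show "peak ?s \<le> peak \<epsilon>" using peak_antimono[OF \<epsilon>(1), of ?s] s by simp
        show "exp (- (1/4) * ((Pm A B ?s *v ?X) \<bullet> ?X)) \<le> exp (- (k / \<epsilon>))"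
          unfolding exp_le_cancel_iff using q by linarith
      qed (use peak_pos[OF \<epsilon>(1)] in auto)
      finally have "1 / \<epsilon> * cutoff' (?s / \<epsilon>) * hk A B 1 \<zeta> z \<le> 1 / \<epsilon> * 9 * (peak \<epsilon> * exp (- (k / \<epsilon>)))"
        using \<epsilon> by (intro mult_mono cutoff'_le) (auto simp: cutoff'_nonneg hk_nonneg)
      also have "\<dots> = 9 / \<epsilon> * (gamma_const * \<epsilon> powr (- N)) * exp (- (k / \<epsilon>))" by (simp add: peak_def N_def)
      also have "\<dots> < \<eta>" by (rule \<epsilon>1(2)) (use \<epsilon> \<epsilon>0 \<epsilon>1(1) in linarith)+
      finally show ?thesis by simp
    qed
  qed
qed

lemma flow_eventually_in:
  assumes "good_flow \<Theta>" "open D" "\<zeta> \<in> D"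
  obtains d where "d > 0" "\<And>x :: real. \<bar>x\<bar> < d \<Longrightarrow> \<Theta> x \<zeta> \<in> D"
proof -
  have \<Theta>: "continuous_on UNIV (\<lambda>p. \<Theta> (fst p) (snd p))" "\<Theta> 0 \<zeta> = \<zeta>" using assms(1) by (auto simp: good_flow_def)
  have "continuous_on UNIV (\<lambda>x :: real. (x, \<zeta>))" by (intro continuous_intros)
  from continuous_on_compose2[OF \<Theta>(1) this] have c: "continuous_on UNIV (\<lambda>x. \<Theta> x \<zeta>)" by simp
  have "open ((\<lambda>x. \<Theta> x \<zeta>) -` D)" using c assms(2) by (simp add: continuous_on_open_vimage)
  moreover have "0 \<in> (\<lambda>x. \<Theta> x \<zeta>) -` D" using \<Theta>(2) assms(3) by simp
  ultimately obtain d where d: "d > 0" "ball 0 d \<subseteq> (\<lambda>x. \<Theta> x \<zeta>) -` D" by (rule openE)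
  have "\<Theta> x \<zeta> \<in> D" if "\<bar>x\<bar> < d" for x using d(2) that by (auto simp: subset_iff dist_real_def)
  then show ?thesis using that d(1) by blast
qed

text \<open>All derivatives fall on the cut-off kernel, which satisfies the adjoint equation up to
  the mollifier. At the minimum the second derivatives of the potential are nonnegative. Along the
  adjoint drift time decreases, so the tilt grows at the rate \<delta> and stationarity forces the
  drift derivative of the potential to be -\<delta>.\<close>

lemma cut_pot_interior_min:
  assumes f: "integrable lborel f" and K: "bounded K" "\<And>z. f z \<noteq> 0 \<Longrightarrow> z \<in> K" and \<epsilon>: "\<epsilon> > 0"
    and D: "open D" "\<zeta>0 \<in> D" and min: "\<And>\<zeta>. \<zeta> \<in> D \<Longrightarrow> cut_pot \<epsilon> f \<zeta>0 - \<delta> * snd \<zeta>0 \<le> cut_pot \<epsilon> f \<zeta> - \<delta> * snd \<zeta>"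
  shows "(\<integral>z. (1 / \<epsilon> * cutoff' (hs 1 \<zeta>0 z / \<epsilon>) * hk A B 1 \<zeta>0 z) * f z \<partial>lborel) \<le> - \<delta>"
proof -
  interpret d: kolm A "-B" l by (rule dual)
  have s1: "\<bar>- 1 :: real\<bar> = 1" by simp
  let ?c = "\<lambda>z \<zeta>. cutoff (hs (-1) z \<zeta> / \<epsilon>)" and ?c' = "\<lambda>z \<zeta>. cutoff' (hs (-1) z \<zeta> / \<epsilon>)"
  define k0 where "k0 z \<zeta> = ?c z \<zeta> * hk A (-B) (-1) z \<zeta>" for z \<zeta>
  define k1 where "k1 a z \<zeta> = ?c z \<zeta> * hk1 A (-B) (-1) z a \<zeta>" for a z \<zeta>
  define k2 where "k2 a z \<zeta> = ?c z \<zeta> * hk2 A (-B) (-1) z a \<zeta>" for a z \<zeta>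
  define kt where "kt z \<zeta> = ?c z \<zeta> * hkT A (-B) (-1) z \<zeta> + (1 / \<epsilon> * ?c' z \<zeta>) * hk A (-B) (-1) z \<zeta>" for z \<zeta>
  note C = d.continuous_cut_hk2[OF disjI1[OF refl] \<epsilon>, of "-1"]
  note C' = d.continuous_cut_hk2[OF disjI2[OF refl] \<epsilon>, of "-1"]
  have c0: "continuous_on UNIV (\<lambda>q. k0 (fst q) (snd q))" unfolding k0_def by (rule C(1))
  have c1: "continuous_on UNIV (\<lambda>q. k1 a (fst q) (snd q))" for a unfolding k1_def by (rule C(2))
  have c2: "continuous_on UNIV (\<lambda>q. k2 a (fst q) (snd q))" for a unfolding k2_def by (rule C(3))
  have ct: "continuous_on UNIV (\<lambda>q. kt (fst q) (snd q))"
    using continuous_on_add[OF C(4) continuous_on_mult_left[OF C'(1), of "1 / \<epsilon>"]] by (simp add: kt_def mult.assoc)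
  let ?I = "\<lambda>k \<zeta>. \<integral>z. k z \<zeta> * f z \<partial>lborel"
  have u: "cut_pot \<epsilon> f = ?I k0" by (simp add: cut_pot_def[abs_def] k0_def)
  have int: "integrable lborel (\<lambda>z. k z \<zeta> * f z)" if "continuous_on UNIV (\<lambda>q. k (fst q) (snd q))" for k \<zeta>
    by (rule integrable_continuous_mult[OF continuous_slice[OF that] f K])
  have s2: "?I (k2 a) \<zeta>0 \<ge> 0" for a
  proof -
    have a1: "along (sflow a) (?I k0) (?I (k1 a))"
      by (rule along_potential[OF c0 c1 f K sflow_good], assumption) (unfold k0_def k1_def, rule d.along_cut_hk(1)[OF s1 \<epsilon>])
    have a2: "along (sflow a) (?I (k1 a)) (?I (k2 a))"
      by (rule along_potential[OF c1 c2 f K sflow_good], assumption) (unfold k2_def k1_def, rule d.along_cut_hk(2)[OF s1 \<epsilon>])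
    obtain e where e: "e > 0" "\<And>x :: real. \<bar>x\<bar> < e \<Longrightarrow> sflow a x \<zeta>0 \<in> D"
      by (rule flow_eventually_in[OF sflow_good D]) blast
    have a2': "((\<lambda>h. ?I (k1 a) (sflow a h \<zeta>0)) has_real_derivative ?I (k2 a) \<zeta>0) (at 0)" by (rule alongD[OF a2])
    show ?thesis
    proof (rule second_derivative_local_min[OF along_at[OF sflow_good a1] a2' e(1)])
      fix x :: real assume "\<bar>x\<bar> < e"
      from min[OF e(2)[OF this]] show "?I k0 (sflow a 0 \<zeta>0) \<le> ?I k0 (sflow a x \<zeta>0)"
        by (simp add: u sflow_0 hs_sflow)
    qed
  qed
  have st: "?I kt \<zeta>0 = - \<delta>"
  proof -
    have "along (tflow (-B) (-1)) (?I k0) (?I kt)"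
      by (rule along_potential[OF c0 ct f K d.tflow_good], assumption) (unfold k0_def kt_def, rule d.along_cut_hk(3)[OF s1 \<epsilon>])
    then have "((\<lambda>h. ?I k0 (tflow (-B) (-1) h \<zeta>0)) has_real_derivative ?I kt \<zeta>0) (at 0)" by (rule alongD)
    moreover have "((\<lambda>h. \<delta> * snd (tflow (-B) (-1) h \<zeta>0)) has_real_derivative - \<delta>) (at 0)"
      by (auto simp: tflow_def intro!: derivative_eq_intros)
    ultimately have dv: "((\<lambda>h. ?I k0 (tflow (-B) (-1) h \<zeta>0) - \<delta> * snd (tflow (-B) (-1) h \<zeta>0)) has_real_derivative ?I kt \<zeta>0 - - \<delta>) (at 0)"
      by (rule DERIV_diff)
    obtain e where e: "e > 0" "\<And>x :: real. \<bar>x\<bar> < e \<Longrightarrow> tflow (-B) (-1) x \<zeta>0 \<in> D"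
      by (rule flow_eventually_in[OF d.tflow_good D]) blast
    have "?I kt \<zeta>0 - - \<delta> = 0"
    proof (rule DERIV_local_min[OF dv e(1)])
      show "\<forall>y. \<bar>0 - y\<bar> < e \<longrightarrow> ?I k0 (tflow (-B) (-1) 0 \<zeta>0) - \<delta> * snd (tflow (-B) (-1) 0 \<zeta>0)
          \<le> ?I k0 (tflow (-B) (-1) y \<zeta>0) - \<delta> * snd (tflow (-B) (-1) y \<zeta>0)"
        using min[OF e(2)] by (simp add: u d.tflow_0)
    qed
    then show ?thesis by simp
  qed
  have "(\<Sum>k\<in>UNIV. ?I (k2 (avec A k)) \<zeta>0) = (\<integral>z. (\<Sum>k\<in>UNIV. k2 (avec A k) z \<zeta>0 * f z) \<partial>lborel)"
    by (rule Bochner_Integration.integral_sum[symmetric]) (rule int[OF c2])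
  also have "\<dots> = (\<integral>z. kt z \<zeta>0 * f z - (1 / \<epsilon> * ?c' z \<zeta>0 * hk A (-B) (-1) z \<zeta>0) * f z \<partial>lborel)"
    by (intro Bochner_Integration.integral_cong refl)
      (simp add: kt_def k2_def hkT_def sum_distrib_left sum_distrib_right algebra_simps)
  also have "\<dots> = ?I kt \<zeta>0 - (\<integral>z. (1 / \<epsilon> * ?c' z \<zeta>0 * hk A (-B) (-1) z \<zeta>0) * f z \<partial>lborel)"
  proof (rule Bochner_Integration.integral_diff[OF int[OF ct]])
    have "continuous_on UNIV (\<lambda>q. 1 / \<epsilon> * (?c' (fst q) (snd q) * hk A (-B) (-1) (fst q) (snd q)))"
      by (rule continuous_on_mult_left[OF C'(1)])
    from int[of "\<lambda>z \<zeta>. 1 / \<epsilon> * (?c' z \<zeta> * hk A (-B) (-1) z \<zeta>)", OF this]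
    show "integrable lborel (\<lambda>z. (1 / \<epsilon> * ?c' z \<zeta>0 * hk A (-B) (-1) z \<zeta>0) * f z)" by (simp add: mult.assoc)
  qed
  finally have "(\<integral>z. (1 / \<epsilon> * ?c' z \<zeta>0 * hk A (-B) (-1) z \<zeta>0) * f z \<partial>lborel) = - \<delta> - (\<Sum>k\<in>UNIV. ?I (k2 (avec A k)) \<zeta>0)"
    using st by simp
  also have "\<dots> \<le> - \<delta>" using sum_nonneg[of UNIV "\<lambda>k. ?I (k2 (avec A k)) \<zeta>0"] s2 by simp
  finally show ?thesis by (simp only: hs_back hk_swap)
qed

text \<open>The minimum principle for \<open>L\<^sup>*\<close>: at an interior minimum of the regularised potential,
  tilted in time, the regularisation of \<open>f\<close> would have to be negative.\<close>

lemma pot_nonneg: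
  assumes f: "integrable lborel f" and p: "p > hdim / 2 + 1"
    and F: "integrable lborel (\<lambda>z. \<bar>f z\<bar> powr p)" and K: "bounded K" "\<And>z. f z \<noteq> 0 \<Longrightarrow> z \<in> K"
    and D: "open D" "bounded D" "\<And>z. z \<in> D \<Longrightarrow> f z \<ge> 0" and off: "\<And>\<zeta>. \<zeta> \<notin> D \<Longrightarrow> pot f \<zeta> \<ge> 0"
  shows "pot f \<zeta> \<ge> 0"
proof (rule ccontr)
  assume neg: "\<not> pot f \<zeta> \<ge> 0"
  then have \<zeta>D: "\<zeta> \<in> D" using off by blast
  \<comment> \<open>A third of the depth of the negative value: two errors of m/2 from the cutoff
    and two of m/2 from the tilt still leave the potential at most -m at the minimum of the tilted
    function.\<close>
  define m where "m = - pot f \<zeta> / 3"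
  have m: "m > 0" using neg by (simp add: m_def)
  have uc: "continuous_on UNIV (pot f)" by (rule pot_continuous[OF f p F K])
  have cD: "compact (closure D)" using D(2) by simp
  obtain R where R: "R > 0" "\<And>\<zeta>. \<zeta> \<in> closure D \<Longrightarrow> norm \<zeta> \<le> R"
    using compact_imp_bounded[OF cD] unfolding bounded_pos by blast
  \<comment> \<open>The steepest tilt that changes values on the closure of D by at most
    m/2.\<close>
  define \<delta> where "\<delta> = m / (2 * R)"
  have \<delta>: "\<delta> > 0" using m R by (simp add: \<delta>_def)
  have \<delta>R: "\<bar>\<delta> * snd \<zeta>\<bar> \<le> m / 2" if "\<zeta> \<in> closure D" for \<zeta>
  proof -
    have "\<bar>snd \<zeta>\<bar> \<le> R" using R(2)[OF that] norm_snd_le[of "snd \<zeta>" "fst \<zeta>"] by simp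
    then have "\<delta> * \<bar>snd \<zeta>\<bar> \<le> \<delta> * R" using \<delta> by (intro mult_left_mono) auto
    moreover have "\<delta> * R = m / 2" using R(1) by (simp add: \<delta>_def)
    ultimately show ?thesis using \<delta> by (simp add: abs_mult)
  qed
  \<comment> \<open>By the sign of the potential off D this compact sublevel set lies inside D, at a
    positive distance \<rho> from the complement, the only place where \<open>f\<close> may be
    negative.\<close>
  define N where "N = {\<zeta> \<in> closure D. pot f \<zeta> \<le> - m}"
  have "compact (closure D \<inter> {\<zeta>. pot f \<zeta> \<le> - m})"
    by (intro compact_Int_closed cD closed_Collect_le uc continuous_on_const)
  then have cN: "compact N" by (simp add: N_def Collect_conj_eq)
  have ND: "N \<subseteq> D" using off m by (force simp: N_def)
  have "N \<inter> - D = {}" using ND by blast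
  then obtain \<rho> where \<rho>: "\<rho> > 0" "\<And>x y. x \<in> N \<Longrightarrow> y \<in> - D \<Longrightarrow> \<rho> \<le> dist x y"
    using separate_compact_closed[OF cN] D(1) by (metis closed_Compl)
  define J where "J = (\<integral>z. \<bar>f z\<bar> \<partial>lborel)"
  have J: "J \<ge> 0" by (simp add: J_def)
  \<comment> \<open>Chosen so that the tail of the mollifier, tested against |f|, contributes less
    than \<delta>.\<close>
  define \<eta> where "\<eta> = \<delta> / (2 * (J + 1))"
  have \<eta>: "\<eta> > 0" using \<delta> J by (simp add: \<eta>_def)
  have "\<eta> * J = \<delta> / 2 * (J / (J + 1))" by (simp add: \<eta>_def)
  also have "\<dots> \<le> \<delta> / 2 * 1" using \<delta> J by (intro mult_left_mono) auto
  finally have \<eta>J: "\<eta> * J < \<delta>" using \<delta> by linarith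
  obtain e1 where e1: "e1 > 0" "\<And>\<epsilon> \<zeta> z. 0 < \<epsilon> \<Longrightarrow> \<epsilon> \<le> e1 \<Longrightarrow> \<zeta> \<in> D \<Longrightarrow> dist z \<zeta> \<ge> \<rho> \<Longrightarrow>
     1 / \<epsilon> * cutoff' (hs 1 \<zeta> z / \<epsilon>) * hk A B 1 \<zeta> z \<le> \<eta>"
    by (rule kernel_tail[OF D(2) \<rho>(1) \<eta>]) blast
  obtain e2 where e2: "e2 > 0" "\<And>\<epsilon> \<zeta>. 0 < \<epsilon> \<Longrightarrow> \<epsilon> \<le> e2 \<Longrightarrow> \<bar>pot f \<zeta> - cut_pot \<epsilon> f \<zeta>\<bar> \<le> m / 2"
    by (rule cut_pot_uniform[OF f p F K, of "m / 2"], assumption, use m in simp) blast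
  define \<epsilon> where "\<epsilon> = min e1 e2"
  have \<epsilon>: "\<epsilon> > 0" "\<epsilon> \<le> e1" "\<epsilon> \<le> e2" using e1 e2 by (auto simp: \<epsilon>_def)
  let ?v = "\<lambda>\<zeta>. cut_pot \<epsilon> f \<zeta> - \<delta> * snd \<zeta>"
  have "continuous_on (closure D) ?v"
    by (intro continuous_intros continuous_on_subset[OF cut_pot_continuous[OF f p F K \<epsilon>(1)]]) auto
  then obtain \<zeta>0 where \<zeta>0: "\<zeta>0 \<in> closure D" "\<And>\<zeta>. \<zeta> \<in> closure D \<Longrightarrow> ?v \<zeta>0 \<le> ?v \<zeta>"
    using continuous_attains_inf[OF cD, of ?v] \<zeta>D closure_subset by blast
  have \<zeta>c: "\<zeta> \<in> closure D" using \<zeta>D closure_subset by blast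
  have "?v \<zeta>0 \<le> ?v \<zeta>" by (rule \<zeta>0(2)[OF \<zeta>c])
  moreover have "pot f \<zeta> = - 3 * m" by (simp add: m_def)
  ultimately have "pot f \<zeta>0 \<le> - m"
    using e2(2)[OF \<epsilon>(1,3), of \<zeta>] e2(2)[OF \<epsilon>(1,3), of \<zeta>0] \<delta>R[OF \<zeta>c] \<delta>R[OF \<zeta>0(1)] by linarith
  then have \<zeta>N: "\<zeta>0 \<in> N" using \<zeta>0(1) by (simp add: N_def)
  then have \<zeta>0D: "\<zeta>0 \<in> D" using ND by blast
  let ?k = "\<lambda>z. 1 / \<epsilon> * cutoff' (hs 1 \<zeta>0 z / \<epsilon>) * hk A B 1 \<zeta>0 z"
  have mn: "?v \<zeta>0 \<le> ?v \<zeta>'" if "\<zeta>' \<in> D" for \<zeta>'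
    by (rule \<zeta>0(2)) (use that closure_subset in blast)
  have up: "(\<integral>z. ?k z * f z \<partial>lborel) \<le> - \<delta>"
    by (rule cut_pot_interior_min[OF f K \<epsilon>(1) D(1) \<zeta>0D mn])
  have k0: "?k z \<ge> 0" for z using \<epsilon> by (simp add: cutoff'_nonneg hk_nonneg)
  have ki: "integrable lborel (\<lambda>z. ?k z * f z)"
  proof (rule integrable_continuous_mult[OF _ f K])
    show "continuous_on UNIV ?k"
      using continuous_on_mult_left[OF continuous_cut_hk(1)[OF disjI2[OF refl] \<epsilon>(1)], of "1 / \<epsilon>" 1 \<zeta>0] by (simp add: mult.assoc)
  qed
  \<comment> \<open>On D the integrand is nonnegative; off D the distance to the minimum point is at
    least \<rho> and the kernel is at most \<eta>.\<close>
  have lo: "- (\<eta> * \<bar>f z\<bar>) \<le> ?k z * f z" for z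
  proof (cases "z \<in> D")
    case True
    then have "?k z * f z \<ge> 0" by (intro mult_nonneg_nonneg k0 D(3))
    moreover have "\<eta> * \<bar>f z\<bar> \<ge> 0" using \<eta> by simp
    ultimately show ?thesis by linarith
  next
    case False
    then have "dist z \<zeta>0 \<ge> \<rho>" using \<rho>(2)[OF \<zeta>N, of z] by (simp add: dist_commute)
    then have "?k z \<le> \<eta>" by (rule e1(2)[OF \<epsilon>(1,2) \<zeta>0D])
    then have "?k z * \<bar>f z\<bar> \<le> \<eta> * \<bar>f z\<bar>" by (intro mult_right_mono) auto
    moreover have "- (?k z * \<bar>f z\<bar>) \<le> ?k z * f z" using mult_left_mono[OF abs_ge_minus_self[of "f z"] k0[of z]] by linarith
    ultimately show ?thesis by linarith
  qed
  have "- (\<eta> * J) = (\<integral>z. - (\<eta> * \<bar>f z\<bar>) \<partial>lborel)" by (simp add: J_def)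
  also have "\<dots> \<le> (\<integral>z. ?k z * f z \<partial>lborel)"
    by (rule integral_mono[OF _ ki lo]) (use f in simp)
  finally show False using up \<eta>J by linarith
qed

end

section \<open>Barriers\<close>

text \<open>The third power makes the extension by 0 of class C^2. The exponential yields theta''
  \<ge> K theta', so that for large K the second-order part of the operator absorbs the first-order
  terms.\<close>

definition theta :: "real \<Rightarrow> real \<Rightarrow> real"
  where "theta K s = exp (K * s) * max 0 s ^ 3"
definition theta1 :: "real \<Rightarrow> real \<Rightarrow> real"
  where "theta1 K s = exp (K * s) * (K * max 0 s ^ 3 + 3 * max 0 s ^ 2)"
definition theta2 :: "real \<Rightarrow> real \<Rightarrow> real"
  where "theta2 K s = exp (K * s) * (K\<^sup>2 * max 0 s ^ 3 + 6 * K * max 0 s ^ 2 + 6 * max 0 s)"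

lemma theta_deriv:
  "(theta K has_real_derivative theta1 K s) (at s)" "(theta1 K has_real_derivative theta2 K s) (at s)"
proof -
  have e: "((\<lambda>s. exp (K * s)) has_real_derivative exp (K * s) * K) (at s)"
    by (auto intro!: derivative_eq_intros)
  have m3: "((\<lambda>s. max 0 s ^ 3) has_real_derivative 3 * max 0 s ^ 2) (at s)"
    using max_pow_deriv[of 3 s] by simp
  have m2: "((\<lambda>s. max 0 s ^ 2) has_real_derivative 2 * max 0 s) (at s)"
    using max_pow_deriv[of 2 s] by simp
  define M where "M = max 0 s"
  show "(theta K has_real_derivative theta1 K s) (at s)"
    unfolding theta_def[abs_def] theta1_def
    by (rule DERIV_cong[OF DERIV_mult[OF e m3]]) (simp add: algebra_simps flip: M_def)
  show "(theta1 K has_real_derivative theta2 K s) (at s)"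
    unfolding theta1_def[abs_def] theta2_def
    by (rule DERIV_cong[OF DERIV_mult[OF e DERIV_add[OF DERIV_cmult[OF m3, of K] DERIV_cmult[OF m2, of 3]]]])
      (simp add: algebra_simps power2_eq_square flip: M_def)
qed

lemma theta_zero: "s \<le> 0 \<Longrightarrow> theta K s = 0" "s \<le> 0 \<Longrightarrow> theta1 K s = 0" "s \<le> 0 \<Longrightarrow> theta2 K s = 0"
  by (simp_all add: theta_def theta1_def theta2_def max_def)

lemma theta_pos: "s > 0 \<Longrightarrow> theta K s > 0" and theta_nonneg: "theta K s \<ge> 0"
  and theta1_nonneg: "K \<ge> 0 \<Longrightarrow> theta1 K s \<ge> 0"
  by (simp_all add: theta_def theta1_def)

lemma theta2_ge:
  assumes "K \<ge> 0" shows "theta2 K s \<ge> K * theta1 K s"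
proof -
  have "0 \<le> exp (K * s) * (3 * (K * max 0 s ^ 2) + 6 * max 0 s)" using assms by simp
  also have "\<dots> = theta2 K s - K * theta1 K s"
    by (simp add: theta1_def theta2_def algebra_simps power2_eq_square)
  finally show ?thesis by simp
qed

lemma continuous_theta [continuous_intros]:
  assumes "continuous_on S f"
  shows "continuous_on S (\<lambda>x. theta K (f x))" "continuous_on S (\<lambda>x. theta1 K (f x))" "continuous_on S (\<lambda>x. theta2 K (f x))"
  unfolding theta_def theta1_def theta2_def by (intro continuous_intros assms)+

lemma isCont_open:
  fixes f :: "'a::t2_space \<Rightarrow> 'b::topological_space"
  assumes "open U" "continuous_on U f" "z \<in> U"
  shows "isCont f z"
  using assms by (simp add: continuous_on_eq_continuous_at)

context kolm begin

text \<open>Spatial coordinates that are constant along the drift: functions of \<open>yv\<close>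
  alone have no drift derivative, and an affine function of \<open>yv\<close> stays affine on every
  time slice.\<close>

definition yv :: "'n spacetime \<Rightarrow> 'n rvec" where "yv \<zeta> = E_mat B (- snd \<zeta>) *v fst \<zeta>"
abbreviation ev :: "'n rvec \<Rightarrow> 'n spacetime \<Rightarrow> 'n rvec" where "ev a \<zeta> \<equiv> E_mat B (- snd \<zeta>) *v a"

lemma yv_continuous [continuous_intros]: "continuous_on S f \<Longrightarrow> continuous_on S (\<lambda>x. yv (f x))"
  unfolding yv_def by (intro continuous_intros)

lemma yv_sflow: "yv (sflow a x \<zeta>) = yv \<zeta> + x *\<^sub>R ev a \<zeta>"
  by (simp add: yv_def sflow_def matrix_vector_right_distrib matrix_vector_mult_scaleR)

lemma yv_tflow: "yv (tflow B 1 x \<zeta>) = yv \<zeta>"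
  by (simp add: yv_def tflow_def E_mat_mult_vec)

context
  fixes \<alpha> :: "'n rvec" and \<beta> c m t1 K e :: real
  assumes e: "e > 0"
begin

text \<open>An affine function in the drift-invariant coordinates, which will separate a point from
  the ball, corrected by -\<beta> |y|^2 to bound the positivity set in space and by m (t - t1) to
  bound it in the past.\<close>

definition psi where "psi \<zeta> = \<alpha> \<bullet> yv \<zeta> - \<beta> * (yv \<zeta> \<bullet> yv \<zeta>) - c + m * (snd \<zeta> - t1)"
definition psi1 where "psi1 a \<zeta> = \<alpha> \<bullet> ev a \<zeta> - 2 * \<beta> * (yv \<zeta> \<bullet> ev a \<zeta>)"
definition psi2 where "psi2 a \<zeta> = - (2 * \<beta>) * (ev a \<zeta> \<bullet> ev a \<zeta>)"
text \<open>Equal to 1 up to the time t1 and to 0 from t1 + e on. It is decreasing, and the operator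
  contains minus the time derivative, so its derivative has the favourable sign.\<close>

definition chi :: "real \<Rightarrow> real" where "chi t = 1 - cutoff (1 + (t - t1) / e)"
definition chi1 :: "real \<Rightarrow> real" where "chi1 t = - (cutoff' (1 + (t - t1) / e) * (1 / e))"
definition bar where "bar \<zeta> = chi (snd \<zeta>) * theta K (psi \<zeta>)"
definition bar1 where "bar1 a \<zeta> = chi (snd \<zeta>) * (theta1 K (psi \<zeta>) * psi1 a \<zeta>)"
definition bar2 where "bar2 a \<zeta> = chi (snd \<zeta>) * (theta2 K (psi \<zeta>) * psi1 a \<zeta> * psi1 a \<zeta> + psi2 a \<zeta> * theta1 K (psi \<zeta>))"
definition barT where "barT \<zeta> = chi1 (snd \<zeta>) * theta K (psi \<zeta>) + theta1 K (psi \<zeta>) * m * chi (snd \<zeta>)"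

lemma psi_sflow: "psi (sflow a x \<zeta>) = psi \<zeta> + x * psi1 a \<zeta> + x\<^sup>2 * (psi2 a \<zeta> / 2)"
  unfolding psi_def psi1_def psi2_def yv_sflow hs_sflow
  by (simp add: inner_add_left inner_add_right power2_eq_square algebra_simps inner_commute)

lemma psi1_sflow: "psi1 a (sflow a x \<zeta>) = psi1 a \<zeta> + x * psi2 a \<zeta>"
  unfolding psi1_def psi2_def yv_sflow hs_sflow
  by (simp add: inner_add_left algebra_simps)

lemma psi_deriv: "((\<lambda>x. psi (sflow a x \<zeta>)) has_real_derivative psi1 a \<zeta>) (at 0)"
  unfolding psi_sflow by (auto intro!: derivative_eq_intros)

lemma bar_along: "along (sflow a) bar (bar1 a)" "along (sflow a) (bar1 a) (bar2 a)" "along (tflow B 1) bar barT"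
  unfolding along_def
proof (safe del: disjE)
  fix x :: "'n rvec" and t :: real
  let ?z = "(x, t)"
  have 1: "((\<lambda>x. theta K (psi (sflow a x ?z))) has_real_derivative theta1 K (psi (sflow a 0 ?z)) * psi1 a ?z) (at 0)"
    by (rule DERIV_chain2[OF theta_deriv(1) psi_deriv])
  show "((\<lambda>h. bar (sflow a h ?z)) has_real_derivative bar1 a ?z) (at 0)"
    using DERIV_cmult[OF 1, of "chi t"] by (simp add: bar_def bar1_def hs_sflow sflow_0)
  have 2: "((\<lambda>x. theta1 K (psi (sflow a x ?z))) has_real_derivative theta2 K (psi (sflow a 0 ?z)) * psi1 a ?z) (at 0)"
    by (rule DERIV_chain2[OF theta_deriv(2) psi_deriv])
  have 3: "((\<lambda>x. psi1 a (sflow a x ?z)) has_real_derivative psi2 a ?z) (at 0)"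
    unfolding psi1_sflow by (auto intro!: derivative_eq_intros)
  show "((\<lambda>h. bar1 a (sflow a h ?z)) has_real_derivative bar2 a ?z) (at 0)"
    using DERIV_cmult[OF DERIV_mult[OF 2 3], of "chi t"] by (simp add: bar1_def bar2_def hs_sflow sflow_0)
  have l: "((\<lambda>h. 1 + (t + h - t1) / e) has_real_derivative 1 / e) (at 0)"
    using e by (auto intro!: derivative_eq_intros)
  have 4: "((\<lambda>h. chi (t + h)) has_real_derivative chi1 t) (at 0)"
    unfolding chi_def chi1_def using DERIV_diff[OF DERIV_const DERIV_chain2[OF cutoff_deriv l], of 1] by simp
  have p: "psi (tflow B 1 h ?z) = psi ?z + m * h" for h
    unfolding psi_def yv_tflow by (simp add: tflow_def algebra_simps)
  have "((\<lambda>h. psi ?z + m * h) has_real_derivative m) (at 0)" by (auto intro!: derivative_eq_intros)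
  then have 5: "((\<lambda>h. theta K (psi ?z + m * h)) has_real_derivative theta1 K (psi ?z + m * 0) * m) (at 0)"
    by (rule DERIV_chain2[OF theta_deriv(1)])
  have s: "snd (tflow B 1 h ?z) = t + h" for h by (simp add: tflow_def)
  show "((\<lambda>h. bar (tflow B 1 h ?z)) has_real_derivative barT ?z) (at 0)"
    unfolding bar_def p s barT_def using DERIV_mult[OF 4 5] by simp
qed

lemma bar_continuous:
  "continuous_on UNIV bar" "continuous_on UNIV (bar1 a)" "continuous_on UNIV (bar2 a)" "continuous_on UNIV barT"
proof -
  have "e \<noteq> 0" using e by simp
  then have c: "continuous_on UNIV (\<lambda>\<zeta> :: 'n spacetime. chi (snd \<zeta>))" "continuous_on UNIV (\<lambda>\<zeta> :: 'n spacetime. chi1 (snd \<zeta>))"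
    unfolding chi_def chi1_def by (intro continuous_intros; simp)+
  have p: "continuous_on UNIV (\<lambda>\<zeta>. psi \<zeta>)" "continuous_on UNIV (\<lambda>\<zeta>. psi1 a \<zeta>)" "continuous_on UNIV (\<lambda>\<zeta>. psi2 a \<zeta>)"
    unfolding psi_def psi1_def psi2_def by (intro continuous_intros)+
  show "continuous_on UNIV bar" "continuous_on UNIV (bar1 a)" "continuous_on UNIV (bar2 a)" "continuous_on UNIV barT"
    unfolding bar_def[abs_def] bar1_def[abs_def] bar2_def[abs_def] barT_def[abs_def]
    by (intro continuous_intros c p)+
qed

lemma chi_zero: "t \<ge> t1 + e \<Longrightarrow> chi t = 0" "t \<ge> t1 + e \<Longrightarrow> chi1 t = 0"
proof -
  assume "t \<ge> t1 + e"
  then have "1 + (t - t1) / e \<ge> 2" using e by (simp add: pos_le_divide_eq)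
  then show "chi t = 0" "chi1 t = 0" by (simp_all add: chi_def chi1_def cutoff_eq_1 cutoff'_eq_0)
qed

lemma bar_zero:
  assumes "snd \<zeta> \<ge> t1 + e \<or> psi \<zeta> \<le> 0"
  shows "bar \<zeta> = 0" "bar1 a \<zeta> = 0" "bar2 a \<zeta> = 0" "barT \<zeta> = 0"
  using assms by (auto simp: bar_def bar1_def bar2_def barT_def chi_zero theta_zero)

lemma bar_nonneg: "bar \<zeta> \<ge> 0"
  unfolding bar_def chi_def by (simp add: theta_nonneg cutoff_le_1)

text \<open>Positivity of psi bounds |y| through the quadratic term; then the linear term in time
  gives a lower bound for the time, while the upper bound is imposed. The set lies in the continuous
  image of a compact box under the inverse coordinates.\<close>

lemma bar_support:
  assumes \<beta>: "\<beta> > 0" and m: "m > 0"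
  shows "bounded {\<zeta>. snd \<zeta> < t1 + e \<and> psi \<zeta> > 0}"
proof -
  define b where "b = \<bar>c\<bar> + m * e"
  define N where "N = 1 + (norm \<alpha> + b) / \<beta>"
  have b: "b \<ge> 0" unfolding b_def using m e by simp
  have N: "N \<ge> 1" using b \<beta> by (simp add: N_def)
  define tl where "tl = t1 - (norm \<alpha> * N + \<bar>c\<bar>) / m"
  have sub: "norm (yv \<zeta>) \<le> N \<and> tl \<le> snd \<zeta>" if h: "snd \<zeta> < t1 + e" "psi \<zeta> > 0" for \<zeta>
  proof -
    let ?n = "norm (yv \<zeta>)"
    have cs: "\<alpha> \<bullet> yv \<zeta> \<le> norm \<alpha> * ?n" by (rule norm_cauchy_schwarz)
    have mt: "m * (snd \<zeta> - t1) \<le> m * e" using h(1) m by (intro mult_left_mono) auto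
    have n2: "yv \<zeta> \<bullet> yv \<zeta> = ?n * ?n" by (simp add: dot_square_norm power2_eq_square)
    have q: "\<beta> * (?n * ?n) < norm \<alpha> * ?n + b"
      using h(2) cs mt unfolding psi_def n2 b_def by linarith
    have n: "?n \<le> N"
    proof (rule ccontr)
      assume "\<not> ?n \<le> N"
      then have g: "?n > N" by simp
      then have "?n - 1 > (norm \<alpha> + b) / \<beta>" by (simp add: N_def)
      then have "norm \<alpha> + b < \<beta> * (?n - 1)" using \<beta> by (simp add: pos_divide_less_eq mult.commute)
      also have "\<dots> \<le> \<beta> * ?n" using \<beta> by simp
      finally have "(norm \<alpha> + b) * ?n \<le> (\<beta> * ?n) * ?n" by (intro mult_right_mono) auto
      moreover have "b * 1 \<le> b * ?n" using b g N by (intro mult_left_mono) auto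
      ultimately show False using q by (simp add: algebra_simps)
    qed
    have "norm \<alpha> * ?n \<le> norm \<alpha> * N" using n by (intro mult_left_mono) auto
    moreover have "0 \<le> \<beta> * (yv \<zeta> \<bullet> yv \<zeta>)" using \<beta> by simp
    ultimately have "- (norm \<alpha> * N + \<bar>c\<bar>) \<le> m * (snd \<zeta> - t1)" using h(2) cs unfolding psi_def by linarith
    then have "- (norm \<alpha> * N + \<bar>c\<bar>) / m \<le> snd \<zeta> - t1" using m by (simp add: pos_divide_le_eq mult.commute)
    then show ?thesis using n unfolding tl_def minus_divide_left[symmetric] by linarith
  qed
  let ?F = "\<lambda>q :: 'n spacetime. (E_mat B (snd q) *v fst q, snd q)"
  have "compact (?F ` (cball 0 N \<times> {tl..t1 + e}))"
    by (intro compact_continuous_image compact_Times compact_cball compact_Icc continuous_intros)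
  then have bd: "bounded (?F ` (cball 0 N \<times> {tl..t1 + e}))" by (rule compact_imp_bounded)
  show ?thesis
  proof (rule bounded_subset[OF bd], rule subsetI)
    fix \<zeta> assume "\<zeta> \<in> {\<zeta>. snd \<zeta> < t1 + e \<and> psi \<zeta> > 0}"
    then have h: "snd \<zeta> < t1 + e" "psi \<zeta> > 0" by auto
    have "\<zeta> = ?F (yv \<zeta>, snd \<zeta>)" by (simp add: yv_def E_mat_mult_vec E_mat_0)
    moreover have "(yv \<zeta>, snd \<zeta>) \<in> cball 0 N \<times> {tl..t1 + e}" using sub[OF h] h(1) by simp
    ultimately show "\<zeta> \<in> ?F ` (cball 0 N \<times> {tl..t1 + e})" by (rule image_eqI)
  qed
qed

lemma bar_operator:
  "(\<Sum>k\<in>UNIV. bar2 (avec A k) \<zeta>) - barT \<zeta> = chi (snd \<zeta>) * (theta2 K (psi \<zeta>) * (\<Sum>k\<in>UNIV. (psi1 (avec A k) \<zeta>)\<^sup>2)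
    + theta1 K (psi \<zeta>) * ((\<Sum>k\<in>UNIV. psi2 (avec A k) \<zeta>) - m)) - chi1 (snd \<zeta>) * theta K (psi \<zeta>)"
proof -
  have "(\<Sum>k\<in>UNIV. bar2 (avec A k) \<zeta>) = chi (snd \<zeta>) * (theta2 K (psi \<zeta>) * (\<Sum>k\<in>UNIV. (psi1 (avec A k) \<zeta>)\<^sup>2)
    + theta1 K (psi \<zeta>) * (\<Sum>k\<in>UNIV. psi2 (avec A k) \<zeta>))"
    unfolding bar2_def by (simp add: sum.distrib sum_distrib_left sum_distrib_right power2_eq_square mult_ac distrib_left)
  then show ?thesis by (simp add: barT_def algebra_simps)
qed

text \<open>With the sum of squared slopes of psi at least \<delta>, the second-order term is at
  least K \<delta> theta', which outweighs the remaining multiple of theta'; the term with the time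
  cutoff is nonnegative by monotonicity.\<close>

lemma bar_operator_nonneg:
  assumes K: "K \<ge> 0" and h: "(\<Sum>k\<in>UNIV. (psi1 (avec A k) \<zeta>)\<^sup>2) \<ge> \<delta>" "\<delta> \<ge> 0" "(\<Sum>k\<in>UNIV. psi2 (avec A k) \<zeta>) - m \<ge> - (K * \<delta>)"
  shows "(\<Sum>k\<in>UNIV. bar2 (avec A k) \<zeta>) - barT \<zeta> \<ge> 0"
proof -
  have t1: "theta1 K (psi \<zeta>) \<ge> 0" by (rule theta1_nonneg[OF K])
  have "theta2 K (psi \<zeta>) * (\<Sum>k\<in>UNIV. (psi1 (avec A k) \<zeta>)\<^sup>2) \<ge> (K * theta1 K (psi \<zeta>)) * \<delta>"
    by (rule mult_mono[OF theta2_ge[OF K] h(1)]) (use h(2) t1 K order_trans[OF _ theta2_ge[OF K]] in auto)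
  moreover have "theta1 K (psi \<zeta>) * ((\<Sum>k\<in>UNIV. psi2 (avec A k) \<zeta>) - m) \<ge> theta1 K (psi \<zeta>) * (- (K * \<delta>))"
    by (rule mult_left_mono[OF h(3) t1])
  ultimately have x: "theta2 K (psi \<zeta>) * (\<Sum>k\<in>UNIV. (psi1 (avec A k) \<zeta>)\<^sup>2) + theta1 K (psi \<zeta>) * ((\<Sum>k\<in>UNIV. psi2 (avec A k) \<zeta>) - m) \<ge> 0"
    by (simp add: algebra_simps)
  have c: "chi (snd \<zeta>) \<ge> 0" by (simp add: chi_def cutoff_le_1)
  have "- chi1 (snd \<zeta>) \<ge> 0" using e by (simp add: chi1_def cutoff'_nonneg)
  then have "- chi1 (snd \<zeta>) * theta K (psi \<zeta>) \<ge> 0" by (rule mult_nonneg_nonneg[OF _ theta_nonneg])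
  then show ?thesis unfolding bar_operator using mult_nonneg_nonneg[OF c x] by linarith
qed

end

text \<open>If \<open>D\<close> reached outside the closed ball, a barrier supported near \<open>\<zeta>1\<close> (convexity of
  the time slices of the ball separates \<open>\<zeta>1\<close> from the ball by a half space) would contradict
  the weak equation.\<close>

lemma no_point_below:
  fixes z0 \<zeta>1 :: "'n spacetime" and r :: real and D
  defines "g \<equiv> hk A (-B) (-1) z0" and "W \<equiv> Wq A (-B) (-1) z0"
  defines "\<Omega> \<equiv> {z. g z > 1 / r}"
  defines "f \<equiv> \<lambda>z. (indicator D z - indicator \<Omega> z) * W z"
  assumes r: "r > 0" and D: "open D" "bounded D" and f: "integrable lborel f"
    and pos: "\<And>\<zeta>. pot f \<zeta> \<ge> 0" and zero: "\<And>\<zeta>. \<zeta> \<notin> D \<union> \<Omega> \<Longrightarrow> pot f \<zeta> = 0"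
    and \<zeta>1: "\<zeta>1 \<in> D" "snd \<zeta>1 < snd z0" "g \<zeta>1 < 1 / r" "W \<zeta>1 > 0"
  shows False
proof -
  interpret d: kolm A "-B" l by (rule dual)
  define t1 where "t1 = snd \<zeta>1"
  define s1 where "s1 = snd z0 - t1"
  have s1: "s1 > 0" using \<zeta>1(2) by (simp add: s1_def t1_def)
  define X where "X \<zeta> = hX (-B) (-1) z0 \<zeta>" for \<zeta>
  let ?P = "Pm A (-B) s1"
  define v1 where "v1 = ?P *v X \<zeta>1"
  define q1 where "q1 = v1 \<bullet> X \<zeta>1"
  \<comment> \<open>v1 is half the gradient of the quadratic form at \<zeta>1, the normal of its
    level ellipsoid; \<alpha> is the same covector in the coordinates \<open>yv\<close>.\<close>
  define \<alpha> where "\<alpha> = transpose (E_mat B t1) *v v1"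
  have \<alpha>: "\<alpha> \<bullet> w = v1 \<bullet> (E_mat B t1 *v w)" for w by (simp add: \<alpha>_def dot_lmul_matrix)
  have hs1: "hs (-1) z0 \<zeta> = s1" if "snd \<zeta> = t1" for \<zeta> using that by (simp add: s1_def)
  have \<alpha>y: "\<alpha> \<bullet> yv \<zeta> = v1 \<bullet> fst \<zeta>" if "snd \<zeta> = t1" for \<zeta>
    using that by (simp add: \<alpha> yv_def E_mat_mult_vec E_mat_0)
  define bb where "bb = v1 \<bullet> (E_mat (-B) s1 *v fst z0)"
  have vX: "v1 \<bullet> fst \<zeta> = v1 \<bullet> X \<zeta> + bb" if "snd \<zeta> = t1" for \<zeta>
    unfolding X_def hX_def hs1[OF that] bb_def by (simp add: inner_diff_right)
  define pk where "pk = d.peak s1"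
  have pk: "pk > 0" using d.peak_pos[OF s1] by (simp add: pk_def)
  have gq: "g \<zeta> = pk * exp (- (1/4) * ((?P *v X \<zeta>) \<bullet> X \<zeta>))" if "snd \<zeta> = t1" for \<zeta>
    using d.hk_eq[of "-1" \<zeta> z0] s1 unfolding hs1[OF that] g_def pk_def X_def by simp
  define w where "w = 1 / (r * pk)"
  have w: "w > 0" using r pk by (simp add: w_def)
  \<comment> \<open>On the slice through \<zeta>1 the closed ball is the ellipsoid where the
    quadratic form is at most qs; \<zeta>1 lies strictly outside.\<close>
  define qs where "qs = - 4 * ln w"
  have q1s: "q1 > qs"
  proof -
    have "pk * exp (- (1/4) * q1) < 1 / r" using \<zeta>1(3) gq[of \<zeta>1] by (simp add: t1_def q1_def v1_def)
    then have "exp (- (1/4) * q1) < w" using pk r by (simp add: w_def field_simps)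
    then have "ln (exp (- (1/4) * q1)) < ln w" using w by (subst ln_less_cancel_iff) auto
    then show ?thesis by (simp add: qs_def)
  qed
  define dd where "dd = (q1 - qs) / 4"
  have ddq: "q1 - qs = 4 * dd" by (simp add: dd_def)
  have dd: "dd > 0" using q1s by (simp add: dd_def)
  \<comment> \<open>By Cauchy-Schwarz for P, the functional \<alpha> is at most bb + q1 - 2 dd on
    the slice of the closed ball, and it is bb + q1 at \<zeta>1. The thresholds c1 and c2 lie
    between, at distance dd from each other; this gap will pay for the growth m e of psi in
    time.\<close>
  define c1 where "c1 = bb + q1 - dd * (3/2)"
  define c2 where "c2 = bb + q1 - dd / 2"
  have slice: "\<alpha> \<bullet> yv \<zeta> < c1" if t: "snd \<zeta> = t1" and gr: "g \<zeta> \<ge> 1 / r" for \<zeta>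
  proof -
    let ?q = "(?P *v X \<zeta>) \<bullet> X \<zeta>"
    have "1 / r \<le> pk * exp (- (1/4) * ?q)" using gr gq[OF t] by simp
    then have "w \<le> exp (- (1/4) * ?q)" using pk r by (simp add: w_def field_simps)
    then have "ln w \<le> ln (exp (- (1/4) * ?q))" using w by (subst ln_le_cancel_iff) auto
    then have qq: "?q \<le> qs" by (simp add: qs_def)
    have "0 \<le> (?P *v (X \<zeta>1 + (-1) *\<^sub>R X \<zeta>)) \<bullet> (X \<zeta>1 + (-1) *\<^sub>R X \<zeta>)" by (rule d.P_nonneg[OF s1])
    also have "\<dots> = q1 + 2 * (-1) * (v1 \<bullet> X \<zeta>) + (-1)\<^sup>2 * ?q"
      unfolding d.P_quad_line[OF s1] by (simp add: v1_def q1_def)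
    finally have "2 * (v1 \<bullet> X \<zeta>) \<le> q1 + ?q" by simp
    moreover have "V + bb < bb + q1 - dd * (3/2)" if "2 * V \<le> q1 + Q" "Q \<le> qs" for V Q
      using that ddq dd by (simp add: field_simps)
    ultimately show ?thesis using qq unfolding \<alpha>y[OF t] vX[OF t] c1_def by blast
  qed
  have y1: "\<alpha> \<bullet> yv \<zeta>1 = q1 + bb" using \<alpha>y[of \<zeta>1] vX[of \<zeta>1] by (simp add: t1_def q1_def)
  have gcont: "continuous_on {\<zeta>. snd \<zeta> < snd z0} g"
    unfolding g_def by (intro d.continuous_hk continuous_on_const continuous_on_id) simp
  have Wcont: "continuous_on {\<zeta>. snd \<zeta> < snd z0} W"
    unfolding W_def by (intro d.continuous_hk continuous_on_const continuous_on_id) simp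
  have s1': "\<bar>- 1 :: real\<bar> = 1" by simp
  \<comment> \<open>The separation persists on nearby slices: points of the closed ball violating it
    form a compact set without points at the time t1, so their times stay away from t1. The bound
    s1/2 keeps all times before \<open>z0\<close>, where g is continuous.\<close>
  obtain \<eta> where \<eta>: "\<eta> > 0" "\<eta> \<le> s1 / 2" "\<And>\<zeta>. \<bar>snd \<zeta> - t1\<bar> < \<eta> \<Longrightarrow> g \<zeta> \<ge> 1 / r \<Longrightarrow> \<alpha> \<bullet> yv \<zeta> < c1"
  proof -
    let ?T = "{\<zeta> :: 'n spacetime. \<bar>snd \<zeta> - t1\<bar> \<le> s1 / 2}"
    have T: "closed ?T" by (intro closed_Collect_le continuous_intros)
    have "?T \<subseteq> {\<zeta>. snd \<zeta> < snd z0}"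
    proof
      fix \<zeta> :: "'n spacetime" assume "\<zeta> \<in> ?T"
      then have "\<bar>snd \<zeta> - t1\<bar> \<le> s1 / 2" by simp
      moreover have "t1 + s1 = snd z0" by (simp add: s1_def)
      ultimately have "snd \<zeta> < snd z0" using s1 by linarith
      then show "\<zeta> \<in> {\<zeta>. snd \<zeta> < snd z0}" by simp
    qed
    then have "continuous_on ?T g" by (rule continuous_on_subset[OF gcont])
    from continuous_closed_preimage[OF this T closed_atLeast[of "1 / r"]]
    have cl: "closed (?T \<inter> g -` {1 / r..})" .
    have "bounded {z. g z > 1 / (2 * r)}" unfolding g_def by (rule d.bounded_superlevel[OF s1']) (use r in simp)
    moreover have "?T \<inter> g -` {1 / r..} \<subseteq> {z. g z > 1 / (2 * r)}"
    proof
      fix z assume "z \<in> ?T \<inter> g -` {1 / r..}"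
      moreover have "1 / (2 * r) < 1 / r" using r by (simp add: field_simps)
      ultimately show "z \<in> {z. g z > 1 / (2 * r)}" by auto
    qed
    ultimately have "bounded (?T \<inter> g -` {1 / r..})" by (rule bounded_subset)
    with cl have "compact (?T \<inter> g -` {1 / r..})" by (simp add: compact_eq_bounded_closed)
    moreover have "closed {\<zeta>. c1 \<le> \<alpha> \<bullet> yv \<zeta>}" by (intro closed_Collect_le continuous_intros)
    ultimately have C: "compact ((?T \<inter> g -` {1 / r..}) \<inter> {\<zeta>. c1 \<le> \<alpha> \<bullet> yv \<zeta>})" (is "compact ?C")
      by (rule compact_Int_closed)
    show ?thesis
    proof (cases "?C = {}")
      case True
      have "\<alpha> \<bullet> yv \<zeta> < c1" if "\<bar>snd \<zeta> - t1\<bar> < s1 / 2" "g \<zeta> \<ge> 1 / r" for \<zeta>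
        using True that by (metis (mono_tags, lifting) IntI atLeast_iff empty_iff less_imp_le mem_Collect_eq not_le vimageI)
      then show ?thesis using that[of "s1 / 2"] s1 by simp
    next
      case False
      have "continuous_on ?C (\<lambda>\<zeta>. \<bar>snd \<zeta> - t1\<bar>)" by (intro continuous_intros)
      then obtain \<zeta>m where m: "\<zeta>m \<in> ?C" "\<And>\<zeta>. \<zeta> \<in> ?C \<Longrightarrow> \<bar>snd \<zeta>m - t1\<bar> \<le> \<bar>snd \<zeta> - t1\<bar>"
        using continuous_attains_inf[OF C False] by blast
      have "snd \<zeta>m \<noteq> t1" using m(1) slice[of \<zeta>m] by auto
      then have p: "\<bar>snd \<zeta>m - t1\<bar> > 0" by simp
      have "\<alpha> \<bullet> yv \<zeta> < c1" if "\<bar>snd \<zeta> - t1\<bar> < min (s1 / 2) \<bar>snd \<zeta>m - t1\<bar>" "g \<zeta> \<ge> 1 / r" for \<zeta>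
      proof (rule ccontr)
        assume "\<not> \<alpha> \<bullet> yv \<zeta> < c1"
        then have "\<zeta> \<in> ?C" using that by simp
        from m(2)[OF this] that(1) show False by simp
      qed
      moreover have "min (s1 / 2) \<bar>snd \<zeta>m - t1\<bar> > 0" using s1 p by (simp only: min_less_iff_conj) simp
      ultimately show ?thesis using that[of "min (s1 / 2) \<bar>snd \<zeta>m - t1\<bar>"] min.cobounded1 by blast
    qed
  qed
  \<comment> \<open>The sum of squared slopes of the affine part of psi. At t1 it is 4 W(\<zeta>1),
    which explains the choice of \<zeta>1 with W positive: the separating direction is seen by the
    degenerate second-order part.\<close>
  define \<Phi> where "\<Phi> t = (\<Sum>k\<in>UNIV. (\<alpha> \<bullet> (E_mat B (- t) *v avec A k))\<^sup>2)" for t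
  have "\<Phi> t1 = (\<Sum>k\<in>UNIV. (v1 \<bullet> avec A k) * (v1 \<bullet> avec A k))"
    by (simp add: \<Phi>_def \<alpha> E_mat_mult_vec E_mat_0 power2_eq_square)
  also have "\<dots> = 4 * W \<zeta>1"
    unfolding W_def Wq_alt hs1[of \<zeta>1, unfolded t1_def, OF refl] by (simp add: v1_def X_def A_avec)
  finally have \<Phi>1: "\<Phi> t1 > 0" using \<zeta>1(4) by simp
  have \<Phi>c: "continuous_on UNIV \<Phi>" unfolding \<Phi>_def[abs_def] by (intro continuous_intros)
  have "open {t. \<Phi> t > \<Phi> t1 / 2}" by (intro open_Collect_less \<Phi>c continuous_on_const)
  moreover have "t1 \<in> {t. \<Phi> t > \<Phi> t1 / 2}" using \<Phi>1 by simp
  ultimately obtain \<eta>2 where \<eta>2: "\<eta>2 > 0" "ball t1 \<eta>2 \<subseteq> {t. \<Phi> t > \<Phi> t1 / 2}" by (rule openE)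
  define \<eta>3 where "\<eta>3 = min \<eta> \<eta>2"
  have \<eta>3: "\<eta>3 > 0" "\<eta>3 \<le> \<eta>" "\<eta>3 \<le> \<eta>2" using \<eta> \<eta>2 by (auto simp: \<eta>3_def)
  have \<Phi>g: "\<Phi> t > \<Phi> t1 / 2" if "\<bar>t - t1\<bar> < \<eta>3" for t
    using \<eta>2(2) that \<eta>3(3) by (auto simp: subset_iff dist_real_def abs_minus_commute)
  have \<Omega>b: "bounded \<Omega>" unfolding \<Omega>_def g_def by (rule d.bounded_superlevel[OF s1']) (use r in simp)
  have U: "bounded (D \<union> \<Omega>)" using D(2) \<Omega>b by simp
  have "continuous_on UNIV (\<lambda>\<zeta>. \<alpha> \<bullet> yv \<zeta>)" by (intro continuous_intros)
  then obtain M0 where M0: "\<And>z. z \<in> D \<union> \<Omega> \<Longrightarrow> \<bar>\<alpha> \<bullet> yv z\<bar> \<le> M0" by (rule continuous_bounded_on[OF _ U]) blast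
  have "continuous_on UNIV (\<lambda>\<zeta>. \<Sum>k\<in>UNIV. (yv \<zeta> \<bullet> ev (avec A k) \<zeta>)\<^sup>2)" by (intro continuous_intros)
  then obtain M1 where M1: "\<And>z. z \<in> D \<union> \<Omega> \<Longrightarrow> \<bar>\<Sum>k\<in>UNIV. (yv z \<bullet> ev (avec A k) z)\<^sup>2\<bar> \<le> M1" by (rule continuous_bounded_on[OF _ U]) blast
  have "continuous_on UNIV (\<lambda>\<zeta>. \<Sum>k\<in>UNIV. ev (avec A k) \<zeta> \<bullet> ev (avec A k) \<zeta>)" by (intro continuous_intros)
  then obtain M2 where M2: "\<And>z. z \<in> D \<union> \<Omega> \<Longrightarrow> \<bar>\<Sum>k\<in>UNIV. ev (avec A k) z \<bullet> ev (avec A k) z\<bar> \<le> M2" by (rule continuous_bounded_on[OF _ U]) blast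
  have M0p: "M0 \<ge> 0" "M1 \<ge> 0" "M2 \<ge> 0" 
    using M0[OF UnI1[OF \<zeta>1(1)]] M1[OF UnI1[OF \<zeta>1(1)]] M2[OF UnI1[OF \<zeta>1(1)]] abs_ge_zero order_trans by blast+
  let ?Y = "yv \<zeta>1 \<bullet> yv \<zeta>1"
  \<comment> \<open>Small enough that the quadratic correction costs at most dd/4 at \<zeta>1 and
    cannot destroy the slope estimate on D and the ball.\<close>
  define \<beta> where "\<beta> = min 1 (min (\<Phi> t1 / (32 * (M1 + 1))) (dd / (4 * (?Y + 1))))"
  have Y0: "?Y \<ge> 0" by simp
  have \<beta>: "\<beta> > 0" "\<beta> \<le> 1" "\<beta> \<le> \<Phi> t1 / (32 * (M1 + 1))" "\<beta> \<le> dd / (4 * (?Y + 1))"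
    using \<Phi>1 M0p dd Y0 by (auto simp: \<beta>_def add_nonneg_pos)
  have cancel: "x / (k * N) * N = x / k" if "N \<noteq> 0" for x k N :: real using that by simp
  have \<beta>Y: "\<beta> * ?Y \<le> dd / 4"
  proof -
    have "\<beta> * ?Y \<le> dd / (4 * (?Y + 1)) * (?Y + 1)" using \<beta>(1,4) Y0 by (intro mult_mono) auto
    also have "\<dots> = dd / 4" by (rule cancel) (use Y0 in linarith)
    finally show ?thesis .
  qed
  have \<beta>M: "32 * (\<beta> * M1) \<le> \<Phi> t1"
  proof -
    have "\<beta> * M1 \<le> \<Phi> t1 / (32 * (M1 + 1)) * (M1 + 1)" using \<beta>(1,3) M0p by (intro mult_mono) auto
    also have "\<dots> = \<Phi> t1 / 32" by (rule cancel) (use M0p in linarith)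
    finally show ?thesis by simp
  qed
  \<comment> \<open>Large enough that psi is negative on D and the ball at all times up to t1 -
    \<eta>3.\<close>
  define m where "m = (M0 + \<bar>c2\<bar> + 1) / \<eta>3"
  have m: "m > 0" using M0p \<eta>3(1) by (simp add: m_def)
  have m\<eta>: "m * \<eta>3 = M0 + \<bar>c2\<bar> + 1" using \<eta>3(1) by (simp add: m_def)
  \<comment> \<open>Short enough to remain in the time window and to let psi gain at most dd after
    t1.\<close>
  define e where "e = min (\<eta>3 / 2) (dd / m)"
  have e: "e > 0" "e < \<eta>3" "e \<le> dd / m" using \<eta>3(1) dd m by (auto simp: e_def)
  have me: "m * e \<le> dd" using e(3) m by (simp add: pos_le_divide_eq mult.commute)
  \<comment> \<open>In the window \<Phi>/2 exceeds a quarter of \<Phi>(t1), and the quadratic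
    correction takes away at most one eighth.\<close>
  define \<delta> where "\<delta> = \<Phi> t1 / 8"
  have \<delta>: "\<delta> > 0" using \<Phi>1 by (simp add: \<delta>_def)
  \<comment> \<open>K \<delta> dominates m and the second derivatives of the quadratic correction,
    bounded by 2 M2 as \<beta> is at most 1.\<close>
  define K where "K = (m + 2 * M2) / \<delta>"
  have K: "K \<ge> 0" "K * \<delta> = m + 2 * M2" using m M0p \<delta> by (auto simp: K_def)
  let ?psi = "psi \<alpha> \<beta> c2 m t1" and ?bar = "bar \<alpha> \<beta> c2 m t1 K e"
  let ?bar1 = "\<lambda>k. bar1 \<alpha> \<beta> c2 m t1 K e (avec A k)" and ?bar2 = "\<lambda>k. bar2 \<alpha> \<beta> c2 m t1 K e (avec A k)"
  let ?barT = "barT \<alpha> \<beta> c2 m t1 K e"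
  have near: "\<bar>snd \<zeta> - t1\<bar> < \<eta>3" if h: "\<zeta> \<in> D \<union> \<Omega>" "snd \<zeta> < t1 + e" "?psi \<zeta> > 0" for \<zeta>
  proof (rule ccontr)
    assume "\<not> \<bar>snd \<zeta> - t1\<bar> < \<eta>3"
    then have "snd \<zeta> - t1 \<le> - \<eta>3" using h(2) e(2) by linarith
    then have "m * (snd \<zeta> - t1) \<le> m * (- \<eta>3)" using m by (intro mult_left_mono) auto
    then have "m * (snd \<zeta> - t1) \<le> - (M0 + \<bar>c2\<bar> + 1)" using m\<eta> by simp
    moreover have "0 \<le> \<beta> * (yv \<zeta> \<bullet> yv \<zeta>)" using \<beta>(1) by simp
    ultimately show False using M0[OF h(1)] h(3) unfolding psi_def[OF e(1)] by linarith
  qed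
  have \<Omega>0: "snd \<zeta> \<ge> t1 + e \<or> ?psi \<zeta> \<le> 0" if "\<zeta> \<in> \<Omega>" for \<zeta>
  proof (rule ccontr)
    assume "\<not> ?thesis"
    then have h: "snd \<zeta> < t1 + e" "?psi \<zeta> > 0" by auto
    then have "\<bar>snd \<zeta> - t1\<bar> < \<eta>" using near[of \<zeta>] that \<eta>3(2) by auto
    moreover have "g \<zeta> \<ge> 1 / r" using that by (simp add: \<Omega>_def)
    ultimately have "\<alpha> \<bullet> yv \<zeta> < c1" by (rule \<eta>(3))
    moreover have "m * (snd \<zeta> - t1) \<le> m * e" using h(1) m by (intro mult_left_mono) auto
    moreover have "0 \<le> \<beta> * (yv \<zeta> \<bullet> yv \<zeta>)" using \<beta>(1) by simp
    ultimately show False using h(2) me unfolding psi_def[OF e(1)] c1_def c2_def by linarith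
  qed
  have Lpos: "(\<Sum>k\<in>UNIV. ?bar2 k \<zeta>) - ?barT \<zeta> \<ge> 0" if U: "\<zeta> \<in> D \<union> \<Omega>" for \<zeta>
  proof (cases "snd \<zeta> \<ge> t1 + e \<or> ?psi \<zeta> \<le> 0")
    case True
    then show ?thesis by (simp add: bar_zero[OF e(1) True])
  next
    case False
    then have h: "snd \<zeta> < t1 + e" "?psi \<zeta> > 0" by auto
    have n: "\<bar>snd \<zeta> - t1\<bar> < \<eta>3" by (rule near[OF U h])
    show ?thesis
    proof (rule bar_operator_nonneg[OF e(1) K(1) _ less_imp_le[OF \<delta>]])
      have half: "(x - y)\<^sup>2 \<ge> x\<^sup>2 / 2 - y\<^sup>2" for x y :: real
        using zero_le_power2[of "x - 2 * y"] by (simp add: power2_eq_square algebra_simps)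
      have "\<Phi> (snd \<zeta>) / 2 - 4 * (\<beta> * \<beta>) * (\<Sum>k\<in>UNIV. (yv \<zeta> \<bullet> ev (avec A k) \<zeta>)\<^sup>2)
        = (\<Sum>k\<in>UNIV. (\<alpha> \<bullet> ev (avec A k) \<zeta>)\<^sup>2 / 2 - (2 * \<beta> * (yv \<zeta> \<bullet> ev (avec A k) \<zeta>))\<^sup>2)"
        unfolding \<Phi>_def by (simp add: sum_subtractf sum_divide_distrib sum_distrib_left power_mult_distrib power2_eq_square mult_ac)
      also have "\<dots> \<le> (\<Sum>k\<in>UNIV. (psi1 \<alpha> \<beta> (avec A k) \<zeta>)\<^sup>2)"
        unfolding psi1_def[OF e(1)] by (intro sum_mono half)
      finally have s: "\<Phi> (snd \<zeta>) / 2 - 4 * (\<beta> * \<beta>) * (\<Sum>k\<in>UNIV. (yv \<zeta> \<bullet> ev (avec A k) \<zeta>)\<^sup>2) \<le> (\<Sum>k\<in>UNIV. (psi1 \<alpha> \<beta> (avec A k) \<zeta>)\<^sup>2)" .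
      have b1: "\<beta> * \<beta> \<le> \<beta> * 1" using \<beta>(1,2) by (intro mult_left_mono) auto
      have b2: "(\<Sum>k\<in>UNIV. (yv \<zeta> \<bullet> ev (avec A k) \<zeta>)\<^sup>2) \<le> M1" using M1[OF U] by linarith
      have "(\<beta> * \<beta>) * (\<Sum>k\<in>UNIV. (yv \<zeta> \<bullet> ev (avec A k) \<zeta>)\<^sup>2) \<le> (\<beta> * 1) * M1"
        by (rule mult_mono[OF b1 b2]) (use \<beta>(1) in \<open>auto intro!: sum_nonneg\<close>)
      then show "\<delta> \<le> (\<Sum>k\<in>UNIV. (psi1 \<alpha> \<beta> (avec A k) \<zeta>)\<^sup>2)"
        using s \<Phi>g[OF n] \<beta>M unfolding \<delta>_def by linarith
      have "(\<Sum>k\<in>UNIV. psi2 \<beta> (avec A k) \<zeta>) = - 2 * (\<beta> * (\<Sum>k\<in>UNIV. ev (avec A k) \<zeta> \<bullet> ev (avec A k) \<zeta>))"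
        unfolding psi2_def[OF e(1)] by (simp add: sum_distrib_left sum_negf mult_ac)
      moreover have "\<beta> * (\<Sum>k\<in>UNIV. ev (avec A k) \<zeta> \<bullet> ev (avec A k) \<zeta>) \<le> 1 * M2"
        using \<beta>(1,2) M2[OF U] M0p by (intro mult_mono) (auto intro!: sum_nonneg)
      ultimately show "(\<Sum>k\<in>UNIV. psi2 \<beta> (avec A k) \<zeta>) - m \<ge> - (K * \<delta>)" unfolding K(2) by linarith
    qed
  qed
  let ?H = "{\<zeta>. snd \<zeta> < t1 + e \<and> ?psi \<zeta> > 0}"
  have Hb: "bounded ?H" by (rule bar_support[OF e(1) \<beta>(1) m])
  have Hz: "snd \<zeta> \<ge> t1 + e \<or> ?psi \<zeta> \<le> 0" if "\<zeta> \<notin> ?H" for \<zeta> using that by auto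
  have fK: "z \<in> D \<union> \<Omega>" if "f z \<noteq> 0" for z using that by (auto simp: f_def indicator_def split: if_splits)
  have weak: "(\<integral>\<zeta>. pot f \<zeta> * ((\<Sum>k\<in>UNIV. ?bar2 k \<zeta>) - ?barT \<zeta>) \<partial>lborel) = - (\<integral>z. f z * ?bar z \<partial>lborel)"
    by (rule pot_weak_equation[where H = ?H and ?h1.0 = ?bar1 and K = "D \<union> \<Omega>", OF bar_along[OF e(1)] bar_continuous[OF e(1)] Hb
          bar_zero[OF e(1) Hz] f U fK])
  have "0 \<le> (\<integral>\<zeta>. pot f \<zeta> * ((\<Sum>k\<in>UNIV. ?bar2 k \<zeta>) - ?barT \<zeta>) \<partial>lborel)"
  proof (rule Bochner_Integration.integral_nonneg)
    fix \<zeta>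
    show "0 \<le> pot f \<zeta> * ((\<Sum>k\<in>UNIV. ?bar2 k \<zeta>) - ?barT \<zeta>)"
    proof (cases "\<zeta> \<in> D \<union> \<Omega>")
      case True
      show ?thesis by (rule mult_nonneg_nonneg[OF pos Lpos[OF True]])
    next
      case False
      show ?thesis unfolding zero[OF False] by simp
    qed
  qed
  then have le: "(\<integral>z. f z * ?bar z \<partial>lborel) \<le> 0" using weak by linarith
  \<comment> \<open>The barrier vanishes on the ball, so only the nonnegative part of
    \<open>f\<close>, carried by D, is tested.\<close>
  have fb: "f z * ?bar z = indicator D z *\<^sub>R (W z * ?bar z)" for z
  proof (cases "z \<in> \<Omega>")
    case True
    then show ?thesis by (simp only: bar_zero(1)[OF e(1) \<Omega>0[OF True]] mult_zero_right scaleR_zero_right)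
  qed (simp add: f_def)
  have "integrable lborel (\<lambda>z. ?bar z * f z)" by (rule integrable_continuous_mult[OF bar_continuous(1)[OF e(1)] f U fK])
  then have si: "set_integrable lborel D (\<lambda>z. W z * ?bar z)"
    unfolding set_integrable_def fb[symmetric] by (simp add: mult.commute)
  have "(LBINT z:D. W z * ?bar z) > 0"
  proof (rule set_integral_pos_open[OF D(1) \<zeta>1(1) si])
    show "0 \<le> W z * ?bar z" for z
      unfolding W_def by (intro mult_nonneg_nonneg d.Wq_nonneg bar_nonneg[OF e(1)])
    have o: "open {\<zeta> :: 'n spacetime. snd \<zeta> < snd z0}" by (intro open_Collect_less continuous_intros)
    have "isCont W \<zeta>1" by (rule isCont_open[OF o Wcont]) (use \<zeta>1(2) in simp)
    moreover have "isCont ?bar \<zeta>1" by (rule isCont_open[OF open_UNIV bar_continuous(1)[OF e(1)] UNIV_I])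
    ultimately show "isCont (\<lambda>z. W z * ?bar z) \<zeta>1" by (rule continuous_mult)
    have "?psi \<zeta>1 > 0" using \<beta>Y dd y1 unfolding psi_def[OF e(1)] c2_def t1_def by simp
    moreover have "chi t1 e (snd \<zeta>1) = 1" unfolding chi_def[OF e(1)] by (simp add: t1_def cutoff_eq_0)
    ultimately show "W \<zeta>1 * ?bar \<zeta>1 > 0" using \<zeta>1(4) unfolding bar_def[OF e(1)] by (simp add: theta_pos)
  qed
  then show False using le unfolding set_lebesgue_integral_def fb by linarith
qed

end

section \<open>Characterization of the balls\<close>

context kolm begin

text \<open>If no coordinate had level 0, the premise of \<open>controllable\<close> would be
  vacuous and every vector would be 0.\<close>

lemma level0: obtains i where "l i = 0"
proof (cases "\<exists>i. l i = 0")
  case False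
  have "axis (undefined :: 'n) (1 :: real) = 0" by (rule controllable) (use False in blast)
  then show ?thesis by (simp add: axis_eq_0_iff)
qed (use that in blast)

text \<open>Along the direction C e, with e a basis vector of level 0, P X moves along e, so 4 W is
  a quadratic polynomial with positive leading coefficient. Its values at h and -h have a positive
  sum, hence W cannot vanish on a neighbourhood within a time slice.\<close>

lemma Wq_pos_near:
  assumes s: "hs \<sigma> p \<zeta> > 0" and V: "open V" "\<zeta> \<in> V"
  obtains \<zeta>' where "\<zeta>' \<in> V" "snd \<zeta>' = snd \<zeta>" "Wq A B \<sigma> p \<zeta>' > 0"
proof -
  obtain i where i: "l i = 0" by (rule level0)
  let ?e = "axis i (1 :: real) :: 'n rvec" and ?s = "hs \<sigma> p \<zeta>"
  have Ae: "(A *v ?e) \<bullet> ?e > 0"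
  proof (rule A_pos)
    show "?e \<noteq> 0" by (simp add: axis_eq_0_iff)
    show "l j \<noteq> 0 \<Longrightarrow> ?e $ j = 0" for j using i by (auto simp: axis_def)
  qed
  let ?a = "C_mat A B ?s *v ?e"
  have Pa: "Pm A B ?s *v ?a = ?e" using s by (simp only: matrix_vector_mul_assoc P_C matrix_vector_mul_lid)
  obtain d where d: "d > 0" "\<And>x :: real. \<bar>x\<bar> < d \<Longrightarrow> sflow ?a x \<zeta> \<in> V"
    by (rule flow_eventually_in[OF sflow_good V]) blast
  let ?y = "Pm A B ?s *v hX B \<sigma> p \<zeta>"
  have W: "4 * Wq A B \<sigma> p (sflow ?a x \<zeta>) = (A *v ?y) \<bullet> ?y + x * ((A *v ?e) \<bullet> ?y + (A *v ?y) \<bullet> ?e) + x * x * ((A *v ?e) \<bullet> ?e)" for x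
    unfolding Wq_alt hX_sflow hs_sflow
    by (simp only: matrix_vector_right_distrib matrix_vector_mult_scaleR Pa)
      (simp add: inner_add_left inner_add_right algebra_simps)
  define h where "h = d / 2"
  have h: "h > 0" "\<bar>h\<bar> < d" "\<bar>- h\<bar> < d" using d(1) by (auto simp: h_def)
  have "4 * Wq A B \<sigma> p (sflow ?a h \<zeta>) + 4 * Wq A B \<sigma> p (sflow ?a (- h) \<zeta>) = 2 * ((A *v ?y) \<bullet> ?y) + 2 * (h * h * ((A *v ?e) \<bullet> ?e))"
    unfolding W by (simp add: algebra_simps)
  moreover have "(A *v ?y) \<bullet> ?y \<ge> 0" by (rule A_vec_nonneg)
  moreover have "h * h * ((A *v ?e) \<bullet> ?e) > 0" using h(1) Ae by simp
  ultimately have "Wq A B \<sigma> p (sflow ?a h \<zeta>) > 0 \<or> Wq A B \<sigma> p (sflow ?a (- h) \<zeta>) > 0" by linarith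
  then show ?thesis
    using that[OF d(2)[OF h(2)] hs_sflow] that[OF d(2)[OF h(3)] hs_sflow] by blast
qed

text \<open>Moving in a direction in which the quadratic form does not decrease to first order
  increases it strictly. The kernel therefore has no local minimum within a time slice, and an open
  subset of a closed ball lies in the open ball.\<close>

lemma hk_smaller_near:
  assumes s: "hs \<sigma> p \<zeta> > 0" and V: "open V" "\<zeta> \<in> V"
  obtains \<zeta>' where "\<zeta>' \<in> V" "snd \<zeta>' = snd \<zeta>" "hk A B \<sigma> p \<zeta>' < hk A B \<sigma> p \<zeta>"
proof -
  let ?s = "hs \<sigma> p \<zeta>" and ?X = "hX B \<sigma> p \<zeta>"
  obtain b :: "'n rvec" where b: "b \<noteq> 0" by (metis axis_eq_0_iff zero_neq_one)
  define a where "a = (if (Pm A B ?s *v ?X) \<bullet> b \<ge> 0 then b else - b)"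
  have a: "a \<noteq> 0" "(Pm A B ?s *v ?X) \<bullet> a \<ge> 0" using b by (auto simp: a_def)
  have Pa: "(Pm A B ?s *v a) \<bullet> a > 0" using P_pos_def[OF s] a(1) by (simp add: pos_def_def)
  obtain d where d: "d > 0" "\<And>x :: real. \<bar>x\<bar> < d \<Longrightarrow> sflow a x \<zeta> \<in> V"
    by (rule flow_eventually_in[OF sflow_good V]) blast
  let ?z = "sflow a (d / 2) \<zeta>"
  have s': "hs \<sigma> p ?z = ?s" by (simp add: hs_sflow)
  have "(Pm A B ?s *v ?X) \<bullet> ?X < (Pm A B ?s *v hX B \<sigma> p ?z) \<bullet> hX B \<sigma> p ?z"
    unfolding hX_sflow P_quad_line[OF s] using d(1) a(2) Pa
    by (simp add: add_nonneg_pos)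
  then have "hk A B \<sigma> p ?z < hk A B \<sigma> p \<zeta>"
    using s peak_pos[OF s] by (simp add: hk_eq s')
  then show ?thesis by (rule that[OF d(2) hs_sflow, rotated]) (use d(1) in simp)
qed

lemma W_kernel_nonneg: "W_kernel A B (gcomp B (ginv B z) \<zeta>) \<ge> 0"
proof -
  interpret d: kolm A "-B" l by (rule dual)
  consider "snd \<zeta> < snd z" | "snd \<zeta> = snd z" | "snd z < snd \<zeta>" by linarith
  then show ?thesis
  proof cases
    case 1 then show ?thesis by (simp add: W_kernel_backward d.Wq_nonneg)
  next
    case 2 then show ?thesis by (simp add: W_kernel_def gcomp_def ginv_def)
  next
    case 3 then show ?thesis by (simp add: W_kernel_forward Wq_nonneg)
  qed
qed

theorem ball_characterization:
  fixes z0 :: "'n spacetime" and D and r p :: real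
  defines "W \<equiv> \<lambda>\<zeta>. W_kernel A B (gcomp B (ginv B z0) \<zeta>)"
  defines "f \<equiv> \<lambda>\<zeta>. (indicator D \<zeta> - indicator (L_ball A B r z0) \<zeta>) * W \<zeta>"
  assumes D: "open D" "bounded D" and r: "r > 0"
    and mean: "\<And>u S. open S \<Longrightarrow> D \<union> {z0} \<subseteq> S \<Longrightarrow> L_harmonic_on A B u S \<Longrightarrow> (\<forall>z\<in>S. u z \<ge> 0) \<Longrightarrow>
      set_integrable lborel D (\<lambda>\<zeta>. u \<zeta> * W \<zeta>) \<and> u z0 = 1 / r * (LBINT \<zeta>:D. u \<zeta> * W \<zeta>)"
    and f: "integrable lborel f" and p: "p > hdim / 2 + 1" and F: "integrable lborel (\<lambda>z. \<bar>f z\<bar> powr p)"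
  shows "D = L_ball A B r z0"
proof -
  interpret d: kolm A "-B" l by (rule dual)
  let ?Wb = "Wq A (-B) (-1) z0"
  define g where "g = hk A (-B) (-1) z0"
  define \<Omega> where "\<Omega> = {z. g z > 1 / r}"
  have ball: "L_ball A B r z0 = \<Omega>" by (simp add: L_ball_def \<Omega>_def g_def fund_sol_backward)
  have W0: "W z \<ge> 0" for z unfolding W_def by (rule W_kernel_nonneg)
  \<comment> \<open>Off its pole the kernel is a nonnegative L-harmonic function; as a function of
    the pole its value at \<open>z0\<close> is g.\<close>
  have test: "set_integrable lborel D (\<lambda>z. hk A B 1 \<zeta> z * W z) \<and> g \<zeta> = 1 / r * (LBINT z:D. hk A B 1 \<zeta> z * W z)"
    if "\<zeta> \<notin> D" "\<zeta> \<noteq> z0" for \<zeta>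
  proof -
    have L: "L_harmonic_on A B (hk A B 1 \<zeta>) (- {\<zeta>})" by (rule L_harmonic_hk) auto
    have o: "open (- {\<zeta>})" and s: "D \<union> {z0} \<subseteq> - {\<zeta>}" and n: "\<forall>z\<in>- {\<zeta>}. hk A B 1 \<zeta> z \<ge> 0"
      using that by (auto simp: hk_nonneg)
    from mean[OF o s L n] show ?thesis unfolding g_def hk_swap .
  qed
  \<comment> \<open>Otherwise D contains points strictly after \<open>z0\<close>. A kernel whose
    pole has the time of \<open>z0\<close> vanishes at \<open>z0\<close> but is positive afterwards,
    so the mean value formula would force the integral of a function positive near one of these
    points to vanish.\<close>
  have before: "snd \<zeta> < snd z0" if \<zeta>: "\<zeta> \<in> D" for \<zeta>
  proof (rule ccontr)
    assume "\<not> snd \<zeta> < snd z0"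
    obtain e where e: "e > 0" "\<And>x :: real. \<bar>x\<bar> < e \<Longrightarrow> tflow B 1 x \<zeta> \<in> D"
      by (rule flow_eventually_in[OF tflow_good D(1) \<zeta>]) blast
    let ?V = "D \<inter> {z. hs 1 z0 z > 0}"
    have oS: "open {z :: 'n spacetime. hs 1 z0 z > 0}" by (intro open_Collect_less continuous_intros)
    have oV: "open ?V" by (rule open_Int[OF D(1) oS])
    have zV: "tflow B 1 (e / 2) \<zeta> \<in> ?V" using e(1) e(2)[of "e / 2"] \<open>\<not> snd \<zeta> < snd z0\<close> by (simp add: tflow_def)
    have "hs 1 z0 (tflow B 1 (e / 2) \<zeta>) > 0" using zV by simp
    from Wq_pos_near[OF this oV zV] obtain \<zeta>2 where \<zeta>2: "\<zeta>2 \<in> ?V" "Wq A B 1 z0 \<zeta>2 > 0" by blast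
    obtain R where R: "\<And>z. z \<in> insert z0 D \<Longrightarrow> norm z \<le> R"
      using D(2) by (metis bounded_iff bounded_insert)
    have "R \<ge> 0" by (rule order_trans[OF norm_ge_zero R[OF insertI1]])
    then have "R + 1 \<ge> 0" by simp
    \<comment> \<open>The pole must avoid D and \<open>z0\<close>; it is placed far out in space,
      which boundedness of D allows.\<close>
    then obtain x :: "'n rvec" where x: "norm x = R + 1" using vector_choose_size by blast
    define p where "p = (x, snd z0)"
    have "norm p > R" using norm_fst_le[of x "snd z0"] x by (simp add: p_def)
    then have pD: "p \<notin> D" "p \<noteq> z0" using R[of p] by auto
    from test[OF this] have si: "set_integrable lborel D (\<lambda>z. hk A B 1 p z * W z)"
      and val: "g p = 1 / r * (LBINT z:D. hk A B 1 p z * W z)" by auto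
    have "g p = 0" unfolding g_def by (rule hk_nonpos_time) (simp add: p_def)
    then have zero: "(LBINT z:D. hk A B 1 p z * W z) = 0" using val r by simp
    have siV: "set_integrable lborel ?V (\<lambda>z. hk A B 1 p z * W z)"
      by (rule set_integrable_subset[OF si]) (use oV in auto)
    have "(LBINT z:?V. hk A B 1 p z * W z) > 0"
    proof (rule set_integral_pos_open[OF oV \<zeta>2(1) siV])
      show "0 \<le> hk A B 1 p z * W z" for z by (intro mult_nonneg_nonneg hk_nonneg W0)
      have WV: "W z = Wq A B 1 z0 z" if "z \<in> ?V" for z using that by (simp add: W_def W_kernel_forward)
      have "continuous_on ?V (\<lambda>z. hk A B 1 p z * Wq A B 1 z0 z)"
        by (intro continuous_on_mult continuous_hk continuous_on_const continuous_on_id) (auto simp: p_def)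
      then have "continuous_on ?V (\<lambda>z. hk A B 1 p z * W z)" by (rule continuous_on_eq) (simp add: WV)
      then show "isCont (\<lambda>z. hk A B 1 p z * W z) \<zeta>2" by (rule isCont_open[OF oV _ \<zeta>2(1)])
      have "hk A B 1 p \<zeta>2 > 0" by (rule hk_pos) (use \<zeta>2(1) in \<open>simp add: p_def\<close>)
      then show "hk A B 1 p \<zeta>2 * W \<zeta>2 > 0" using \<zeta>2 WV by simp
    qed
    also have "(LBINT z:?V. hk A B 1 p z * W z) \<le> (LBINT z:D. hk A B 1 p z * W z)"
      unfolding set_lebesgue_integral_def
    proof (rule integral_mono)
      show "integrable lborel (\<lambda>z. indicator ?V z *\<^sub>R (hk A B 1 p z * W z))" "integrable lborel (\<lambda>z. indicator D z *\<^sub>R (hk A B 1 p z * W z))"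
        using siV si by (simp_all add: set_integrable_def)
      fix z
      have "0 \<le> hk A B 1 p z * W z" by (intro mult_nonneg_nonneg hk_nonneg W0)
      then show "indicator ?V z *\<^sub>R (hk A B 1 p z * W z) \<le> indicator D z *\<^sub>R (hk A B 1 p z * W z)"
        by (simp add: indicator_def)
    qed
    finally show False using zero by simp
  qed
  have \<Omega>before: "snd \<zeta> < snd z0" if "\<zeta> \<in> \<Omega>" for \<zeta>
  proof (rule ccontr)
    assume "\<not> snd \<zeta> < snd z0"
    then have "g \<zeta> = 0" unfolding g_def by (intro hk_nonpos_time) simp
    then show False using that r by (simp add: \<Omega>_def)
  qed
  have Wb: "W z = ?Wb z" if "z \<in> D \<union> \<Omega>" for z
    unfolding W_def by (rule W_kernel_backward) (use that before \<Omega>before in blast)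
  have f_eq: "f = (\<lambda>z. (indicator D z - indicator \<Omega> z) * ?Wb z)"
  proof
    fix z show "f z = (indicator D z - indicator \<Omega> z) * ?Wb z"
      using Wb[of z] unfolding f_def ball by (auto simp: indicator_def)
  qed
  have \<Omega>b: "bounded \<Omega>" unfolding \<Omega>_def g_def by (rule d.bounded_superlevel) (use r in auto)
  have U: "bounded (D \<union> \<Omega>)" using D(2) \<Omega>b by simp
  have fU: "z \<in> D \<union> \<Omega>" if "f z \<noteq> 0" for z using that by (auto simp: f_eq indicator_def split: if_splits)
  \<comment> \<open>\<open>f\<close> lives before \<open>z0\<close>, where a kernel with pole at or
    after that time vanishes.\<close>
  have late: "pot f \<zeta> = 0" if "\<not> snd \<zeta> < snd z0" for \<zeta>
  proof -
    have hz: "hk A B 1 \<zeta> z * f z = 0" for z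
    proof (cases "f z = 0")
      case False
      then have "snd z < snd z0" using fU before \<Omega>before by blast
      then have "hk A B 1 \<zeta> z = 0" using that by (intro hk_nonpos_time) simp
      then show ?thesis by simp
    qed simp
    show ?thesis unfolding pot_def hz by simp
  qed
  \<comment> \<open>For a pole outside D the mean value property evaluates the potential of W on D
    as r g; subtracting the potential of the ball leaves the defect.\<close>
  have off: "pot f \<zeta> = ball_defect (r * g \<zeta>)" if \<zeta>: "\<zeta> \<notin> D" "snd \<zeta> < snd z0" for \<zeta>
  proof -
    have "\<zeta> \<noteq> z0" using \<zeta>(2) by auto
    note t = test[OF \<zeta>(1) this]
    let ?G = "hk A B 1 \<zeta>"
    have e1: "indicator D z *\<^sub>R (?G z * W z) = ?G z * (indicator D z * ?Wb z)" for z
      using Wb[of z] by (auto simp: indicator_def)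
    have i1: "integrable lborel (\<lambda>z. ?G z * (indicator D z * ?Wb z))"
      using t unfolding set_integrable_def e1 by blast
    have v1: "(\<integral>z. ?G z * (indicator D z * ?Wb z) \<partial>lborel) = r * g \<zeta>"
      using t r unfolding set_lebesgue_integral_def e1 by simp
    note bp = ball_potential[OF \<zeta>(2) r, folded g_def, folded \<Omega>_def]
    have "pot f \<zeta> = (\<integral>z. ?G z * (indicator D z * ?Wb z) - ?G z * (indicator \<Omega> z * ?Wb z) \<partial>lborel)"
      unfolding pot_def f_eq by (simp add: algebra_simps)
    also have "\<dots> = r * g \<zeta> - (r * g \<zeta> - ball_defect (r * g \<zeta>))"
      by (subst Bochner_Integration.integral_diff[OF i1 bp(1)]) (simp only: v1 bp(2))
    finally show ?thesis by simp
  qed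
  have rg: "r * g \<zeta> > 1 \<longleftrightarrow> \<zeta> \<in> \<Omega>" for \<zeta> using r by (simp add: \<Omega>_def pos_divide_less_eq mult.commute)
  have nonneg_off: "pot f \<zeta> \<ge> 0" if "\<zeta> \<notin> D" for \<zeta>
    using late[of \<zeta>] off[OF that] ball_defect_nonneg by (cases "snd \<zeta> < snd z0") auto
  have zero_off: "pot f \<zeta> = 0" if "\<zeta> \<notin> D \<union> \<Omega>" for \<zeta>
    using late[of \<zeta>] off[of \<zeta>] that rg[of \<zeta>] ball_defect_eq_0[of "r * g \<zeta>"] by (cases "snd \<zeta> < snd z0") auto
  have fD: "f z \<ge> 0" if "z \<in> D" for z
    using that d.Wq_nonneg[of "-1" z0 z] by (auto simp: f_eq indicator_def)
  have pos: "pot f \<zeta> \<ge> 0" for \<zeta>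
    by (rule pot_nonneg[OF f p F U fU D fD nonneg_off])
  have above: "\<not> g \<zeta> < 1 / r" if \<zeta>: "\<zeta> \<in> D" for \<zeta>
  proof
    assume lt: "g \<zeta> < 1 / r"
    let ?B = "{z :: 'n spacetime. snd z < snd z0}"
    have oB: "open ?B" by (intro open_Collect_less continuous_intros)
    have "continuous_on ?B g"
      unfolding g_def by (intro d.continuous_hk continuous_on_const continuous_on_id) simp
    then have "open (?B \<inter> g -` {..< 1 / r})" by (rule continuous_open_preimage[OF _ oB open_lessThan])
    then have oV: "open (D \<inter> (?B \<inter> g -` {..< 1 / r}))" by (rule open_Int[OF D(1)])
    have zV: "\<zeta> \<in> D \<inter> (?B \<inter> g -` {..< 1 / r})" using \<zeta> lt before by simp
    have "hs (-1) z0 \<zeta> > 0" using before[OF \<zeta>] by simp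
    \<comment> \<open>The given point is moved within its slice to one where W is positive, without
      leaving D or reaching the closed ball, as the barrier argument requires.\<close>
    from d.Wq_pos_near[OF this oV zV] obtain \<zeta>1 where \<zeta>1: "\<zeta>1 \<in> D" "snd \<zeta>1 < snd z0" "g \<zeta>1 < 1 / r" "?Wb \<zeta>1 > 0"
      by blast
    show False
      by (rule no_point_below[OF r D f[unfolded f_eq \<Omega>_def g_def] pos[unfolded f_eq \<Omega>_def g_def]
            zero_off[unfolded f_eq \<Omega>_def g_def] \<zeta>1(1,2) \<zeta>1(3)[unfolded g_def] \<zeta>1(4)])
  qed
  have sub: "D \<subseteq> \<Omega>"
  proof
    fix \<zeta> assume \<zeta>: "\<zeta> \<in> D"
    have "hs (-1) z0 \<zeta> > 0" using before[OF \<zeta>] by simp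
    from d.hk_smaller_near[OF this D(1) \<zeta>] obtain \<zeta>' where "\<zeta>' \<in> D" "g \<zeta>' < g \<zeta>" unfolding g_def by blast
    then show "\<zeta> \<in> \<Omega>" using above[of \<zeta>'] by (simp add: \<Omega>_def)
  qed
  have "\<zeta> \<in> D" if \<zeta>: "\<zeta> \<in> \<Omega>" for \<zeta>
  proof (rule ccontr)
    assume "\<zeta> \<notin> D"
    then have "pot f \<zeta> = ball_defect (r * g \<zeta>)" using off \<Omega>before[OF \<zeta>] by blast
    then have "pot f \<zeta> > 0" using ball_defect_pos rg \<zeta> by simp
    moreover have np: "hk A B 1 \<zeta> z * f z \<le> 0" for z
    proof (rule mult_nonneg_nonpos[OF hk_nonneg])
      have "?Wb z \<ge> 0" by (rule d.Wq_nonneg)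
      then show "f z \<le> 0" using sub by (auto simp: f_eq indicator_def)
    qed
    have "pot f \<zeta> \<le> 0" unfolding pot_def using integral_nonneg_AE[of "\<lambda>z. - (hk A B 1 \<zeta> z * f z)" lborel] np by simp
    ultimately show False by simp
  qed
  then show ?thesis using sub ball by blast
qed

end

section \<open>The block form satisfies the axioms of the locale\<close>

lemma rank_block_injective:
  fixes M :: "real^'n^'n" and v :: "real^'n"
  assumes L: "card L \<le> rank M" "\<And>i. i \<notin> L \<Longrightarrow> row i M = 0"
    and v: "\<And>i. i \<notin> L \<Longrightarrow> v $ i = 0" "(\<Sum>i\<in>L. v $ i *\<^sub>R row i M) = 0"
  shows "v = 0"
proof -
  let ?f = "\<lambda>i. row i M"
  have sp: "rows M \<subseteq> span (?f ` L)"
  proof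
    fix x assume "x \<in> rows M"
    then obtain i where "x = row i M" by (auto simp: rows_def)
    then show "x \<in> span (?f ` L)" using L(2)[of i] by (cases "i \<in> L") (auto intro: span_base span_zero)
  qed
  have fin: "finite (?f ` L)" by simp
  have "rank M \<le> dim (?f ` L)"
    unfolding row_rank_def using dim_subset[OF sp] by simp
  moreover have d1: "dim (?f ` L) \<le> card (?f ` L)" by (rule dim_le_card'[OF fin])
  moreover have "card (?f ` L) \<le> card L" by (rule card_image_le) simp
  \<comment> \<open>The rows with indices in L span the row space, so the rank hypothesis forces
    equality throughout: they are pairwise distinct and independent.\<close>
  ultimately have c: "card (?f ` L) = card L" and c': "card (?f ` L) = dim (?f ` L)" using L(1) by linarith+
  have inj: "inj_on ?f L" by (rule eq_card_imp_inj_on[OF _ c]) simp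
  have ind: "independent (?f ` L)"
    by (rule card_le_dim_spanning[OF order_refl span_superset fin]) (simp add: c')
  have "(\<Sum>x\<in>?f ` L. v $ (inv_into L ?f x) *\<^sub>R x) = 0"
    by (subst sum.reindex[OF inj]) (simp add: v(2) inv_into_f_f[OF inj] cong: sum.cong)
  note z = this
  have vL: "v $ i = 0" if "i \<in> L" for i
    using independentD[where u = "\<lambda>x. v $ (inv_into L ?f x)", OF ind fin order_refl z imageI[OF that]]
    unfolding inv_into_f_f[OF inj that] .
  have "v $ i = 0" for i by (cases "i \<in> L") (rule vL, assumption, rule v(1))
  then show "v = 0" by (simp add: vec_eq_iff)
qed

context
  fixes \<kappa> :: nat and p :: "nat \<Rightarrow> nat" and A B :: "real^('n::{finite,wellorder})^('n::{finite,wellorder})"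
  assumes form: "kolmogorov_form \<kappa> p A B"
begin

definition lev :: "'n \<Rightarrow> nat" where "lev i = (LEAST k. coord_pos i < (\<Sum>j\<le>k. p j))"

lemma coord_pos_inj: "inj (coord_pos :: 'n \<Rightarrow> nat)"
proof (rule linorder_injI)
  fix i j :: 'n assume "i < j"
  then have "card {..<i} < card {..<j}" by (intro psubset_card_mono) auto
  then show "coord_pos i \<noteq> coord_pos j" by (simp add: coord_pos_def)
qed

lemma sum_lessThan_le: "k' < k \<Longrightarrow> (\<Sum>j\<le>k'. p j) \<le> (\<Sum>j<k. p j)"
  by (rule sum_mono2) auto

lemma level_imp: "i \<in> level p k \<Longrightarrow> lev i = k"
  unfolding lev_def level_def
proof (rule Least_equality)
  fix k' assume "i \<in> {i. sum p {..<k} \<le> coord_pos i \<and> coord_pos i < sum p {..k}}" "coord_pos i < sum p {..k'}"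
  then show "k \<le> k'" using sum_lessThan_le[of k' k] by (cases "k \<le> k'") auto
qed simp

lemma lev_level: "i \<in> level p (lev i)" and lev_le: "lev i \<le> \<kappa>"
proof -
  have "card {..<i} < card (UNIV :: 'n set)" by (rule psubset_card_mono) auto
  then have c: "coord_pos i < (\<Sum>j\<le>\<kappa>. p j)" using form by (simp add: kolmogorov_form_def coord_pos_def)
  then show "lev i \<le> \<kappa>" unfolding lev_def by (rule Least_le)
  have u: "coord_pos i < (\<Sum>j\<le>lev i. p j)" unfolding lev_def using c by (rule LeastI)
  have "(\<Sum>j<lev i. p j) \<le> coord_pos i"
  proof (cases "lev i")
    case (Suc k)
    then have "\<not> coord_pos i < (\<Sum>j\<le>k. p j)" unfolding lev_def by (intro not_less_Least) simp
    then show ?thesis using Suc by (simp add: lessThan_Suc_atMost)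
  qed simp
  then show "i \<in> level p (lev i)" using u by (simp add: level_def)
qed

lemma level_eq: "level p k = {i. lev i = k}"
  using level_imp lev_level by auto

lemma card_level: "card (level p k :: 'n set) \<le> p k"
proof -
  have "card (coord_pos ` (level p k :: 'n set)) \<le> card {(\<Sum>j<k. p j)..<(\<Sum>j\<le>k. p j)}"
    by (rule card_mono) (auto simp: level_def)
  moreover have "card (coord_pos ` (level p k :: 'n set)) = card (level p k :: 'n set)"
    by (rule card_image) (rule inj_on_subset[OF coord_pos_inj], simp)
  ultimately show ?thesis by (simp add: lessThan_Suc_atMost[symmetric])
qed

lemma form_B: "B $ i $ j \<noteq> 0 \<Longrightarrow> lev i = Suc (lev j)"
proof -
  assume "B $ i $ j \<noteq> 0"
  then obtain k where "k \<in> {1..\<kappa>}" "i \<in> level p k" "j \<in> level p (k - 1)"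
    using form unfolding kolmogorov_form_def by blast
  then show ?thesis by (auto simp: level_eq)
qed

text \<open>The block below level k has full row rank, so its transpose has trivial kernel. Beyond
  the last level there are no coordinates, and v is 0 at once.\<close>

lemma transpose_B_injective:
  assumes v: "\<And>i. lev i \<noteq> Suc k \<Longrightarrow> v $ i = 0" and z: "transpose B *v v = 0"
  shows "v = 0"
proof (cases "Suc k \<le> \<kappa>")
  case True
  let ?M = "block (level p (Suc k)) (level p k) B"
  have "Suc k \<in> {1..\<kappa>}" using True by simp
  then have "rank (block (level p (Suc k)) (level p (Suc k - 1)) B) = p (Suc k)"
    using form unfolding kolmogorov_form_def by blast
  then have rk: "rank ?M = p (Suc k)" by simp
  show ?thesis
  proof (rule rank_block_injective[where L = "level p (Suc k)" and M = ?M])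
    show "card (level p (Suc k) :: 'n set) \<le> rank ?M" unfolding rk by (rule card_level)
    show "i \<notin> level p (Suc k) \<Longrightarrow> row i ?M = 0" for i by (simp add: row_def block_def vec_eq_iff)
    show v0: "i \<notin> level p (Suc k) \<Longrightarrow> v $ i = 0" for i using v by (simp add: level_eq)
    show "(\<Sum>i\<in>level p (Suc k). v $ i *\<^sub>R row i ?M) = 0"
    proof (rule vec_eq_iff[THEN iffD2, rule_format])
      fix j
      have "(\<Sum>i\<in>level p (Suc k). v $ i * ?M $ i $ j) = (\<Sum>i\<in>UNIV. (if j \<in> level p k then B $ i $ j * v $ i else 0))"
        by (rule sum.mono_neutral_cong_left) (auto simp: v0 block_def)
      also have "\<dots> = (if j \<in> level p k then (transpose B *v v) $ j else 0)"
        unfolding matrix_vector_mult_def transpose_def by simp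
      finally show "(\<Sum>i\<in>level p (Suc k). v $ i *\<^sub>R row i ?M) $ j = 0 $ j"
        unfolding z by (simp add: row_def)
    qed
  qed
next
  case False
  then have "v $ i = 0" for i using v[of i] lev_le[of i] by linarith
  then show ?thesis by (simp add: vec_eq_iff)
qed

text \<open>The transpose of \<open>B\<close> lowers the level by one and loses nothing on a single
  level; descending to level 0, where the vector is observed, recovers it.\<close>

lemma level_controllable:
  assumes "\<And>i. lev i \<noteq> k \<Longrightarrow> v $ i = 0" "\<And>i. lev i = 0 \<Longrightarrow> (transpose (mpow B k) *v v) $ i = 0"
  shows "v = 0"
  using assms
proof (induction k arbitrary: v)
  case 0
  have "v $ i = 0" for i
    using 0(1)[of i] 0(2)[of i] by (cases "lev i = 0") (simp_all add: mpow_0 transpose_mat del: transpose_matrix_vector)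
  then show ?case by (simp add: vec_eq_iff)
next
  case (Suc k)
  have tz: "transpose B *v v = 0"
  proof (rule Suc.IH)
    fix i assume i: "lev i \<noteq> k"
    have bz: "B $ j $ i * v $ j = 0" for j using form_B[of j i] Suc.prems(1)[of j] i by fastforce
    show "(transpose B *v v) $ i = 0" unfolding matrix_vector_mult_def transpose_def vec_lambda_beta
      by (rule sum.neutral) (use bz in blast)
  next
    fix i assume "lev i = 0"
    from Suc.prems(2)[OF this] show "(transpose (mpow B k) *v (transpose B *v v)) $ i = 0"
      unfolding mpow_Suc matrix_transpose_mul matrix_vector_mul_assoc .
  qed
  show ?case by (rule transpose_B_injective[OF _ tz]) (rule Suc.prems(1))
qed

lemma mpow_lev: "mpow B k $ i $ j \<noteq> 0 \<Longrightarrow> lev i = lev j + k"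
proof (induction k arbitrary: i)
  case 0
  then show ?case by (auto simp: mpow_0 mat_def split: if_splits)
next
  case (Suc k)
  from Suc.prems have "(\<Sum>m\<in>UNIV. B $ i $ m * mpow B k $ m $ j) \<noteq> 0"
    by (simp add: mpow_Suc matrix_matrix_mult_def)
  then obtain m where "B $ i $ m * mpow B k $ m $ j \<noteq> 0"
    by (rule sum.not_neutral_contains_not_neutral)
  then show ?case using Suc.IH[of m] form_B[of i m] by auto
qed

lemma kolm_lev: "kolm A B lev"
proof
  show "transpose A = A" using form by (simp add: kolmogorov_form_def)
  show "A $ i $ j \<noteq> 0 \<Longrightarrow> lev i = 0 \<and> lev j = 0" for i j
    using form unfolding kolmogorov_form_def level_eq by blast
  show "(A *v x) \<bullet> x > 0" if "x \<noteq> 0" "\<And>i. lev i \<noteq> 0 \<Longrightarrow> x $ i = 0" for x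
    using form that unfolding kolmogorov_form_def level_eq by blast
  show "B $ i $ j \<noteq> 0 \<Longrightarrow> lev i = Suc (lev j)" for i j by (rule form_B)
  fix x assume x: "\<And>k i. lev i = 0 \<Longrightarrow> (transpose (mpow B k) *v x) $ i = 0"
  have "x $ j = 0" for j
  proof -
    define k where "k = lev j"
    \<comment> \<open>At indices of level 0 the k-th power of the transpose sees only the part of
      \<open>x\<close> at level k, so the levels can be treated separately.\<close>
    define v where "v = (\<chi> i. if lev i = k then x $ i else 0)"
    have "v = 0"
    proof (rule level_controllable[where k = k])
      show "lev i \<noteq> k \<Longrightarrow> v $ i = 0" for i by (simp add: v_def)
      fix i :: 'n assume i: "lev i = 0"
      have mz: "mpow B k $ m $ i * v $ m = mpow B k $ m $ i * x $ m" for m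
        using mpow_lev[of k m i] i by (auto simp: v_def)
      have "(transpose (mpow B k) *v v) $ i = (transpose (mpow B k) *v x) $ i"
        unfolding matrix_vector_mult_def transpose_def vec_lambda_beta by (rule sum.cong[OF refl mz])
      then show "(transpose (mpow B k) *v v) $ i = 0" using x[OF i] by (simp only:)
    qed
    then have "v $ j = 0" by simp
    then show "x $ j = 0" by (simp add: v_def k_def)
  qed
  then show "x = 0" by (simp add: vec_eq_iff)
qed

text \<open>The sum over coordinates is regrouped by levels. The result hdim/2 + 1 \<le> Q/2 turns q
  > Q/2 into the integrability condition of the abstract argument.\<close>

lemma hdim_le: "kolm.hdim lev + 2 \<le> hom_dim \<kappa> p"
proof -
  have "kolm.hdim lev = (\<Sum>i\<in>UNIV. 2 * lev i + 1)" by (rule kolm.hdim_def[OF kolm_lev])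
  also have "\<dots> = (\<Sum>k\<in>{..\<kappa>}. \<Sum>i\<in>{i \<in> UNIV. lev i = k}. 2 * lev i + 1)"
    by (rule sum.group[symmetric]) (auto simp: lev_le)
  also have "\<dots> = (\<Sum>k\<le>\<kappa>. (2 * k + 1) * card (level p k :: 'n set))"
    by (intro sum.cong refl) (simp add: level_eq)
  also have "\<dots> \<le> (\<Sum>k\<le>\<kappa>. (2 * k + 1) * p k)" by (intro sum_mono mult_left_mono card_level) simp
  finally show ?thesis by (simp add: hom_dim_def)
qed

end

theorem corollary1p2:
  fixes A B :: "real^('n::{finite,wellorder})^('n::{finite,wellorder})"
    and \<kappa> :: nat and p :: "nat \<Rightarrow> nat"
    and z\<^sub>0 :: "(real^('n::{finite,wellorder})) \<times> real" and D :: "((real^('n::{finite,wellorder})) \<times> real) set"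
    and r :: real and q :: ennreal
  assumes "kolmogorov_form \<kappa> p A B"
    and "open D" and "bounded D" and "r > 0"
    and "\<And>u S. open S \<Longrightarrow> D \<union> {z\<^sub>0} \<subseteq> S \<Longrightarrow> L_harmonic_on A B u S \<Longrightarrow> (\<forall>z\<in>S. u z \<ge> 0) \<Longrightarrow>
           set_integrable lborel D (\<lambda>\<zeta>. u \<zeta> * W_kernel A B (gcomp B (ginv B z\<^sub>0) \<zeta>)) \<and>
           u z\<^sub>0 = 1 / r * (LBINT \<zeta>:D. u \<zeta> * W_kernel A B (gcomp B (ginv B z\<^sub>0) \<zeta>))"
    and "q > ennreal (real (hom_dim \<kappa> p) / 2)"
    and "in_Lp q lborel (\<lambda>\<zeta>. (indicator D \<zeta> - indicator (L_ball A B r z\<^sub>0) \<zeta>)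
                               * W_kernel A B (gcomp B (ginv B z\<^sub>0) \<zeta>))"
  shows "D = L_ball A B r z\<^sub>0"
proof -
  define l where "l = (lev p :: 'n \<Rightarrow> nat)"
  interpret kolm A B l unfolding l_def by (rule kolm_lev[OF assms(1)])
  interpret d: kolm A "-B" l by (rule dual)
  define f where "f \<zeta> = (indicator D \<zeta> - indicator (L_ball A B r z\<^sub>0) \<zeta>) * W_kernel A B (gcomp B (ginv B z\<^sub>0) \<zeta>)" for \<zeta>
  have f: "in_Lp q lborel f" using assms(7) by (simp add: f_def[abs_def])
  have fm [measurable]: "f \<in> borel_measurable lborel" using f by (simp add: in_Lp_def)
  have "hdim + 2 \<le> hom_dim \<kappa> p" using hdim_le[OF assms(1)] by (simp add: l_def)
  then have h: "real hdim / 2 + 1 \<le> real (hom_dim \<kappa> p) / 2" by (simp add: field_simps)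
  have "bounded (L_ball A B r z\<^sub>0)"
    unfolding L_ball_def fund_sol_backward by (rule d.bounded_superlevel) (use assms(4) in auto)
  then have "bounded (D \<union> L_ball A B r z\<^sub>0)" using assms(3) by simp
  then obtain R where "\<forall>z\<in>D \<union> L_ball A B r z\<^sub>0. norm z \<le> R" unfolding bounded_iff by blast
  then have R: "D \<union> L_ball A B r z\<^sub>0 \<subseteq> cball 0 R" by (simp add: subset_iff)
  let ?I = "indicator (cball 0 R) :: 'n spacetime \<Rightarrow> real"
  have fz: "f \<zeta> = 0" if "\<zeta> \<notin> cball 0 R" for \<zeta>
    using that R by (auto simp: f_def indicator_def)
  have Ii: "integrable lborel ?I"
  proof (rule integrable_real_indicator)
    show "emeasure lborel (cball 0 R :: 'n spacetime set) < \<infinity>" by (rule emeasure_bounded_finite) simp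
  qed simp
  \<comment> \<open>A finite exponent above the threshold is extracted. For q infinite,
    \<open>f\<close> is bounded with bounded support and any exponent is admissible, here hdim/2 +
    2.\<close>
  obtain s where s: "s > real hdim / 2 + 1" "integrable lborel (\<lambda>\<zeta>. \<bar>f \<zeta>\<bar> powr s)"
  proof (cases "q = \<infinity>")
    case True
    then obtain c where c: "AE \<zeta> in lborel. \<bar>f \<zeta>\<bar> \<le> c" using f by (auto simp: in_Lp_def)
    let ?s = "real hdim / 2 + 2"
    have "integrable lborel (\<lambda>\<zeta>. \<bar>f \<zeta>\<bar> powr ?s)"
    proof (rule Bochner_Integration.integrable_bound)
      show "integrable lborel (\<lambda>\<zeta>. \<bar>c\<bar> powr ?s * ?I \<zeta>)" using Ii by simp
      show "AE \<zeta> in lborel. norm (\<bar>f \<zeta>\<bar> powr ?s) \<le> norm (\<bar>c\<bar> powr ?s * ?I \<zeta>)"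
        using c
      proof eventually_elim
        case (elim \<zeta>)
        then have "\<bar>f \<zeta>\<bar> powr ?s \<le> \<bar>c\<bar> powr ?s" by (intro powr_mono2) auto
        then show ?case using fz[of \<zeta>] by (cases "\<zeta> \<in> cball 0 R") auto
      qed
    qed measurable
    then show ?thesis by (rule that[rotated]) simp
  next
    case False
    have "enn2real q > real (hom_dim \<kappa> p) / 2"
      using assms(6) False by (cases q) (auto simp: ennreal_less_iff)
    then show ?thesis using f False h by (intro that[of "enn2real q"]) (auto simp: in_Lp_def)
  qed
  \<comment> \<open>On its bounded support |f| is at most 1 + |f|^s, hence \<open>f\<close> is
    integrable.\<close>
  have fi: "integrable lborel f"
  proof (rule Bochner_Integration.integrable_bound)
    show "integrable lborel (\<lambda>\<zeta>. ?I \<zeta> + \<bar>f \<zeta>\<bar> powr s)" using Ii s(2) by simp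
    have "\<bar>f \<zeta>\<bar> \<le> ?I \<zeta> + \<bar>f \<zeta>\<bar> powr s" for \<zeta>
    proof (cases "\<zeta> \<in> cball 0 R")
      case True
      have s1: "s \<ge> 1" using s(1) by (simp add: add_increasing less_imp_le order_trans[of 1 "real hdim / 2 + 1"])
      have "\<bar>f \<zeta>\<bar> \<le> 1 + \<bar>f \<zeta>\<bar> powr s"
      proof (cases "\<bar>f \<zeta>\<bar> \<le> 1")
        case False
        then have "\<bar>f \<zeta>\<bar> powr 1 \<le> \<bar>f \<zeta>\<bar> powr s" using s1 by (intro powr_mono) auto
        then show ?thesis using False by simp
      qed (simp add: add_increasing2)
      then show ?thesis using True by simp
    qed (simp add: fz)
    then show "AE \<zeta> in lborel. norm (f \<zeta>) \<le> norm (?I \<zeta> + \<bar>f \<zeta>\<bar> powr s)"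
      by (intro AE_I2) (simp add: order_trans[OF _ abs_ge_self])
  qed (rule fm)
  show ?thesis
    by (rule ball_characterization[OF assms(2,3,4,5) _ s(1)]) (use fi s(2) in \<open>simp_all add: f_def[abs_def]\<close>)
qed

end
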